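(* Let $\mathcal{A}$ and $\mathcal{B}$ be unital $*$-algebras. For given states $\mu$ and $\nu$ on $\mathcal{A}$ and $\mathcal{B}$, respectively, there exist states $\widehat{\mu}$ and $\widehat{\nu}$ on $\mathcal{H}(\mathcal{A})$ and $\mathcal{H}(\mathcal{B})$ and a unital $*$-homomorphism $$j:\ \mathcal{A}*\mathcal{B}\rightarrow \mathcal{H}(\mathcal{A})\,\overline{\otimes}\,\mathcal{H}(\mathcal{B})$$ such that $$\mu*\nu=(\widehat{\mu}\,\overline{\otimes}\,\widehat{\nu})\circ j .$$ Thus, the unital $*$-algebras $j(\mathcal{A})$ and $j(\mathcal{B})$ are free with respect to $\widehat{\mu}\,\overline{\otimes}\,\widehat{\nu}$.
   Context: All algebras are over $\mathbb{C}$; a state on a unital $*$-algebra is a linear functional $\varphi$ with $\varphi(1)=1$, $\varphi(x^*x)\ge 0$. $\mathcal{A}*\mathcal{B}$ is the free product of unital $*$-algebras with identified units. The free product state $\mu*\nu$ on $\mathcal{A}*\mathcal{B}$ is the state extending $\mu$ and $\nu$ which vanishes on every product $a_1\cdots a_n$ whose factors come alternately from $\ker\mu\subset\mathcal{A}$ and $\ker\nu\subset\mathcal{B}$. Two unital $*$-subalgebras are free with respect to a state $\varphi$ if $\varphi(a_1\cdots a_n)=0$ whenever the $a_i$ come alternately from the two subalgebras and $\varphi(a_i)=0$ for all $i$. The algebra $\mathcal{H}_0(\mathcal{A})$. For each $k\ge1$ let $\mathcal{A}(k)$ be a copy of $\mathcal{A}$, and write $X(k)\in\mathcal{A}(k)$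 for the copy of $X\in\mathcal{A}$. Let $\mathbb{C}[p_1,p_2,\ldots]$ be the unital $*$-algebra generated by $p_1,p_2,\ldots$ subject to $p_kp_l=\delta_{k,l}p_k$, $p_k^*=p_k$. Put $q_0=0$, $q_m=p_1+\cdots+p_m$, $q_\infty=1$, and $\mathcal{P}_1=\{q_m:0\le m\le\infty\}$ (a totally ordered lattice of increasing projections). $\mathcal{H}_0(\mathcal{A})$ is the quotient of the free product, with identified units, of all $\mathcal{A}(k)$, $k\geq 1$, and $\mathbb{C}[p_1,p_2,\ldots]$ by the two-sided $*$-ideal generated by the elements $(1-q_m)X(k)$ with $k<m$, $X\in\mathcal{A}$. For $m\ge 0$, $\mathcal{H}^{(m)}(\mathcal{A})$ is the unital $*$-subalgebra generated by all $p_j$ and by $\mathcal{A}(1),\ldots,\mathcal{A}(m)$. The algebras $\mathcal{H}_0(\mathcal{B})$, $\mathcal{H}^{(m)}(\mathcal{B})$ are defined in the same way from $\mathcal{B}$, with projections denoted $p_k'$, $q_m'$. Monotone closure. Let $\mathcal{C}_0=\bigcup_m\mathcal{C}^{(m)}$ be a union of increasing unital $*$-algebras $\mathcal{C}^{(0)}\subset\mathcal{C}^{(1)}\subset\cdots$ and let $\mathcal{P}=\{c_m:0\le m\le\infty\}\subset\mathcal{C}^{(0)}$ be an increasing chain of projections with $c_0=0$, $c_\infty=1$. A monotone strongly dense domain (MSDD) is an increasing sequence $(e_m)_{m\ge1}$ in $\mathcal{P}$ with supremum $1$ in $\mathcal{P}$. An operator with monotone closure (OWMC) is a sequence $(x_m,e_m)_{m\ge1}$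 with $x_m\in\mathcal{C}^{(m)}$, $(e_m)$ an MSDD, and $x_ne_m=x_me_m$, $x_n^*e_m=x_m^*e_m$ for $n>m$. Two OWMC $(x_m,e_m)$, $(y_m,f_m)$ are equivalent if for some MSDD $(g_m)$ one has $x_mg_m=y_mg_m$ and $x_m^*g_m=y_m^*g_m$ for all $m$. The classes $[x_m,e_m]$ are called monotone closed operators (MCO). For $x\in\mathcal{C}_0$, $e\in\mathcal{P}$, $x^{-1}(e)$ is the largest $g\in\mathcal{P}$ with $exg=xg$. The set $\mathcal{C}$ of all MCO (the monotone closure of $\mathcal{C}_0$) is a unital $*$-algebra under $[x_m,e_m]+[y_m,f_m]=[x_m+y_m,e_mf_m]$, $\lambda[x_m,e_m]=[\lambda x_m,e_m]$, $[x_m,e_m]^*=[x_m^*,e_m]$, $[x_m,e_m][y_m,f_m]=[x_my_m,k_m]$ with $k_m=f_my_m^{-1}(e_m)e_m(x_m^* )^{-1}(f_m)$. An element $x\in\mathcal{C}^{(k)}$ is identified with the class of $(x_m,e_m)$ where $x_m=0$, $e_m=0$ for $m\le k$ and $x_m=x$, $e_m=1$ for $m>k$; thus $\mathcal{C}_0$ is embedded in $\mathcal{C}$. $\mathcal{H}(\mathcal{A})$ is the monotone closure of $\mathcal{H}_0(\mathcal{A})$ (with $\mathcal{C}^{(m)}=\mathcal{H}^{(m)}(\mathcal{A})$, $c_m=q_m$), and similarly $\mathcal{H}(\mathcal{B})$. The monotone tensor product $\mathcal{H}(\mathcal{A})\overline{\otimes}\mathcal{H}(\mathcal{B})$ is the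 monotone closure of $\mathcal{H}_0(\mathcal{A})\otimes\mathcal{H}_0(\mathcal{B})$ with $\mathcal{C}^{(m)}=\mathcal{H}^{(m)}(\mathcal{A})\otimes\mathcal{H}^{(m)}(\mathcal{B})$ and $c_m=q_m\otimes q_m'$ ($0\le m\le\infty$). The tensor product state is given by the pointwise limit $(\widehat\mu\,\overline{\otimes}\,\widehat\nu)([w_m,r_m])=\lim_{m\to\infty}(\widehat\mu\otimes\widehat\nu)(w_m)$, where $\widehat\mu,\widehat\nu$ on the right are restricted to $\mathcal{H}_0(\mathcal{A}),\mathcal{H}_0(\mathcal{B})$; that these limits exist and do not depend on representatives is understood as part of the assertion about $\widehat\mu,\widehat\nu$. *)

theory Defs
  imports
    Complex_Main
    "HOL-Algebra.QuotRing"
    "HOL-Algebra.Module"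
    "HOL-Library.Poly_Mapping"
    "HOL-Library.Nonpos_Ints"
    "HOL-Library.FuncSet"
begin

section \<open>Unital complex *-algebras\<close>

record 'a star_algebra = "(complex, 'a) module" +
  star :: "'a \<Rightarrow> 'a"

text \<open>The locales \<^locale>\<open>module\<close> and \<^locale>\<open>algebra\<close> of the library ask for a record for the scalars
  and for a commutative multiplication, so that the axioms are spelled out here.\<close>

locale star_algebra = ring A for A :: "('a, 'x) star_algebra_scheme" (structure) +
  assumes smult_closed: "x \<in> carrier A \<Longrightarrow> c \<odot> x \<in> carrier A"
    and smult_add_left: "x \<in> carrier A \<Longrightarrow> (c + d) \<odot> x = c \<odot> x \<oplus> d \<odot> x"
    and smult_add_right: "x \<in> carrier A \<Longrightarrow> y \<in> carrier A \<Longrightarrow> c \<odot> (x \<oplus> y) = c \<odot> x \<oplus> c \<odot> y"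
    and smult_smult: "x \<in> carrier A \<Longrightarrow> c \<odot> (d \<odot> x) = (c * d) \<odot> x"
    and smult_1: "x \<in> carrier A \<Longrightarrow> 1 \<odot> x = x"
    and smult_mult_left: "x \<in> carrier A \<Longrightarrow> y \<in> carrier A \<Longrightarrow> (c \<odot> x) \<otimes> y = c \<odot> (x \<otimes> y)"
    and smult_mult_right: "x \<in> carrier A \<Longrightarrow> y \<in> carrier A \<Longrightarrow> x \<otimes> (c \<odot> y) = c \<odot> (x \<otimes> y)"
    and star_closed: "x \<in> carrier A \<Longrightarrow> star A x \<in> carrier A"
    and star_star: "x \<in> carrier A \<Longrightarrow> star A (star A x) = x"
    and star_add: "x \<in> carrier A \<Longrightarrow> y \<in> carrier A \<Longrightarrow> star A (x \<oplus> y) = star A x \<oplus> star A y"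
    and star_smult: "x \<in> carrier A \<Longrightarrow> star A (c \<odot> x) = cnj c \<odot> star A x"
    and star_mult: "x \<in> carrier A \<Longrightarrow> y \<in> carrier A \<Longrightarrow> star A (x \<otimes> y) = star A y \<otimes> star A x"

definition star_hom ::
    "('a, 'x) star_algebra_scheme \<Rightarrow> ('b, 'y) star_algebra_scheme \<Rightarrow> ('a \<Rightarrow> 'b) \<Rightarrow> bool" where
  "star_hom A B h \<longleftrightarrow> h \<in> ring_hom A B \<and>
     (\<forall>c. \<forall>x\<in>carrier A. h (c \<odot>\<^bsub>A\<^esub> x) = c \<odot>\<^bsub>B\<^esub> h x) \<and>
     (\<forall>x\<in>carrier A. h (star A x) = star B (h x))"

definition state :: "('a, 'x) star_algebra_scheme \<Rightarrow> ('a \<Rightarrow> complex) \<Rightarrow> bool" where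
  "state A \<phi> \<longleftrightarrow>
     (\<forall>x\<in>carrier A. \<forall>y\<in>carrier A. \<phi> (x \<oplus>\<^bsub>A\<^esub> y) = \<phi> x + \<phi> y) \<and>
     (\<forall>c. \<forall>x\<in>carrier A. \<phi> (c \<odot>\<^bsub>A\<^esub> x) = c * \<phi> x) \<and>
     \<phi> \<one>\<^bsub>A\<^esub> = 1 \<and>
     (\<forall>x\<in>carrier A. \<phi> (star A x \<otimes>\<^bsub>A\<^esub> x) \<in> \<real>\<^sub>\<ge>\<^sub>0)"

definition star_subalgebra :: "('a, 'x) star_algebra_scheme \<Rightarrow> 'a set \<Rightarrow> bool" where
  "star_subalgebra A S \<longleftrightarrow> S \<subseteq> carrier A \<and> \<one>\<^bsub>A\<^esub> \<in> S \<and>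
     (\<forall>x\<in>S. \<forall>y\<in>S. x \<oplus>\<^bsub>A\<^esub> y \<in> S \<and> x \<otimes>\<^bsub>A\<^esub> y \<in> S) \<and>
     (\<forall>c. \<forall>x\<in>S. c \<odot>\<^bsub>A\<^esub> x \<in> S) \<and> (\<forall>x\<in>S. star A x \<in> S)"

definition star_subalgebra_generated :: "('a, 'x) star_algebra_scheme \<Rightarrow> 'a set \<Rightarrow> 'a set" where
  "star_subalgebra_generated A G = \<Inter>{S. star_subalgebra A S \<and> G \<subseteq> S}"

definition star_ideal_generated :: "('a, 'x) star_algebra_scheme \<Rightarrow> 'a set \<Rightarrow> 'a set" where
  "star_ideal_generated A R = \<Inter>{I. ideal I A \<and> (\<forall>x\<in>I. star A x \<in> I) \<and> R \<subseteq> I}"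


section \<open>Freeness\<close>

fun alternating :: "'a set \<Rightarrow> 'a set \<Rightarrow> 'a list \<Rightarrow> bool" where
  "alternating S T [] \<longleftrightarrow> True"
| "alternating S T (x # xs) \<longleftrightarrow> x \<in> S \<and> alternating T S xs"

definition list_prod :: "('a, 'x) monoid_scheme \<Rightarrow> 'a list \<Rightarrow> 'a" where
  "list_prod M xs = foldr (mult M) xs \<one>\<^bsub>M\<^esub>"

text \<open>\<open>\<phi>\<close> vanishes on the nonempty products of factors taken alternately from \<open>S\<close> and \<open>T\<close>,
  starting with either of the two sets.\<close>

definition vanishes_on_alternating ::
    "('a, 'x) star_algebra_scheme \<Rightarrow> ('a \<Rightarrow> complex) \<Rightarrow> 'a set \<Rightarrow> 'a set \<Rightarrow> bool" where
  "vanishes_on_alternating A \<phi> S T \<longleftrightarrow>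
     (\<forall>xs. xs \<noteq> [] \<and> (alternating S T xs \<or> alternating T S xs) \<longrightarrow> \<phi> (list_prod A xs) = 0)"

definition free_wrt ::
    "('a, 'x) star_algebra_scheme \<Rightarrow> ('a \<Rightarrow> complex) \<Rightarrow> 'a set \<Rightarrow> 'a set \<Rightarrow> bool" where
  "free_wrt A \<phi> S T \<longleftrightarrow> star_subalgebra A S \<and> star_subalgebra A T \<and>
     vanishes_on_alternating A \<phi> {x \<in> S. \<phi> x = 0} {x \<in> T. \<phi> x = 0}"


section \<open>Constructions of *-algebras\<close>

text \<open>The complex monoid algebra of a monoid \<open>M\<close> with an involution \<open>adj\<close>. Its element
  \<open>single w 1\<close> is the basis vector given by \<open>w\<close>.\<close>

definition monoid_algebra ::
    "('m, 'x) monoid_scheme \<Rightarrow> ('m \<Rightarrow> 'm) \<Rightarrow> ('m \<Rightarrow>\<^sub>0 complex) star_algebra" where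
  "monoid_algebra M adj =
    \<lparr>carrier = {f. Poly_Mapping.keys f \<subseteq> carrier M},
     mult = (\<lambda>f g. \<Sum>s\<in>Poly_Mapping.keys f. \<Sum>t\<in>Poly_Mapping.keys g.
        Poly_Mapping.single (s \<otimes>\<^bsub>M\<^esub> t) (Poly_Mapping.lookup f s * Poly_Mapping.lookup g t)),
     one = Poly_Mapping.single \<one>\<^bsub>M\<^esub> 1,
     zero = 0,
     add = (+),
     smult = (\<lambda>c. Poly_Mapping.map ((*) c)),
     star = (\<lambda>f. \<Sum>s\<in>Poly_Mapping.keys f. Poly_Mapping.single (adj s) (cnj (Poly_Mapping.lookup f s)))\<rparr>"

definition word_monoid :: "'g set \<Rightarrow> 'g list monoid" where
  "word_monoid G = \<lparr>carrier = lists G, mult = (@), one = []\<rparr>"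

text \<open>The free *-algebra on generators \<open>G\<close> whose adjoints are prescribed by an involution
  of \<open>G\<close>.\<close>

definition free_star_algebra :: "'g set \<Rightarrow> ('g \<Rightarrow> 'g) \<Rightarrow> ('g list \<Rightarrow>\<^sub>0 complex) star_algebra" where
  "free_star_algebra G adj = monoid_algebra (word_monoid G) (\<lambda>w. rev (map adj w))"

text \<open>The quotient by the two-sided *-ideal \<open>I\<close>; the ring structure is that of
  \<^const>\<open>FactRing\<close>. The sets in the unions below do not depend on \<open>x \<in> X\<close>.\<close>

definition star_quotient :: "('a, 'x) star_algebra_scheme \<Rightarrow> 'a set \<Rightarrow> 'a set star_algebra" where
  "star_quotient A I =
    \<lparr>carrier = carrier (A Quot I), mult = mult (A Quot I), one = one (A Quot I),
     zero = zero (A Quot I), add = add (A Quot I),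
     smult = (\<lambda>c X. \<Union>x\<in>X. I +>\<^bsub>A\<^esub> (c \<odot>\<^bsub>A\<^esub> x)),
     star = (\<lambda>X. \<Union>x\<in>X. I +>\<^bsub>A\<^esub> star A x)\<rparr>"

definition transported_algebra ::
    "('a \<Rightarrow> 'b) \<Rightarrow> ('a, 'x) star_algebra_scheme \<Rightarrow> 'b star_algebra" where
  "transported_algebra f A = (let g = inv_into (carrier A) f in
    \<lparr>carrier = f ` carrier A,
     mult = (\<lambda>x y. f (g x \<otimes>\<^bsub>A\<^esub> g y)),
     one = f \<one>\<^bsub>A\<^esub>,
     zero = f \<zero>\<^bsub>A\<^esub>,
     add = (\<lambda>x y. f (g x \<oplus>\<^bsub>A\<^esub> g y)),
     smult = (\<lambda>c x. f (c \<odot>\<^bsub>A\<^esub> g x)),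
     star = (\<lambda>x. f (star A (g x)))\<rparr>)"


subsection \<open>Free products with identified units\<close>

text \<open>For a family of algebras indexed by the elements of the type \<open>'i\<close>, all of them with elements
  of the type \<open>'c\<close>, the letter \<open>(i, x)\<close> is the element \<open>x\<close> of the \<open>i\<close>-th algebra.\<close>

definition free_product_letters ::
    "('i \<Rightarrow> 'c star_algebra) \<Rightarrow> (('i \<times> 'c) list \<Rightarrow>\<^sub>0 complex) star_algebra" where
  "free_product_letters F =
     free_star_algebra (SIGMA i:UNIV. carrier (F i)) (\<lambda>(i, x). (i, star (F i) x))"

definition free_product_relations ::
    "('i \<Rightarrow> 'c star_algebra) \<Rightarrow> (('i \<times> 'c) list \<Rightarrow>\<^sub>0 complex) set" where
  "free_product_relations F =
     {Poly_Mapping.single [(i, x \<oplus>\<^bsub>F i\<^esub> y)] 1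
        - Poly_Mapping.single [(i, x)] 1 - Poly_Mapping.single [(i, y)] 1
       | i x y. x \<in> carrier (F i) \<and> y \<in> carrier (F i)} \<union>
     {Poly_Mapping.single [(i, c \<odot>\<^bsub>F i\<^esub> x)] 1 - Poly_Mapping.single [(i, x)] c
       | i c x. x \<in> carrier (F i)} \<union>
     {Poly_Mapping.single [(i, x \<otimes>\<^bsub>F i\<^esub> y)] 1 - Poly_Mapping.single [(i, x), (i, y)] 1
       | i x y. x \<in> carrier (F i) \<and> y \<in> carrier (F i)} \<union>
     {Poly_Mapping.single [(i, \<one>\<^bsub>F i\<^esub>)] 1 - Poly_Mapping.single [] 1 | i. True}"

definition free_product_ideal ::
    "('i \<Rightarrow> 'c star_algebra) \<Rightarrow> (('i \<times> 'c) list \<Rightarrow>\<^sub>0 complex) set" where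
  "free_product_ideal F =
     star_ideal_generated (free_product_letters F) (free_product_relations F)"

definition free_product ::
    "('i \<Rightarrow> 'c star_algebra) \<Rightarrow> (('i \<times> 'c) list \<Rightarrow>\<^sub>0 complex) set star_algebra" where
  "free_product F = star_quotient (free_product_letters F) (free_product_ideal F)"

definition free_product_in ::
    "('i \<Rightarrow> 'c star_algebra) \<Rightarrow> 'i \<Rightarrow> 'c \<Rightarrow> (('i \<times> 'c) list \<Rightarrow>\<^sub>0 complex) set" where
  "free_product_in F i x =
     free_product_ideal F +>\<^bsub>free_product_letters F\<^esub> Poly_Mapping.single [(i, x)] 1"

definition pair_family ::
    "'a star_algebra \<Rightarrow> 'b star_algebra \<Rightarrow> bool \<Rightarrow> ('a + 'b) star_algebra" where
  "pair_family A B i = (if i then transported_algebra Inl A else transported_algebra Inr B)"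

type_synonym ('a, 'b) free_product2 = "((bool \<times> ('a + 'b)) list \<Rightarrow>\<^sub>0 complex) set"

definition free_product2 ::
    "'a star_algebra \<Rightarrow> 'b star_algebra \<Rightarrow> ('a, 'b) free_product2 star_algebra" where
  "free_product2 A B = free_product (pair_family A B)"

definition free_inl :: "'a star_algebra \<Rightarrow> 'b star_algebra \<Rightarrow> 'a \<Rightarrow> ('a, 'b) free_product2" where
  "free_inl A B a = free_product_in (pair_family A B) True (Inl a)"

definition free_inr :: "'a star_algebra \<Rightarrow> 'b star_algebra \<Rightarrow> 'b \<Rightarrow> ('a, 'b) free_product2" where
  "free_inr A B b = free_product_in (pair_family A B) False (Inr b)"

text \<open>The free product state \<open>\<mu> * \<nu>\<close>. It is taken to be \<^const>\<open>undefined\<close> outside the carrier, which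
  makes it unique as a function.\<close>

definition free_product_state ::
    "'a star_algebra \<Rightarrow> 'b star_algebra \<Rightarrow> ('a \<Rightarrow> complex) \<Rightarrow> ('b \<Rightarrow> complex)
      \<Rightarrow> ('a, 'b) free_product2 \<Rightarrow> complex" where
  "free_product_state A B \<mu> \<nu> = (THE \<phi>.
     \<phi> \<in> extensional (carrier (free_product2 A B)) \<and>
     state (free_product2 A B) \<phi> \<and>
     (\<forall>a\<in>carrier A. \<phi> (free_inl A B a) = \<mu> a) \<and>
     (\<forall>b\<in>carrier B. \<phi> (free_inr A B b) = \<nu> b) \<and>
     vanishes_on_alternating (free_product2 A B) \<phi>
       (free_inl A B ` {a \<in> carrier A. \<mu> a = 0})
       (free_inr A B ` {b \<in> carrier B. \<nu> b = 0}))"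


subsection \<open>Algebraic tensor products\<close>

text \<open>In the monoid algebra of the multiplicative monoid \<open>A \<times> B\<close> the linear span of the
  bilinearity relations is already a two-sided *-ideal, so that the quotient is the
  vector space tensor product with its usual multiplication and involution.\<close>

definition tensor_pairs ::
    "'a star_algebra \<Rightarrow> 'b star_algebra \<Rightarrow> ('a \<times> 'b \<Rightarrow>\<^sub>0 complex) star_algebra" where
  "tensor_pairs A B = monoid_algebra (A \<times>\<times> B) (\<lambda>(a, b). (star A a, star B b))"

definition tensor_relations ::
    "'a star_algebra \<Rightarrow> 'b star_algebra \<Rightarrow> ('a \<times> 'b \<Rightarrow>\<^sub>0 complex) set" where
  "tensor_relations A B =
     {Poly_Mapping.single (a \<oplus>\<^bsub>A\<^esub> a', b) 1
        - Poly_Mapping.single (a, b) 1 - Poly_Mapping.single (a', b) 1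
       | a a' b. a \<in> carrier A \<and> a' \<in> carrier A \<and> b \<in> carrier B} \<union>
     {Poly_Mapping.single (a, b \<oplus>\<^bsub>B\<^esub> b') 1
        - Poly_Mapping.single (a, b) 1 - Poly_Mapping.single (a, b') 1
       | a b b'. a \<in> carrier A \<and> b \<in> carrier B \<and> b' \<in> carrier B} \<union>
     {Poly_Mapping.single (c \<odot>\<^bsub>A\<^esub> a, b) 1 - Poly_Mapping.single (a, b) c
       | c a b. a \<in> carrier A \<and> b \<in> carrier B} \<union>
     {Poly_Mapping.single (a, c \<odot>\<^bsub>B\<^esub> b) 1 - Poly_Mapping.single (a, b) c
       | c a b. a \<in> carrier A \<and> b \<in> carrier B}"

definition tensor_ideal ::
    "'a star_algebra \<Rightarrow> 'b star_algebra \<Rightarrow> ('a \<times> 'b \<Rightarrow>\<^sub>0 complex) set" where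
  "tensor_ideal A B = star_ideal_generated (tensor_pairs A B) (tensor_relations A B)"

definition tensor_product ::
    "'a star_algebra \<Rightarrow> 'b star_algebra \<Rightarrow> ('a \<times> 'b \<Rightarrow>\<^sub>0 complex) set star_algebra" where
  "tensor_product A B = star_quotient (tensor_pairs A B) (tensor_ideal A B)"

definition tensor_elem ::
    "'a star_algebra \<Rightarrow> 'b star_algebra \<Rightarrow> 'a \<Rightarrow> 'b \<Rightarrow> ('a \<times> 'b \<Rightarrow>\<^sub>0 complex) set" where
  "tensor_elem A B a b = tensor_ideal A B +>\<^bsub>tensor_pairs A B\<^esub> Poly_Mapping.single (a, b) 1"

text \<open>The subspace \<open>S \<otimes> T\<close> for *-subalgebras \<open>S\<close> and \<open>T\<close>: elementary tensors being closed under
  products and adjoints, the subalgebra that they generate is their linear span.\<close>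

definition tensor_subalgebra ::
    "'a star_algebra \<Rightarrow> 'b star_algebra \<Rightarrow> 'a set \<Rightarrow> 'b set \<Rightarrow> ('a \<times> 'b \<Rightarrow>\<^sub>0 complex) set set" where
  "tensor_subalgebra A B S T =
     star_subalgebra_generated (tensor_product A B) {tensor_elem A B a b | a b. a \<in> S \<and> b \<in> T}"

text \<open>The functional \<open>\<phi> \<otimes> \<psi>\<close> for linear \<open>\<phi>\<close> and \<open>\<psi>\<close>: the sum does not depend on the choice
  of \<open>f\<close> in the coset \<open>w\<close>.\<close>

definition tensor_functional ::
    "('a \<Rightarrow> complex) \<Rightarrow> ('b \<Rightarrow> complex) \<Rightarrow> ('a \<times> 'b \<Rightarrow>\<^sub>0 complex) set \<Rightarrow> complex" where
  "tensor_functional \<phi> \<psi> w =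
     the_elem ((\<lambda>f. \<Sum>(a, b)\<in>Poly_Mapping.keys f. Poly_Mapping.lookup f (a, b) * (\<phi> a * \<psi> b)) ` w)"


section \<open>Monotone closure\<close>

text \<open>Throughout, \<open>C\<close> is the algebra \<open>\<C>\<^sub>0\<close>, \<open>F m\<close> is the subalgebra with index \<open>m\<close>, and \<open>c m\<close> is the
  projection with the finite index \<open>m\<close>. Sequences start with the index 1; the entry of a
  function on \<^typ>\<open>nat\<close> at 0 is ignored by all the predicates.\<close>

type_synonym 'c mco = "((nat \<Rightarrow> 'c) \<times> (nat \<Rightarrow> 'c)) set"

definition projection_chain :: "'c star_algebra \<Rightarrow> (nat \<Rightarrow> 'c) \<Rightarrow> 'c set" where
  "projection_chain C c = insert \<one>\<^bsub>C\<^esub> (range c)"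

definition proj_le :: "'c star_algebra \<Rightarrow> 'c \<Rightarrow> 'c \<Rightarrow> bool" where
  "proj_le C e f \<longleftrightarrow> e \<otimes>\<^bsub>C\<^esub> f = e"

definition msdd :: "'c star_algebra \<Rightarrow> (nat \<Rightarrow> 'c) \<Rightarrow> (nat \<Rightarrow> 'c) \<Rightarrow> bool" where
  "msdd C c e \<longleftrightarrow>
     (\<forall>m\<ge>1. e m \<in> projection_chain C c) \<and>
     (\<forall>m\<ge>1. proj_le C (e m) (e (Suc m))) \<and>
     (\<forall>g\<in>projection_chain C c. (\<forall>m\<ge>1. proj_le C (e m) g) \<longrightarrow> proj_le C \<one>\<^bsub>C\<^esub> g)"

definition owmc ::
    "'c star_algebra \<Rightarrow> (nat \<Rightarrow> 'c set) \<Rightarrow> (nat \<Rightarrow> 'c) \<Rightarrow> (nat \<Rightarrow> 'c) \<times> (nat \<Rightarrow> 'c) \<Rightarrow> bool" where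
  "owmc C F c = (\<lambda>(x, e).
     (\<forall>m\<ge>1. x m \<in> F m) \<and> msdd C c e \<and>
     (\<forall>m\<ge>1. \<forall>n>m. x n \<otimes>\<^bsub>C\<^esub> e m = x m \<otimes>\<^bsub>C\<^esub> e m \<and>
        star C (x n) \<otimes>\<^bsub>C\<^esub> e m = star C (x m) \<otimes>\<^bsub>C\<^esub> e m))"

definition owmc_equiv ::
    "'c star_algebra \<Rightarrow> (nat \<Rightarrow> 'c set) \<Rightarrow> (nat \<Rightarrow> 'c)
      \<Rightarrow> (((nat \<Rightarrow> 'c) \<times> (nat \<Rightarrow> 'c)) \<times> ((nat \<Rightarrow> 'c) \<times> (nat \<Rightarrow> 'c))) set" where
  "owmc_equiv C F c = {((x, e), (y, f)).
     owmc C F c (x, e) \<and> owmc C F c (y, f) \<and>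
     (\<exists>g. msdd C c g \<and>
       (\<forall>m\<ge>1. x m \<otimes>\<^bsub>C\<^esub> g m = y m \<otimes>\<^bsub>C\<^esub> g m \<and>
          star C (x m) \<otimes>\<^bsub>C\<^esub> g m = star C (y m) \<otimes>\<^bsub>C\<^esub> g m))}"

definition mco_class ::
    "'c star_algebra \<Rightarrow> (nat \<Rightarrow> 'c set) \<Rightarrow> (nat \<Rightarrow> 'c) \<Rightarrow> (nat \<Rightarrow> 'c) \<Rightarrow> (nat \<Rightarrow> 'c) \<Rightarrow> 'c mco" where
  "mco_class C F c x e = owmc_equiv C F c `` {(x, e)}"

text \<open>The largest \<open>g\<close> in the chain with \<open>e x g = x g\<close>, written \<open>x\<^sup>-\<^sup>1(e)\<close>.\<close>

definition proj_preimage :: "'c star_algebra \<Rightarrow> (nat \<Rightarrow> 'c) \<Rightarrow> 'c \<Rightarrow> 'c \<Rightarrow> 'c" where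
  "proj_preimage C c x e = (let Q = {g \<in> projection_chain C c. e \<otimes>\<^bsub>C\<^esub> x \<otimes>\<^bsub>C\<^esub> g = x \<otimes>\<^bsub>C\<^esub> g}
     in THE g. g \<in> Q \<and> (\<forall>h\<in>Q. proj_le C h g))"

text \<open>The embedding of \<open>\<C>\<^sub>0\<close>; any other \<open>k\<close> with \<open>x \<in> F k\<close> gives the same class.\<close>

definition mco_embed ::
    "'c star_algebra \<Rightarrow> (nat \<Rightarrow> 'c set) \<Rightarrow> (nat \<Rightarrow> 'c) \<Rightarrow> 'c \<Rightarrow> 'c mco" where
  "mco_embed C F c x = (let k = (LEAST k. x \<in> F k) in
     mco_class C F c (\<lambda>m. if m \<le> k then \<zero>\<^bsub>C\<^esub> else x) (\<lambda>m. if m \<le> k then \<zero>\<^bsub>C\<^esub> else \<one>\<^bsub>C\<^esub>))"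

text \<open>The operations are given on representatives; the unions are over all choices of these.\<close>

definition monotone_closure ::
    "'c star_algebra \<Rightarrow> (nat \<Rightarrow> 'c set) \<Rightarrow> (nat \<Rightarrow> 'c) \<Rightarrow> 'c mco star_algebra" where
  "monotone_closure C F c =
    \<lparr>carrier = Collect (owmc C F c) // owmc_equiv C F c,
     mult = (\<lambda>X Y. \<Union>(x, e)\<in>X. \<Union>(y, f)\<in>Y.
        mco_class C F c (\<lambda>m. x m \<otimes>\<^bsub>C\<^esub> y m)
          (\<lambda>m. f m \<otimes>\<^bsub>C\<^esub> proj_preimage C c (y m) (e m) \<otimes>\<^bsub>C\<^esub> e m
             \<otimes>\<^bsub>C\<^esub> proj_preimage C c (star C (x m)) (f m))),
     one = mco_embed C F c \<one>\<^bsub>C\<^esub>,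
     zero = mco_embed C F c \<zero>\<^bsub>C\<^esub>,
     add = (\<lambda>X Y. \<Union>(x, e)\<in>X. \<Union>(y, f)\<in>Y.
        mco_class C F c (\<lambda>m. x m \<oplus>\<^bsub>C\<^esub> y m) (\<lambda>m. e m \<otimes>\<^bsub>C\<^esub> f m)),
     smult = (\<lambda>a X. \<Union>(x, e)\<in>X. mco_class C F c (\<lambda>m. a \<odot>\<^bsub>C\<^esub> x m) e),
     star = (\<lambda>X. \<Union>(x, e)\<in>X. mco_class C F c (\<lambda>m. star C (x m)) e)\<rparr>"

text \<open>The pointwise limit \<open>[x\<^sub>m, e\<^sub>m] \<mapsto> lim \<phi>(x\<^sub>m)\<close>, with its existence and its independence of
  the representative as a separate predicate.\<close>

definition has_limit_functional ::
    "('c \<Rightarrow> complex) \<Rightarrow> 'c mco \<Rightarrow> complex \<Rightarrow> bool" where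
  "has_limit_functional \<phi> X z \<longleftrightarrow> (\<forall>(x, e)\<in>X. (\<lambda>m. \<phi> (x m)) \<longlonglongrightarrow> z)"

definition limit_functional :: "('c \<Rightarrow> complex) \<Rightarrow> 'c mco \<Rightarrow> complex" where
  "limit_functional \<phi> X = (THE z. has_limit_functional \<phi> X z)"


section \<open>The algebras of monotone closed operators\<close>

subsection \<open>The algebra generated by orthogonal projections\<close>

type_synonym projs = "(nat list \<Rightarrow>\<^sub>0 complex) set"

text \<open>The generators are indexed by \<open>k \<ge> 1\<close>; the relations \<open>p\<^sub>k\<^sup>* = p\<^sub>k\<close> are part of the free
  *-algebra used.\<close>

definition projs_ideal :: projs where
  "projs_ideal = star_ideal_generated (free_star_algebra {1..} id)
     {Poly_Mapping.single [k, l] 1 - (if k = l then Poly_Mapping.single [k] 1 else 0)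
       | k l. k \<ge> 1 \<and> l \<ge> 1}"

definition projs_algebra :: "projs star_algebra" where
  "projs_algebra = star_quotient (free_star_algebra {1..} id) projs_ideal"

definition projs_gen :: "nat \<Rightarrow> projs" where
  "projs_gen k = projs_ideal +>\<^bsub>free_star_algebra {1..} id\<^esub> Poly_Mapping.single [k] 1"


subsection \<open>The algebra \<open>\<H>\<^sub>0(\<A>)\<close> and its monotone closure\<close>

text \<open>The factor with index 0 is \<^const>\<open>projs_algebra\<close>; the factor with index \<open>k \<ge> 1\<close> is the \<open>k\<close>-th
  copy of \<open>A\<close>.\<close>

definition H0_family :: "'a star_algebra \<Rightarrow> nat \<Rightarrow> ('a + projs) star_algebra" where
  "H0_family A k =
     (if k = 0 then transported_algebra Inr projs_algebra else transported_algebra Inl A)"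

type_synonym 'a H0_free = "((nat \<times> ('a + projs)) list \<Rightarrow>\<^sub>0 complex) set"
type_synonym 'a H0 = "'a H0_free set"

definition H0_free :: "'a star_algebra \<Rightarrow> 'a H0_free star_algebra" where
  "H0_free A = free_product (H0_family A)"

definition H0_free_copy :: "'a star_algebra \<Rightarrow> nat \<Rightarrow> 'a \<Rightarrow> 'a H0_free" where
  "H0_free_copy A k X = free_product_in (H0_family A) k (Inl X)"

definition H0_free_p :: "'a star_algebra \<Rightarrow> nat \<Rightarrow> 'a H0_free" where
  "H0_free_p A k = free_product_in (H0_family A) 0 (Inr (projs_gen k))"

definition H0_free_q :: "'a star_algebra \<Rightarrow> nat \<Rightarrow> 'a H0_free" where
  "H0_free_q A m = (\<Oplus>\<^bsub>H0_free A\<^esub>k\<in>{1..m}. H0_free_p A k)"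

definition H0_ideal :: "'a star_algebra \<Rightarrow> 'a H0" where
  "H0_ideal A = star_ideal_generated (H0_free A)
     {(\<one>\<^bsub>H0_free A\<^esub> \<ominus>\<^bsub>H0_free A\<^esub> H0_free_q A m) \<otimes>\<^bsub>H0_free A\<^esub> H0_free_copy A k X
       | k m X. 1 \<le> k \<and> k < m \<and> X \<in> carrier A}"

definition H0 :: "'a star_algebra \<Rightarrow> 'a H0 star_algebra" where
  "H0 A = star_quotient (H0_free A) (H0_ideal A)"

definition H0_copy :: "'a star_algebra \<Rightarrow> nat \<Rightarrow> 'a \<Rightarrow> 'a H0" where
  "H0_copy A k X = H0_ideal A +>\<^bsub>H0_free A\<^esub> H0_free_copy A k X"

definition H0_p :: "'a star_algebra \<Rightarrow> nat \<Rightarrow> 'a H0" where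
  "H0_p A k = H0_ideal A +>\<^bsub>H0_free A\<^esub> H0_free_p A k"

definition H0_q :: "'a star_algebra \<Rightarrow> nat \<Rightarrow> 'a H0" where
  "H0_q A m = H0_ideal A +>\<^bsub>H0_free A\<^esub> H0_free_q A m"

definition H0_filt :: "'a star_algebra \<Rightarrow> nat \<Rightarrow> 'a H0 set" where
  "H0_filt A m = star_subalgebra_generated (H0 A)
     ({H0_p A j | j. j \<ge> 1} \<union> {H0_copy A k X | k X. 1 \<le> k \<and> k \<le> m \<and> X \<in> carrier A})"

definition H :: "'a star_algebra \<Rightarrow> 'a H0 mco star_algebra" where
  "H A = monotone_closure (H0 A) (H0_filt A) (H0_q A)"

definition H_embed :: "'a star_algebra \<Rightarrow> 'a H0 \<Rightarrow> 'a H0 mco" where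
  "H_embed A = mco_embed (H0 A) (H0_filt A) (H0_q A)"


subsection \<open>The monotone tensor product \<open>\<H>(\<A>) \<otimes> \<H>(\<B>)\<close>\<close>

type_synonym ('a, 'b) H0_tensor = "('a H0 \<times> 'b H0 \<Rightarrow>\<^sub>0 complex) set"

definition H_tensor ::
    "'a star_algebra \<Rightarrow> 'b star_algebra \<Rightarrow> ('a, 'b) H0_tensor mco star_algebra" where
  "H_tensor A B = monotone_closure (tensor_product (H0 A) (H0 B))
     (\<lambda>m. tensor_subalgebra (H0 A) (H0 B) (H0_filt A m) (H0_filt B m))
     (\<lambda>m. tensor_elem (H0 A) (H0 B) (H0_q A m) (H0_q B m))"

text \<open>The algebraic tensor product of the restrictions of functionals on \<^term>\<open>H A\<close> and \<^term>\<open>H B\<close>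
  to \<^term>\<open>H0 A\<close> and \<^term>\<open>H0 B\<close>.\<close>

definition H0_tensor_functional ::
    "'a star_algebra \<Rightarrow> 'b star_algebra \<Rightarrow> ('a H0 mco \<Rightarrow> complex) \<Rightarrow> ('b H0 mco \<Rightarrow> complex)
      \<Rightarrow> ('a, 'b) H0_tensor \<Rightarrow> complex" where
  "H0_tensor_functional A B \<phi> \<psi> = tensor_functional (\<phi> \<circ> H_embed A) (\<psi> \<circ> H_embed B)"

definition H_tensor_functional ::
    "'a star_algebra \<Rightarrow> 'b star_algebra \<Rightarrow> ('a H0 mco \<Rightarrow> complex) \<Rightarrow> ('b H0 mco \<Rightarrow> complex)
      \<Rightarrow> ('a, 'b) H0_tensor mco \<Rightarrow> complex" where
  "H_tensor_functional A B \<phi> \<psi> = limit_functional (H0_tensor_functional A B \<phi> \<psi>)"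

end

theory Submission
  imports Defs
begin

text \<open>
  The units of the copies of \<open>A\<close> are identified, so the relation \<open>(1 - q\<^sub>m) X(k) = 0\<close> with \<open>X = 1\<close> gives
  \<open>q\<^sub>m = 1\<close> for \<open>m \<ge> 2\<close>. The chain of projections is therefore \<open>{0, p\<^sub>1, 1}\<close>, every MSDD is
  eventually 1, and the monotone closures are the algebras themselves.

  Two copies of \<open>A\<close> and the single projection \<open>p\<^sub>1\<close> suffice for exact freeness. Represent two copies of \<open>A\<close>
  on the free product of their GNS spaces, let \<open>p\<^sub>1\<close> be the projection onto the words of odd length, and
  let \<open>\<phi>\<close> be the vacuum state; proceed likewise for \<open>B\<close>. Put
  \<open>j(a) = a(1) \<otimes> p\<^sub>1' + a(2) \<otimes> (1 - p\<^sub>1')\<close> and \<open>j(b) = p\<^sub>1 \<otimes> b(1) + (1 - p\<^sub>1) \<otimes> b(2)\<close>. Applied to the vacuum, an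
  alternating product of centred elements produces one alternating word in each tensor factor: every
  letter is taken from the copy given by the parity of the length of the other word, which has changed
  since the previous letter of the same factor was added. Such a nonempty vector is orthogonal to the
  vacuum. The tensor product of the two states is positive by the Schur product theorem, so that its
  pullback under \<open>j\<close> is the free product state.
\<close>

section \<open>Star algebras, ideals and quotients\<close>

text \<open>Two copies are used because a letter that meets a first letter of its own copy merges
  with it, while one from the other copy prolongs the word. One bit, the parity of the other word,
  then suffices to choose the right copy, and one bit is all that the relations leave: with
  \<open>q\<^sub>2 = 1\<close> the images of \<open>p\<^sub>1\<close> and \<open>p\<^sub>2\<close>
  are complementary and those of the later \<open>p\<^sub>k\<close> vanish. The algebras carry no
  norm and the states may be degenerate, so the GNS construction stays algebraic: formal words with
  a positive kernel replace the Hilbert space, operators are carried together with an adjoint, and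
  operators invisible to the form are factored out. In the tensor product, vectors are elements
  compared modulo the left kernel of the state. The free product state is a definite description, so
  its uniqueness has to be proved as well. Likewise the operations of the monotone closure are
  unions over representatives; they collapse only after the product formula has been shown to yield
  an OWMC at every index, not merely eventually.\<close>

lemma star_homI:
  assumes "\<And>x. x \<in> carrier A \<Longrightarrow> h x \<in> carrier B"
    and "\<And>x y. x \<in> carrier A \<Longrightarrow> y \<in> carrier A \<Longrightarrow> h (x \<otimes>\<^bsub>A\<^esub> y) = h x \<otimes>\<^bsub>B\<^esub> h y"
    and "\<And>x y. x \<in> carrier A \<Longrightarrow> y \<in> carrier A \<Longrightarrow> h (x \<oplus>\<^bsub>A\<^esub> y) = h x \<oplus>\<^bsub>B\<^esub> h y"
    and "h \<one>\<^bsub>A\<^esub> = \<one>\<^bsub>B\<^esub>"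
    and "\<And>c x. x \<in> carrier A \<Longrightarrow> h (c \<odot>\<^bsub>A\<^esub> x) = c \<odot>\<^bsub>B\<^esub> h x"
    and "\<And>x. x \<in> carrier A \<Longrightarrow> h (star A x) = star B (h x)"
  shows "star_hom A B h"
  using assms by (simp add: star_hom_def ring_hom_def)

lemma star_homD:
  assumes "star_hom A B h"
  shows star_hom_closed: "x \<in> carrier A \<Longrightarrow> h x \<in> carrier B"
    and star_hom_mult: "x \<in> carrier A \<Longrightarrow> y \<in> carrier A \<Longrightarrow> h (x \<otimes>\<^bsub>A\<^esub> y) = h x \<otimes>\<^bsub>B\<^esub> h y"
    and star_hom_add: "x \<in> carrier A \<Longrightarrow> y \<in> carrier A \<Longrightarrow> h (x \<oplus>\<^bsub>A\<^esub> y) = h x \<oplus>\<^bsub>B\<^esub> h y"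
    and star_hom_one: "h \<one>\<^bsub>A\<^esub> = \<one>\<^bsub>B\<^esub>"
    and star_hom_smult: "x \<in> carrier A \<Longrightarrow> h (c \<odot>\<^bsub>A\<^esub> x) = c \<odot>\<^bsub>B\<^esub> h x"
    and star_hom_star: "x \<in> carrier A \<Longrightarrow> h (star A x) = star B (h x)"
  using assms by (auto simp: star_hom_def ring_hom_def)

lemma star_hom_comp:
  assumes "star_hom A B g" "star_hom B C h"
  shows "star_hom A C (\<lambda>x. h (g x))"
  by (rule star_homI) (simp_all add: star_homD[OF assms(1)] star_homD[OF assms(2)])

lemma state_star_hom:
  assumes "star_algebra A" "star_hom A B h" "state B \<phi>"
  shows "state A (\<lambda>x. \<phi> (h x))"
proof -
  interpret star_algebra A by fact
  show ?thesis
    using assms(3) unfolding state_def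
    by (simp add: star_homD[OF assms(2)] star_closed)
qed

lemma stateD:
  assumes "state A \<phi>"
  shows state_add: "x \<in> carrier A \<Longrightarrow> y \<in> carrier A \<Longrightarrow> \<phi> (x \<oplus>\<^bsub>A\<^esub> y) = \<phi> x + \<phi> y"
    and state_smult: "x \<in> carrier A \<Longrightarrow> \<phi> (c \<odot>\<^bsub>A\<^esub> x) = c * \<phi> x"
    and state_one: "\<phi> \<one>\<^bsub>A\<^esub> = 1"
    and state_pos: "x \<in> carrier A \<Longrightarrow> \<phi> (star A x \<otimes>\<^bsub>A\<^esub> x) \<in> \<real>\<^sub>\<ge>\<^sub>0"
  using assms by (auto simp: state_def)

context star_algebra
begin

lemma smult_zero_left: "x \<in> carrier A \<Longrightarrow> 0 \<odot> x = \<zero>"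
  using smult_add_left[of x 0 0] by (metis add.l_cancel_one add_0 smult_closed)

lemma smult_minus_1: "x \<in> carrier A \<Longrightarrow> (-1) \<odot> x = \<ominus> x"
  using smult_add_left[of x "-1" 1] by (simp add: smult_1 smult_zero_left smult_closed minus_equality)

lemma smult_zero_right: "c \<odot> \<zero> = \<zero>"
  using smult_smult[of \<zero> c 0] by (simp add: smult_zero_left)

lemma smult_eq_mult: "x \<in> carrier A \<Longrightarrow> c \<odot> x = (c \<odot> \<one>) \<otimes> x"
  by (simp add: smult_mult_left)

lemma smult_diff:
  assumes "x \<in> carrier A" "y \<in> carrier A"
  shows "c \<odot> (x \<ominus> y) = c \<odot> x \<ominus> c \<odot> y"
proof -
  have "c \<odot> (x \<ominus> y) = c \<odot> x \<oplus> c \<odot> ((-1) \<odot> y)"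
    using assms by (simp add: a_minus_def smult_add_right smult_minus_1)
  also have "c \<odot> ((-1) \<odot> y) = (-1) \<odot> (c \<odot> y)"
    using assms by (simp add: smult_smult)
  also have "\<dots> = \<ominus> (c \<odot> y)" using assms by (simp only: smult_minus_1 smult_closed)
  finally show ?thesis by (simp add: a_minus_def)
qed

lemma minus_eq_zeroD:
  assumes "x \<in> carrier A" "y \<in> carrier A" "x \<ominus> y = \<zero>"
  shows "x = y"
proof -
  have "x = (x \<ominus> y) \<oplus> y" using assms(1,2) by (simp add: a_minus_def a_assoc l_neg)
  then show ?thesis using assms by simp
qed

lemma star_one: "star A \<one> = \<one>"
proof -
  have "star A (star A \<one> \<otimes> \<one>) = star A \<one> \<otimes> star A (star A \<one>)"
    by (rule star_mult) (simp_all add: star_closed)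
  then show ?thesis by (simp add: star_star star_closed)
qed

lemma star_zero: "star A \<zero> = \<zero>"
  using star_smult[of \<zero> 0] by (simp add: smult_zero_left star_closed)

lemma star_minus: "x \<in> carrier A \<Longrightarrow> star A (\<ominus> x) = \<ominus> star A x"
  using star_smult[of x "-1"] by (simp add: smult_minus_1 star_closed)

lemma star_diff: "x \<in> carrier A \<Longrightarrow> y \<in> carrier A \<Longrightarrow> star A (x \<ominus> y) = star A x \<ominus> star A y"
  by (simp add: a_minus_def star_add star_minus)

lemma state_zero: "state A \<phi> \<Longrightarrow> \<phi> \<zero> = 0"
  using state_smult[of A \<phi> \<zero> 0] by (simp add: smult_zero_left)

lemma state_minus: "state A \<phi> \<Longrightarrow> x \<in> carrier A \<Longrightarrow> \<phi> (\<ominus> x) = - \<phi> x"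
  using state_smult[of A \<phi> x "-1"] by (simp add: smult_minus_1)

lemma state_diff:
  "state A \<phi> \<Longrightarrow> x \<in> carrier A \<Longrightarrow> y \<in> carrier A \<Longrightarrow> \<phi> (x \<ominus> y) = \<phi> x - \<phi> y"
  by (simp add: a_minus_def state_add state_minus)

text \<open>Positivity at \<open>y \<oplus> \<one>\<close> and at \<open>y\<close> makes the mixed
  terms \<open>\<phi> (star A y) + \<phi> y\<close> real. Used for \<open>x\<close> itself this
  compares imaginary parts, and used for the multiple of \<open>x\<close> by the imaginary unit it
  compares real parts.\<close>

lemma state_star:
  assumes "state A \<phi>" "x \<in> carrier A"
  shows "\<phi> (star A x) = cnj (\<phi> x)"
proof -
  have main: "Im (\<phi> (star A y)) + Im (\<phi> y) = 0" if y: "y \<in> carrier A" for y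
  proof -
    have "star A (y \<oplus> \<one>) \<otimes> (y \<oplus> \<one>) = (star A y \<otimes> y \<oplus> star A y) \<oplus> (y \<oplus> \<one>)"
      using y by (simp add: star_add star_one l_distr r_distr star_closed a_ac)
    then have "\<phi> (star A (y \<oplus> \<one>) \<otimes> (y \<oplus> \<one>)) = \<phi> (star A y \<otimes> y) + \<phi> (star A y) + (\<phi> y + 1)"
      using y by (simp add: state_add[OF assms(1)] state_one[OF assms(1)] star_closed)
    moreover have "Im (\<phi> (star A z \<otimes> z)) = 0" if "z \<in> carrier A" for z
      using state_pos[OF assms(1) that] complex_nonneg_Reals_iff by blast
    ultimately have "Im (\<phi> (star A y \<otimes> y) + \<phi> (star A y) + (\<phi> y + 1)) = 0"
      "Im (\<phi> (star A y \<otimes> y)) = 0" using y a_closed[OF y one_closed] by metis+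
    then show ?thesis by simp
  qed
  have "Im (\<phi> (star A (\<i> \<odot> x))) + Im (\<phi> (\<i> \<odot> x)) = 0"
    using assms(2) by (intro main) (simp add: smult_closed)
  then have "Re (\<phi> (star A x)) = Re (\<phi> x)"
    using assms by (simp add: star_smult state_smult[OF assms(1)] star_closed)
  with main[OF assms(2)] show ?thesis by (simp add: complex_eq_iff)
qed

text \<open>Scaling is multiplication by \<open>c \<odot> \<one>\<close>, so every ring ideal is a
  linear subspace and may serve as an ideal of the algebra.\<close>

lemma ideal_smult_closed: "ideal I A \<Longrightarrow> x \<in> I \<Longrightarrow> c \<odot> x \<in> I"
  using ideal.I_l_closed[of I A x "c \<odot> \<one>"] additive_subgroup.a_Hcarr[OF ideal.axioms(1), of I A x]
  by (simp only: smult_eq_mult[of x c] smult_closed one_closed)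

end

lemma star_hom_zero:
  assumes "star_algebra A" "star_algebra B" "star_hom A B h"
  shows "h \<zero>\<^bsub>A\<^esub> = \<zero>\<^bsub>B\<^esub>"
proof -
  interpret A: star_algebra A by fact
  interpret B: star_algebra B by fact
  show ?thesis
    using star_hom_smult[OF assms(3), of "\<zero>\<^bsub>A\<^esub>" 0]
    by (simp add: A.smult_zero_left B.smult_zero_left star_hom_closed[OF assms(3)])
qed

lemma star_hom_minus:
  assumes "star_algebra A" "star_algebra B" "star_hom A B h" "x \<in> carrier A"
  shows "h (\<ominus>\<^bsub>A\<^esub> x) = \<ominus>\<^bsub>B\<^esub> h x"
proof -
  interpret A: star_algebra A by fact
  interpret B: star_algebra B by fact
  show ?thesis
    using star_hom_smult[OF assms(3,4), of "-1"]
    by (simp add: A.smult_minus_1 B.smult_minus_1 star_hom_closed[OF assms(3)] assms(4))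
qed

lemma star_hom_diff:
  assumes "star_algebra A" "star_algebra B" "star_hom A B h" "x \<in> carrier A" "y \<in> carrier A"
  shows "h (x \<ominus>\<^bsub>A\<^esub> y) = h x \<ominus>\<^bsub>B\<^esub> h y"
proof -
  interpret A: star_algebra A by fact
  show ?thesis using assms
    by (simp add: a_minus_def star_hom_add star_hom_minus)
qed

text \<open>Apart from closure and negatives the axioms are identities, and these pass along a
  surjection that respects the operations. The lemma covers both the renaming of elements by an
  injection and the passage to cosets.\<close>

lemma star_algebra_image:
  assumes "star_algebra A" and surj: "h ` carrier A = carrier B"
    and add: "\<And>x y. x \<in> carrier A \<Longrightarrow> y \<in> carrier A \<Longrightarrow> h x \<oplus>\<^bsub>B\<^esub> h y = h (x \<oplus>\<^bsub>A\<^esub> y)"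
    and mult: "\<And>x y. x \<in> carrier A \<Longrightarrow> y \<in> carrier A \<Longrightarrow> h x \<otimes>\<^bsub>B\<^esub> h y = h (x \<otimes>\<^bsub>A\<^esub> y)"
    and one: "\<one>\<^bsub>B\<^esub> = h \<one>\<^bsub>A\<^esub>"
    and zero: "\<zero>\<^bsub>B\<^esub> = h \<zero>\<^bsub>A\<^esub>"
    and smult: "\<And>c x. x \<in> carrier A \<Longrightarrow> c \<odot>\<^bsub>B\<^esub> h x = h (c \<odot>\<^bsub>A\<^esub> x)"
    and star: "\<And>x. x \<in> carrier A \<Longrightarrow> star B (h x) = h (star A x)"
  shows "star_algebra B"
proof -
  interpret A: star_algebra A by fact
  note hom = add mult one zero smult star
  have ex: "\<exists>x\<in>carrier A. y = h x" if "y \<in> carrier B" for y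
    using that surj by auto
  have cl: "h x \<in> carrier B" if "x \<in> carrier A" for x
    using that surj by auto
  note [simp] = hom cl A.smult_closed A.star_closed
  have grp: "abelian_group B"
  proof (rule abelian_groupI)
    fix x y z
    assume "x \<in> carrier B" "y \<in> carrier B" "z \<in> carrier B"
    then obtain x' y' z' where *: "x' \<in> carrier A" "y' \<in> carrier A" "z' \<in> carrier A"
      "x = h x'" "y = h y'" "z = h z'" using ex by metis
    show "x \<oplus>\<^bsub>B\<^esub> y \<oplus>\<^bsub>B\<^esub> z = x \<oplus>\<^bsub>B\<^esub> (y \<oplus>\<^bsub>B\<^esub> z)" using * by (simp add: A.a_assoc)
  next
    fix x y assume "x \<in> carrier B" "y \<in> carrier B"
    then obtain x' y' where *: "x' \<in> carrier A" "y' \<in> carrier A" "x = h x'" "y = h y'"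
      using ex by metis
    show "x \<oplus>\<^bsub>B\<^esub> y \<in> carrier B" "x \<oplus>\<^bsub>B\<^esub> y = y \<oplus>\<^bsub>B\<^esub> x"
      using * by (simp_all add: A.a_comm)
  next
    fix x assume "x \<in> carrier B"
    then obtain x' where *: "x' \<in> carrier A" "x = h x'" using ex by metis
    show "\<zero>\<^bsub>B\<^esub> \<oplus>\<^bsub>B\<^esub> x = x" using * by simp
    show "\<exists>y\<in>carrier B. y \<oplus>\<^bsub>B\<^esub> x = \<zero>\<^bsub>B\<^esub>"
      using * by (intro bexI[of _ "h (\<ominus>\<^bsub>A\<^esub> x')"]) (simp_all add: A.l_neg)
  qed simp
  have "ring B"
  proof (rule ringI[OF grp])
    show "monoid B"
    proof (rule monoidI)
      fix x y z
      assume "x \<in> carrier B" "y \<in> carrier B" "z \<in> carrier B"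
      then obtain x' y' z' where *: "x' \<in> carrier A" "y' \<in> carrier A" "z' \<in> carrier A"
        "x = h x'" "y = h y'" "z = h z'" using ex by metis
      show "x \<otimes>\<^bsub>B\<^esub> y \<otimes>\<^bsub>B\<^esub> z = x \<otimes>\<^bsub>B\<^esub> (y \<otimes>\<^bsub>B\<^esub> z)" using * by (simp add: A.m_assoc)
    next
      fix x y assume "x \<in> carrier B" "y \<in> carrier B"
      then obtain x' y' where *: "x' \<in> carrier A" "y' \<in> carrier A" "x = h x'" "y = h y'"
        using ex by metis
      show "x \<otimes>\<^bsub>B\<^esub> y \<in> carrier B" using * by simp
    next
      fix x assume "x \<in> carrier B"
      then obtain x' where *: "x' \<in> carrier A" "x = h x'" using ex by metis
      show "\<one>\<^bsub>B\<^esub> \<otimes>\<^bsub>B\<^esub> x = x" "x \<otimes>\<^bsub>B\<^esub> \<one>\<^bsub>B\<^esub> = x" using * by simp_all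
    qed simp
  next
    fix x y z
    assume "x \<in> carrier B" "y \<in> carrier B" "z \<in> carrier B"
    then obtain x' y' z' where *: "x' \<in> carrier A" "y' \<in> carrier A" "z' \<in> carrier A"
      "x = h x'" "y = h y'" "z = h z'" using ex by metis
    show "(x \<oplus>\<^bsub>B\<^esub> y) \<otimes>\<^bsub>B\<^esub> z = x \<otimes>\<^bsub>B\<^esub> z \<oplus>\<^bsub>B\<^esub> y \<otimes>\<^bsub>B\<^esub> z"
      "z \<otimes>\<^bsub>B\<^esub> (x \<oplus>\<^bsub>B\<^esub> y) = z \<otimes>\<^bsub>B\<^esub> x \<oplus>\<^bsub>B\<^esub> z \<otimes>\<^bsub>B\<^esub> y"
      using * by (simp_all add: A.l_distr A.r_distr)
  qed
  moreover have "star_algebra_axioms B"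
  proof (unfold star_algebra_axioms_def, intro conjI allI impI)
    fix x y c d
    assume "x \<in> carrier B" 
    then obtain x' where x: "x' \<in> carrier A" "x = h x'" using ex by metis
    show "c \<odot>\<^bsub>B\<^esub> x \<in> carrier B" "star B x \<in> carrier B" using x by simp_all
    show "(c + d) \<odot>\<^bsub>B\<^esub> x = c \<odot>\<^bsub>B\<^esub> x \<oplus>\<^bsub>B\<^esub> d \<odot>\<^bsub>B\<^esub> x" "c \<odot>\<^bsub>B\<^esub> (d \<odot>\<^bsub>B\<^esub> x) = (c * d) \<odot>\<^bsub>B\<^esub> x"
      "1 \<odot>\<^bsub>B\<^esub> x = x" "star B (star B x) = x" "star B (c \<odot>\<^bsub>B\<^esub> x) = cnj c \<odot>\<^bsub>B\<^esub> star B x"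
      using x by (simp_all add: A.smult_add_left A.smult_smult A.smult_1 A.star_star A.star_smult)
    assume "y \<in> carrier B"
    then obtain y' where y: "y' \<in> carrier A" "y = h y'" using ex by metis
    show "c \<odot>\<^bsub>B\<^esub> (x \<oplus>\<^bsub>B\<^esub> y) = c \<odot>\<^bsub>B\<^esub> x \<oplus>\<^bsub>B\<^esub> c \<odot>\<^bsub>B\<^esub> y"
      "c \<odot>\<^bsub>B\<^esub> x \<otimes>\<^bsub>B\<^esub> y = c \<odot>\<^bsub>B\<^esub> (x \<otimes>\<^bsub>B\<^esub> y)" "x \<otimes>\<^bsub>B\<^esub> (c \<odot>\<^bsub>B\<^esub> y) = c \<odot>\<^bsub>B\<^esub> (x \<otimes>\<^bsub>B\<^esub> y)"
      "star B (x \<oplus>\<^bsub>B\<^esub> y) = star B x \<oplus>\<^bsub>B\<^esub> star B y" "star B (x \<otimes>\<^bsub>B\<^esub> y) = star B y \<otimes>\<^bsub>B\<^esub> star B x"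
      using x y by (simp_all add: A.smult_add_right A.smult_mult_left A.smult_mult_right A.star_add A.star_mult)
  qed
  ultimately show ?thesis by (simp add: star_algebra_def)
qed

lemma
  assumes "star_algebra A" "inj_on f (carrier A)"
  shows star_algebra_transported: "star_algebra (transported_algebra f A)"
    and star_hom_transported: "star_hom A (transported_algebra f A) f"
proof -
  interpret A: star_algebra A by fact
  let ?B = "transported_algebra f A"
  have inv: "inv_into (carrier A) f (f x) = x" if "x \<in> carrier A" for x
    using that assms(2) by (rule inv_into_f_f[rotated])
  note [simp] = transported_algebra_def Let_def inv
  show "star_algebra ?B"
    by (rule star_algebra_image[OF assms(1), of f]) simp_all
  show "star_hom A ?B f"
    by (rule star_homI) simp_all
qed

lemma carrier_transported: "carrier (transported_algebra f A) = f ` carrier A"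
  by (simp add: transported_algebra_def Let_def)

lemma star_hom_inv_transported:
  assumes "star_algebra A" "inj_on f (carrier A)"
  shows "star_hom (transported_algebra f A) A (inv_into (carrier A) f)"
proof -
  interpret A: star_algebra A by fact
  have inv: "inv_into (carrier A) f (f x) = x" if "x \<in> carrier A" for x
    using that assms(2) by (rule inv_into_f_f[rotated])
  show ?thesis
    by (rule star_homI) (auto simp: transported_algebra_def Let_def inv A.smult_closed A.star_closed)
qed

section \<open>Star ideals, quotients and their universal property\<close>

definition star_ideal :: "('a, 'x) star_algebra_scheme \<Rightarrow> 'a set \<Rightarrow> bool" where
  "star_ideal A I \<longleftrightarrow> ideal I A \<and> (\<forall>x\<in>I. star A x \<in> I)"

text \<open>Negatives are multiples by the element \<open>(-1) \<odot> \<one>\<close>, so closure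
  under them follows from absorption.\<close>

lemma star_idealI:
  assumes "star_algebra A" "I \<subseteq> carrier A" "\<zero>\<^bsub>A\<^esub> \<in> I"
    and "\<And>x y. x \<in> I \<Longrightarrow> y \<in> I \<Longrightarrow> x \<oplus>\<^bsub>A\<^esub> y \<in> I"
    and "\<And>x y. x \<in> carrier A \<Longrightarrow> y \<in> I \<Longrightarrow> x \<otimes>\<^bsub>A\<^esub> y \<in> I"
    and "\<And>x y. x \<in> carrier A \<Longrightarrow> y \<in> I \<Longrightarrow> y \<otimes>\<^bsub>A\<^esub> x \<in> I"
    and "\<And>x. x \<in> I \<Longrightarrow> star A x \<in> I"
  shows "star_ideal A I"
proof -
  interpret A: star_algebra A by fact
  have "\<ominus>\<^bsub>A\<^esub> x \<in> I" if "x \<in> I" for x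
  proof -
    have "x \<in> carrier A" using that assms(2) by auto
    then have "\<ominus>\<^bsub>A\<^esub> x = ((-1) \<odot>\<^bsub>A\<^esub> \<one>\<^bsub>A\<^esub>) \<otimes>\<^bsub>A\<^esub> x"
      using A.smult_eq_mult[of x "-1"] by (simp only: A.smult_minus_1)
    then show ?thesis using assms(5)[OF _ that] by (simp add: A.smult_closed)
  qed
  then have "ideal I A"
    by (intro idealI A.ring_axioms A.add.subgroupI) (use assms in \<open>auto simp: a_inv_def\<close>)
  then show ?thesis using assms(7) by (simp add: star_ideal_def)
qed

lemma star_ideal_generated_minimal:
  "star_ideal A I \<Longrightarrow> R \<subseteq> I \<Longrightarrow> star_ideal_generated A R \<subseteq> I"
  by (auto simp: star_ideal_generated_def star_ideal_def)

lemma
  assumes "star_algebra A" "R \<subseteq> carrier A"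
  shows star_ideal_star_ideal_generated: "star_ideal A (star_ideal_generated A R)"
    and star_ideal_generated_incl: "R \<subseteq> star_ideal_generated A R"
proof -
  interpret A: star_algebra A by fact
  have "ideal (star_ideal_generated A R) A"
    unfolding star_ideal_generated_def
    by (rule A.i_Intersect) (use assms(2) A.oneideal A.star_closed in auto)
  then show "star_ideal A (star_ideal_generated A R)"
    by (auto simp: star_ideal_def star_ideal_generated_def)
  show "R \<subseteq> star_ideal_generated A R" by (auto simp: star_ideal_generated_def)
qed

lemma star_ideal_vimage:
  assumes "star_algebra A" "star_algebra B" "star_hom A B h" "star_ideal B J"
  shows "star_ideal A {x \<in> carrier A. h x \<in> J}"
proof -
  interpret A: star_algebra A by fact
  interpret B: star_algebra B by fact
  interpret J: ideal J B using assms(4) by (simp add: star_ideal_def)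
  show ?thesis
    by (rule star_idealI[OF assms(1)])
      (use assms(4) in \<open>auto simp: star_homD[OF assms(3)] star_hom_zero[OF assms(1-3)] J.I_l_closed
        J.I_r_closed A.star_closed star_ideal_def\<close>)
qed

lemma star_ideal_zero:
  assumes "star_algebra A"
  shows "star_ideal A {\<zero>\<^bsub>A\<^esub>}"
proof -
  interpret A: star_algebra A by fact
  show ?thesis by (rule star_idealI[OF assms]) (auto simp: A.star_zero)
qed

text \<open>The ring operations are those of the quotient ring; scaling and adjoints are unions over
  a coset and have to be shown independent of the representative. The axioms are then inherited
  along the coset map.\<close>

lemma
  assumes "star_algebra A" "star_ideal A I"
  shows star_algebra_quotient: "star_algebra (star_quotient A I)"
    and star_hom_quotient: "star_hom A (star_quotient A I) (\<lambda>x. I +>\<^bsub>A\<^esub> x)"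
    and carrier_quotient: "carrier (star_quotient A I) = (\<lambda>x. I +>\<^bsub>A\<^esub> x) ` carrier A"
    and coset_eq_iff: "x \<in> carrier A \<Longrightarrow> y \<in> carrier A \<Longrightarrow>
      I +>\<^bsub>A\<^esub> x = I +>\<^bsub>A\<^esub> y \<longleftrightarrow> x \<ominus>\<^bsub>A\<^esub> y \<in> I"
    and mem_coset: "x \<in> carrier A \<Longrightarrow> y \<in> I +>\<^bsub>A\<^esub> x \<Longrightarrow> y \<in> carrier A \<and> I +>\<^bsub>A\<^esub> y = I +>\<^bsub>A\<^esub> x"
    and self_mem_coset: "x \<in> carrier A \<Longrightarrow> x \<in> I +>\<^bsub>A\<^esub> x"
proof -
  interpret A: star_algebra A by fact
  interpret I: ideal I A using assms(2) by (simp add: star_ideal_def)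
  let ?B = "star_quotient A I" and ?k = "\<lambda>x. I +>\<^bsub>A\<^esub> x"
  show eq: "I +>\<^bsub>A\<^esub> x = I +>\<^bsub>A\<^esub> y \<longleftrightarrow> x \<ominus>\<^bsub>A\<^esub> y \<in> I" if "x \<in> carrier A" "y \<in> carrier A" for x y
    by (rule A.quotient_eq_iff_same_a_r_cos[OF I.ideal_axioms that, symmetric])
  show mem: "y \<in> carrier A \<and> I +>\<^bsub>A\<^esub> y = I +>\<^bsub>A\<^esub> x" if "x \<in> carrier A" "y \<in> I +>\<^bsub>A\<^esub> x" for x y
    using I.a_elemrcos_carrier[OF that] I.a_repr_independence'[OF that(2,1)] by metis
  show self: "x \<in> I +>\<^bsub>A\<^esub> x" if "x \<in> carrier A" for x
    using that by (rule I.a_rcos_self)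
  \<comment> \<open>The union over a coset collapses as soon as \<open>g\<close> maps elements
    congruent modulo \<open>I\<close> to congruent ones.\<close>
  have Un: "(\<Union>y\<in>?k x. ?k (g y)) = ?k (g x)"
    if x: "x \<in> carrier A" and g: "\<And>y. y \<in> carrier A \<Longrightarrow> g y \<in> carrier A"
      "\<And>y. y \<in> carrier A \<Longrightarrow> y \<ominus>\<^bsub>A\<^esub> x \<in> I \<Longrightarrow> g y \<ominus>\<^bsub>A\<^esub> g x \<in> I" for x g
  proof -
    have "?k (g y) = ?k (g x)" if "y \<in> ?k x" for y
    proof -
      have y: "y \<in> carrier A" "?k y = ?k x" using mem[OF x that] by auto
      then have "y \<ominus>\<^bsub>A\<^esub> x \<in> I" by (simp only: eq[OF y(1) x])
      from g(2)[OF y(1) this] show ?thesis by (simp only: eq[OF g(1)[OF y(1)] g(1)[OF x]])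
    qed
    then show ?thesis using self[OF x] by blast
  qed
  have smult: "c \<odot>\<^bsub>?B\<^esub> ?k x = ?k (c \<odot>\<^bsub>A\<^esub> x)" if "x \<in> carrier A" for c x
  proof -
    have "(\<Union>y\<in>?k x. ?k (c \<odot>\<^bsub>A\<^esub> y)) = ?k (c \<odot>\<^bsub>A\<^esub> x)"
    proof (rule Un[OF that])
      fix y assume y: "y \<in> carrier A" "y \<ominus>\<^bsub>A\<^esub> x \<in> I"
      show "c \<odot>\<^bsub>A\<^esub> y \<ominus>\<^bsub>A\<^esub> c \<odot>\<^bsub>A\<^esub> x \<in> I"
        using A.ideal_smult_closed[OF I.ideal_axioms y(2), of c] that y by (simp add: A.smult_diff)
    qed (rule A.smult_closed)
    then show ?thesis by (simp add: star_quotient_def)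
  qed
  have star: "star ?B (?k x) = ?k (star A x)" if "x \<in> carrier A" for x
  proof -
    have "(\<Union>y\<in>?k x. ?k (star A y)) = ?k (star A x)"
    proof (rule Un[OF that])
      fix y assume y: "y \<in> carrier A" "y \<ominus>\<^bsub>A\<^esub> x \<in> I"
      then have "star A (y \<ominus>\<^bsub>A\<^esub> x) \<in> I" using assms(2) by (simp add: star_ideal_def)
      then show "star A y \<ominus>\<^bsub>A\<^esub> star A x \<in> I" using that y by (simp add: A.star_diff)
    qed (rule A.star_closed)
    then show ?thesis by (simp add: star_quotient_def)
  qed
  have mult: "?k x \<otimes>\<^bsub>?B\<^esub> ?k y = ?k (x \<otimes>\<^bsub>A\<^esub> y)" and add: "?k x \<oplus>\<^bsub>?B\<^esub> ?k y = ?k (x \<oplus>\<^bsub>A\<^esub> y)"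
    if "x \<in> carrier A" "y \<in> carrier A" for x y
    using that ring_hom_mult[OF I.rcos_ring_hom] ring_hom_add[OF I.rcos_ring_hom]
    by (simp_all add: star_quotient_def)
  have one: "\<one>\<^bsub>?B\<^esub> = ?k \<one>\<^bsub>A\<^esub>"
    using ring_hom_one[OF I.rcos_ring_hom] by (simp add: star_quotient_def)
  have zero: "\<zero>\<^bsub>?B\<^esub> = ?k \<zero>\<^bsub>A\<^esub>"
    using A.a_coset_add_zero[OF I.a_subset] by (simp add: star_quotient_def FactRing_def)
  show car: "carrier ?B = ?k ` carrier A"
    by (simp add: star_quotient_def FactRing_def A_RCOSETS_def RCOSETS_def a_r_coset_def) blast
  show "star_algebra ?B"
    by (rule star_algebra_image[OF assms(1) car[symmetric]])
      (simp_all add: mult add one zero smult star)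
  show "star_hom A ?B ?k"
    by (rule star_homI) (simp_all add: mult add one smult star car)
qed

text \<open>The kernel of \<open>h\<close> is a star ideal containing \<open>R\<close>, hence it
  contains the ideal generated by \<open>R\<close>, and \<open>h\<close> is constant on
  cosets.\<close>

lemma quotient_universal:
  assumes "star_algebra A" "star_algebra B" "star_hom A B h" "R \<subseteq> carrier A"
    and R: "\<And>r. r \<in> R \<Longrightarrow> h r = \<zero>\<^bsub>B\<^esub>"
  defines "I \<equiv> star_ideal_generated A R"
  obtains g where "star_hom (star_quotient A I) B g" "\<And>x. x \<in> carrier A \<Longrightarrow> g (I +>\<^bsub>A\<^esub> x) = h x"
proof -
  interpret A: star_algebra A by fact
  interpret B: star_algebra B by fact
  have I: "star_ideal A I" unfolding I_def
    using star_ideal_star_ideal_generated[OF assms(1,4)] .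
  note q = star_algebra_quotient[OF assms(1) I] star_hom_quotient[OF assms(1) I]
    carrier_quotient[OF assms(1) I] coset_eq_iff[OF assms(1) I] self_mem_coset[OF assms(1) I]
  have sub: "I \<subseteq> {x \<in> carrier A. h x \<in> {\<zero>\<^bsub>B\<^esub>}}" unfolding I_def
    by (rule star_ideal_generated_minimal[OF star_ideal_vimage[OF assms(1-3) star_ideal_zero[OF assms(2)]]])
      (use R assms(4) in auto)
  have well: "h x = h y" if "x \<in> carrier A" "y \<in> carrier A" "I +>\<^bsub>A\<^esub> x = I +>\<^bsub>A\<^esub> y" for x y
  proof -
    have "h (x \<ominus>\<^bsub>A\<^esub> y) = \<zero>\<^bsub>B\<^esub>" using q(4)[OF that(1,2)] that(3) sub by blast
    then show ?thesis using that
      by (simp add: star_hom_diff[OF assms(1-3)] star_hom_closed[OF assms(3)] B.minus_eq_zeroD)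
  qed
  define g where "g X = h (SOME x. x \<in> carrier A \<and> X = I +>\<^bsub>A\<^esub> x)" for X
  have g: "g (I +>\<^bsub>A\<^esub> x) = h x" if "x \<in> carrier A" for x
  proof -
    have "\<exists>y. y \<in> carrier A \<and> I +>\<^bsub>A\<^esub> x = I +>\<^bsub>A\<^esub> y" using that by blast
    from someI_ex[OF this] show ?thesis unfolding g_def using well[OF that] by metis
  qed
  have "star_hom (star_quotient A I) B g"
  proof (rule star_homI)
    fix X Y c assume "X \<in> carrier (star_quotient A I)"
    then obtain x where x: "x \<in> carrier A" "X = I +>\<^bsub>A\<^esub> x" by (auto simp: q(3))
    show "g X \<in> carrier B" using x by (simp add: g star_hom_closed[OF assms(3)])
    show "g (c \<odot>\<^bsub>star_quotient A I\<^esub> X) = c \<odot>\<^bsub>B\<^esub> g X"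
      using x by (simp only: g star_hom_smult[OF q(2), symmetric] star_hom_smult[OF assms(3)] A.smult_closed)
    show "g (star (star_quotient A I) X) = star B (g X)"
      using x by (simp only: g star_hom_star[OF q(2), symmetric] star_hom_star[OF assms(3)] A.star_closed)
    assume "Y \<in> carrier (star_quotient A I)"
    then obtain y where y: "y \<in> carrier A" "Y = I +>\<^bsub>A\<^esub> y" by (auto simp: q(3))
    show "g (X \<otimes>\<^bsub>star_quotient A I\<^esub> Y) = g X \<otimes>\<^bsub>B\<^esub> g Y"
      using x y by (simp only: g star_hom_mult[OF q(2), symmetric] star_hom_mult[OF assms(3)] A.m_closed)
    show "g (X \<oplus>\<^bsub>star_quotient A I\<^esub> Y) = g X \<oplus>\<^bsub>B\<^esub> g Y"
      using x y by (simp only: g star_hom_add[OF q(2), symmetric] star_hom_add[OF assms(3)] A.a_closed)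
  next
    show "g \<one>\<^bsub>star_quotient A I\<^esub> = \<one>\<^bsub>B\<^esub>"
      by (simp only: g star_hom_one[OF q(2), symmetric] star_hom_one[OF assms(3)] A.one_closed)
  qed
  then show thesis using g that by blast
qed

section \<open>Subalgebras and generation\<close>

lemma star_subalgebra_vimage:
  assumes "star_algebra A" "star_hom A B h" "star_subalgebra B S"
  shows "star_subalgebra A {x \<in> carrier A. h x \<in> S}"
proof -
  interpret A: star_algebra A by fact
  show ?thesis using assms(3)
    by (auto simp: star_subalgebra_def star_homD[OF assms(2)] A.smult_closed A.star_closed)
qed

lemma star_subalgebra_image:
  assumes "star_hom A B h" "star_subalgebra A S"
  shows "star_subalgebra B (h ` S)"
proof -
  have S: "S \<subseteq> carrier A" "\<one>\<^bsub>A\<^esub> \<in> S"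
    "\<And>x y. x \<in> S \<Longrightarrow> y \<in> S \<Longrightarrow> x \<oplus>\<^bsub>A\<^esub> y \<in> S" "\<And>x y. x \<in> S \<Longrightarrow> y \<in> S \<Longrightarrow> x \<otimes>\<^bsub>A\<^esub> y \<in> S"
    "\<And>c x. x \<in> S \<Longrightarrow> c \<odot>\<^bsub>A\<^esub> x \<in> S" "\<And>x. x \<in> S \<Longrightarrow> star A x \<in> S"
    using assms(2) by (auto simp: star_subalgebra_def)
  show ?thesis unfolding star_subalgebra_def
  proof (intro conjI ballI allI)
    show "h ` S \<subseteq> carrier B" using star_hom_closed[OF assms(1)] S(1) by auto
    show "\<one>\<^bsub>B\<^esub> \<in> h ` S"
      using S(2) star_hom_one[OF assms(1)] by (metis imageI)
    fix x c assume "x \<in> h ` S"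
    then obtain x' where x: "x' \<in> S" "x = h x'" by auto
    show "c \<odot>\<^bsub>B\<^esub> x \<in> h ` S" using imageI[OF S(5)[OF x(1)], of h] star_hom_smult[OF assms(1)] S(1) x by auto
    show "star B x \<in> h ` S" using imageI[OF S(6)[OF x(1)], of h] star_hom_star[OF assms(1)] S(1) x by auto
    fix y assume "y \<in> h ` S"
    then obtain y' where y: "y' \<in> S" "y = h y'" by auto
    have "x' \<in> carrier A" "y' \<in> carrier A" using x y S(1) by auto
    then show "x \<oplus>\<^bsub>B\<^esub> y \<in> h ` S" "x \<otimes>\<^bsub>B\<^esub> y \<in> h ` S"
      using imageI[OF S(3)[OF x(1) y(1)], of h] imageI[OF S(4)[OF x(1) y(1)], of h] x y
      by (simp_all add: star_hom_add[OF assms(1)] star_hom_mult[OF assms(1)])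
  qed
qed

lemma star_subalgebra_carrier: "star_algebra A \<Longrightarrow> star_subalgebra A (carrier A)"
proof -
  assume "star_algebra A"
  then interpret A: star_algebra A .
  show ?thesis by (auto simp: star_subalgebra_def A.smult_closed A.star_closed)
qed

lemma star_subalgebra_generated_incl: "G \<subseteq> star_subalgebra_generated A G"
  by (auto simp: star_subalgebra_generated_def)

lemma star_subalgebra_generated_minimal:
  "star_subalgebra A S \<Longrightarrow> G \<subseteq> S \<Longrightarrow> star_subalgebra_generated A G \<subseteq> S"
  by (auto simp: star_subalgebra_generated_def)

lemma star_subalgebra_generated_mono:
  "G \<subseteq> G' \<Longrightarrow> star_subalgebra_generated A G \<subseteq> star_subalgebra_generated A G'"
  by (auto simp: star_subalgebra_generated_def)

lemma star_subalgebra_star_subalgebra_generated: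
  assumes "star_algebra A" "G \<subseteq> carrier A"
  shows "star_subalgebra A (star_subalgebra_generated A G)"
proof -
  have "star_subalgebra_generated A G \<subseteq> carrier A"
    by (rule star_subalgebra_generated_minimal[OF star_subalgebra_carrier[OF assms(1)] assms(2)])
  then show ?thesis
    unfolding star_subalgebra_def star_subalgebra_generated_def by blast
qed

lemma star_subalgebra_directed_Union:
  assumes "\<And>m. star_subalgebra A (F m)" "\<And>m n :: nat. m \<le> n \<Longrightarrow> F m \<subseteq> F n"
  shows "star_subalgebra A (\<Union>m. F m)"
proof -
  have ex: "\<exists>m. x \<in> F m \<and> y \<in> F m" if xy: "x \<in> (\<Union>m. F m)" "y \<in> (\<Union>m. F m)" for x y
  proof -
    obtain k l where "x \<in> F k" "y \<in> F l" using xy by blast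
    then show ?thesis using assms(2)[of k "max k l"] assms(2)[of l "max k l"] by auto
  qed
  have F: "F m \<subseteq> carrier A" "\<one>\<^bsub>A\<^esub> \<in> F m"
    "\<And>x y. x \<in> F m \<Longrightarrow> y \<in> F m \<Longrightarrow> x \<oplus>\<^bsub>A\<^esub> y \<in> F m \<and> x \<otimes>\<^bsub>A\<^esub> y \<in> F m"
    "\<And>c x. x \<in> F m \<Longrightarrow> c \<odot>\<^bsub>A\<^esub> x \<in> F m" "\<And>x. x \<in> F m \<Longrightarrow> star A x \<in> F m" for m
    using assms(1)[of m] by (simp_all add: star_subalgebra_def)
  show ?thesis
    unfolding star_subalgebra_def
  proof (intro conjI ballI allI)
    show "x \<oplus>\<^bsub>A\<^esub> y \<in> (\<Union>m. F m)" "x \<otimes>\<^bsub>A\<^esub> y \<in> (\<Union>m. F m)"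
      if xy: "x \<in> (\<Union>m. F m)" "y \<in> (\<Union>m. F m)" for x y
    proof -
      obtain m where "x \<in> F m" "y \<in> F m" using ex[OF xy] by blast
      from F(3)[OF this] show "x \<oplus>\<^bsub>A\<^esub> y \<in> (\<Union>m. F m)" "x \<otimes>\<^bsub>A\<^esub> y \<in> (\<Union>m. F m)" by blast+
    qed
    fix x assume "x \<in> (\<Union>m. F m)"
    then obtain m where x: "x \<in> F m" by blast
    show "c \<odot>\<^bsub>A\<^esub> x \<in> (\<Union>m. F m)" for c using F(4)[OF x, of c] by blast
    show "star A x \<in> (\<Union>m. F m)" using F(5)[OF x] by blast
  qed (use F(1,2) in auto)
qed

section \<open>Monoid algebras\<close>

lemma poly_mapping_expand:
  "f = (\<Sum>k\<in>Poly_Mapping.keys f. Poly_Mapping.single k (Poly_Mapping.lookup f k))"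
  by (rule poly_mapping_eqI) (simp add: lookup_sum lookup_single when_def in_keys_iff)

lemma keys_add_subset:
  "Poly_Mapping.keys f \<subseteq> G \<Longrightarrow> Poly_Mapping.keys g \<subseteq> G \<Longrightarrow> Poly_Mapping.keys (f + g) \<subseteq> G"
  using keys_add[of f g] by blast

text \<open>The standard reduction of linear statements to basis vectors. The set \<open>G\<close>
  keeps every intermediate vector inside the carrier, where the axioms of the algebra apply.\<close>

lemma poly_mapping_span_induct [consumes 1, case_names zero single add]:
  fixes f :: "'a \<Rightarrow>\<^sub>0 complex"
  assumes "Poly_Mapping.keys f \<subseteq> G" and "P 0" and "\<And>g c. g \<in> G \<Longrightarrow> P (Poly_Mapping.single g c)"
    and add: "\<And>f g. Poly_Mapping.keys f \<subseteq> G \<Longrightarrow> Poly_Mapping.keys g \<subseteq> G \<Longrightarrow> P f \<Longrightarrow> P g \<Longrightarrow> P (f + g)"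
  shows "P f"
proof -
  have "P (\<Sum>k\<in>S. Poly_Mapping.single k (Poly_Mapping.lookup f k))
      \<and> Poly_Mapping.keys (\<Sum>k\<in>S. Poly_Mapping.single k (Poly_Mapping.lookup f k)) \<subseteq> G"
    if "finite S" "S \<subseteq> Poly_Mapping.keys f" for S
    using that
  proof (induction S rule: finite_induct)
    case (insert k S)
    have k: "k \<in> G" using insert assms(1) by auto
    have "Poly_Mapping.keys (Poly_Mapping.single k (Poly_Mapping.lookup f k)) \<subseteq> G" using k by simp
    with insert show ?case using assms(3)[OF k] by (simp add: add keys_add_subset)
  qed (simp add: assms(2))
  from this[OF finite_keys order_refl] show ?thesis
    using poly_mapping_expand[of f] by metis
qed

text \<open>The coefficient is an argument of \<open>F\<close> and not a factor in front of it, so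
  that antilinear extensions such as the involution, and nested ones such as the product, have the
  same form.\<close>

definition lin_ext :: "('a \<Rightarrow> complex \<Rightarrow> 'b::comm_monoid_add) \<Rightarrow> ('a \<Rightarrow>\<^sub>0 complex) \<Rightarrow> 'b" where
  "lin_ext F f = (\<Sum>s\<in>Poly_Mapping.keys f. F s (Poly_Mapping.lookup f s))"

lemma lin_ext_zero [simp]: "lin_ext F 0 = 0"
  by (simp add: lin_ext_def)

lemma lin_ext_single: "F s 0 = 0 \<Longrightarrow> lin_ext F (Poly_Mapping.single s c) = F s c"
  by (simp add: lin_ext_def)

lemma lin_ext_add:
  assumes "\<And>s. F s 0 = 0" "\<And>s x y. F s (x + y) = F s x + F s y"
  shows "lin_ext F (f + g) = lin_ext F f + lin_ext F g"
  unfolding lin_ext_def by (rule setsum_keys_plus_distrib) (simp_all add: assms)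

definition scale_pm :: "complex \<Rightarrow> ('a \<Rightarrow>\<^sub>0 complex) \<Rightarrow> ('a \<Rightarrow>\<^sub>0 complex)" where
  "scale_pm c = Poly_Mapping.map ((*) c)"

lemma lookup_scale_pm [simp]: "Poly_Mapping.lookup (scale_pm c f) k = c * Poly_Mapping.lookup f k"
  by (simp add: scale_pm_def map.rep_eq when_def)

lemma scale_pm_single [simp]: "scale_pm c (Poly_Mapping.single k d) = Poly_Mapping.single k (c * d)"
  by (simp add: scale_pm_def)

lemma scale_pm_add: "scale_pm c (f + g) = scale_pm c f + scale_pm c g"
  by (rule poly_mapping_eqI) (simp add: lookup_add distrib_left)

lemma scale_pm_add_left: "scale_pm (c + d) f = scale_pm c f + scale_pm d f"
  by (rule poly_mapping_eqI) (simp add: lookup_add distrib_right)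

lemma scale_pm_scale_pm: "scale_pm c (scale_pm d f) = scale_pm (c * d) f"
  by (rule poly_mapping_eqI) simp

lemma scale_pm_1 [simp]: "scale_pm 1 f = f"
  by (rule poly_mapping_eqI) simp

lemma scale_pm_0 [simp]: "scale_pm c 0 = 0"
  by (rule poly_mapping_eqI) simp

lemma scale_pm_0_left [simp]: "scale_pm 0 f = 0"
  by (rule poly_mapping_eqI) simp

lemma keys_scale_pm: "Poly_Mapping.keys (scale_pm c f) \<subseteq> Poly_Mapping.keys f"
  by (auto simp: in_keys_iff)

locale involutive_monoid = monoid M for M :: "('m, 'x) monoid_scheme" (structure) +
  fixes adj :: "'m \<Rightarrow> 'm"
  assumes adj_closed: "s \<in> carrier M \<Longrightarrow> adj s \<in> carrier M"
    and adj_adj: "s \<in> carrier M \<Longrightarrow> adj (adj s) = s"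
    and adj_mult: "s \<in> carrier M \<Longrightarrow> t \<in> carrier M \<Longrightarrow> adj (s \<otimes> t) = adj t \<otimes> adj s"
begin

abbreviation "MA \<equiv> monoid_algebra M adj"

lemma MA_mult: "f \<otimes>\<^bsub>MA\<^esub> g =
    lin_ext (\<lambda>s x. lin_ext (\<lambda>t y. Poly_Mapping.single (s \<otimes> t) (x * y)) g) f"
  by (simp add: monoid_algebra_def lin_ext_def)

lemma MA_star: "star MA f = lin_ext (\<lambda>s x. Poly_Mapping.single (adj s) (cnj x)) f"
  by (simp add: monoid_algebra_def lin_ext_def)

lemma MA_simps [simp]:
  "f \<in> carrier MA \<longleftrightarrow> Poly_Mapping.keys f \<subseteq> carrier M"
  "\<one>\<^bsub>MA\<^esub> = Poly_Mapping.single \<one> 1" "\<zero>\<^bsub>MA\<^esub> = 0" "f \<oplus>\<^bsub>MA\<^esub> g = f + g" "c \<odot>\<^bsub>MA\<^esub> f = scale_pm c f"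
  by (simp_all add: monoid_algebra_def scale_pm_def)

lemma MA_mult_add_left: "(f + g) \<otimes>\<^bsub>MA\<^esub> h = f \<otimes>\<^bsub>MA\<^esub> h + g \<otimes>\<^bsub>MA\<^esub> h"
  unfolding MA_mult
  by (rule lin_ext_add) (simp_all add: lin_ext_def distrib_right single_add sum.distrib)

lemma MA_mult_add_right: "h \<otimes>\<^bsub>MA\<^esub> (f + g) = h \<otimes>\<^bsub>MA\<^esub> f + h \<otimes>\<^bsub>MA\<^esub> g"
  unfolding MA_mult lin_ext_def[of _ h] sum.distrib[symmetric]
  by (rule sum.cong[OF refl], rule lin_ext_add) (simp_all add: distrib_left single_add)

lemma MA_mult_0 [simp]: "0 \<otimes>\<^bsub>MA\<^esub> h = 0" "h \<otimes>\<^bsub>MA\<^esub> 0 = 0"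
  unfolding MA_mult by (simp_all add: lin_ext_def[of _ h])

lemma MA_mult_single [simp]: "Poly_Mapping.single s x \<otimes>\<^bsub>MA\<^esub> Poly_Mapping.single t y
    = Poly_Mapping.single (s \<otimes> t) (x * y)"
  unfolding MA_mult by (subst lin_ext_single; simp add: lin_ext_single)

lemma MA_star_add: "star MA (f + g) = star MA f + star MA g"
  unfolding MA_star by (rule lin_ext_add) (simp_all add: single_add)

lemma MA_star_single [simp]: "star MA (Poly_Mapping.single s x) = Poly_Mapping.single (adj s) (cnj x)"
  unfolding MA_star by (simp add: lin_ext_single)

lemma MA_star_0 [simp]: "star MA 0 = 0"
  unfolding MA_star by simp

lemma MA_mult_closed:
  assumes "Poly_Mapping.keys f \<subseteq> carrier M" "Poly_Mapping.keys g \<subseteq> carrier M"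
  shows "Poly_Mapping.keys (f \<otimes>\<^bsub>MA\<^esub> g) \<subseteq> carrier M"
  using assms(1)
proof (induction rule: poly_mapping_span_induct)
  case (single s c)
  show ?case using assms(2)
    by (induction rule: poly_mapping_span_induct) (use single in \<open>simp_all add: MA_mult_add_right keys_add_subset\<close>)
qed (simp_all add: MA_mult_add_left keys_add_subset)

lemma MA_star_closed:
  assumes "Poly_Mapping.keys f \<subseteq> carrier M"
  shows "Poly_Mapping.keys (star MA f) \<subseteq> carrier M"
  using assms
  by (induction rule: poly_mapping_span_induct) (simp_all add: MA_star_add keys_add_subset adj_closed)

lemma MA_assoc:
  assumes f: "Poly_Mapping.keys f \<subseteq> carrier M" and g: "Poly_Mapping.keys g \<subseteq> carrier M"
    and h: "Poly_Mapping.keys h \<subseteq> carrier M"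
  shows "(f \<otimes>\<^bsub>MA\<^esub> g) \<otimes>\<^bsub>MA\<^esub> h = f \<otimes>\<^bsub>MA\<^esub> (g \<otimes>\<^bsub>MA\<^esub> h)"
  using f
proof (induction rule: poly_mapping_span_induct)
  case s: (single s c)
  show ?case using g
  proof (induction rule: poly_mapping_span_induct)
    case t: (single t d)
    show ?case using h
      by (induction rule: poly_mapping_span_induct) (use s t in \<open>simp_all add: MA_mult_add_right m_assoc mult.assoc\<close>)
  qed (simp_all add: MA_mult_add_left MA_mult_add_right)
qed (simp_all add: MA_mult_add_left)

lemma MA_scale_left:
  assumes "Poly_Mapping.keys f \<subseteq> carrier M" "Poly_Mapping.keys g \<subseteq> carrier M"
  shows "scale_pm c f \<otimes>\<^bsub>MA\<^esub> g = scale_pm c (f \<otimes>\<^bsub>MA\<^esub> g)"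
  using assms(1)
proof (induction rule: poly_mapping_span_induct)
  case s: (single s d)
  show ?case using assms(2)
    by (induction rule: poly_mapping_span_induct) (use s in \<open>simp_all add: MA_mult_add_right scale_pm_add ac_simps\<close>)
qed (simp_all add: MA_mult_add_left scale_pm_add)

lemma MA_scale_right:
  assumes "Poly_Mapping.keys f \<subseteq> carrier M" "Poly_Mapping.keys g \<subseteq> carrier M"
  shows "f \<otimes>\<^bsub>MA\<^esub> scale_pm c g = scale_pm c (f \<otimes>\<^bsub>MA\<^esub> g)"
  using assms(1)
proof (induction rule: poly_mapping_span_induct)
  case s: (single s d)
  show ?case using assms(2)
    by (induction rule: poly_mapping_span_induct) (use s in \<open>simp_all add: MA_mult_add_right scale_pm_add ac_simps\<close>)
qed (simp_all add: MA_mult_add_left scale_pm_add)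

lemma MA_star_mult:
  assumes "Poly_Mapping.keys f \<subseteq> carrier M" "Poly_Mapping.keys g \<subseteq> carrier M"
  shows "star MA (f \<otimes>\<^bsub>MA\<^esub> g) = star MA g \<otimes>\<^bsub>MA\<^esub> star MA f"
  using assms(1)
proof (induction rule: poly_mapping_span_induct)
  case s: (single s c)
  show ?case using assms(2)
    by (induction rule: poly_mapping_span_induct)
      (use s in \<open>simp_all add: MA_mult_add_right MA_mult_add_left MA_star_add adj_mult mult.commute\<close>)
qed (simp_all add: MA_mult_add_left MA_mult_add_right MA_star_add)

lemma MA_one:
  assumes "Poly_Mapping.keys f \<subseteq> carrier M"
  shows "\<one>\<^bsub>MA\<^esub> \<otimes>\<^bsub>MA\<^esub> f = f" "f \<otimes>\<^bsub>MA\<^esub> \<one>\<^bsub>MA\<^esub> = f"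
  using assms
  by (induction rule: poly_mapping_span_induct) (simp_all add: MA_mult_add_right MA_mult_add_left)

lemma MA_star_star:
  assumes "Poly_Mapping.keys f \<subseteq> carrier M"
  shows "star MA (star MA f) = f"
  using assms
  by (induction rule: poly_mapping_span_induct) (simp_all add: MA_star_add adj_adj)

lemma MA_star_scale:
  assumes "Poly_Mapping.keys f \<subseteq> carrier M"
  shows "star MA (scale_pm c f) = scale_pm (cnj c) (star MA f)"
  using assms
  by (induction rule: poly_mapping_span_induct) (simp_all add: MA_star_add scale_pm_add)

lemma star_algebra_monoid_algebra: "star_algebra MA"
proof -
  have "abelian_group MA"
    by (rule abelian_groupI) (auto simp: keys_add_subset add.assoc add.commute intro!: bexI[of _ "- _"])
  moreover have "monoid MA"
    by (rule monoidI) (auto simp: MA_mult_closed MA_assoc MA_one[simplified])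
  ultimately have "ring MA"
    by (rule ringI) (simp_all add: MA_mult_add_left MA_mult_add_right)
  moreover have "star_algebra_axioms MA"
    by unfold_locales (simp_all add: scale_pm_add scale_pm_add_left scale_pm_scale_pm MA_scale_left
      MA_scale_right MA_star_closed MA_star_star MA_star_add MA_star_scale MA_star_mult
      subset_trans[OF keys_scale_pm])
  ultimately show ?thesis by (simp add: star_algebra_def)
qed

sublocale MA: star_algebra MA by (rule star_algebra_monoid_algebra)

lemma MA_uminus: "Poly_Mapping.keys f \<subseteq> carrier M \<Longrightarrow> \<ominus>\<^bsub>MA\<^esub> f = - f"
  by (rule MA.minus_equality) simp_all

lemma MA_minus:
  "Poly_Mapping.keys f \<subseteq> carrier M \<Longrightarrow> Poly_Mapping.keys g \<subseteq> carrier M \<Longrightarrow> f \<ominus>\<^bsub>MA\<^esub> g = f - g"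
  by (simp add: a_minus_def MA_uminus)

lemma monoid_algebra_universal:
  assumes "star_algebra B" and g: "\<And>s. s \<in> carrier M \<Longrightarrow> g s \<in> carrier B" "g \<one> = \<one>\<^bsub>B\<^esub>"
    "\<And>s t. s \<in> carrier M \<Longrightarrow> t \<in> carrier M \<Longrightarrow> g (s \<otimes> t) = g s \<otimes>\<^bsub>B\<^esub> g t"
    "\<And>s. s \<in> carrier M \<Longrightarrow> g (adj s) = star B (g s)"
  obtains h where "star_hom MA B h"
    "\<And>s c. s \<in> carrier M \<Longrightarrow> h (Poly_Mapping.single s c) = c \<odot>\<^bsub>B\<^esub> g s"
proof -
  interpret B: star_algebra B by fact
  define h where "h f = finsum B (\<lambda>s. Poly_Mapping.lookup f s \<odot>\<^bsub>B\<^esub> g s) (Poly_Mapping.keys f)" for f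
  \<comment> \<open>Summing over any finite superset of the support allows two vectors to be
    compared on the union of their supports.\<close>
  have h_eq: "h f = finsum B (\<lambda>s. Poly_Mapping.lookup f s \<odot>\<^bsub>B\<^esub> g s) S"
    if "Poly_Mapping.keys f \<subseteq> S" "S \<subseteq> carrier M" "finite S" for f S
    unfolding h_def
    by (rule B.add.finprod_mono_neutral_cong_left)
      (use that g(1) in \<open>auto simp: B.smult_closed B.smult_zero_left in_keys_iff Pi_def\<close>)
  have h0: "h 0 = \<zero>\<^bsub>B\<^esub>" by (simp add: h_def)
  have hs: "h (Poly_Mapping.single s c) = c \<odot>\<^bsub>B\<^esub> g s" if "s \<in> carrier M" for s c
    using that g(1) by (subst h_eq[of _ "{s}"]) (simp_all add: B.smult_closed)
  have hc: "h f \<in> carrier B" if "Poly_Mapping.keys f \<subseteq> carrier M" for f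
    unfolding h_def using that g(1) by (intro B.finsum_closed) (auto simp: B.smult_closed)
  have hadd: "h (f + f') = h f \<oplus>\<^bsub>B\<^esub> h f'"
    if "Poly_Mapping.keys f \<subseteq> carrier M" "Poly_Mapping.keys f' \<subseteq> carrier M" for f f'
  proof -
    let ?S = "Poly_Mapping.keys f \<union> Poly_Mapping.keys f'"
    have "h (f + f') = finsum B (\<lambda>s. Poly_Mapping.lookup f s \<odot>\<^bsub>B\<^esub> g s \<oplus>\<^bsub>B\<^esub> Poly_Mapping.lookup f' s \<odot>\<^bsub>B\<^esub> g s) ?S"
      using that g(1) keys_add[of f f']
      by (subst h_eq[of _ ?S]) (auto simp: lookup_add B.smult_add_left B.smult_closed intro!: B.finsum_cong')
    also have "\<dots> = h f \<oplus>\<^bsub>B\<^esub> h f'"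
      using that g(1)
      by (subst B.finsum_addf) (auto simp: h_eq[of f ?S] h_eq[of f' ?S] B.smult_closed)
    finally show ?thesis .
  qed
  have "star_hom MA B h"
  proof (rule star_homI)
    show "h (f \<otimes>\<^bsub>MA\<^esub> f') = h f \<otimes>\<^bsub>B\<^esub> h f'" if "f \<in> carrier MA" "f' \<in> carrier MA" for f f'
      using that(1) unfolding MA_simps
    proof (induction rule: poly_mapping_span_induct)
      case s: (single s c)
      show ?case using that(2) unfolding MA_simps
      proof (induction rule: poly_mapping_span_induct)
        case (single t d)
        then show ?case using s g
          by (simp add: hs B.smult_mult_left B.smult_mult_right B.smult_smult B.smult_closed mult.commute)
      next
        case (add f g)
        then show ?case using s g(1)
          by (simp add: MA_mult_add_right hadd MA_mult_closed B.r_distr hc hs B.smult_closed)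
      qed (use s g(1) in \<open>simp add: h0 hs B.smult_closed\<close>)
    next
      case (add f g)
      then show ?case using that(2)
        by (simp add: MA_mult_add_left hadd MA_mult_closed B.l_distr hc)
    qed (use that(2) in \<open>simp add: h0 hc\<close>)
    show "h (c \<odot>\<^bsub>MA\<^esub> f) = c \<odot>\<^bsub>B\<^esub> h f" if "f \<in> carrier MA" for f c
      using that unfolding MA_simps
    proof (induction rule: poly_mapping_span_induct)
      case (add f g)
      then show ?case
        by (simp add: scale_pm_add hadd subset_trans[OF keys_scale_pm] B.smult_add_right hc)
    qed (use g(1) in \<open>simp_all add: h0 hs B.smult_zero_right B.smult_smult\<close>)
    show "h (star MA f) = star B (h f)" if "f \<in> carrier MA" for f
      using that unfolding MA_simps
    proof (induction rule: poly_mapping_span_induct)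
      case (add f g)
      then show ?case by (simp add: MA_star_add hadd MA_star_closed B.star_add hc)
    qed (use g in \<open>simp_all add: h0 hs B.star_zero B.star_smult adj_closed\<close>)
  qed (simp_all add: hc hadd hs g(2) B.smult_1)
  then show thesis using hs that by blast
qed

lemma monoid_algebra_generated:
  assumes "star_subalgebra MA S" "\<And>s. s \<in> carrier M \<Longrightarrow> Poly_Mapping.single s 1 \<in> S"
  shows "S = carrier MA"
proof (rule antisym)
  have S: "x + y \<in> S" "scale_pm c x \<in> S" if "x \<in> S" "y \<in> S" for x y c
    using assms(1) that unfolding star_subalgebra_def MA_simps by blast+
  show "carrier MA \<subseteq> S"
  proof
    fix f assume "f \<in> carrier MA"
    then have "Poly_Mapping.keys f \<subseteq> carrier M" by simp
    then show "f \<in> S"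
    proof (induction rule: poly_mapping_span_induct)
      case zero
      show ?case using S(2)[of _ _ 0, OF assms(2) assms(2)] by auto
    next
      case (single s c)
      show ?case using S(2)[of _ _ c, OF assms(2)[OF single] assms(2)[OF single]] by simp
    qed (rule S(1))
  qed
qed (use assms(1) in \<open>simp add: star_subalgebra_def\<close>)

end


section \<open>Free algebras and free products\<close>

lemma list_prod_Nil [simp]: "list_prod M [] = \<one>\<^bsub>M\<^esub>"
  by (simp add: list_prod_def)

lemma list_prod_Cons [simp]: "list_prod M (x # xs) = x \<otimes>\<^bsub>M\<^esub> list_prod M xs"
  by (simp add: list_prod_def)

context monoid
begin

lemma list_prod_closed: "set xs \<subseteq> carrier G \<Longrightarrow> list_prod G xs \<in> carrier G"
  by (induction xs) auto

lemma list_prod_append: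
  "set xs \<subseteq> carrier G \<Longrightarrow> set ys \<subseteq> carrier G \<Longrightarrow>
    list_prod G (xs @ ys) = list_prod G xs \<otimes> list_prod G ys"
  by (induction xs) (auto simp: m_assoc list_prod_closed)

end

lemma (in star_algebra) star_list_prod:
  "set xs \<subseteq> carrier A \<Longrightarrow> star A (list_prod A xs) = list_prod A (rev (map (star A) xs))"
proof (induction xs)
  case (Cons x xs)
  have "star A ` set xs \<subseteq> carrier A" using Cons star_closed by auto
  then show ?case
    using Cons by (simp add: star_mult star_closed list_prod_closed list_prod_append)
qed (simp add: star_one)

lemma star_hom_list_prod:
  assumes "star_algebra A" "star_hom A B h" "set xs \<subseteq> carrier A"
  shows "h (list_prod A xs) = list_prod B (map h xs)"
proof -
  interpret star_algebra A by fact
  show ?thesis using assms(3)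
    by (induction xs) (simp_all add: star_homD[OF assms(2)] list_prod_closed)
qed

lemma involutive_monoid_words:
  assumes "\<forall>g\<in>G. adj g \<in> G \<and> adj (adj g) = g"
  shows "involutive_monoid (word_monoid G) (\<lambda>w. rev (map adj w))"
proof -
  have "monoid (word_monoid G)" by (rule monoidI) (auto simp: word_monoid_def)
  then show ?thesis
  proof (rule involutive_monoid.intro, unfold_locales)
    fix s assume "s \<in> carrier (word_monoid G)"
    then have "\<forall>g\<in>set s. g \<in> G" by (auto simp: word_monoid_def)
    then show "rev (map adj (rev (map adj s))) = s"
      using assms by (simp add: rev_map map_idI)
  qed (use assms in \<open>auto simp: word_monoid_def\<close>)
qed

lemma free_star_algebra_universal:
  assumes G: "\<forall>g\<in>G. adj g \<in> G \<and> adj (adj g) = g"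
    and B: "star_algebra B" "\<And>g. g \<in> G \<Longrightarrow> l g \<in> carrier B"
    "\<And>g. g \<in> G \<Longrightarrow> l (adj g) = star B (l g)"
  obtains h where "star_hom (free_star_algebra G adj) B h"
    "\<And>w c. w \<in> lists G \<Longrightarrow> h (Poly_Mapping.single w c) = c \<odot>\<^bsub>B\<^esub> list_prod B (map l w)"
proof -
  interpret W: involutive_monoid "word_monoid G" "\<lambda>w. rev (map adj w)"
    by (rule involutive_monoid_words[OF G])
  interpret B: star_algebra B by fact
  have l: "set (map l w) \<subseteq> carrier B" if "w \<in> lists G" for w
    using that B(2) by (auto simp: lists_eq_set)
  show thesis
  proof (rule W.monoid_algebra_universal[OF B(1), of "\<lambda>w. list_prod B (map l w)"])
    fix s assume "s \<in> carrier (word_monoid G)"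
    then have s: "s \<in> lists G" by (simp add: word_monoid_def)
    show "list_prod B (map l s) \<in> carrier B" by (rule B.list_prod_closed[OF l[OF s]])
    have "map l (map adj s) = map (star B) (map l s)" using s B(3) by (auto simp: lists_eq_set)
    then show "list_prod B (map l (rev (map adj s))) = star B (list_prod B (map l s))"
      by (simp add: B.star_list_prod[OF l[OF s]] rev_map[symmetric] del: map_map)
    fix t assume "t \<in> carrier (word_monoid G)"
    then have t: "t \<in> lists G" by (simp add: word_monoid_def)
    show "list_prod B (map l (s \<otimes>\<^bsub>word_monoid G\<^esub> t)) = list_prod B (map l s) \<otimes>\<^bsub>B\<^esub> list_prod B (map l t)"
      using B.list_prod_append[OF l[OF s] l[OF t]] by (simp add: word_monoid_def)
  next
    show "list_prod B (map l \<one>\<^bsub>word_monoid G\<^esub>) = \<one>\<^bsub>B\<^esub>" by (simp add: word_monoid_def)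
  next
    fix h assume "star_hom (monoid_algebra (word_monoid G) (\<lambda>w. rev (map adj w))) B h"
      "\<And>s c. s \<in> carrier (word_monoid G) \<Longrightarrow> h (Poly_Mapping.single s c) = c \<odot>\<^bsub>B\<^esub> list_prod B (map l s)"
    then show thesis by (intro that) (simp_all add: free_star_algebra_def word_monoid_def)
  qed
qed

lemma
  assumes G: "\<forall>g\<in>G. adj g \<in> G \<and> adj (adj g) = g"
  defines "FA \<equiv> free_star_algebra G adj"
  shows star_algebra_free_star_algebra: "star_algebra FA"
    and carrier_free_star_algebra: "f \<in> carrier FA \<longleftrightarrow> Poly_Mapping.keys f \<subseteq> lists G"
    and free_star_algebra_add: "f \<oplus>\<^bsub>FA\<^esub> g = f + g"
    and free_star_algebra_zero: "\<zero>\<^bsub>FA\<^esub> = 0"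
    and free_star_algebra_one: "\<one>\<^bsub>FA\<^esub> = Poly_Mapping.single [] 1"
    and free_star_algebra_smult: "c \<odot>\<^bsub>FA\<^esub> f = scale_pm c f"
    and free_star_algebra_mult_single: "Poly_Mapping.single v x \<otimes>\<^bsub>FA\<^esub> Poly_Mapping.single w y
      = Poly_Mapping.single (v @ w) (x * y)"
    and free_star_algebra_star_single: "star FA (Poly_Mapping.single w x)
      = Poly_Mapping.single (rev (map adj w)) (cnj x)"
    and free_star_algebra_minus: "f \<in> carrier FA \<Longrightarrow> g \<in> carrier FA \<Longrightarrow> f \<ominus>\<^bsub>FA\<^esub> g = f - g"
    and free_star_algebra_generated: "star_subalgebra FA S \<Longrightarrow>
      (\<And>g. g \<in> G \<Longrightarrow> Poly_Mapping.single [g] 1 \<in> S) \<Longrightarrow> S = carrier FA"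
proof -
  interpret W: involutive_monoid "word_monoid G" "\<lambda>w. rev (map adj w)"
    by (rule involutive_monoid_words[OF G])
  note [simp] = FA_def free_star_algebra_def
  show "star_algebra FA" using W.star_algebra_monoid_algebra by simp
  show "f \<in> carrier FA \<longleftrightarrow> Poly_Mapping.keys f \<subseteq> lists G" by (simp) (simp add: word_monoid_def)
  show "f \<oplus>\<^bsub>FA\<^esub> g = f + g" "\<zero>\<^bsub>FA\<^esub> = 0" "\<one>\<^bsub>FA\<^esub> = Poly_Mapping.single [] 1" "c \<odot>\<^bsub>FA\<^esub> f = scale_pm c f"
    by (simp_all) (simp add: word_monoid_def)
  show m: "Poly_Mapping.single v x \<otimes>\<^bsub>FA\<^esub> Poly_Mapping.single w y
      = Poly_Mapping.single (v @ w) (x * y)" for v w x y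
    by simp (simp add: word_monoid_def)
  show "star FA (Poly_Mapping.single w x) = Poly_Mapping.single (rev (map adj w)) (cnj x)"
    by simp
  show "f \<in> carrier FA \<Longrightarrow> g \<in> carrier FA \<Longrightarrow> f \<ominus>\<^bsub>FA\<^esub> g = f - g"
    by (simp add: W.MA_minus)
  show "S = carrier FA" if S: "star_subalgebra FA S" and "\<And>g. g \<in> G \<Longrightarrow> Poly_Mapping.single [g] 1 \<in> S"
  proof -
    have "Poly_Mapping.single w 1 \<in> S" if "w \<in> lists G" for w
      using that
    proof (induction w)
      case Nil
      show ?case using S W.MA_simps(2) by (simp add: star_subalgebra_def) (simp add: word_monoid_def)
    next
      case (Cons g w)
      have "Poly_Mapping.single [g] 1 \<otimes>\<^bsub>FA\<^esub> Poly_Mapping.single w 1 \<in> S"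
        using S Cons \<open>\<And>g. g \<in> G \<Longrightarrow> Poly_Mapping.single [g] 1 \<in> S\<close> unfolding star_subalgebra_def by blast
      then show ?case unfolding m by simp
    qed
    then show ?thesis
      using W.monoid_algebra_generated[of S] S by simp (simp add: word_monoid_def)
  qed
qed

locale algebra_family =
  fixes F :: "'i \<Rightarrow> 'c star_algebra"
  assumes alg: "star_algebra (F i)"
begin

abbreviation "letters \<equiv> SIGMA i:UNIV. carrier (F i)"
abbreviation "letter_adj \<equiv> \<lambda>(i, x). (i, star (F i) x)"

lemma letters_adj: "\<forall>g\<in>letters. letter_adj g \<in> letters \<and> letter_adj (letter_adj g) = g"
  using star_algebra.star_closed[OF alg] star_algebra.star_star[OF alg] by auto

lemmas letters_star_algebra = star_algebra_free_star_algebra[where G = letters and adj = letter_adj,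
  OF letters_adj, folded free_product_letters_def]
lemmas letters_carrier = carrier_free_star_algebra[where G = letters and adj = letter_adj,
  OF letters_adj, folded free_product_letters_def]
lemmas letters_add = free_star_algebra_add[where G = letters and adj = letter_adj,
  OF letters_adj, folded free_product_letters_def]
lemmas letters_zero = free_star_algebra_zero[where G = letters and adj = letter_adj,
  OF letters_adj, folded free_product_letters_def]
lemmas letters_one = free_star_algebra_one[where G = letters and adj = letter_adj,
  OF letters_adj, folded free_product_letters_def]
lemmas letters_smult = free_star_algebra_smult[where G = letters and adj = letter_adj,
  OF letters_adj, folded free_product_letters_def]
lemmas letters_mult_single = free_star_algebra_mult_single[where G = letters and adj = letter_adj,
  OF letters_adj, folded free_product_letters_def]
lemmas letters_star_single = free_star_algebra_star_single[where G = letters and adj = letter_adj,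
  OF letters_adj, folded free_product_letters_def]
lemmas letters_minus = free_star_algebra_minus[where G = letters and adj = letter_adj,
  OF letters_adj, folded free_product_letters_def]
lemmas letters_generated = free_star_algebra_generated[where G = letters and adj = letter_adj,
  OF letters_adj, folded free_product_letters_def]

sublocale FL: star_algebra "free_product_letters F" by (rule letters_star_algebra)

lemma single_letter_closed: "x \<in> carrier (F i) \<Longrightarrow> Poly_Mapping.single [(i, x)] c \<in> carrier (free_product_letters F)"
  by (simp add: letters_carrier)

lemma relations_closed: "free_product_relations F \<subseteq> carrier (free_product_letters F)"
proof -
  interpret F: star_algebra "F i" for i by (rule alg)
  have d: "f - g \<in> carrier (free_product_letters F)"
    if "f \<in> carrier (free_product_letters F)" "g \<in> carrier (free_product_letters F)" for f g
    using FL.minus_closed[OF that] by (simp only: letters_minus[OF that])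
  show ?thesis
    unfolding free_product_relations_def
    by (auto intro!: d simp: letters_carrier F.smult_closed)
qed

lemma star_ideal_free_product: "star_ideal (free_product_letters F) (free_product_ideal F)"
  unfolding free_product_ideal_def by (rule star_ideal_star_ideal_generated[OF letters_star_algebra relations_closed])

lemma relations_incl: "free_product_relations F \<subseteq> free_product_ideal F"
  unfolding free_product_ideal_def by (rule star_ideal_generated_incl[OF letters_star_algebra relations_closed])

lemma star_algebra_free_product: "star_algebra (free_product F)"
  unfolding free_product_def by (rule star_algebra_quotient[OF letters_star_algebra star_ideal_free_product])

lemmas quot_hom = star_hom_quotient[OF letters_star_algebra star_ideal_free_product, folded free_product_def]
lemmas quot_carrier = carrier_quotient[OF letters_star_algebra star_ideal_free_product, folded free_product_def]
lemmas quot_eq = coset_eq_iff[OF letters_star_algebra star_ideal_free_product]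

lemma quot_eqI:
  assumes "f \<in> carrier (free_product_letters F)" "g \<in> carrier (free_product_letters F)"
    "f - g \<in> free_product_relations F"
  shows "free_product_ideal F +>\<^bsub>free_product_letters F\<^esub> f = free_product_ideal F +>\<^bsub>free_product_letters F\<^esub> g"
  using assms relations_incl by (auto simp: quot_eq letters_minus)

text \<open>Sums, multiples, products and the unit are respected because each difference is one of
  the defining relations; adjoints are respected already by the involution on the letters.\<close>

lemma star_hom_free_product_in: "star_hom (F i) (free_product F) (free_product_in F i)"
proof -
  interpret F: star_algebra "F i" by (rule alg)
  show ?thesis
  proof (rule star_homI)
    fix x y :: "'c" and c :: complex
    assume x: "x \<in> carrier (F i)"
    show "free_product_in F i x \<in> carrier (free_product F)"
      unfolding free_product_in_def by (rule star_hom_closed[OF quot_hom single_letter_closed[OF x]])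
    have "free_product_in F i (c \<odot>\<^bsub>F i\<^esub> x) = free_product_ideal F +>\<^bsub>free_product_letters F\<^esub>
        Poly_Mapping.single [(i, x)] c"
      unfolding free_product_in_def
      by (rule quot_eqI) (use x in \<open>auto simp: letters_carrier F.smult_closed free_product_relations_def\<close>)
    also have "Poly_Mapping.single [(i, x)] c = c \<odot>\<^bsub>free_product_letters F\<^esub> Poly_Mapping.single [(i, x)] 1"
      by (simp add: letters_smult)
    finally show "free_product_in F i (c \<odot>\<^bsub>F i\<^esub> x) = c \<odot>\<^bsub>free_product F\<^esub> free_product_in F i x"
      using x by (simp add: free_product_in_def star_hom_smult[OF quot_hom] single_letter_closed)
    show "free_product_in F i (star (F i) x) = star (free_product F) (free_product_in F i x)"
      using x by (simp add: free_product_in_def letters_star_single single_letter_closed flip: star_hom_star[OF quot_hom])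
    assume y: "y \<in> carrier (F i)"
    have "free_product_in F i (x \<otimes>\<^bsub>F i\<^esub> y) = free_product_ideal F +>\<^bsub>free_product_letters F\<^esub>
        Poly_Mapping.single [(i, x), (i, y)] 1"
      unfolding free_product_in_def
      by (rule quot_eqI) (use x y in \<open>auto simp: letters_carrier free_product_relations_def\<close>)
    also have "Poly_Mapping.single [(i, x), (i, y)] 1 =
        Poly_Mapping.single [(i, x)] 1 \<otimes>\<^bsub>free_product_letters F\<^esub> Poly_Mapping.single [(i, y)] 1"
      by (simp add: letters_mult_single)
    finally show "free_product_in F i (x \<otimes>\<^bsub>F i\<^esub> y) = free_product_in F i x \<otimes>\<^bsub>free_product F\<^esub> free_product_in F i y"
      using x y by (simp add: free_product_in_def star_hom_mult[OF quot_hom] single_letter_closed)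
    have "Poly_Mapping.single [(i, x)] 1 \<oplus>\<^bsub>free_product_letters F\<^esub> Poly_Mapping.single [(i, y)] 1
       \<in> carrier (free_product_letters F)" using x y by (simp add: single_letter_closed)
    then have "free_product_in F i (x \<oplus>\<^bsub>F i\<^esub> y) = free_product_ideal F +>\<^bsub>free_product_letters F\<^esub>
        (Poly_Mapping.single [(i, x)] 1 \<oplus>\<^bsub>free_product_letters F\<^esub> Poly_Mapping.single [(i, y)] 1)"
      unfolding free_product_in_def
      by (intro quot_eqI) (use x y in \<open>auto simp: single_letter_closed free_product_relations_def letters_add diff_diff_eq[symmetric]\<close>)
    then show "free_product_in F i (x \<oplus>\<^bsub>F i\<^esub> y) = free_product_in F i x \<oplus>\<^bsub>free_product F\<^esub> free_product_in F i y"
      using x y by (simp add: free_product_in_def star_hom_add[OF quot_hom] single_letter_closed)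
  next
    have "free_product_in F i \<one>\<^bsub>F i\<^esub> = free_product_ideal F +>\<^bsub>free_product_letters F\<^esub> Poly_Mapping.single [] 1"
      unfolding free_product_in_def
      by (rule quot_eqI) (auto simp: letters_carrier free_product_relations_def)
    then show "free_product_in F i \<one>\<^bsub>F i\<^esub> = \<one>\<^bsub>free_product F\<^esub>"
      using star_hom_one[OF quot_hom] by (simp add: letters_one)
  qed
qed

lemma free_product_universal:
  assumes B: "star_algebra B" "\<And>i. star_hom (F i) B (h i)"
  obtains g where "star_hom (free_product F) B g"
    "\<And>i x. x \<in> carrier (F i) \<Longrightarrow> g (free_product_in F i x) = h i x"
proof -
  interpret B: star_algebra B by fact
  interpret F: star_algebra "F i" for i by (rule alg)
  obtain k where k: "star_hom (free_product_letters F) B k"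
    "\<And>w c. w \<in> lists letters \<Longrightarrow> k (Poly_Mapping.single w c) = c \<odot>\<^bsub>B\<^esub> list_prod B (map (\<lambda>(i, x). h i x) w)"
  proof (rule free_star_algebra_universal[where G = letters and adj = letter_adj and
        l = "\<lambda>(i, x). h i x", OF letters_adj B(1)])
    fix k assume "star_hom (free_star_algebra letters letter_adj) B k"
      "\<And>w c. w \<in> lists letters \<Longrightarrow> k (Poly_Mapping.single w c) = c \<odot>\<^bsub>B\<^esub> list_prod B (map (\<lambda>(i, x). h i x) w)"
    then show thesis unfolding free_product_letters_def[symmetric] by (rule that)
  qed (auto simp: star_homD(1,6)[OF B(2)])
  have k1: "k (Poly_Mapping.single [(i, x)] c) = c \<odot>\<^bsub>B\<^esub> h i x" if "x \<in> carrier (F i)" for i x c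
    using that by (simp add: k(2) star_hom_closed[OF B(2)])
  have kd: "k (f - f') = k f \<ominus>\<^bsub>B\<^esub> k f'"
    if "f \<in> carrier (free_product_letters F)" "f' \<in> carrier (free_product_letters F)" for f f'
    using star_hom_diff[OF letters_star_algebra B(1) k(1) that] by (simp only: letters_minus[OF that])
  have dc: "f - g \<in> carrier (free_product_letters F)"
    if "f \<in> carrier (free_product_letters F)" "g \<in> carrier (free_product_letters F)" for f g
    using FL.minus_closed[OF that] by (simp only: letters_minus[OF that])
  have "k r = \<zero>\<^bsub>B\<^esub>" if r: "r \<in> free_product_relations F" for r
  proof -
    have B0: "x \<ominus>\<^bsub>B\<^esub> x = \<zero>\<^bsub>B\<^esub>" if "x \<in> carrier B" for x
      using that by (simp add: a_minus_def B.r_neg)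
    have B1: "x \<oplus>\<^bsub>B\<^esub> y \<ominus>\<^bsub>B\<^esub> x \<ominus>\<^bsub>B\<^esub> y = \<zero>\<^bsub>B\<^esub>" if "x \<in> carrier B" "y \<in> carrier B" for x y
    proof -
      have "x \<oplus>\<^bsub>B\<^esub> y \<ominus>\<^bsub>B\<^esub> x \<ominus>\<^bsub>B\<^esub> y = (x \<oplus>\<^bsub>B\<^esub> y) \<oplus>\<^bsub>B\<^esub> (\<ominus>\<^bsub>B\<^esub> x \<oplus>\<^bsub>B\<^esub> \<ominus>\<^bsub>B\<^esub> y)"
        using that by (simp add: a_minus_def B.a_assoc)
      also have "\<ominus>\<^bsub>B\<^esub> x \<oplus>\<^bsub>B\<^esub> \<ominus>\<^bsub>B\<^esub> y = \<ominus>\<^bsub>B\<^esub> (x \<oplus>\<^bsub>B\<^esub> y)" using that by (simp add: B.minus_add)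
      finally show ?thesis using that by (simp add: B.r_neg)
    qed
    have w: "Poly_Mapping.single w 1 \<in> carrier (free_product_letters F)" if "w \<in> lists letters" for w
      using that by (simp add: letters_carrier)
    show ?thesis
      using r unfolding free_product_relations_def
      by (auto simp: kd dc single_letter_closed k1 F.smult_closed B.smult_1 B0 B1
        star_homD[OF B(2)] B.smult_closed k(2) w)
  qed
  from quotient_universal[OF letters_star_algebra B(1) k(1) relations_closed this]
  obtain g where "star_hom (free_product F) B g" and
    g: "\<And>x. x \<in> carrier (free_product_letters F) \<Longrightarrow>
      g (free_product_ideal F +>\<^bsub>free_product_letters F\<^esub> x) = k x"
    unfolding free_product_def free_product_ideal_def by blast
  moreover have "g (free_product_in F i x) = h i x" if "x \<in> carrier (F i)" for i x
    unfolding free_product_in_def using that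
    by (simp add: g single_letter_closed k1 B.smult_1 star_hom_closed[OF B(2)])
  ultimately show thesis using that by blast
qed

lemma free_product_generated:
  assumes "star_subalgebra (free_product F) S"
    and "\<And>i x. x \<in> carrier (F i) \<Longrightarrow> free_product_in F i x \<in> S"
  shows "S = carrier (free_product F)"
proof -
  let ?k = "\<lambda>f. free_product_ideal F +>\<^bsub>free_product_letters F\<^esub> f"
  have "{f \<in> carrier (free_product_letters F). ?k f \<in> S} = carrier (free_product_letters F)"
    by (rule letters_generated[OF star_subalgebra_vimage[OF letters_star_algebra quot_hom assms(1)]])
      (use assms(2) in \<open>auto simp: single_letter_closed free_product_in_def\<close>)
  then have "carrier (free_product F) \<subseteq> S" by (auto simp: quot_carrier)
  then show ?thesis using assms(1) by (auto simp: star_subalgebra_def)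
qed

lemma free_product_word:
  assumes "w \<in> lists letters"
  shows "free_product_ideal F +>\<^bsub>free_product_letters F\<^esub> Poly_Mapping.single w 1
    = list_prod (free_product F) (map (\<lambda>(i, x). free_product_in F i x) w)"
  using assms
proof (induction w)
  case Nil
  show ?case using star_hom_one[OF quot_hom] by (simp add: letters_one)
next
  case (Cons g w)
  have "Poly_Mapping.single (g # w) 1 =
     Poly_Mapping.single [g] 1 \<otimes>\<^bsub>free_product_letters F\<^esub> Poly_Mapping.single w 1"
    by (simp add: letters_mult_single)
  moreover have "Poly_Mapping.single [g] 1 \<in> carrier (free_product_letters F)"
    "Poly_Mapping.single w 1 \<in> carrier (free_product_letters F)" using Cons by (auto simp: letters_carrier)
  ultimately show ?case using Cons
    by (simp add: star_hom_mult[OF quot_hom] split_def free_product_in_def)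
qed

end

section \<open>Positive kernels\<close>

definition psd_on :: "'i set \<Rightarrow> ('i \<Rightarrow> 'i \<Rightarrow> complex) \<Rightarrow> bool" where
  "psd_on S K \<longleftrightarrow> (\<forall>x\<in>S. \<forall>y\<in>S. K y x = cnj (K x y)) \<and>
     (\<forall>c. (\<Sum>x\<in>S. \<Sum>y\<in>S. cnj (c x) * c y * K x y) \<in> \<real>\<^sub>\<ge>\<^sub>0)"

lemma psd_onI:
  assumes "\<And>x y. x \<in> S \<Longrightarrow> y \<in> S \<Longrightarrow> K y x = cnj (K x y)"
    and "\<And>c. (\<Sum>x\<in>S. \<Sum>y\<in>S. cnj (c x) * c y * K x y) \<in> \<real>\<^sub>\<ge>\<^sub>0"
  shows "psd_on S K"
  unfolding psd_on_def using assms by blast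

lemma psd_on_herm: "psd_on S K \<Longrightarrow> x \<in> S \<Longrightarrow> y \<in> S \<Longrightarrow> K y x = cnj (K x y)"
  unfolding psd_on_def by blast

lemma psd_on_pos: "psd_on S K \<Longrightarrow> (\<Sum>x\<in>S. \<Sum>y\<in>S. cnj (c x) * c y * K x y) \<in> \<real>\<^sub>\<ge>\<^sub>0"
  unfolding psd_on_def by blast

lemma psd_on_subset:
  assumes "psd_on S K" "T \<subseteq> S" "finite S"
  shows "psd_on T K"
  unfolding psd_on_def
proof (intro conjI allI)
  fix c :: "_ \<Rightarrow> complex"
  define c' where "c' x = (if x \<in> T then c x else 0)" for x
  have "(\<Sum>x\<in>S. \<Sum>y\<in>S. cnj (c' x) * c' y * K x y) = (\<Sum>x\<in>T. \<Sum>y\<in>T. cnj (c' x) * c' y * K x y)"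
    using assms(2,3)
    by (intro sum.mono_neutral_cong_right) (auto simp: c'_def intro!: sum.mono_neutral_cong_right)
  also have "\<dots> = (\<Sum>x\<in>T. \<Sum>y\<in>T. cnj (c x) * c y * K x y)"
    by (intro sum.cong refl) (simp add: c'_def)
  finally show "(\<Sum>x\<in>T. \<Sum>y\<in>T. cnj (c x) * c y * K x y) \<in> \<real>\<^sub>\<ge>\<^sub>0"
    using psd_on_pos[OF assms(1), of c'] by simp
qed (use psd_on_herm[OF assms(1)] assms(2) in blast)

lemma psd_on_cong:
  assumes "psd_on S K" "\<And>x y. x \<in> S \<Longrightarrow> y \<in> S \<Longrightarrow> L x y = K x y"
  shows "psd_on S L"
proof (rule psd_onI)
  show "L y x = cnj (L x y)" if "x \<in> S" "y \<in> S" for x y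
    unfolding assms(2)[OF that] assms(2)[OF that(2,1)] by (rule psd_on_herm[OF assms(1) that])
  have "(\<Sum>x\<in>S. \<Sum>y\<in>S. cnj (c x) * c y * L x y) = (\<Sum>x\<in>S. \<Sum>y\<in>S. cnj (c x) * c y * K x y)" for c
    by (intro sum.cong refl) (simp add: assms(2))
  then show "(\<Sum>x\<in>S. \<Sum>y\<in>S. cnj (c x) * c y * L x y) \<in> \<real>\<^sub>\<ge>\<^sub>0" for c
    using psd_on_pos[OF assms(1), of c] by simp
qed

text \<open>Adding up the coefficients over each fibre of \<open>f\<close> turns the form of the
  pulled back kernel into the form of \<open>K\<close> on the image.\<close>

lemma psd_on_vimage:
  assumes "psd_on (f ` S) K" "finite S"
  shows "psd_on S (\<lambda>x y. K (f x) (f y))"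
  unfolding psd_on_def
proof (intro conjI allI)
  fix c :: "_ \<Rightarrow> complex"
  define c' where "c' u = (\<Sum>x\<in>{x\<in>S. f x = u}. c x)" for u
  have *: "(\<Sum>u\<in>f ` S. g u * c' u) = (\<Sum>x\<in>S. g (f x) * c x)" for g
  proof -
    have "(\<Sum>x\<in>S. g (f x) * c x) = (\<Sum>u\<in>f ` S. \<Sum>x\<in>{x\<in>S. f x = u}. g (f x) * c x)"
      by (rule sum.image_gen[OF assms(2)])
    then show ?thesis by (simp add: c'_def sum_distrib_left)
  qed
  have **: "(\<Sum>u\<in>f ` S. g u * cnj (c' u)) = (\<Sum>x\<in>S. g (f x) * cnj (c x))" for g
    using arg_cong[OF *[of "\<lambda>u. cnj (g u)"], of cnj] by simp
  have "(\<Sum>u\<in>f ` S. \<Sum>v\<in>f ` S. cnj (c' u) * c' v * K u v) =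
      (\<Sum>u\<in>f ` S. (\<Sum>v\<in>f ` S. K u v * c' v) * cnj (c' u))"
    by (simp add: sum_distrib_right sum_distrib_left mult_ac)
  also have "\<dots> = (\<Sum>x\<in>S. \<Sum>y\<in>S. cnj (c x) * c y * K (f x) (f y))"
    unfolding ** * by (simp add: sum_distrib_right sum_distrib_left mult_ac)
  finally show "(\<Sum>x\<in>S. \<Sum>y\<in>S. cnj (c x) * c y * K (f x) (f y)) \<in> \<real>\<^sub>\<ge>\<^sub>0"
    using psd_on_pos[OF assms(1), of c'] by simp
qed (use psd_on_herm[OF assms(1)] in blast)

lemma psd_on_diag: "psd_on S K \<Longrightarrow> finite S \<Longrightarrow> x \<in> S \<Longrightarrow> K x x \<in> \<real>\<^sub>\<ge>\<^sub>0"
  using psd_on_pos[of "{x}" K "\<lambda>_. 1"] psd_on_subset[of S K "{x}"] by simp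

text \<open>A nonzero entry beside a vanishing diagonal entry would make the form of a two by two
  submatrix negative somewhere.\<close>

lemma psd_on_zero_diag:
  assumes "psd_on S K" "finite S" "z \<in> S" "x \<in> S" "K z z = 0"
  shows "K z x = 0"
proof (rule ccontr)
  assume nz: "K z x \<noteq> 0"
  then have zx: "z \<noteq> x" using assms by auto
  have psd: "psd_on {z, x} K" using assms by (intro psd_on_subset[OF assms(1)]) auto
  define a where "a = (cmod (K z x))\<^sup>2"
  have a: "a > 0" using nz by (simp add: a_def)
  \<comment> \<open>With this factor the form at the coefficients \<open>c\<close> has real part
    \<open>Re (K x x) - 2 * s * a = -1\<close>.\<close>
  define s where "s = (Re (K x x) + 1) / (2 * a)"
  define c where "c i = (if i = z then - of_real s * K z x else 1)" for i
  have xz: "K x z = cnj (K z x)" by (rule psd_on_herm[OF assms(1,3,4)])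
  have aa: "cnj (K z x) * K z x = of_real a" "K z x * cnj (K z x) = of_real a"
    using complex_norm_square[of "K z x"] by (simp_all add: a_def mult.commute)
  have "(\<Sum>i\<in>{z, x}. \<Sum>j\<in>{z, x}. cnj (c i) * c j * K i j) \<in> \<real>\<^sub>\<ge>\<^sub>0"
    by (rule psd_on_pos[OF psd])
  also have "(\<Sum>i\<in>{z, x}. \<Sum>j\<in>{z, x}. cnj (c i) * c j * K i j)
     = - of_real s * (cnj (K z x) * K z x) - of_real s * (K z x * cnj (K z x)) + K x x"
    using zx by (simp add: c_def xz assms(5))
  also have "\<dots> = K x x - of_real (2 * s * a)" unfolding aa by simp
  finally have "Re (K x x) - 2 * s * a \<ge> 0" by (simp add: complex_nonneg_Reals_iff)
  then show False using a by (simp add: s_def)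
qed

text \<open>The Schur product theorem: split off from \<open>K\<close> the rank one kernel of one row and recurse on
  the Schur complement.\<close>

lemma psd_on_mult:
  assumes "finite S" "psd_on S K" "psd_on S L"
  shows "psd_on S (\<lambda>x y. K x y * L x y)"
  using assms
proof (induction S arbitrary: K rule: finite_induct)
  case (insert z S)
  have KS: "psd_on S K" and LS: "psd_on S L"
    using insert.prems insert.hyps by (auto intro: psd_on_subset)
  have herm: "K y x = cnj (K x y)" "L y x = cnj (L x y)" if "x \<in> insert z S" "y \<in> insert z S" for x y
    using insert.prems that by (auto intro: psd_on_herm)
  have pos: "(\<Sum>x\<in>insert z S. \<Sum>y\<in>insert z S. cnj (c x) * c y * (K x y * L x y)) \<in> \<real>\<^sub>\<ge>\<^sub>0" for c
  proof (cases "K z z = 0")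
    case True
    \<comment> \<open>A zero pivot forces its whole row and column to vanish, so that the sums
      reduce to \<open>S\<close>.\<close>
    then have z: "K z x = 0" "K x z = 0" if "x \<in> insert z S" for x
      using psd_on_zero_diag[OF insert.prems(1) _ _ that, of z] herm(1)[OF _ that, of z] insert.hyps that by auto
    have "(\<Sum>x\<in>insert z S. \<Sum>y\<in>insert z S. cnj (c x) * c y * (K x y * L x y)) =
        (\<Sum>x\<in>S. \<Sum>y\<in>S. cnj (c x) * c y * (K x y * L x y))"
      using insert.hyps by (simp add: z)
    then show ?thesis
      using psd_on_pos[OF insert.IH[OF KS LS], of c] by simp
  next
    case False
    define d where "d = Re (K z z)"
    have d: "K z z = of_real d" "d > 0"
      using psd_on_diag[OF insert.prems(1), of z] insert.hyps False
      by (auto simp: d_def complex_nonneg_Reals_iff complex_eq_iff less_le)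
    define K' where "K' x y = K x y - K x z * K z y / of_real d" for x y
    have K'z: "K' z y = 0" "K' y z = 0" for y using d by (simp_all add: K'_def)
    have psd': "psd_on S K'"
      unfolding psd_on_def
    proof (intro conjI allI)
      fix e :: "_ \<Rightarrow> complex"
      define w where "w = (\<Sum>y\<in>S. e y * K z y)"
      have w': "cnj w = (\<Sum>x\<in>S. cnj (e x) * K x z)"
        unfolding w_def cnj_sum using herm(1)[of z] by (intro sum.cong refl) (metis complex_cnj_mult insertCI)
      \<comment> \<open>The coefficient at \<open>z\<close> completes the square: it minimises the
        form of \<open>K\<close> for given coefficients on \<open>S\<close>, and the minimum is the
        form of the Schur complement \<open>K'\<close>.\<close>
      define e' where "e' x = (if x = z then - w / of_real d else e x)" for x
      have e': "e' x = e x" if "x \<in> S" for x using that insert.hyps by (auto simp: e'_def)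
      have "(\<Sum>x\<in>insert z S. \<Sum>y\<in>insert z S. cnj (e' x) * e' y * K x y)
        = cnj (e' z) * e' z * K z z + (\<Sum>y\<in>S. cnj (e' z) * e y * K z y)
          + (\<Sum>x\<in>S. cnj (e x) * e' z * K x z) + (\<Sum>x\<in>S. \<Sum>y\<in>S. cnj (e x) * e y * K x y)"
        using insert.hyps by (simp add: e' sum.distrib)
      also have "(\<Sum>y\<in>S. cnj (e' z) * e y * K z y) = cnj (e' z) * w"
        by (simp add: w_def sum_distrib_left mult_ac)
      also have "(\<Sum>x\<in>S. cnj (e x) * e' z * K x z) = e' z * cnj w"
        unfolding w' by (simp add: sum_distrib_left mult_ac)
      also have "cnj (e' z) * e' z * K z z + cnj (e' z) * w + e' z * cnj w = - (cnj w * w / of_real d)"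
        using d by (simp add: e'_def field_simps)
      also have "cnj w * w / of_real d = (\<Sum>x\<in>S. \<Sum>y\<in>S. cnj (e x) * e y * (K x z * K z y / of_real d))"
      proof -
        have "cnj w * w = (\<Sum>x\<in>S. \<Sum>y\<in>S. (cnj (e x) * K x z) * (e y * K z y))"
          unfolding w' unfolding w_def by (rule sum_product)
        then show ?thesis
          by (simp only: sum_divide_distrib) (intro sum.cong refl, simp add: mult_ac)
      qed
      also have "- \<dots> + (\<Sum>x\<in>S. \<Sum>y\<in>S. cnj (e x) * e y * K x y) =
          (\<Sum>x\<in>S. \<Sum>y\<in>S. cnj (e x) * e y * K' x y)"
        by (simp add: K'_def right_diff_distrib sum_subtractf)
      finally show "(\<Sum>x\<in>S. \<Sum>y\<in>S. cnj (e x) * e y * K' x y) \<in> \<real>\<^sub>\<ge>\<^sub>0"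
        using psd_on_pos[OF insert.prems(1), of e'] by simp
    next
      show "\<forall>x\<in>S. \<forall>y\<in>S. K' y x = cnj (K' x y)"
      proof (intro ballI)
        fix x y assume "x \<in> S" "y \<in> S"
        then have "K y x = cnj (K x y)" "K y z = cnj (K z y)" "K z x = cnj (K x z)"
          by (intro herm; simp)+
        then show "K' y x = cnj (K' x y)" by (simp add: K'_def mult.commute)
      qed
    qed
    \<comment> \<open>The rank one part of \<open>K\<close>, multiplied by \<open>L\<close>, gives
      the form of \<open>L\<close> itself with the coefficients twisted by the row of
      \<open>z\<close>, divided by the pivot \<open>d\<close>.\<close>
    define e where "e x = c x * K z x" for x
    have "(\<Sum>x\<in>insert z S. \<Sum>y\<in>insert z S. cnj (c x) * c y * (K x y * L x y)) =
      (\<Sum>x\<in>insert z S. \<Sum>y\<in>insert z S. cnj (c x) * c y * (K' x y * L x y) + cnj (e x) * e y * L x y / of_real d)"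
    proof (intro sum.cong refl)
      fix x y assume "x \<in> insert z S" "y \<in> insert z S"
      then have "K x z = cnj (K z x)" by (intro herm) auto
      then show "cnj (c x) * c y * (K x y * L x y) =
        cnj (c x) * c y * (K' x y * L x y) + cnj (e x) * e y * L x y / of_real d"
        by (simp add: K'_def e_def algebra_simps)
    qed
    also have "\<dots> = (\<Sum>x\<in>insert z S. \<Sum>y\<in>insert z S. cnj (c x) * c y * (K' x y * L x y))
      + (\<Sum>x\<in>insert z S. \<Sum>y\<in>insert z S. cnj (e x) * e y * L x y) / of_real d"
      by (simp only: sum.distrib sum_divide_distrib)
    also have "(\<Sum>x\<in>insert z S. \<Sum>y\<in>insert z S. cnj (c x) * c y * (K' x y * L x y)) =
      (\<Sum>x\<in>S. \<Sum>y\<in>S. cnj (c x) * c y * (K' x y * L x y))"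
      using insert.hyps by (simp add: K'z)
    also have "\<dots> + (\<Sum>x\<in>insert z S. \<Sum>y\<in>insert z S. cnj (e x) * e y * L x y) / of_real d \<in> \<real>\<^sub>\<ge>\<^sub>0"
    proof (rule nonneg_Reals_add_I)
      show "(\<Sum>x\<in>S. \<Sum>y\<in>S. cnj (c x) * c y * (K' x y * L x y)) \<in> \<real>\<^sub>\<ge>\<^sub>0"
        by (rule psd_on_pos[OF insert.IH[OF psd' LS]])
      have "(\<Sum>x\<in>insert z S. \<Sum>y\<in>insert z S. cnj (e x) * e y * L x y) \<in> \<real>\<^sub>\<ge>\<^sub>0"
        by (rule psd_on_pos[OF insert.prems(2)])
      then show "(\<Sum>x\<in>insert z S. \<Sum>y\<in>insert z S. cnj (e x) * e y * L x y) / of_real d \<in> \<real>\<^sub>\<ge>\<^sub>0"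
        using d(2) by (intro nonneg_Reals_divide_I) auto
    qed
    finally show ?thesis .
  qed
  have "K y x * L y x = cnj (K x y * L x y)" if "x \<in> insert z S" "y \<in> insert z S" for x y
    unfolding herm[OF that] by simp
  with pos show ?case unfolding psd_on_def by blast
qed (simp add: psd_on_def)

context star_algebra
begin

lemma state_mult_finsum:
  assumes "state A \<phi>" "finite S" "\<And>i. i \<in> S \<Longrightarrow> f i \<in> carrier A" "x \<in> carrier A"
  shows "\<phi> (x \<otimes> finsum A f S) = (\<Sum>i\<in>S. \<phi> (x \<otimes> f i))"
  using assms(2,3)
proof (induction S rule: finite_induct)
  case (insert i S)
  then have "finsum A f S \<in> carrier A" "f i \<in> carrier A" by (auto intro!: finsum_closed)
  moreover have "finsum A f (insert i S) = f i \<oplus> finsum A f S"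
    using insert by (intro finsum_insert) auto
  ultimately show ?case using insert assms(4)
    by (simp add: r_distr state_add[OF assms(1)])
qed (use assms(4) in \<open>simp add: state_zero[OF assms(1)]\<close>)

text \<open>A Gram kernel: its quadratic form is the value of the state at
  \<open>star A X \<otimes> X\<close>, where \<open>X\<close> is the linear combination of the
  \<open>g i\<close> with the given coefficients.\<close>

lemma psd_on_state:
  assumes "state A \<phi>" "finite S" "\<And>i. i \<in> S \<Longrightarrow> g i \<in> carrier A"
  shows "psd_on S (\<lambda>i j. \<phi> (star A (g i) \<otimes> g j))"
  unfolding psd_on_def
proof (intro conjI allI ballI)
  fix i j assume "i \<in> S" "j \<in> S"
  then show "\<phi> (star A (g j) \<otimes> g i) = cnj (\<phi> (star A (g i) \<otimes> g j))"
    using assms(3) by (simp add: star_mult star_star star_closed flip: state_star[OF assms(1)])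
next
  fix c :: "_ \<Rightarrow> complex"
  define X where "X = finsum A (\<lambda>i. c i \<odot> g i) S"
  have X: "X \<in> carrier A" unfolding X_def by (intro finsum_closed) (use assms(3) smult_closed in auto)
  have e: "\<phi> (star A Y \<otimes> X) = (\<Sum>j\<in>S. c j * \<phi> (star A Y \<otimes> g j))" if "Y \<in> carrier A" for Y
  proof -
    have "\<phi> (star A Y \<otimes> X) = (\<Sum>j\<in>S. \<phi> (star A Y \<otimes> (c j \<odot> g j)))"
      unfolding X_def
      by (rule state_mult_finsum[OF assms(1,2)]) (use that assms(3) in \<open>auto simp: smult_closed star_closed\<close>)
    also have "\<dots> = (\<Sum>j\<in>S. c j * \<phi> (star A Y \<otimes> g j))"
      by (intro sum.cong refl)
        (use that assms(3) in \<open>auto simp: smult_mult_right star_closed state_smult[OF assms(1)]\<close>)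
    finally show ?thesis .
  qed
  \<comment> \<open>The expansion in the first argument is reduced to that in the second one by the
    hermitian symmetry of the state.\<close>
  have e2: "\<phi> (star A X \<otimes> Y) = (\<Sum>i\<in>S. cnj (c i) * \<phi> (star A (g i) \<otimes> Y))" if Y: "Y \<in> carrier A" for Y
  proof -
    have "\<phi> (star A X \<otimes> Y) = cnj (\<phi> (star A Y \<otimes> X))"
      using X Y by (simp add: star_mult star_star star_closed flip: state_star[OF assms(1)])
    also have "\<dots> = (\<Sum>i\<in>S. cnj (c i) * cnj (\<phi> (star A Y \<otimes> g i)))"
      by (simp add: e[OF Y] cnj_sum)
    also have "\<dots> = (\<Sum>i\<in>S. cnj (c i) * \<phi> (star A (g i) \<otimes> Y))"
      by (intro sum.cong refl)
        (use Y assms(3) in \<open>auto simp: star_mult star_star star_closed simp flip: state_star[OF assms(1)]\<close>)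
    finally show ?thesis .
  qed
  have "\<phi> (star A X \<otimes> X) = (\<Sum>i\<in>S. \<Sum>j\<in>S. cnj (c i) * c j * \<phi> (star A (g i) \<otimes> g j))"
    unfolding e2[OF X] by (intro sum.cong refl) (simp add: e assms(3) sum_distrib_left mult_ac)
  then show "(\<Sum>i\<in>S. \<Sum>j\<in>S. cnj (c i) * c j * \<phi> (star A (g i) \<otimes> g j)) \<in> \<real>\<^sub>\<ge>\<^sub>0"
    using state_pos[OF assms(1) X] by simp
qed

text \<open>Testing with factors on both sides makes the set absorb products. If the generators of
  an ideal lie in it, so does the ideal, and testing with units then shows that
  \<open>\<Lambda>\<close> vanishes there.\<close>

lemma star_ideal_null:
  assumes add: "\<And>x y. x \<in> carrier A \<Longrightarrow> y \<in> carrier A \<Longrightarrow> \<Lambda> (x \<oplus> y) = \<Lambda> x + \<Lambda> y"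
    and star: "\<And>x. x \<in> carrier A \<Longrightarrow> \<Lambda> (star A x) = cnj (\<Lambda> x)"
  shows "star_ideal A {x \<in> carrier A. \<forall>u\<in>carrier A. \<forall>v\<in>carrier A. \<Lambda> (u \<otimes> x \<otimes> v) = (0 :: complex)}"
    (is "star_ideal A ?N")
proof (rule star_idealI[OF star_algebra_axioms])
  have "\<Lambda> \<zero> = 0" using add[of \<zero> \<zero>] by simp
  then show "\<zero> \<in> ?N" by simp
  show "x \<oplus> y \<in> ?N" if "x \<in> ?N" "y \<in> ?N" for x y
    using that by (auto simp: l_distr r_distr add)
  show "x \<otimes> y \<in> ?N" if "x \<in> carrier A" "y \<in> ?N" for x y
    using that by (auto simp flip: m_assoc)
  show "y \<otimes> x \<in> ?N" if "x \<in> carrier A" "y \<in> ?N" for x y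
    using that by (auto simp: m_assoc)
  show "star A x \<in> ?N" if x: "x \<in> ?N" for x
  proof -
    have "\<Lambda> (u \<otimes> star A x \<otimes> v) = 0" if uv: "u \<in> carrier A" "v \<in> carrier A" for u v
    proof -
      have "u \<otimes> star A x \<otimes> v = star A (star A v \<otimes> x \<otimes> star A u)"
        using uv x by (simp add: star_mult star_star star_closed m_assoc)
      then show ?thesis using uv x by (simp add: star star_closed)
    qed
    then show ?thesis using x by (simp add: star_closed)
  qed
qed auto

end

section \<open>Tensor products\<close>

locale algebra_pair = A: star_algebra A + B: star_algebra B
  for A :: "'a star_algebra" and B :: "'b star_algebra"
begin

abbreviation "pair_adj \<equiv> \<lambda>(a, b). (star A a, star B b)"

lemma involutive_monoid_pairs: "involutive_monoid (A \<times>\<times> B) pair_adj"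
proof (rule involutive_monoid.intro)
  show "monoid (A \<times>\<times> B)" by (rule DirProd_monoid) unfold_locales
  show "involutive_monoid_axioms (A \<times>\<times> B) pair_adj"
    by unfold_locales (auto simp: A.star_closed B.star_closed A.star_star B.star_star A.star_mult B.star_mult)
qed

sublocale P: involutive_monoid "A \<times>\<times> B" pair_adj
  by (rule involutive_monoid_pairs)

abbreviation "TP \<equiv> tensor_pairs A B"
abbreviation "T \<equiv> tensor_product A B"
abbreviation "tel \<equiv> tensor_elem A B"

lemma TP_eq: "TP = P.MA"
  by (simp add: tensor_pairs_def)

lemmas star_algebra_TP = P.star_algebra_monoid_algebra[folded TP_eq]

lemma TP_carrier: "f \<in> carrier TP \<longleftrightarrow> Poly_Mapping.keys f \<subseteq> carrier A \<times> carrier B"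
  by (simp add: TP_eq)

lemma TP_diff_closed: "f \<in> carrier TP \<Longrightarrow> g \<in> carrier TP \<Longrightarrow> f - g \<in> carrier TP"
  using star_algebra.axioms(1)[OF star_algebra_TP, THEN ring.ring_simprules(4), of f g]
  by (simp add: TP_eq P.MA_minus)

lemma TP_single: "a \<in> carrier A \<Longrightarrow> b \<in> carrier B \<Longrightarrow> Poly_Mapping.single (a, b) c \<in> carrier TP"
  by (simp add: TP_carrier)

lemma tensor_relations_closed: "tensor_relations A B \<subseteq> carrier TP"
  unfolding tensor_relations_def
  by (auto intro!: TP_diff_closed TP_single A.smult_closed B.smult_closed)

lemma star_ideal_tensor: "star_ideal TP (tensor_ideal A B)"
  unfolding tensor_ideal_def
  by (rule star_ideal_star_ideal_generated[OF star_algebra_TP tensor_relations_closed])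

lemma tensor_relations_incl: "tensor_relations A B \<subseteq> tensor_ideal A B"
  unfolding tensor_ideal_def by (rule star_ideal_generated_incl[OF star_algebra_TP tensor_relations_closed])

lemma star_algebra_tensor_product: "star_algebra T"
  unfolding tensor_product_def by (rule star_algebra_quotient[OF star_algebra_TP star_ideal_tensor])

sublocale T: star_algebra T by (rule star_algebra_tensor_product)

lemmas T_hom = star_hom_quotient[OF star_algebra_TP star_ideal_tensor, folded tensor_product_def]
lemmas T_carrier = carrier_quotient[OF star_algebra_TP star_ideal_tensor, folded tensor_product_def]
lemmas T_eq = coset_eq_iff[OF star_algebra_TP star_ideal_tensor]

lemma T_eqI:
  "f \<in> carrier TP \<Longrightarrow> g \<in> carrier TP \<Longrightarrow> f - g \<in> tensor_relations A B \<Longrightarrow>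
    tensor_ideal A B +>\<^bsub>TP\<^esub> f = tensor_ideal A B +>\<^bsub>TP\<^esub> g"
  using tensor_relations_incl by (auto simp: T_eq) (simp add: TP_eq P.MA_minus subset_iff)

lemma elem_closed: "a \<in> carrier A \<Longrightarrow> b \<in> carrier B \<Longrightarrow> tel a b \<in> carrier T"
  unfolding tensor_elem_def by (rule star_hom_closed[OF T_hom TP_single])

lemma elem_add_left:
  assumes "a \<in> carrier A" "a' \<in> carrier A" "b \<in> carrier B"
  shows "tel (a \<oplus>\<^bsub>A\<^esub> a') b = tel a b \<oplus>\<^bsub>T\<^esub> tel a' b"
proof -
  have "tel (a \<oplus>\<^bsub>A\<^esub> a') b = tensor_ideal A B +>\<^bsub>TP\<^esub>
      (Poly_Mapping.single (a, b) 1 \<oplus>\<^bsub>TP\<^esub> Poly_Mapping.single (a', b) 1)"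
    unfolding tensor_elem_def
  proof (rule T_eqI)
    show "Poly_Mapping.single (a, b) 1 \<oplus>\<^bsub>TP\<^esub> Poly_Mapping.single (a', b) 1 \<in> carrier TP"
      using assms by (simp add: TP_eq keys_add_subset)
    show "Poly_Mapping.single (a \<oplus>\<^bsub>A\<^esub> a', b) 1 - (Poly_Mapping.single (a, b) 1 \<oplus>\<^bsub>TP\<^esub>
      Poly_Mapping.single (a', b) 1) \<in> tensor_relations A B"
      unfolding tensor_relations_def using assms by (auto simp: TP_eq diff_diff_eq[symmetric])
  qed (use assms in \<open>simp add: TP_single\<close>)
  also have "\<dots> = tel a b \<oplus>\<^bsub>T\<^esub> tel a' b"
    unfolding tensor_elem_def by (rule star_hom_add[OF T_hom]) (use assms in \<open>simp_all add: TP_single\<close>)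
  finally show ?thesis .
qed

lemma elem_add_right:
  assumes "a \<in> carrier A" "b \<in> carrier B" "b' \<in> carrier B"
  shows "tel a (b \<oplus>\<^bsub>B\<^esub> b') = tel a b \<oplus>\<^bsub>T\<^esub> tel a b'"
proof -
  have "tel a (b \<oplus>\<^bsub>B\<^esub> b') = tensor_ideal A B +>\<^bsub>TP\<^esub>
      (Poly_Mapping.single (a, b) 1 \<oplus>\<^bsub>TP\<^esub> Poly_Mapping.single (a, b') 1)"
    unfolding tensor_elem_def
  proof (rule T_eqI)
    show "Poly_Mapping.single (a, b) 1 \<oplus>\<^bsub>TP\<^esub> Poly_Mapping.single (a, b') 1 \<in> carrier TP"
      using assms by (simp add: TP_eq keys_add_subset)
    show "Poly_Mapping.single (a, b \<oplus>\<^bsub>B\<^esub> b') 1 - (Poly_Mapping.single (a, b) 1 \<oplus>\<^bsub>TP\<^esub>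
      Poly_Mapping.single (a, b') 1) \<in> tensor_relations A B"
      unfolding tensor_relations_def using assms by (auto simp: TP_eq diff_diff_eq[symmetric])
  qed (use assms in \<open>simp add: TP_single\<close>)
  also have "\<dots> = tel a b \<oplus>\<^bsub>T\<^esub> tel a b'"
    unfolding tensor_elem_def by (rule star_hom_add[OF T_hom]) (use assms in \<open>simp_all add: TP_single\<close>)
  finally show ?thesis .
qed

lemma elem_scale: "a \<in> carrier A \<Longrightarrow> b \<in> carrier B \<Longrightarrow>
    tensor_ideal A B +>\<^bsub>TP\<^esub> Poly_Mapping.single (a, b) c = c \<odot>\<^bsub>T\<^esub> tel a b"
  unfolding tensor_elem_def
  by (subst star_hom_smult[OF T_hom, symmetric]) (simp_all add: TP_single, simp add: TP_eq)

lemma elem_smult_left: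
  assumes "a \<in> carrier A" "b \<in> carrier B"
  shows "tel (c \<odot>\<^bsub>A\<^esub> a) b = c \<odot>\<^bsub>T\<^esub> tel a b"
  unfolding elem_scale[OF assms, symmetric]
  unfolding tensor_elem_def
  by (rule T_eqI) (use assms in \<open>auto simp: TP_single A.smult_closed tensor_relations_def\<close>)

lemma elem_smult_right:
  assumes "a \<in> carrier A" "b \<in> carrier B"
  shows "tel a (c \<odot>\<^bsub>B\<^esub> b) = c \<odot>\<^bsub>T\<^esub> tel a b"
  unfolding elem_scale[OF assms, symmetric]
  unfolding tensor_elem_def
  by (rule T_eqI) (use assms in \<open>auto simp: TP_single B.smult_closed tensor_relations_def\<close>)

lemma elem_mult:
  assumes "a \<in> carrier A" "a' \<in> carrier A" "b \<in> carrier B" "b' \<in> carrier B"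
  shows "tel a b \<otimes>\<^bsub>T\<^esub> tel a' b' = tel (a \<otimes>\<^bsub>A\<^esub> a') (b \<otimes>\<^bsub>B\<^esub> b')"
  unfolding tensor_elem_def
  by (subst star_hom_mult[OF T_hom, symmetric]) (use assms in \<open>simp_all add: TP_single\<close>, simp add: TP_eq)

lemma elem_one: "tel \<one>\<^bsub>A\<^esub> \<one>\<^bsub>B\<^esub> = \<one>\<^bsub>T\<^esub>"
  unfolding tensor_elem_def star_hom_one[OF T_hom, symmetric] by (simp add: TP_eq)

lemma elem_star:
  assumes "a \<in> carrier A" "b \<in> carrier B"
  shows "star T (tel a b) = tel (star A a) (star B b)"
  unfolding tensor_elem_def
  by (subst star_hom_star[OF T_hom, symmetric]) (use assms in \<open>simp_all add: TP_single\<close>, simp add: TP_eq)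

lemma elem_zero: "b \<in> carrier B \<Longrightarrow> tel \<zero>\<^bsub>A\<^esub> b = \<zero>\<^bsub>T\<^esub>"
  using elem_smult_left[of "\<zero>\<^bsub>A\<^esub>" b 0] by (simp add: A.smult_zero_left T.smult_zero_left elem_closed)

text \<open>Scalars are absorbed into the left factor, so that additive statements have to be
  checked on elementary tensors only.\<close>

lemma T_induct [consumes 1, case_names elem add]:
  assumes "w \<in> carrier T"
    and elem: "\<And>a b. a \<in> carrier A \<Longrightarrow> b \<in> carrier B \<Longrightarrow> P (tel a b)"
    and add: "\<And>v w. v \<in> carrier T \<Longrightarrow> w \<in> carrier T \<Longrightarrow> P v \<Longrightarrow> P w \<Longrightarrow> P (v \<oplus>\<^bsub>T\<^esub> w)"
  shows "P w"
proof -
  obtain f where f: "f \<in> carrier TP" "w = tensor_ideal A B +>\<^bsub>TP\<^esub> f"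
    using assms(1) by (auto simp: T_carrier)
  have "Poly_Mapping.keys f \<subseteq> carrier A \<times> carrier B" using f by (simp add: TP_carrier)
  then have "P (tensor_ideal A B +>\<^bsub>TP\<^esub> f)"
  proof (induction rule: poly_mapping_span_induct)
    case zero
    have "tensor_ideal A B +>\<^bsub>TP\<^esub> 0 = \<zero>\<^bsub>T\<^esub>"
      using star_hom_zero[OF star_algebra_TP T.star_algebra_axioms T_hom] by (simp add: TP_eq)
    then show ?case using elem[of "\<zero>\<^bsub>A\<^esub>" "\<zero>\<^bsub>B\<^esub>"] by (simp add: elem_zero)
  next
    case (single g c)
    then obtain a b where "g = (a, b)" "a \<in> carrier A" "b \<in> carrier B" by auto
    then show ?case using elem[of "c \<odot>\<^bsub>A\<^esub> a" b] by (simp add: elem_scale elem_smult_left A.smult_closed)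
  next
    case (add f g)
    then have "P ((tensor_ideal A B +>\<^bsub>TP\<^esub> f) \<oplus>\<^bsub>T\<^esub> (tensor_ideal A B +>\<^bsub>TP\<^esub> g))"
      by (intro assms(3) star_hom_closed[OF T_hom]) (auto simp: TP_carrier)
    also have "(tensor_ideal A B +>\<^bsub>TP\<^esub> f) \<oplus>\<^bsub>T\<^esub> (tensor_ideal A B +>\<^bsub>TP\<^esub> g) = tensor_ideal A B +>\<^bsub>TP\<^esub> (f \<oplus>\<^bsub>TP\<^esub> g)"
      by (rule star_hom_add[OF T_hom, symmetric]) (use add in \<open>auto simp: TP_carrier\<close>)
    finally show ?case by (simp add: TP_eq)
  qed
  then show ?thesis using f by simp
qed

lemma star_hom_elem_left: "star_hom A T (\<lambda>a. tel a \<one>\<^bsub>B\<^esub>)"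
  by (rule star_homI)
    (simp_all add: elem_closed elem_mult elem_add_left elem_one elem_smult_left elem_star B.star_one)

lemma star_hom_elem_right: "star_hom B T (\<lambda>b. tel \<one>\<^bsub>A\<^esub> b)"
  by (rule star_homI)
    (simp_all add: elem_closed elem_mult elem_add_right elem_one elem_smult_right elem_star A.star_one)

section \<open>The tensor product of two states\<close>

context
  fixes \<phi> :: "'a \<Rightarrow> complex" and \<psi> :: "'b \<Rightarrow> complex"
  assumes \<phi>: "state A \<phi>" and \<psi>: "state B \<psi>"
begin

abbreviation "pair_functional \<equiv> lin_ext (\<lambda>(a, b) c. c * (\<phi> a * \<psi> b))"

lemma pair_functional_add: "pair_functional (f + g) = pair_functional f + pair_functional g"
  by (rule lin_ext_add) (auto simp: distrib_right)

lemma pair_functional_single: "pair_functional (Poly_Mapping.single (a, b) c) = c * (\<phi> a * \<psi> b)"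
  by (simp add: lin_ext_single)

lemma pair_functional_diff: "pair_functional (f - g) = pair_functional f - pair_functional g"
  using pair_functional_add[of "f - g" g] by simp

lemma pair_functional_star:
  assumes "f \<in> carrier TP"
  shows "pair_functional (star TP f) = cnj (pair_functional f)"
proof -
  have "Poly_Mapping.keys f \<subseteq> carrier A \<times> carrier B" using assms by (simp add: TP_carrier)
  then show ?thesis
  proof (induction rule: poly_mapping_span_induct)
    case (single g c)
    then obtain a b where "g = (a, b)" "a \<in> carrier A" "b \<in> carrier B" by auto
    then show ?case
      by (simp add: TP_eq pair_functional_single A.state_star[OF \<phi>] B.state_star[OF \<psi>])
  qed (simp_all add: TP_eq P.MA_star_add pair_functional_add)
qed

text \<open>Multiplied by basis vectors on both sides, a bilinearity relation becomes one of the
  same kind, on which a product of two linear functionals vanishes. Linearity in the outer factors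
  extends this to all of them.\<close>

lemma pair_functional_ideal:
  assumes "r \<in> tensor_ideal A B"
  shows "pair_functional r = 0"
proof -
  interpret TP: star_algebra TP by (rule star_algebra_TP)
  let ?N = "{x \<in> carrier TP. \<forall>u\<in>carrier TP. \<forall>v\<in>carrier TP. pair_functional (u \<otimes>\<^bsub>TP\<^esub> x \<otimes>\<^bsub>TP\<^esub> v) = 0}"
  have N: "star_ideal TP ?N"
    by (rule TP.star_ideal_null) (simp_all add: TP_eq pair_functional_add pair_functional_star[unfolded TP_eq])
  have dl: "(f - g) \<otimes>\<^bsub>TP\<^esub> h = f \<otimes>\<^bsub>TP\<^esub> h - g \<otimes>\<^bsub>TP\<^esub> h" for f g h
    using P.MA_mult_add_left[of "f - g" g h] by (simp add: TP_eq eq_diff_eq)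
  have dr: "h \<otimes>\<^bsub>TP\<^esub> (f - g) = h \<otimes>\<^bsub>TP\<^esub> f - h \<otimes>\<^bsub>TP\<^esub> g" for f g h
    using P.MA_mult_add_right[of h "f - g" g] by (simp add: TP_eq eq_diff_eq)
  have "pair_functional (u \<otimes>\<^bsub>TP\<^esub> r \<otimes>\<^bsub>TP\<^esub> v) = 0"
    if r: "r \<in> tensor_relations A B" and u: "u \<in> carrier TP" and v: "v \<in> carrier TP" for r u v
  proof -
    have "Poly_Mapping.keys u \<subseteq> carrier A \<times> carrier B" using u by (simp add: TP_carrier)
    then show ?thesis
    proof (induction rule: poly_mapping_span_induct)
      case u: (single g c)
      have "Poly_Mapping.keys v \<subseteq> carrier A \<times> carrier B" using v by (simp add: TP_carrier)
      then show ?case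
      proof (induction rule: poly_mapping_span_induct)
        case v: (single h d)
        obtain a1 b1 a2 b2 where "g = (a1, b1)" "h = (a2, b2)" "a1 \<in> carrier A" "b1 \<in> carrier B"
          "a2 \<in> carrier A" "b2 \<in> carrier B" using u v by auto
        then show ?case using r
          by (auto simp: tensor_relations_def dl dr pair_functional_diff)
            (auto simp: TP_eq pair_functional_single A.l_distr A.r_distr B.l_distr B.r_distr
              A.smult_mult_left A.smult_mult_right B.smult_mult_left B.smult_mult_right A.smult_closed B.smult_closed
              state_add[OF \<phi>] state_add[OF \<psi>] state_smult[OF \<phi>] state_smult[OF \<psi>] algebra_simps)
      qed (simp_all add: TP_eq P.MA_mult_add_right pair_functional_add)
    qed (simp_all add: TP_eq P.MA_mult_add_left pair_functional_add)
  qed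
  then have "tensor_ideal A B \<subseteq> ?N"
    unfolding tensor_ideal_def
    by (intro star_ideal_generated_minimal[OF N]) (use tensor_relations_closed in blast)
  with assms have "pair_functional (\<one>\<^bsub>TP\<^esub> \<otimes>\<^bsub>TP\<^esub> r \<otimes>\<^bsub>TP\<^esub> \<one>\<^bsub>TP\<^esub>) = 0" "r \<in> carrier TP" by blast+
  then show ?thesis by simp
qed

text \<open>The sum is constant on cosets of the ideal, so that the image of a coset is a singleton,
  as \<open>the_elem\<close> requires.\<close>

lemma tensor_functional_coset:
  assumes "f \<in> carrier TP"
  shows "tensor_functional \<phi> \<psi> (tensor_ideal A B +>\<^bsub>TP\<^esub> f) = pair_functional f"
proof -
  have eq: "(\<lambda>f. \<Sum>(a, b)\<in>Poly_Mapping.keys f. Poly_Mapping.lookup f (a, b) * (\<phi> a * \<psi> b)) = pair_functional"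
    by (simp add: fun_eq_iff lin_ext_def split_def)
  have "pair_functional ` (tensor_ideal A B +>\<^bsub>TP\<^esub> f) = {pair_functional f}"
  proof -
    have "pair_functional g = pair_functional f" if g: "g \<in> tensor_ideal A B +>\<^bsub>TP\<^esub> f" for g
    proof -
      have "g \<in> carrier TP" "g \<ominus>\<^bsub>TP\<^esub> f \<in> tensor_ideal A B"
        using mem_coset[OF star_algebra_TP star_ideal_tensor assms g] T_eq[of g f] assms by auto
      then have "pair_functional (g - f) = 0"
        using assms pair_functional_ideal by (simp add: TP_eq P.MA_minus)
      then show ?thesis by (simp add: pair_functional_diff)
    qed
    then show ?thesis using self_mem_coset[OF star_algebra_TP star_ideal_tensor assms] by blast
  qed
  then show ?thesis unfolding tensor_functional_def eq by simp
qed

lemma tensor_functional_elem: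
  "a \<in> carrier A \<Longrightarrow> b \<in> carrier B \<Longrightarrow> tensor_functional \<phi> \<psi> (tel a b) = \<phi> a * \<psi> b"
  unfolding tensor_elem_def by (subst tensor_functional_coset) (simp_all add: TP_single pair_functional_single)

text \<open>Expanding \<open>f\<close> in pairs yields a quadratic form whose kernel is the
  entrywise product of two Gram kernels, one for each state.\<close>

lemma pair_functional_positive:
  assumes "f \<in> carrier TP"
  shows "pair_functional (star TP f \<otimes>\<^bsub>TP\<^esub> f) \<in> \<real>\<^sub>\<ge>\<^sub>0"
proof -
  have keys: "Poly_Mapping.keys f \<subseteq> carrier A \<times> carrier B" using assms by (simp add: TP_carrier)
  let ?K = "\<lambda>x y. \<phi> (star A (fst x) \<otimes>\<^bsub>A\<^esub> fst y) * \<psi> (star B (snd x) \<otimes>\<^bsub>B\<^esub> snd y)"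
  let ?l = "Poly_Mapping.lookup f"
  have sums: "pair_functional (sum g S) = (\<Sum>i\<in>S. pair_functional (g i))" for g :: "'a \<times> 'b \<Rightarrow> _" and S
    by (induction S rule: infinite_finite_induct) (simp_all add: pair_functional_add)
  have ml: "sum g S \<otimes>\<^bsub>TP\<^esub> h = (\<Sum>i\<in>S. g i \<otimes>\<^bsub>TP\<^esub> h)" for g :: "'a \<times> 'b \<Rightarrow> _" and S h
    by (induction S rule: infinite_finite_induct) (simp_all add: TP_eq P.MA_mult_add_left)
  have mr: "h \<otimes>\<^bsub>TP\<^esub> sum g S = (\<Sum>i\<in>S. h \<otimes>\<^bsub>TP\<^esub> g i)" for g :: "'a \<times> 'b \<Rightarrow> _" and S h
    by (induction S rule: infinite_finite_induct) (simp_all add: TP_eq P.MA_mult_add_right)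
  have trm: "pair_functional (Poly_Mapping.single (pair_adj x) c \<otimes>\<^bsub>TP\<^esub> Poly_Mapping.single y d)
      = c * d * ?K x y" for x y c d
    by (cases x; cases y) (simp add: TP_eq pair_functional_single)
  have sf: "star TP f = (\<Sum>x\<in>Poly_Mapping.keys f. Poly_Mapping.single (pair_adj x) (cnj (?l x)))"
    by (simp add: TP_eq P.MA_star lin_ext_def)
  have "star TP f \<otimes>\<^bsub>TP\<^esub> f = (\<Sum>x\<in>Poly_Mapping.keys f. \<Sum>y\<in>Poly_Mapping.keys f.
      Poly_Mapping.single (pair_adj x) (cnj (?l x)) \<otimes>\<^bsub>TP\<^esub> Poly_Mapping.single y (?l y))"
    unfolding sf ml mr[symmetric] by (simp flip: poly_mapping_expand)
  then have "pair_functional (star TP f \<otimes>\<^bsub>TP\<^esub> f) =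
     (\<Sum>x\<in>Poly_Mapping.keys f. \<Sum>y\<in>Poly_Mapping.keys f. cnj (?l x) * ?l y * ?K x y)"
    by (simp only: sums trm)
  moreover have "psd_on (Poly_Mapping.keys f) ?K"
    by (rule psd_on_mult[OF finite_keys A.psd_on_state[OF \<phi>] B.psd_on_state[OF \<psi>]]) (use keys in auto)
  ultimately show ?thesis using psd_on_pos[of "Poly_Mapping.keys f" ?K ?l] by simp
qed

lemma state_tensor_functional: "state T (tensor_functional \<phi> \<psi>)"
  unfolding state_def
proof (intro conjI ballI allI)
  fix v c assume "v \<in> carrier T"
  then obtain f where f: "f \<in> carrier TP" "v = tensor_ideal A B +>\<^bsub>TP\<^esub> f" by (auto simp: T_carrier)
  interpret TP: star_algebra TP by (rule star_algebra_TP)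
  have scale: "pair_functional (scale_pm c f) = c * pair_functional f"
  proof -
    have "Poly_Mapping.keys f \<subseteq> carrier A \<times> carrier B" using f by (simp add: TP_carrier)
    then show ?thesis
      by (induction rule: poly_mapping_span_induct)
        (auto simp: pair_functional_add scale_pm_add pair_functional_single distrib_left)
  qed
  show "tensor_functional \<phi> \<psi> (c \<odot>\<^bsub>T\<^esub> v) = c * tensor_functional \<phi> \<psi> v"
    using f scale by (simp add: tensor_functional_coset TP.smult_closed flip: star_hom_smult[OF T_hom])
      (simp add: TP_eq)
  show "tensor_functional \<phi> \<psi> (star T v \<otimes>\<^bsub>T\<^esub> v) \<in> \<real>\<^sub>\<ge>\<^sub>0"
    using f pair_functional_positive[OF f(1)]
    by (simp add: tensor_functional_coset TP.star_closed flip: star_hom_star[OF T_hom] star_hom_mult[OF T_hom])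
  fix w assume "w \<in> carrier T"
  then obtain g where g: "g \<in> carrier TP" "w = tensor_ideal A B +>\<^bsub>TP\<^esub> g" by (auto simp: T_carrier)
  show "tensor_functional \<phi> \<psi> (v \<oplus>\<^bsub>T\<^esub> w) = tensor_functional \<phi> \<psi> v + tensor_functional \<phi> \<psi> w"
    using f g by (simp add: tensor_functional_coset flip: star_hom_add[OF T_hom])
      (simp add: TP_eq pair_functional_add)
next
  show "tensor_functional \<phi> \<psi> \<one>\<^bsub>T\<^esub> = 1"
    by (simp add: elem_one[symmetric] tensor_functional_elem state_one[OF \<phi>] state_one[OF \<psi>])
qed

end

end

section \<open>Monotone closure of a short chain\<close>

lemma UN_const_pair:
  assumes "X \<noteq> {}" "\<And>x e. (x, e) \<in> X \<Longrightarrow> G x e = Z"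
  shows "(\<Union>(x, e)\<in>X. G x e) = Z"
  using assms by fast

text \<open>If \<open>c m = 1\<close> for \<open>m \<ge> 2\<close>, the chain is \<open>{0, c 1, 1}\<close>. Every MSDD is eventually 1, so that
  every OWMC is eventually constant and the monotone closure is \<open>C\<close> itself.\<close>

locale short_chain = star_algebra C for C :: "'c star_algebra" (structure) +
  fixes F :: "nat \<Rightarrow> 'c set" and c :: "nat \<Rightarrow> 'c"
  assumes F_subalgebra: "star_subalgebra C (F m)"
    and F_mono: "m \<le> n \<Longrightarrow> F m \<subseteq> F n"
    and F_Union: "(\<Union>m. F m) = carrier C"
    and c_0: "c 0 = \<zero>"
    and c_1: "c (Suc 0) \<in> carrier C" "c (Suc 0) \<otimes> c (Suc 0) = c (Suc 0)"
    and c_ge_2: "2 \<le> m \<Longrightarrow> c m = \<one>"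
begin

lemma F_simps:
  "x \<in> F m \<Longrightarrow> x \<in> carrier C" "x \<in> F m \<Longrightarrow> y \<in> F m \<Longrightarrow> x \<oplus> y \<in> F m"
  "x \<in> F m \<Longrightarrow> y \<in> F m \<Longrightarrow> x \<otimes> y \<in> F m" "x \<in> F m \<Longrightarrow> a \<odot> x \<in> F m" "x \<in> F m \<Longrightarrow> star C x \<in> F m"
  "\<one> \<in> F m"
  using F_subalgebra[of m] by (auto simp: star_subalgebra_def)

lemma F_zero: "\<zero> \<in> F m"
  using F_simps(4)[OF F_simps(6), of 0 m] by (simp add: smult_zero_left)

section \<open>The chain of projections and its dense domains\<close>

abbreviation "Ch \<equiv> projection_chain C c"

lemma Ch_eq: "Ch = {\<zero>, c (Suc 0), \<one>}"
proof -
  have "c m \<in> {\<zero>, c (Suc 0), \<one>}" for m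
    using c_0 c_ge_2[of m] by (cases "m = 0"; cases "m = 1") auto
  moreover have "\<zero> \<in> range c" using c_0 by (metis rangeI)
  ultimately show ?thesis unfolding projection_chain_def by auto
qed

lemma Ch_closed: "e \<in> Ch \<Longrightarrow> e \<in> carrier C"
  using c_1 by (auto simp: Ch_eq)

lemma Ch_idem: "e \<in> Ch \<Longrightarrow> e \<otimes> e = e"
  using c_1 by (auto simp: Ch_eq)

lemma Ch_comm: "e \<in> Ch \<Longrightarrow> f \<in> Ch \<Longrightarrow> e \<otimes> f = f \<otimes> e"
  using c_1 by (auto simp: Ch_eq)

lemma Ch_mult: "e \<in> Ch \<Longrightarrow> f \<in> Ch \<Longrightarrow> e \<otimes> f \<in> Ch"
  using c_1 by (auto simp: Ch_eq)

lemma Ch_absorb: "k \<in> Ch \<Longrightarrow> x \<in> Ch \<Longrightarrow> k \<otimes> x \<otimes> x = k \<otimes> x"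
  using Ch_closed Ch_idem by (simp add: m_assoc)

text \<open>Being below \<open>x\<close> survives multiplication by a further projection. Iterated,
  this places a product of four projections below each of its factors.\<close>

lemma Ch_absorb2:
  assumes "k \<in> Ch" "x \<in> Ch" "y \<in> Ch" "k \<otimes> x = k"
  shows "k \<otimes> y \<otimes> x = k \<otimes> y"
proof -
  have "k \<otimes> y \<otimes> x = k \<otimes> x \<otimes> y"
    using assms(1-3) Ch_closed Ch_comm[of y x] by (simp add: m_assoc)
  then show ?thesis by (simp add: assms(4))
qed

lemma Ch_mem: "\<zero> \<in> Ch" "\<one> \<in> Ch"
  by (simp_all add: Ch_eq)

lemma msdd_Ch: "msdd C c e \<Longrightarrow> 1 \<le> m \<Longrightarrow> e m \<in> Ch"
  by (simp add: msdd_def)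

lemma msdd_le:
  assumes "msdd C c e" "1 \<le> m" "m \<le> n"
  shows "e m \<otimes> e n = e m"
  using assms(3)
proof (induction n rule: dec_induct)
  case base
  show ?case using Ch_idem msdd_Ch[OF assms(1,2)] by blast
next
  case (step n)
  have cl: "e m \<in> carrier C" "e n \<in> carrier C" "e (Suc n) \<in> carrier C"
    using msdd_Ch[OF assms(1)] Ch_closed assms(2) step by auto
  have "e n \<otimes> e (Suc n) = e n" using assms step by (simp add: msdd_def proj_le_def)
  then have "e m \<otimes> e n \<otimes> e (Suc n) = e m \<otimes> e n" using cl by (simp add: m_assoc)
  then show ?case using step by simp
qed

text \<open>Suppose that 1 is never attained. Then all values are 0 or \<open>c (Suc 0)\<close>, so
  \<open>c (Suc 0)\<close> is an upper bound and equals 1 by density. Hence all values are 0, and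
  density yields \<open>\<zero> = \<one>\<close>, so that 1 is attained after all.\<close>

lemma msdd_eventually_one:
  assumes "msdd C c e"
  obtains N where "1 \<le> N" "\<And>m. N \<le> m \<Longrightarrow> e m = \<one>"
proof -
  have sup: "g = \<one>" if "g \<in> Ch" "\<And>m. 1 \<le> m \<Longrightarrow> e m \<otimes> g = e m" for g
  proof -
    have "\<one> \<otimes> g = \<one>" using assms that by (auto simp: msdd_def proj_le_def)
    then show ?thesis using Ch_closed[OF that(1)] by simp
  qed
  have "\<exists>N\<ge>1. e N = \<one>"
  proof (rule ccontr)
    assume neg: "\<not> ?thesis"
    then have e: "e m \<in> {\<zero>, c (Suc 0)}" if "1 \<le> m" for m
      using msdd_Ch[OF assms that] that by (auto simp: Ch_eq)
    then have "e m \<otimes> c (Suc 0) = e m" if "1 \<le> m" for m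
      using e[OF that] c_1 by auto
    then have "c (Suc 0) = \<one>" by (intro sup) (auto simp: Ch_eq)
    then have "e m = \<zero>" if "1 \<le> m" for m
      using neg e[OF that] that by auto
    then have "\<zero> = \<one>" by (intro sup) (auto simp: Ch_eq)
    moreover have "e 1 = \<zero>" using \<open>\<And>m. 1 \<le> m \<Longrightarrow> e m = \<zero>\<close> by simp
    ultimately show False using neg by auto
  qed
  then obtain N where N: "1 \<le> N" "e N = \<one>" by blast
  have "e m = \<one>" if "N \<le> m" for m
  proof -
    have "e m \<in> carrier C" using msdd_Ch[OF assms] Ch_closed N that by auto
    then show ?thesis using msdd_le[OF assms N(1) that] N(2) by simp
  qed
  with N show thesis using that by blast
qed

lemma msddI:
  assumes "\<And>m. 1 \<le> m \<Longrightarrow> e m \<in> Ch" "\<And>m. 1 \<le> m \<Longrightarrow> e m \<otimes> e (Suc m) = e m"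
    and "\<And>m. N \<le> m \<Longrightarrow> e m = \<one>"
  shows "msdd C c e"
  unfolding msdd_def proj_le_def
proof (intro conjI ballI allI impI)
  fix g assume g: "g \<in> Ch" "\<forall>m\<ge>1. e m \<otimes> g = e m"
  have "e (max 1 N) \<otimes> g = e (max 1 N)" using g(2) by simp
  then show "\<one> \<otimes> g = \<one>" using assms(3)[of "max 1 N"] by simp
qed (use assms in auto)

text \<open>It serves both as the domain of an embedded element and as a witness that sequences
  agreeing from some index on are equivalent.\<close>

lemma msdd_cut: "msdd C c (\<lambda>m. if m \<le> k then \<zero> else \<one>)"
  by (rule msddI[of _ "Suc k"]) (auto simp: Ch_mem)

section \<open>Operators with monotone closure and their classes\<close>

lemma owmc_closed: "owmc C F c (x, e) \<Longrightarrow> 1 \<le> m \<Longrightarrow> x m \<in> F m"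
  by (simp add: owmc_def)

lemma owmc_msdd: "owmc C F c (x, e) \<Longrightarrow> msdd C c e"
  by (simp add: owmc_def)

text \<open>Once \<open>e N\<close> is the unit, compatibility of the entries at \<open>N\<close>
  and at a later index says that they are equal.\<close>

lemma owmc_eventually_const:
  assumes "owmc C F c (x, e)"
  obtains v where "v \<in> carrier C" "\<forall>\<^sub>F m in sequentially. x m = v"
proof -
  obtain N where N: "1 \<le> N" "\<And>m. N \<le> m \<Longrightarrow> e m = \<one>"
    using msdd_eventually_one[OF owmc_msdd[OF assms]] by blast
  have cl: "x m \<in> carrier C" if "N \<le> m" for m
    using owmc_closed[OF assms, of m] F_simps(1) N that by auto
  have "x m = x N" if "N \<le> m" for m
  proof (cases "m = N")
    case False
    have "\<forall>m\<ge>1. \<forall>n>m. x n \<otimes> e m = x m \<otimes> e m" using assms by (simp add: owmc_def)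
    then have "x m \<otimes> e N = x N \<otimes> e N" using False N(1) that by (metis le_neq_implies_less)
    then show ?thesis using N cl that by simp
  qed simp
  then have "\<forall>\<^sub>F m in sequentially. x m = x N" unfolding eventually_sequentially by blast
  then show thesis using that cl by blast
qed

lemma owmc_cut:
  assumes "v \<in> F k"
  shows "owmc C F c (\<lambda>m. if m \<le> k then \<zero> else v, \<lambda>m. if m \<le> k then \<zero> else \<one>)"
  using assms F_mono[of k] F_zero F_simps(1)[OF assms] msdd_cut
  by (auto simp: owmc_def star_closed star_zero subset_iff)

text \<open>Equivalence turns out to be eventual equality, so that a class is labelled by the
  eventual value of its members.\<close>

definition cls :: "'c \<Rightarrow> 'c mco" where
  "cls v = {(x, e). owmc C F c (x, e) \<and> (\<forall>\<^sub>F m in sequentially. x m = v)}"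

text \<open>A witness \<open>g\<close> is eventually 1 and disappears there. Conversely, cutting at
  an index beyond which the two sequences agree gives a witness.\<close>

lemma owmc_equiv_iff:
  "((x, e), (y, f)) \<in> owmc_equiv C F c \<longleftrightarrow> owmc C F c (x, e) \<and> owmc C F c (y, f) \<and>
     (\<forall>\<^sub>F m in sequentially. x m = y m)"
proof (intro iffI conjI)
  assume *: "((x, e), (y, f)) \<in> owmc_equiv C F c"
  then show ow: "owmc C F c (x, e)" "owmc C F c (y, f)" by (auto simp: owmc_equiv_def)
  from * obtain g where g: "msdd C c g" "\<And>m. 1 \<le> m \<Longrightarrow> x m \<otimes> g m = y m \<otimes> g m"
    by (auto simp: owmc_equiv_def)
  obtain N where N: "1 \<le> N" "\<And>m. N \<le> m \<Longrightarrow> g m = \<one>"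
    using msdd_eventually_one[OF g(1)] by blast
  have "x m = y m" if "N \<le> m" for m
    using g(2)[of m] N that F_simps(1)[OF owmc_closed[OF ow(1), of m]] F_simps(1)[OF owmc_closed[OF ow(2), of m]]
    by simp
  then show "\<forall>\<^sub>F m in sequentially. x m = y m" unfolding eventually_sequentially by blast
next
  assume *: "owmc C F c (x, e) \<and> owmc C F c (y, f) \<and> (\<forall>\<^sub>F m in sequentially. x m = y m)"
  then obtain N where N: "\<And>m. N \<le> m \<Longrightarrow> x m = y m" unfolding eventually_sequentially by blast
  have cl: "x m \<in> carrier C" "y m \<in> carrier C" if "1 \<le> m" for m
    using * owmc_closed F_simps(1) that by blast+
  let ?g = "\<lambda>m. if m \<le> N then \<zero> else \<one>"
  have "x m \<otimes> ?g m = y m \<otimes> ?g m \<and> star C (x m) \<otimes> ?g m = star C (y m) \<otimes> ?g m" if "1 \<le> m" for m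
    using cl[OF that] N[of m] by (simp add: star_closed)
  with * msdd_cut[of N] show "((x, e), (y, f)) \<in> owmc_equiv C F c"
    unfolding owmc_equiv_def by blast
qed

lemma mco_class_eq:
  assumes "owmc C F c (x, e)" "\<forall>\<^sub>F m in sequentially. x m = v"
  shows "mco_class C F c x e = cls v"
proof -
  have "(\<forall>\<^sub>F m in sequentially. x m = y m) \<longleftrightarrow> (\<forall>\<^sub>F m in sequentially. y m = v)" for y
    using assms(2) by (auto elim: eventually_elim2)
  then show ?thesis unfolding mco_class_def cls_def using owmc_equiv_iff assms(1) by auto
qed

lemma mco_embed_eq:
  assumes "v \<in> carrier C"
  shows "mco_embed C F c v = cls v"
proof -
  define k where "k = (LEAST k. v \<in> F k)"
  have "\<exists>k. v \<in> F k" using assms F_Union by auto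
  then have "v \<in> F k" unfolding k_def by (rule LeastI_ex)
  moreover have "\<forall>\<^sub>F m in sequentially. (if m \<le> k then \<zero> else v) = v"
    using eventually_gt_at_top[of k] by eventually_elim simp
  ultimately show ?thesis
    unfolding mco_embed_def Let_def k_def[symmetric] by (intro mco_class_eq owmc_cut)
qed

lemma cls_nonempty: "v \<in> carrier C \<Longrightarrow> cls v \<noteq> {}"
proof -
  assume "v \<in> carrier C"
  then obtain k where k: "v \<in> F k" using F_Union by auto
  have "\<forall>\<^sub>F m in sequentially. (if m \<le> k then \<zero> else v) = v"
    using eventually_gt_at_top[of k] by eventually_elim simp
  with owmc_cut[OF k] show ?thesis by (auto simp: cls_def)
qed

abbreviation "MC \<equiv> monotone_closure C F c"

lemma MC_carrier: "carrier MC = cls ` carrier C"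
proof -
  have "carrier MC = (\<lambda>(x, e). mco_class C F c x e) ` Collect (owmc C F c)"
    by (simp add: monotone_closure_def quotient_def mco_class_def UNION_singleton_eq_range split_def)
  moreover have "mco_class C F c x e \<in> cls ` carrier C" if xe: "owmc C F c (x, e)" for x e
  proof -
    obtain v where v: "v \<in> carrier C" "\<forall>\<^sub>F m in sequentially. x m = v"
      using owmc_eventually_const[OF xe] by metis
    show ?thesis unfolding mco_class_eq[OF xe v(2)] using v(1) by (rule imageI)
  qed
  moreover have "cls v \<in> (\<lambda>(x, e). mco_class C F c x e) ` Collect (owmc C F c)" if v: "v \<in> carrier C" for v
  proof -
    obtain x e where "(x, e) \<in> cls v" using cls_nonempty[OF v] by auto
    then have "owmc C F c (x, e)" "\<forall>\<^sub>F m in sequentially. x m = v" by (auto simp: cls_def)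
    then have "mco_class C F c x e = cls v" "owmc C F c (x, e)" by (simp_all add: mco_class_eq)
    then show ?thesis by (intro image_eqI[of _ _ "(x, e)"]) simp_all
  qed
  ultimately show ?thesis by auto
qed

text \<open>A largest element exists because the candidates include 0 and lie in a totally ordered
  chain of at most three elements; it is unique because the elements of the chain commute.\<close>

lemma proj_preimage:
  assumes "a \<in> carrier C" "e \<in> Ch"
  shows "proj_preimage C c a e \<in> Ch" (is ?A)
    and "e \<otimes> a \<otimes> proj_preimage C c a e = a \<otimes> proj_preimage C c a e" (is ?B)
    and "h \<in> Ch \<Longrightarrow> e \<otimes> a \<otimes> h = a \<otimes> h \<Longrightarrow> h \<otimes> proj_preimage C c a e = h" (is "_ \<Longrightarrow> _ \<Longrightarrow> ?D")
proof -
  define Q where "Q = {g \<in> Ch. e \<otimes> a \<otimes> g = a \<otimes> g}"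
  have Q0: "\<zero> \<in> Q" using assms Ch_closed by (auto simp: Q_def Ch_mem)
  have max: "\<exists>g. g \<in> Q \<and> (\<forall>h\<in>Q. proj_le C h g)"
  proof -
    have sub: "Q \<subseteq> {\<zero>, c (Suc 0), \<one>}" by (auto simp: Q_def Ch_eq)
    consider "\<one> \<in> Q" | "\<one> \<notin> Q" "c (Suc 0) \<in> Q" | "\<one> \<notin> Q" "c (Suc 0) \<notin> Q" by blast
    then show ?thesis
    proof cases
      case 1
      have "\<forall>h\<in>Q. proj_le C h \<one>" using sub c_1 by (auto simp: proj_le_def)
      then show ?thesis using 1 by blast
    next
      case 2
      have "\<forall>h\<in>Q. proj_le C h (c (Suc 0))" using sub c_1 2 by (auto simp: proj_le_def)
      then show ?thesis using 2 by blast
    next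
      case 3
      have "\<forall>h\<in>Q. proj_le C h \<zero>" using sub 3 by (auto simp: proj_le_def)
      then show ?thesis using Q0 by blast
    qed
  qed
  have uniq: "g = g'" if "g \<in> Q \<and> (\<forall>h\<in>Q. proj_le C h g)" "g' \<in> Q \<and> (\<forall>h\<in>Q. proj_le C h g')" for g g'
  proof -
    have "g \<otimes> g' = g" "g' \<otimes> g = g'" "g \<in> Ch" "g' \<in> Ch" using that by (auto simp: proj_le_def Q_def)
    then show ?thesis using Ch_comm[of g g'] by simp
  qed
  have eq: "proj_preimage C c a e = (THE g. g \<in> Q \<and> (\<forall>h\<in>Q. proj_le C h g))"
    by (simp add: proj_preimage_def Q_def Let_def)
  obtain g where g: "g \<in> Q \<and> (\<forall>h\<in>Q. proj_le C h g)" using max by blast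
  have "proj_preimage C c a e = g" unfolding eq using g uniq[OF _ g] by (intro the_equality) blast+
  with g show ?A ?B "h \<in> Ch \<Longrightarrow> e \<otimes> a \<otimes> h = a \<otimes> h \<Longrightarrow> ?D"
    by (auto simp: Q_def proj_le_def)
qed

section \<open>Sums and products of representatives\<close>

lemma owmcI:
  assumes "\<And>m. 1 \<le> m \<Longrightarrow> x m \<in> F m" "msdd C c e"
    "\<And>m n. 1 \<le> m \<Longrightarrow> m < n \<Longrightarrow> x n \<otimes> e m = x m \<otimes> e m"
    "\<And>m n. 1 \<le> m \<Longrightarrow> m < n \<Longrightarrow> star C (x n) \<otimes> e m = star C (x m) \<otimes> e m"
  shows "owmc C F c (x, e)"
  using assms by (simp add: owmc_def)

lemma owmcD:
  assumes "owmc C F c (x, e)" "1 \<le> m"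
  shows "x m \<in> carrier C" "e m \<in> Ch" "e m \<in> carrier C"
    "m < n \<Longrightarrow> x n \<otimes> e m = x m \<otimes> e m" "m < n \<Longrightarrow> star C (x n) \<otimes> e m = star C (x m) \<otimes> e m"
  using assms msdd_Ch[of e m] owmc_closed[OF assms] F_simps(1) Ch_closed by (auto simp: owmc_def)

lemma mult_right_cong:
  assumes "u \<otimes> e = w \<otimes> e" "u \<in> carrier C" "w \<in> carrier C" "e \<in> Ch" "f \<in> Ch"
  shows "u \<otimes> (e \<otimes> f) = w \<otimes> (e \<otimes> f)"
  using assms Ch_closed by (simp flip: m_assoc)

lemma owmc_add:
  assumes "owmc C F c (x, e)" "owmc C F c (y, f)"
  shows "owmc C F c (\<lambda>m. x m \<oplus> y m, \<lambda>m. e m \<otimes> f m)"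
proof (rule owmcI)
  note x = owmcD[OF assms(1)] and y = owmcD[OF assms(2)]
  show "x m \<oplus> y m \<in> F m" if "1 \<le> m" for m
    using owmc_closed[OF assms(1) that] owmc_closed[OF assms(2) that] by (rule F_simps(2))
  obtain N M where N: "\<And>m. N \<le> m \<Longrightarrow> e m = \<one>" and M: "\<And>m. M \<le> m \<Longrightarrow> f m = \<one>"
    using msdd_eventually_one[OF owmc_msdd[OF assms(1)]] msdd_eventually_one[OF owmc_msdd[OF assms(2)]] by metis
  show "msdd C c (\<lambda>m. e m \<otimes> f m)"
  proof (rule msddI[of _ "max N M"])
    fix m :: nat assume m: "1 \<le> m"
    show "e m \<otimes> f m \<in> Ch" using x(2) y(2) m by (intro Ch_mult)
    have cl: "e m \<in> carrier C" "e (Suc m) \<in> carrier C" "f m \<in> carrier C" "f (Suc m) \<in> carrier C"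
      using x(3) y(3) m by auto
    have "e m \<otimes> f m \<otimes> (e (Suc m) \<otimes> f (Suc m)) = (e m \<otimes> e (Suc m)) \<otimes> (f m \<otimes> f (Suc m))"
      using cl Ch_comm[of "f m" "e (Suc m)"] x(2)[of "Suc m"] y(2)[OF m] by (metis m_assoc m_closed le_add1 plus_1_eq_Suc)
    then show "e m \<otimes> f m \<otimes> (e (Suc m) \<otimes> f (Suc m)) = e m \<otimes> f m"
      using msdd_le[OF owmc_msdd[OF assms(1)] m, of "Suc m"] msdd_le[OF owmc_msdd[OF assms(2)] m, of "Suc m"] by simp
  qed (use N M in simp)
  fix m n :: nat assume m: "1 \<le> m" and mn: "m < n"
  have n: "1 \<le> n" using m mn by simp
  have comm: "e m \<otimes> f m = f m \<otimes> e m" using x(2)[OF m] y(2)[OF m] by (rule Ch_comm)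
  have "x n \<otimes> (e m \<otimes> f m) = x m \<otimes> (e m \<otimes> f m)" "y n \<otimes> (f m \<otimes> e m) = y m \<otimes> (f m \<otimes> e m)"
    "star C (x n) \<otimes> (e m \<otimes> f m) = star C (x m) \<otimes> (e m \<otimes> f m)"
    "star C (y n) \<otimes> (f m \<otimes> e m) = star C (y m) \<otimes> (f m \<otimes> e m)"
    by (intro mult_right_cong; use x y m n mn star_closed in auto)+
  then show "(x n \<oplus> y n) \<otimes> (e m \<otimes> f m) = (x m \<oplus> y m) \<otimes> (e m \<otimes> f m)"
    "star C (x n \<oplus> y n) \<otimes> (e m \<otimes> f m) = star C (x m \<oplus> y m) \<otimes> (e m \<otimes> f m)"
    using x(1,3)[OF m] x(1)[OF n] y(1,3)[OF m] y(1)[OF n] comm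
    by (simp_all add: l_distr star_add star_closed)
qed

text \<open>Below \<open>f m\<close> one may replace \<open>y n\<close> by \<open>y m\<close>; below
  the preimage of \<open>e m\<close> the range of \<open>y m\<close> lies in \<open>e m\<close>,
  where \<open>x n\<close> may be replaced by \<open>x m\<close>. For the adjoint of the product the
  same is done with \<open>e m\<close>, the preimage of \<open>f m\<close>, and
  \<open>f m\<close>.\<close>

lemma owmc_mult:
  assumes "owmc C F c (x, e)" "owmc C F c (y, f)"
  shows "owmc C F c (\<lambda>m. x m \<otimes> y m, \<lambda>m. f m \<otimes> proj_preimage C c (y m) (e m) \<otimes> e m
     \<otimes> proj_preimage C c (star C (x m)) (f m))"
proof -
  note x = owmcD[OF assms(1)] and y = owmcD[OF assms(2)]
  define g where "g m = proj_preimage C c (y m) (e m)" for m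
  define h where "h m = proj_preimage C c (star C (x m)) (f m)" for m
  have g: "g m \<in> Ch" "e m \<otimes> y m \<otimes> g m = y m \<otimes> g m"
    "k \<in> Ch \<Longrightarrow> e m \<otimes> y m \<otimes> k = y m \<otimes> k \<Longrightarrow> k \<otimes> g m = k" if "1 \<le> m" for m k
    unfolding g_def using proj_preimage[OF y(1)[OF that] x(2)[OF that]] by blast+
  have h: "h m \<in> Ch" "f m \<otimes> star C (x m) \<otimes> h m = star C (x m) \<otimes> h m"
    "k \<in> Ch \<Longrightarrow> f m \<otimes> star C (x m) \<otimes> k = star C (x m) \<otimes> k \<Longrightarrow> k \<otimes> h m = k" if "1 \<le> m" for m k
    unfolding h_def using proj_preimage[OF star_closed[OF x(1)[OF that]] y(2)[OF that]] by blast+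
  define k where "k m = f m \<otimes> g m \<otimes> e m \<otimes> h m" for m
  have kCh: "k m \<in> Ch" if "1 \<le> m" for m
    unfolding k_def using x(2) y(2) g(1) h(1) that by (intro Ch_mult)
  have k_le: "k m \<otimes> f m = k m" "k m \<otimes> g m = k m" "k m \<otimes> e m = k m" "k m \<otimes> h m = k m" if "1 \<le> m" for m
  proof -
    have Ch: "f m \<in> Ch" "g m \<in> Ch" "e m \<in> Ch" "h m \<in> Ch" using x(2) y(2) g(1) h(1) that by auto
    have fg: "f m \<otimes> g m \<in> Ch" "f m \<otimes> g m \<otimes> e m \<in> Ch" using Ch by (simp_all add: Ch_mult)
    show "k m \<otimes> f m = k m" unfolding k_def
      using Ch fg by (intro Ch_absorb2 Ch_idem)
    show "k m \<otimes> g m = k m" unfolding k_def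
      using Ch fg by (intro Ch_absorb2[OF _ _ _ Ch_absorb2[OF _ _ _ Ch_absorb]])
    show "k m \<otimes> e m = k m" unfolding k_def
      using Ch fg by (intro Ch_absorb2[OF _ _ _ Ch_absorb])
    show "k m \<otimes> h m = k m" unfolding k_def
      using Ch fg by (intro Ch_absorb)
  qed
  have k_le': "f m \<otimes> k m = k m" "g m \<otimes> k m = k m" "e m \<otimes> k m = k m" "h m \<otimes> k m = k m" if "1 \<le> m" for m
    using k_le[OF that] Ch_comm[OF kCh[OF that], of "f m"] Ch_comm[OF kCh[OF that], of "g m"]
      Ch_comm[OF kCh[OF that], of "e m"] Ch_comm[OF kCh[OF that], of "h m"] x(2)[OF that] y(2)[OF that]
      g(1)[OF that] h(1)[OF that] by simp_all
  have cl: "k m \<in> carrier C" "g m \<in> carrier C" "h m \<in> carrier C" if "1 \<le> m" for m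
    using kCh g(1) h(1) Ch_closed that by blast+
  note xy_cl = x(1,3) y(1,3) star_closed
  have yk: "y n \<otimes> k m = e m \<otimes> (y m \<otimes> k m)" if "1 \<le> m" "m \<le> n" for m n
  proof -
    have n: "1 \<le> n" using that by simp
    have 1: "y n \<otimes> f m = y m \<otimes> f m" using y(4)[OF that(1), of n] that by (cases "m = n") auto
    have "y n \<otimes> k m = y n \<otimes> f m \<otimes> k m"
      using k_le'(1)[OF that(1)] xy_cl cl that n by (simp add: m_assoc)
    also have "\<dots> = y m \<otimes> g m \<otimes> k m"
      unfolding 1 using k_le'(1,2)[OF that(1)] xy_cl cl that n by (simp add: m_assoc)
    also have "\<dots> = e m \<otimes> y m \<otimes> g m \<otimes> k m" by (simp only: g(2)[OF that(1)])
    finally show ?thesis using k_le'(2)[OF that(1)] xy_cl cl that n by (simp add: m_assoc)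
  qed
  have xk: "star C (x n) \<otimes> k m = f m \<otimes> (star C (x m) \<otimes> k m)" if "1 \<le> m" "m \<le> n" for m n
  proof -
    have n: "1 \<le> n" using that by simp
    have 1: "star C (x n) \<otimes> e m = star C (x m) \<otimes> e m" using x(5)[OF that(1), of n] that by (cases "m = n") auto
    have "star C (x n) \<otimes> k m = star C (x n) \<otimes> e m \<otimes> k m"
      using k_le'(3)[OF that(1)] xy_cl cl that n by (simp add: m_assoc)
    also have "\<dots> = star C (x m) \<otimes> h m \<otimes> k m"
      unfolding 1 using k_le'(3,4)[OF that(1)] xy_cl cl that n by (simp add: m_assoc)
    also have "\<dots> = f m \<otimes> star C (x m) \<otimes> h m \<otimes> k m" by (simp only: h(2)[OF that(1)])
    finally show ?thesis using k_le'(4)[OF that(1)] xy_cl cl that n by (simp add: m_assoc)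
  qed
  have "owmc C F c (\<lambda>m. x m \<otimes> y m, k)"
  proof (rule owmcI)
    show "x m \<otimes> y m \<in> F m" if "1 \<le> m" for m
      using owmc_closed[OF assms(1) that] owmc_closed[OF assms(2) that] by (rule F_simps(3))
    obtain N where N: "1 \<le> N" "\<And>m. N \<le> m \<Longrightarrow> e m = \<one>"
      using msdd_eventually_one[OF owmc_msdd[OF assms(1)]] by metis
    obtain M where M: "1 \<le> M" "\<And>m. M \<le> m \<Longrightarrow> f m = \<one>"
      using msdd_eventually_one[OF owmc_msdd[OF assms(2)]] by metis
    show "msdd C c k"
    proof (rule msddI[of _ "max N M"])
      show "k m \<in> Ch" if "1 \<le> m" for m by (rule kCh[OF that])
      show "k m = \<one>" if "max N M \<le> m" for m
      proof -
        have m: "e m = \<one>" "f m = \<one>" "1 \<le> m" using N M that by auto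
        \<comment> \<open>Where \<open>e m\<close> and \<open>f m\<close> are 1, the unit is a
          candidate for both preimages, and maximality makes them 1.\<close>
        have "\<one> \<otimes> g m = \<one>" "\<one> \<otimes> h m = \<one>"
          using g(3)[OF m(3), of \<one>] h(3)[OF m(3), of \<one>] m xy_cl Ch_mem by auto
        then show ?thesis unfolding k_def using m by simp
      qed
      fix m :: nat assume m: "1 \<le> m"
      let ?n = "Suc m"
      have n: "1 \<le> ?n" by simp
      have e: "e m \<otimes> e ?n = e m" "f m \<otimes> f ?n = f m"
        using msdd_le[OF owmc_msdd[OF assms(1)] m, of ?n] msdd_le[OF owmc_msdd[OF assms(2)] m, of ?n] by auto
      have e': "e ?n \<otimes> e m = e m" "f ?n \<otimes> f m = f m"
        using e Ch_comm[OF x(2)[OF m] x(2)[OF n]] Ch_comm[OF y(2)[OF m] y(2)[OF n]] by simp_all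
      have kf: "k m \<otimes> f ?n = k m"
        using m_assoc[OF cl(1)[OF m] y(3)[OF m] y(3)[OF n]] k_le(1)[OF m] e(2) by simp
      have ke: "k m \<otimes> e ?n = k m"
        using m_assoc[OF cl(1)[OF m] x(3)[OF m] x(3)[OF n]] k_le(3)[OF m] e(1) by simp
      \<comment> \<open>The projection \<open>k m\<close> is a candidate for the preimage at the
        next index: \<open>y ?n\<close> maps it into \<open>e m\<close>, which is below
        \<open>e ?n\<close>. Maximality then puts \<open>k m\<close> below \<open>g ?n\<close>. The
        same argument for the adjoint gives \<open>h ?n\<close>.\<close>
      have "e ?n \<otimes> y ?n \<otimes> k m = y ?n \<otimes> k m"
        using e'(1) cl xy_cl m n yk[OF m, of ?n] by (simp add: m_assoc) (simp flip: m_assoc)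
      then have kg: "k m \<otimes> g ?n = k m" by (rule g(3)[OF n kCh[OF m]])
      have "f ?n \<otimes> star C (x ?n) \<otimes> k m = star C (x ?n) \<otimes> k m"
        using e'(2) cl xy_cl m n xk[OF m, of ?n] by (simp add: m_assoc) (simp flip: m_assoc)
      then have kh: "k m \<otimes> h ?n = k m" by (rule h(3)[OF n kCh[OF m]])
      show "k m \<otimes> k ?n = k m"
        unfolding k_def[of ?n] using kf ke kg kh cl xy_cl m n by (simp flip: m_assoc)
    qed
    fix m n :: nat assume m: "1 \<le> m" and mn: "m < n"
    have n: "1 \<le> n" using m mn by simp
    have "x n \<otimes> y n \<otimes> k m = x n \<otimes> (y n \<otimes> k m)" using xy_cl cl m n by (simp add: m_assoc)
    also have "\<dots> = (x n \<otimes> e m) \<otimes> (y m \<otimes> k m)"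
      unfolding yk[OF m less_imp_le[OF mn]] using xy_cl cl m n by (simp add: m_assoc)
    also have "\<dots> = x m \<otimes> (e m \<otimes> (y m \<otimes> k m))"
      unfolding x(4)[OF m mn] using xy_cl cl m n by (simp add: m_assoc)
    also have "\<dots> = x m \<otimes> y m \<otimes> k m"
      unfolding yk[OF m order_refl, symmetric] using xy_cl cl m n by (simp add: m_assoc)
    finally show "x n \<otimes> y n \<otimes> k m = x m \<otimes> y m \<otimes> k m" .
    have "star C (x n \<otimes> y n) \<otimes> k m = star C (y n) \<otimes> (star C (x n) \<otimes> k m)"
      using xy_cl cl m n by (simp add: star_mult m_assoc)
    also have "\<dots> = (star C (y n) \<otimes> f m) \<otimes> (star C (x m) \<otimes> k m)"
      unfolding xk[OF m less_imp_le[OF mn]] using xy_cl cl m n by (simp add: m_assoc)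
    also have "\<dots> = star C (y m) \<otimes> (f m \<otimes> (star C (x m) \<otimes> k m))"
      unfolding y(5)[OF m mn] using xy_cl cl m n by (simp add: m_assoc)
    also have "\<dots> = star C (x m \<otimes> y m) \<otimes> k m"
      unfolding xk[OF m order_refl, symmetric] using xy_cl cl m n by (simp add: star_mult m_assoc)
    finally show "star C (x n \<otimes> y n) \<otimes> k m = star C (x m \<otimes> y m) \<otimes> k m" .
  qed
  then show ?thesis by (simp add: k_def[abs_def] g_def h_def)
qed

section \<open>The closure as an image of the underlying algebra\<close>

lemma clsD: "(x, e) \<in> cls v \<Longrightarrow> owmc C F c (x, e)" "(x, e) \<in> cls v \<Longrightarrow> \<forall>\<^sub>F m in sequentially. x m = v"
  by (auto simp: cls_def)

lemma cls_add:
  assumes "v \<in> carrier C" "w \<in> carrier C"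
  shows "cls v \<oplus>\<^bsub>MC\<^esub> cls w = cls (v \<oplus> w)"
  unfolding monotone_closure_def ring_record_simps partial_object.simps
proof (simp, intro UN_const_pair cls_nonempty assms)
  fix x e y f assume 1: "(x, e) \<in> cls v" and 2: "(y, f) \<in> cls w"
  show "mco_class C F c (\<lambda>m. x m \<oplus> y m) (\<lambda>m. e m \<otimes> f m) = cls (v \<oplus> w)"
    by (rule mco_class_eq[OF owmc_add[OF clsD(1)[OF 1] clsD(1)[OF 2]]])
      (use clsD(2)[OF 1] clsD(2)[OF 2] in eventually_elim, simp)
qed

lemma cls_mult:
  assumes "v \<in> carrier C" "w \<in> carrier C"
  shows "cls v \<otimes>\<^bsub>MC\<^esub> cls w = cls (v \<otimes> w)"
  unfolding monotone_closure_def
proof (simp, intro UN_const_pair cls_nonempty assms)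
  fix x e y f assume 1: "(x, e) \<in> cls v" and 2: "(y, f) \<in> cls w"
  show "mco_class C F c (\<lambda>m. x m \<otimes> y m) (\<lambda>m. f m \<otimes> proj_preimage C c (y m) (e m) \<otimes> e m
     \<otimes> proj_preimage C c (star C (x m)) (f m)) = cls (v \<otimes> w)"
    by (rule mco_class_eq[OF owmc_mult[OF clsD(1)[OF 1] clsD(1)[OF 2]]])
      (use clsD(2)[OF 1] clsD(2)[OF 2] in eventually_elim, simp)
qed

lemma cls_smult:
  assumes "v \<in> carrier C"
  shows "a \<odot>\<^bsub>MC\<^esub> cls v = cls (a \<odot> v)"
  unfolding monotone_closure_def
proof (simp, intro UN_const_pair cls_nonempty assms)
  fix x e assume 1: "(x, e) \<in> cls v"
  note x = owmcD[OF clsD(1)[OF 1]]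
  have "owmc C F c (\<lambda>m. a \<odot> x m, e)"
    by (rule owmcI)
      (use F_simps(4) owmc_closed[OF clsD(1)[OF 1]] owmc_msdd[OF clsD(1)[OF 1]] x star_closed
        in \<open>auto simp: smult_mult_left star_smult\<close>)
  then show "mco_class C F c (\<lambda>m. a \<odot> x m) e = cls (a \<odot> v)"
    by (rule mco_class_eq) (use clsD(2)[OF 1] in eventually_elim, simp)
qed

lemma cls_star:
  assumes "v \<in> carrier C"
  shows "star MC (cls v) = cls (star C v)"
  unfolding monotone_closure_def
proof (simp, intro UN_const_pair cls_nonempty assms)
  fix x e assume 1: "(x, e) \<in> cls v"
  note x = owmcD[OF clsD(1)[OF 1]]
  have "owmc C F c (\<lambda>m. star C (x m), e)"
    by (rule owmcI)
      (use F_simps(5) owmc_closed[OF clsD(1)[OF 1]] owmc_msdd[OF clsD(1)[OF 1]] x star_closed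
        in \<open>auto simp: star_star\<close>)
  then show "mco_class C F c (\<lambda>m. star C (x m)) e = cls (star C v)"
    by (rule mco_class_eq) (use clsD(2)[OF 1] in eventually_elim, simp)
qed

lemma star_hom_cls: "star_hom C MC cls"
proof (rule star_homI)
  show "cls \<one> = \<one>\<^bsub>MC\<^esub>" by (simp add: monotone_closure_def mco_embed_eq)
qed (simp_all add: MC_carrier cls_add cls_mult cls_smult cls_star)

text \<open>Along every representative the values are eventually constant, so that the limit exists
  for an arbitrary functional.\<close>

lemma has_limit_functional_cls: "has_limit_functional \<phi> (cls v) (\<phi> v)"
proof -
  have "(\<lambda>m. \<phi> (x m)) \<longlonglongrightarrow> \<phi> v" if "(x, e) \<in> cls v" for x e
    by (rule tendsto_eventually) (use clsD(2)[OF that] in eventually_elim, simp)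
  then show ?thesis by (auto simp: has_limit_functional_def)
qed

lemma limit_functional_cls:
  assumes "v \<in> carrier C"
  shows "limit_functional \<phi> (cls v) = \<phi> v"
  unfolding limit_functional_def
proof (rule the_equality)
  show "has_limit_functional \<phi> (cls v) (\<phi> v)" by (rule has_limit_functional_cls)
  fix z assume z: "has_limit_functional \<phi> (cls v) z"
  obtain x e where "(x, e) \<in> cls v" using cls_nonempty[OF assms] by auto
  then show "z = \<phi> v"
    using z has_limit_functional_cls[of \<phi> v] LIMSEQ_unique unfolding has_limit_functional_def by blast
qed

lemma has_limit_functional_ex: "W \<in> carrier MC \<Longrightarrow> \<exists>z. has_limit_functional \<phi> W z"
  using has_limit_functional_cls by (auto simp: MC_carrier)

lemma state_limit_functional:
  assumes "state C \<phi>"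
  shows "state MC (limit_functional \<phi>)"
proof -
  have one: "\<one>\<^bsub>MC\<^esub> = cls \<one>" by (simp add: star_hom_one[OF star_hom_cls])
  show ?thesis
    using assms unfolding state_def MC_carrier
    by (auto simp: cls_add cls_mult cls_smult cls_star limit_functional_cls smult_closed star_closed one)
qed

end

section \<open>Operators on a space with a positive kernel\<close>

text \<open>A state that vanishes on the ideal is constant on cosets by linearity, so that any
  chosen representative computes the state of the quotient.\<close>

lemma state_quotient:
  assumes "star_algebra A" "star_ideal A I" "state A \<phi>" "\<And>x. x \<in> I \<Longrightarrow> \<phi> x = 0"
  obtains \<phi>' where "state (star_quotient A I) \<phi>'" "\<And>x. x \<in> carrier A \<Longrightarrow> \<phi>' (I +>\<^bsub>A\<^esub> x) = \<phi> x"
proof -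
  interpret A: star_algebra A by fact
  note q = star_hom_quotient[OF assms(1,2)] carrier_quotient[OF assms(1,2)]
    coset_eq_iff[OF assms(1,2)] self_mem_coset[OF assms(1,2)] mem_coset[OF assms(1,2)]
  define \<phi>' where "\<phi>' X = \<phi> (SOME x. x \<in> X)" for X
  have \<phi>': "\<phi>' (I +>\<^bsub>A\<^esub> x) = \<phi> x" if x: "x \<in> carrier A" for x
  proof -
    define y where "y = (SOME y. y \<in> I +>\<^bsub>A\<^esub> x)"
    have "y \<in> I +>\<^bsub>A\<^esub> x" unfolding y_def using q(4)[OF x] by (rule someI)
    then have y: "y \<in> carrier A" "y \<ominus>\<^bsub>A\<^esub> x \<in> I" using q(5)[OF x] q(3)[OF _ x] by blast+
    then have "\<phi> y = \<phi> x" using assms(4)[OF y(2)] x by (simp add: A.state_diff[OF assms(3)])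
    then show ?thesis by (simp add: \<phi>'_def y_def)
  qed
  have "state (star_quotient A I) \<phi>'"
    unfolding state_def q(2)
    using assms(3)
    by (auto simp: \<phi>' A.smult_closed A.star_closed state_def simp flip: star_homD(2-)[OF q(1)])
  with \<phi>' show thesis using that by blast
qed

lemma psd_on_rank_one: "psd_on S (\<lambda>x y. cnj (g x) * g y)"
proof (rule psd_onI)
  fix c :: "_ \<Rightarrow> complex"
  let ?w = "\<Sum>x\<in>S. c x * g x"
  have "(\<Sum>x\<in>S. \<Sum>y\<in>S. cnj (c x) * c y * (cnj (g x) * g y)) = cnj ?w * ?w"
    unfolding cnj_sum sum_product by (intro sum.cong refl) (simp add: mult_ac)
  also have "\<dots> = of_real ((cmod ?w)\<^sup>2)"
    using complex_norm_square[of ?w] by (simp add: mult.commute)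
  finally show "(\<Sum>x\<in>S. \<Sum>y\<in>S. cnj (c x) * c y * (cnj (g x) * g y)) \<in> \<real>\<^sub>\<ge>\<^sub>0" by simp
qed simp

lemma psd_on_add:
  assumes "psd_on S K" "psd_on S L"
  shows "psd_on S (\<lambda>x y. K x y + L x y)"
proof (rule psd_onI)
  show "K y x + L y x = cnj (K x y + L x y)" if "x \<in> S" "y \<in> S" for x y
    using psd_on_herm[OF assms(1) that] psd_on_herm[OF assms(2) that] by simp
  show "(\<Sum>x\<in>S. \<Sum>y\<in>S. cnj (c x) * c y * (K x y + L x y)) \<in> \<real>\<^sub>\<ge>\<^sub>0" for c
    using nonneg_Reals_add_I[OF psd_on_pos[OF assms(1), of c] psd_on_pos[OF assms(2), of c]]
    by (simp add: distrib_left sum.distrib)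
qed

text \<open>A possibly degenerate positive kernel on formal basis vectors takes the place of a
  Hilbert space. Only finite combinations occur, hence positivity on finite sets.\<close>

locale kernel_space =
  fixes W :: "'w set" and K :: "'w \<Rightarrow> 'w \<Rightarrow> complex"
  assumes psd: "finite S \<Longrightarrow> S \<subseteq> W \<Longrightarrow> psd_on S K"
begin

abbreviation "V \<equiv> {v :: 'w \<Rightarrow>\<^sub>0 complex. Poly_Mapping.keys v \<subseteq> W}"

definition form :: "('w \<Rightarrow>\<^sub>0 complex) \<Rightarrow> ('w \<Rightarrow>\<^sub>0 complex) \<Rightarrow> complex" where
  "form u v = lin_ext (\<lambda>x a. lin_ext (\<lambda>y b. cnj a * b * K x y) v) u"

abbreviation basis :: "'w \<Rightarrow> 'w \<Rightarrow>\<^sub>0 complex" where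
  "basis x \<equiv> Poly_Mapping.single x 1"

lemma form_add_left: "form (u + u') v = form u v + form u' v"
  unfolding form_def by (rule lin_ext_add) (simp_all add: lin_ext_def distrib_right sum.distrib)

lemma form_add_right: "form v (u + u') = form v u + form v u'"
  unfolding form_def lin_ext_def[of _ v] sum.distrib[symmetric]
  by (rule sum.cong[OF refl], rule lin_ext_add) (simp_all add: distrib_left distrib_right)

lemma form_single: "form (Poly_Mapping.single x a) (Poly_Mapping.single y b) = cnj a * b * K x y"
  unfolding form_def by (subst lin_ext_single) (simp_all add: lin_ext_single lin_ext_def)

lemma form_0: "form 0 v = 0" "form u 0 = 0"
  using form_add_left[of 0 0 v] form_add_right[of u 0 0] by simp_all

lemma form_diff_left: "form (u - u') v = form u v - form u' v"
  using form_add_left[of "u - u'" u' v] by simp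

lemma form_diff_right: "form v (u - u') = form v u - form v u'"
  using form_add_right[of v "u - u'" u'] by simp

lemma form_scale_right: "form v (scale_pm c u) = c * form v u"
proof -
  have "Poly_Mapping.keys v \<subseteq> UNIV" "Poly_Mapping.keys u \<subseteq> UNIV" by auto
  then show ?thesis
  proof (induction rule: poly_mapping_span_induct)
    case (single x a)
    from single(2) show ?case
      by (induction rule: poly_mapping_span_induct)
        (simp_all add: form_0 form_single form_add_right scale_pm_add distrib_left)
  qed (simp_all add: form_0 form_add_left distrib_left)
qed

lemma form_scale_left: "form (scale_pm c u) v = cnj c * form u v"
proof -
  have "Poly_Mapping.keys v \<subseteq> UNIV" "Poly_Mapping.keys u \<subseteq> UNIV" by auto
  then show ?thesis
  proof (induction rule: poly_mapping_span_induct)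
    case (single x a)
    from single(2) show ?case
      by (induction rule: poly_mapping_span_induct)
        (simp_all add: form_0 form_single form_add_left scale_pm_add distrib_left)
  qed (simp_all add: form_0 form_add_right distrib_left)
qed

lemmas form_linear = form_add_left form_add_right form_0 form_diff_left form_diff_right
  form_scale_left form_scale_right form_single

lemma form_herm:
  assumes "u \<in> V" "v \<in> V"
  shows "form v u = cnj (form u v)"
proof -
  have "Poly_Mapping.keys u \<subseteq> W" "Poly_Mapping.keys v \<subseteq> W" using assms by auto
  then show ?thesis
  proof (induction rule: poly_mapping_span_induct)
    case (single x a)
    from single(2) show ?case
    proof (induction rule: poly_mapping_span_induct)
      case (single y b)
      have "K y x = cnj (K x y)"
        by (rule psd_on_herm[OF psd[of "{x, y}"]]) (use single \<open>x \<in> W\<close> in auto)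
      then show ?case unfolding form_single by (simp add: mult_ac)
    qed (simp_all add: form_linear)
  qed (simp_all add: form_linear)
qed

lemma form_positive:
  assumes "v \<in> V"
  shows "form v v \<in> \<real>\<^sub>\<ge>\<^sub>0"
proof -
  have "form v v = (\<Sum>x\<in>Poly_Mapping.keys v. \<Sum>y\<in>Poly_Mapping.keys v.
      cnj (Poly_Mapping.lookup v x) * Poly_Mapping.lookup v y * K x y)"
    by (simp add: form_def lin_ext_def)
  then show ?thesis using psd_on_pos[OF psd, of "Poly_Mapping.keys v"] assms by simp
qed

text \<open>Linearity is imposed on all formal vectors while invariance concerns \<open>V\<close>.
  The ring laws of the operators then hold as equalities of functions.\<close>

definition linear_on_V :: "(('w \<Rightarrow>\<^sub>0 complex) \<Rightarrow> ('w \<Rightarrow>\<^sub>0 complex)) \<Rightarrow> bool" where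
  "linear_on_V T \<longleftrightarrow> (\<forall>u v. T (u + v) = T u + T v) \<and> (\<forall>c u. T (scale_pm c u) = scale_pm c (T u)) \<and> T ` V \<subseteq> V"

text \<open>Adjointable operators, each paired with a chosen adjoint.\<close>

definition ops :: "((('w \<Rightarrow>\<^sub>0 complex) \<Rightarrow> ('w \<Rightarrow>\<^sub>0 complex)) \<times> (('w \<Rightarrow>\<^sub>0 complex) \<Rightarrow> ('w \<Rightarrow>\<^sub>0 complex))) star_algebra" where
  "ops = \<lparr>carrier = {(T, S). linear_on_V T \<and> linear_on_V S \<and> (\<forall>u\<in>V. \<forall>v\<in>V. form (T u) v = form u (S v))},
    mult = (\<lambda>(T, S) (T', S'). (T \<circ> T', S' \<circ> S)),
    one = (\<lambda>u. u, \<lambda>u. u),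
    zero = (\<lambda>u. 0, \<lambda>u. 0),
    add = (\<lambda>(T, S) (T', S'). (\<lambda>u. T u + T' u, \<lambda>u. S u + S' u)),
    smult = (\<lambda>c (T, S). (\<lambda>u. scale_pm c (T u), \<lambda>u. scale_pm (cnj c) (S u))),
    star = (\<lambda>(T, S). (S, T))\<rparr>"

lemma ops_simps [simp]:
  "(T, S) \<in> carrier ops \<longleftrightarrow> linear_on_V T \<and> linear_on_V S \<and> (\<forall>u\<in>V. \<forall>v\<in>V. form (T u) v = form u (S v))"
  "(T, S) \<otimes>\<^bsub>ops\<^esub> (T', S') = (T \<circ> T', S' \<circ> S)"
  "\<one>\<^bsub>ops\<^esub> = (\<lambda>u. u, \<lambda>u. u)" "\<zero>\<^bsub>ops\<^esub> = (\<lambda>u. 0, \<lambda>u. 0)"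
  "(T, S) \<oplus>\<^bsub>ops\<^esub> (T', S') = (\<lambda>u. T u + T' u, \<lambda>u. S u + S' u)"
  "c \<odot>\<^bsub>ops\<^esub> (T, S) = (\<lambda>u. scale_pm c (T u), \<lambda>u. scale_pm (cnj c) (S u))"
  "star ops (T, S) = (S, T)"
  by (simp_all add: ops_def)

lemma linear_on_VI:
  assumes "\<And>u v. T (u + v) = T u + T v" "\<And>c u. T (scale_pm c u) = scale_pm c (T u)"
    "\<And>u. Poly_Mapping.keys u \<subseteq> W \<Longrightarrow> Poly_Mapping.keys (T u) \<subseteq> W"
  shows "linear_on_V T"
  unfolding linear_on_V_def using assms by blast

lemma linear_on_VD:
  assumes "linear_on_V T"
  shows linear_on_V_add: "T (u + v) = T u + T v"
    and linear_on_V_scale: "T (scale_pm c u) = scale_pm c (T u)"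
    and linear_on_V_closed: "Poly_Mapping.keys u \<subseteq> W \<Longrightarrow> Poly_Mapping.keys (T u) \<subseteq> W"
    and linear_on_V_zero: "T 0 = 0"
proof -
  show add: "T (u + v) = T u + T v" for u v using assms unfolding linear_on_V_def by blast
  show "T (scale_pm c u) = scale_pm c (T u)" using assms unfolding linear_on_V_def by blast
  show "Poly_Mapping.keys u \<subseteq> W \<Longrightarrow> Poly_Mapping.keys (T u) \<subseteq> W"
    using assms unfolding linear_on_V_def by blast
  show "T 0 = 0" using add[of 0 0] by simp
qed

lemma linear_on_V_intros:
  "linear_on_V (\<lambda>u. u)" "linear_on_V (\<lambda>u. 0)"
  "linear_on_V T \<Longrightarrow> linear_on_V T' \<Longrightarrow> linear_on_V (T \<circ> T')"
  "linear_on_V T \<Longrightarrow> linear_on_V T' \<Longrightarrow> linear_on_V (\<lambda>u. T u + T' u)"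
  "linear_on_V T \<Longrightarrow> linear_on_V (\<lambda>u. scale_pm c (T u))"
  by (intro linear_on_VI;
      simp add: linear_on_VD scale_pm_add scale_pm_scale_pm mult.commute keys_add_subset
        subset_trans[OF keys_scale_pm] add_ac)+

text \<open>Hermitian symmetry of the form turns the adjoint relation of \<open>(T, S)\<close> into
  that of \<open>(S, T)\<close>.\<close>

lemma ops_cases:
  assumes "t \<in> carrier ops"
  obtains T S where "t = (T, S)" "linear_on_V T" "linear_on_V S"
    "\<And>u v. u \<in> V \<Longrightarrow> v \<in> V \<Longrightarrow> form (T u) v = form u (S v)"
    "\<And>u v. u \<in> V \<Longrightarrow> v \<in> V \<Longrightarrow> form (S u) v = form u (T v)"
proof -
  obtain T S where t: "t = (T, S)" by (cases t)
  then have TS: "linear_on_V T" "linear_on_V S" and adj: "form (T u) v = form u (S v)"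
    if "u \<in> V" "v \<in> V" for u v using assms that by (simp_all add: ops_def)
  have "form (S u) v = form u (T v)" if uv: "u \<in> V" "v \<in> V" for u v
  proof -
    have m: "S u \<in> V" "T v \<in> V"
      using uv linear_on_V_closed TS[OF uv] by simp_all
    have "form (S u) v = cnj (form v (S u))" by (rule form_herm[OF uv(2) m(1)])
    also have "form v (S u) = form (T v) u" by (rule adj[OF uv(2,1), symmetric])
    also have "cnj \<dots> = form u (T v)" by (rule form_herm[OF m(2) uv(1), symmetric])
    finally show ?thesis .
  qed
  then show thesis using that[OF t TS[of 0 0] adj] by simp
qed

lemma opsI:
  "linear_on_V T \<Longrightarrow> linear_on_V S \<Longrightarrow> (\<And>u v. u \<in> V \<Longrightarrow> v \<in> V \<Longrightarrow> form (T u) v = form u (S v)) \<Longrightarrow>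
    (T, S) \<in> carrier ops"
  by (simp add: ops_def)

text \<open>With the adjoint stored in the element, the involution is a swap, and its laws hold
  although a degenerate form does not determine adjoints.\<close>

lemma star_algebra_ops: "star_algebra ops"
proof -
  note ops_simps(1) [simp del]
  have closed: "s \<oplus>\<^bsub>ops\<^esub> t \<in> carrier ops" "s \<otimes>\<^bsub>ops\<^esub> t \<in> carrier ops" "c \<odot>\<^bsub>ops\<^esub> s \<in> carrier ops"
    "star ops s \<in> carrier ops" if s: "s \<in> carrier ops" and t: "t \<in> carrier ops" for s t c
  proof -
    obtain T S where s: "s = (T, S)" "linear_on_V T" "linear_on_V S"
      "\<And>u v. u \<in> V \<Longrightarrow> v \<in> V \<Longrightarrow> form (T u) v = form u (S v)"
      "\<And>u v. u \<in> V \<Longrightarrow> v \<in> V \<Longrightarrow> form (S u) v = form u (T v)" using ops_cases[OF s] by metis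
    obtain T' S' where t: "t = (T', S')" "linear_on_V T'" "linear_on_V S'"
      "\<And>u v. u \<in> V \<Longrightarrow> v \<in> V \<Longrightarrow> form (T' u) v = form u (S' v)" using ops_cases[OF t] by metis
    show "s \<oplus>\<^bsub>ops\<^esub> t \<in> carrier ops" unfolding s(1) t(1) ops_simps(2-)
      by (intro opsI linear_on_V_intros s t) (simp only: form_linear s(4) t(4))
    show "s \<otimes>\<^bsub>ops\<^esub> t \<in> carrier ops" unfolding s(1) t(1) ops_simps(2-)
      by (intro opsI linear_on_V_intros s t)
        (simp add: s(4) t(4) linear_on_V_closed[OF t(2)] linear_on_V_closed[OF s(3)])
    show "c \<odot>\<^bsub>ops\<^esub> s \<in> carrier ops" unfolding s(1) ops_simps(2-)
      by (intro opsI linear_on_V_intros s) (simp only: form_linear s(4))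
    show "star ops s \<in> carrier ops" unfolding s(1) ops_simps(2-) by (intro opsI s)
  qed
  have zero: "\<zero>\<^bsub>ops\<^esub> \<in> carrier ops" and one: "\<one>\<^bsub>ops\<^esub> \<in> carrier ops"
    unfolding ops_simps(2-) by (intro opsI linear_on_V_intros; simp add: form_0)+
  have abel: "abelian_group ops"
  proof (rule abelian_groupI)
    fix s t assume st: "s \<in> carrier ops" "t \<in> carrier ops"
    show "s \<oplus>\<^bsub>ops\<^esub> t \<in> carrier ops" by (rule closed[OF st])
    show "s \<oplus>\<^bsub>ops\<^esub> t = t \<oplus>\<^bsub>ops\<^esub> s" by (cases s; cases t) (simp add: add.commute)
    show "s \<oplus>\<^bsub>ops\<^esub> t \<oplus>\<^bsub>ops\<^esub> r = s \<oplus>\<^bsub>ops\<^esub> (t \<oplus>\<^bsub>ops\<^esub> r)" for r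
      by (cases r; cases s; cases t) (simp add: add.assoc)
  next
    fix t assume t: "t \<in> carrier ops"
    show "\<zero>\<^bsub>ops\<^esub> \<oplus>\<^bsub>ops\<^esub> t = t" by (cases t) simp
    have m: "scale_pm (-1) u + u = 0" for u :: "'w \<Rightarrow>\<^sub>0 complex"
      by (rule poly_mapping_eqI) (simp add: lookup_add)
    have "(-1) \<odot>\<^bsub>ops\<^esub> t \<oplus>\<^bsub>ops\<^esub> t = \<zero>\<^bsub>ops\<^esub>" by (cases t) (simp add: m)
    then show "\<exists>s\<in>carrier ops. s \<oplus>\<^bsub>ops\<^esub> t = \<zero>\<^bsub>ops\<^esub>" using closed(3)[OF t t] by blast
  qed (rule zero)
  have mon: "monoid ops"
  proof (rule monoidI)
    fix s t assume st: "s \<in> carrier ops" "t \<in> carrier ops"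
    show "s \<otimes>\<^bsub>ops\<^esub> t \<in> carrier ops" by (rule closed[OF st])
    show "s \<otimes>\<^bsub>ops\<^esub> t \<otimes>\<^bsub>ops\<^esub> r = s \<otimes>\<^bsub>ops\<^esub> (t \<otimes>\<^bsub>ops\<^esub> r)" for r
      by (cases r; cases s; cases t) (simp add: comp_assoc)
    show "\<one>\<^bsub>ops\<^esub> \<otimes>\<^bsub>ops\<^esub> s = s" "s \<otimes>\<^bsub>ops\<^esub> \<one>\<^bsub>ops\<^esub> = s" by (cases s; simp add: comp_def)+
  qed (rule one)
  have "ring ops"
  proof (rule ringI[OF abel mon])
    fix r s t assume rst: "r \<in> carrier ops" "s \<in> carrier ops" "t \<in> carrier ops"
    obtain R R' where r: "r = (R, R')" "linear_on_V R" "linear_on_V R'" using ops_cases[OF rst(1)] by metis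
    obtain S S' where s: "s = (S, S')" "linear_on_V S" "linear_on_V S'" using ops_cases[OF rst(2)] by metis
    obtain T T' where t: "t = (T, T')" "linear_on_V T" "linear_on_V T'" using ops_cases[OF rst(3)] by metis
    show "(r \<oplus>\<^bsub>ops\<^esub> s) \<otimes>\<^bsub>ops\<^esub> t = r \<otimes>\<^bsub>ops\<^esub> t \<oplus>\<^bsub>ops\<^esub> s \<otimes>\<^bsub>ops\<^esub> t"
      "t \<otimes>\<^bsub>ops\<^esub> (r \<oplus>\<^bsub>ops\<^esub> s) = t \<otimes>\<^bsub>ops\<^esub> r \<oplus>\<^bsub>ops\<^esub> t \<otimes>\<^bsub>ops\<^esub> s"
      unfolding r(1) s(1) t(1) by (simp_all add: fun_eq_iff linear_on_V_add r s t)
  qed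
  moreover have "star_algebra_axioms ops"
  proof (unfold star_algebra_axioms_def, intro conjI allI impI)
    fix s t c d assume s: "s \<in> carrier ops"
    then obtain S S' where S: "s = (S, S')" "linear_on_V S" "linear_on_V S'" using ops_cases by metis
    show "c \<odot>\<^bsub>ops\<^esub> s \<in> carrier ops" "star ops s \<in> carrier ops" using closed[OF s s] by blast+
    show "(c + d) \<odot>\<^bsub>ops\<^esub> s = c \<odot>\<^bsub>ops\<^esub> s \<oplus>\<^bsub>ops\<^esub> d \<odot>\<^bsub>ops\<^esub> s" "c \<odot>\<^bsub>ops\<^esub> (d \<odot>\<^bsub>ops\<^esub> s) = (c * d) \<odot>\<^bsub>ops\<^esub> s"
      "1 \<odot>\<^bsub>ops\<^esub> s = s" "star ops (star ops s) = s" "star ops (c \<odot>\<^bsub>ops\<^esub> s) = cnj c \<odot>\<^bsub>ops\<^esub> star ops s"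
      unfolding S by (simp_all add: scale_pm_add_left scale_pm_scale_pm)
    assume "t \<in> carrier ops"
    then obtain T T' where T: "t = (T, T')" "linear_on_V T" "linear_on_V T'" using ops_cases by metis
    show "c \<odot>\<^bsub>ops\<^esub> (s \<oplus>\<^bsub>ops\<^esub> t) = c \<odot>\<^bsub>ops\<^esub> s \<oplus>\<^bsub>ops\<^esub> c \<odot>\<^bsub>ops\<^esub> t"
      "(c \<odot>\<^bsub>ops\<^esub> s) \<otimes>\<^bsub>ops\<^esub> t = c \<odot>\<^bsub>ops\<^esub> (s \<otimes>\<^bsub>ops\<^esub> t)" "s \<otimes>\<^bsub>ops\<^esub> (c \<odot>\<^bsub>ops\<^esub> t) = c \<odot>\<^bsub>ops\<^esub> (s \<otimes>\<^bsub>ops\<^esub> t)"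
      "star ops (s \<oplus>\<^bsub>ops\<^esub> t) = star ops s \<oplus>\<^bsub>ops\<^esub> star ops t" "star ops (s \<otimes>\<^bsub>ops\<^esub> t) = star ops t \<otimes>\<^bsub>ops\<^esub> star ops s"
      unfolding S(1) T(1) by (simp_all add: fun_eq_iff scale_pm_add linear_on_V_scale S T)
  qed
  ultimately show ?thesis by (simp add: star_algebra_def)
qed

text \<open>These operators map \<open>V\<close> into the radical of the form. Factoring them out
  amounts to working on the quotient of \<open>V\<close> by the radical, without constructing that
  space.\<close>

definition null_ops where
  "null_ops = {(T, S) \<in> carrier ops. \<forall>u\<in>V. \<forall>v\<in>V. form u (T v) = 0}"

text \<open>Only the first component is tested, but \<open>form u (S v)\<close> is conjugate to
  \<open>form v (T u)\<close>, so that the adjoint is null as well. Absorption from the left follows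
  by moving the factor to the other side of the form.\<close>

lemma star_ideal_null_ops: "star_ideal ops null_ops"
proof (rule star_idealI[OF star_algebra_ops])
  interpret ops: star_algebra ops by (rule star_algebra_ops)
  show "null_ops \<subseteq> carrier ops" by (auto simp: null_ops_def)
  have nullI: "s \<in> null_ops" if "s \<in> carrier ops" "\<And>u v. u \<in> V \<Longrightarrow> v \<in> V \<Longrightarrow> form u (fst s v) = 0" for s
    using that by (cases s) (simp add: null_ops_def del: ops_simps(1))
  have nullD: "s \<in> carrier ops" "\<And>u v. u \<in> V \<Longrightarrow> v \<in> V \<Longrightarrow> form u (fst s v) = 0" if "s \<in> null_ops" for s
    using that by (auto simp: null_ops_def simp del: ops_simps(1))
  show "\<zero>\<^bsub>ops\<^esub> \<in> null_ops" by (rule nullI[OF ops.zero_closed]) (simp add: form_0)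
  show "s \<oplus>\<^bsub>ops\<^esub> t \<in> null_ops" if s: "s \<in> null_ops" and t: "t \<in> null_ops" for s t
  proof (rule nullI)
    fix u v assume "u \<in> V" "v \<in> V"
    then show "form u (fst (s \<oplus>\<^bsub>ops\<^esub> t) v) = 0"
      using nullD(2)[OF s] nullD(2)[OF t] by (cases s; cases t) (simp add: form_linear)
  qed (use nullD s t in blast)
  show "s \<otimes>\<^bsub>ops\<^esub> t \<in> null_ops" if s: "s \<in> carrier ops" and t: "t \<in> null_ops" for s t
  proof (rule nullI)
    obtain S S' where S: "s = (S, S')" "linear_on_V S'"
      "\<And>u v. u \<in> V \<Longrightarrow> v \<in> V \<Longrightarrow> form (S' u) v = form u (S v)" using ops_cases[OF s] by metis
    obtain T T' where T: "t = (T, T')" "linear_on_V T" using ops_cases[OF nullD(1)[OF t]] by metis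
    fix u v assume uv: "u \<in> V" "v \<in> V"
    then have m: "S' u \<in> V" "T v \<in> V" using linear_on_V_closed[OF S(2)] linear_on_V_closed[OF T(2)] by simp_all
    have "form u (S (T v)) = form (S' u) (T v)" by (rule S(3)[OF uv(1) m(2), symmetric])
    also have "\<dots> = 0" using nullD(2)[OF t m(1) uv(2)] T by simp
    finally show "form u (fst (s \<otimes>\<^bsub>ops\<^esub> t) v) = 0" by (simp add: S T)
  qed (use ops.m_closed[OF s nullD(1)[OF t]] in simp)
  show "t \<otimes>\<^bsub>ops\<^esub> s \<in> null_ops" if s: "s \<in> carrier ops" and t: "t \<in> null_ops" for s t
  proof (rule nullI)
    obtain S S' where S: "s = (S, S')" "linear_on_V S" using ops_cases[OF s] by metis
    obtain T T' where T: "t = (T, T')" by (cases t)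
    fix u v assume uv: "u \<in> V" "v \<in> V"
    then have "S v \<in> V" using linear_on_V_closed[OF S(2)] by simp
    from nullD(2)[OF t uv(1) this] show "form u (fst (t \<otimes>\<^bsub>ops\<^esub> s) v) = 0" by (simp add: S T)
  qed (use ops.m_closed[OF nullD(1)[OF t] s] in simp)
  show "star ops t \<in> null_ops" if t: "t \<in> null_ops" for t
  proof (rule nullI)
    obtain T S where T: "t = (T, S)" "linear_on_V T"
      "\<And>u v. u \<in> V \<Longrightarrow> v \<in> V \<Longrightarrow> form (T u) v = form u (S v)" using ops_cases[OF nullD(1)[OF t]] by metis
    fix u v assume uv: "u \<in> V" "v \<in> V"
    then have m: "T u \<in> V" using linear_on_V_closed[OF T(2)] by simp
    have "form u (S v) = form (T u) v" by (rule T(3)[OF uv, symmetric])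
    also have "\<dots> = cnj (form v (T u))" by (rule form_herm[OF uv(2) m])
    also have "\<dots> = 0" using nullD(2)[OF t uv(2,1)] T by simp
    finally show "form u (fst (star ops t) v) = 0" by (simp add: T)
  qed (use ops.star_closed[OF nullD(1)[OF t]] in simp)
qed

definition vector_state :: "('w \<Rightarrow>\<^sub>0 complex) \<Rightarrow> _ \<Rightarrow> complex" where
  "vector_state v t = form v (fst t v)"

lemma state_vector_state:
  assumes "v \<in> V" "form v v = 1"
  shows "state ops (vector_state v)"
  unfolding state_def
proof (intro conjI ballI allI)
  fix s t c assume s: "s \<in> carrier ops"
  obtain S S' where S: "s = (S, S')" "linear_on_V S"
    "\<And>u v. u \<in> V \<Longrightarrow> v \<in> V \<Longrightarrow> form (S u) v = form u (S' v)" using ops_cases[OF s] by metis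
  show "vector_state v (c \<odot>\<^bsub>ops\<^esub> s) = c * vector_state v s"
    by (simp add: S vector_state_def form_linear)
  have m: "S v \<in> V" using assms(1) linear_on_V_closed[OF S(2)] by simp
  show "vector_state v (star ops s \<otimes>\<^bsub>ops\<^esub> s) \<in> \<real>\<^sub>\<ge>\<^sub>0"
    using form_positive[OF m] S(3)[OF assms(1) m] by (simp add: S(1) vector_state_def)
  show "vector_state v (s \<oplus>\<^bsub>ops\<^esub> t) = vector_state v s + vector_state v t" for t
    by (cases t) (simp add: S vector_state_def form_linear)
qed (use assms in \<open>simp add: vector_state_def\<close>)

definition extend :: "('w \<Rightarrow> ('w \<Rightarrow>\<^sub>0 complex)) \<Rightarrow> ('w \<Rightarrow>\<^sub>0 complex) \<Rightarrow> ('w \<Rightarrow>\<^sub>0 complex)" where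
  "extend t = lin_ext (\<lambda>x a. scale_pm a (t x))"

lemma extend_basis [simp]: "extend t (basis x) = t x"
  by (simp add: extend_def lin_ext_single)

lemma linear_on_V_extend:
  assumes "\<And>x. x \<in> W \<Longrightarrow> t x \<in> V"
  shows "linear_on_V (extend t)"
proof (rule linear_on_VI)
  show add: "extend t (u + v) = extend t u + extend t v" for u v
    unfolding extend_def by (rule lin_ext_add) (simp_all add: scale_pm_add_left)
  have single: "extend t (Poly_Mapping.single x a) = scale_pm a (t x)" for x a
    by (simp add: extend_def lin_ext_single)
  have zero: "extend t 0 = 0" by (simp add: extend_def)
  show "extend t (scale_pm c u) = scale_pm c (extend t u)" for c u
  proof -
    have "Poly_Mapping.keys u \<subseteq> UNIV" by simp
    then show ?thesis
      by (induction rule: poly_mapping_span_induct) (simp_all add: add scale_pm_add single zero scale_pm_scale_pm)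
  qed
  show "Poly_Mapping.keys (extend t u) \<subseteq> W" if "Poly_Mapping.keys u \<subseteq> W" for u
    using that assms
    by (induction rule: poly_mapping_span_induct)
      (simp_all add: add single zero keys_add_subset subset_trans[OF keys_scale_pm])
qed

lemma form_eq_on_basis:
  assumes "u \<in> V" "v \<in> V" "linear_on_V T" "linear_on_V S"
    and "\<And>x y. x \<in> W \<Longrightarrow> y \<in> W \<Longrightarrow> form (T (basis x)) (basis y) = form (basis x) (S (basis y))"
  shows "form (T u) v = form u (S v)"
proof -
  have sc: "Poly_Mapping.single x a = scale_pm a (basis x)" for x a by simp
  have "Poly_Mapping.keys u \<subseteq> W" "Poly_Mapping.keys v \<subseteq> W" using assms by auto
  then show ?thesis
  proof (induction rule: poly_mapping_span_induct)
    case x: (single x a)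
    from x(2) show ?case
    proof (induction rule: poly_mapping_span_induct)
      case (single y b)
      show ?case unfolding sc[of x a] sc[of y b]
        by (simp only: linear_on_V_scale[OF assms(3)] linear_on_V_scale[OF assms(4)] form_scale_left
          form_scale_right assms(5)[OF x(1) \<open>y \<in> W\<close>])
    qed (simp_all add: form_linear linear_on_VD[OF assms(4)])
  qed (simp_all add: form_linear linear_on_VD[OF assms(3)])
qed

lemma extend_op:
  assumes "\<And>x. x \<in> W \<Longrightarrow> t x \<in> V" "\<And>x. x \<in> W \<Longrightarrow> s x \<in> V"
    and "\<And>x y. x \<in> W \<Longrightarrow> y \<in> W \<Longrightarrow> form (t x) (basis y) = form (basis x) (s y)"
  shows "(extend t, extend s) \<in> carrier ops"
proof -
  have lin: "linear_on_V (extend t)" "linear_on_V (extend s)"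
    by (rule linear_on_V_extend, rule assms, assumption)+
  show ?thesis
    by (rule opsI[OF lin], rule form_eq_on_basis[OF _ _ lin]) (simp_all add: assms(3))
qed

text \<open>Equality in the quotient is decided by the matrix entries of the first components
  between basis words; the stored adjoints may differ as functions.\<close>

lemma null_opsI:
  assumes "(T, S) \<in> carrier ops" "(T', S') \<in> carrier ops"
    and "\<And>x y. x \<in> W \<Longrightarrow> y \<in> W \<Longrightarrow> form (basis y) (T (basis x)) = form (basis y) (T' (basis x))"
  shows "null_ops +>\<^bsub>ops\<^esub> (T, S) = null_ops +>\<^bsub>ops\<^esub> (T', S')"
proof -
  interpret ops: star_algebra ops by (rule star_algebra_ops)
  have lin: "linear_on_V T" "linear_on_V T'" using assms(1,2) by simp_all
  have "(T, S) \<ominus>\<^bsub>ops\<^esub> (T', S') = (T, S) \<oplus>\<^bsub>ops\<^esub> (-1) \<odot>\<^bsub>ops\<^esub> (T', S')"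
    using assms(2) by (simp only: a_minus_def ops.smult_minus_1)
  also have "\<dots> = (\<lambda>u. T u + scale_pm (-1) (T' u), \<lambda>u. S u + scale_pm (-1) (S' u))" by simp
  finally have eq: "(T, S) \<ominus>\<^bsub>ops\<^esub> (T', S') = (\<lambda>u. T u + scale_pm (-1) (T' u), \<lambda>u. S u + scale_pm (-1) (S' u))" .
  have "form u (T v + scale_pm (-1) (T' v)) = 0" if "u \<in> V" "v \<in> V" for u v
  proof -
    have sc: "Poly_Mapping.single x a = scale_pm a (basis x)" for x a by simp
    have "Poly_Mapping.keys u \<subseteq> W" "Poly_Mapping.keys v \<subseteq> W" using that by auto
    then have "form u (T v) = form u (T' v)"
    proof (induction rule: poly_mapping_span_induct)
      case y: (single y a)
      from y(2) show ?case
      proof (induction rule: poly_mapping_span_induct)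
        case (single x b)
        show ?case unfolding sc[of x b] sc[of y a]
          by (simp only: linear_on_V_scale[OF lin(1)] linear_on_V_scale[OF lin(2)] form_scale_left
            form_scale_right assms(3)[OF \<open>x \<in> W\<close> y(1)])
      qed (simp_all add: form_linear linear_on_VD[OF lin(1)] linear_on_VD[OF lin(2)])
    qed (simp_all add: form_linear)
    then show ?thesis by (simp add: form_linear)
  qed
  moreover have "(T, S) \<ominus>\<^bsub>ops\<^esub> (T', S') \<in> carrier ops" using assms(1,2) by (rule ops.minus_closed)
  ultimately have "(T, S) \<ominus>\<^bsub>ops\<^esub> (T', S') \<in> null_ops"
    unfolding eq null_ops_def by (simp del: ops_simps(1))
  then show ?thesis
    using coset_eq_iff[OF star_algebra_ops star_ideal_null_ops assms(1,2)] by simp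
qed

end

section \<open>The parity representation\<close>

fun alt_prod :: "('e, 'x) monoid_scheme \<Rightarrow> (bool \<Rightarrow> 'a \<Rightarrow> 'e) \<Rightarrow> bool \<Rightarrow> 'a list \<Rightarrow> 'e" where
  "alt_prod M \<pi> \<epsilon> [] = \<one>\<^bsub>M\<^esub>"
| "alt_prod M \<pi> \<epsilon> (a # as) = \<pi> \<epsilon> a \<otimes>\<^bsub>M\<^esub> alt_prod M \<pi> (\<not> \<epsilon>) as"

lemma (in monoid) alt_prod_closed:
  "(\<And>\<epsilon> a. a \<in> set as \<Longrightarrow> \<pi> \<epsilon> a \<in> carrier G) \<Longrightarrow> alt_prod G \<pi> \<epsilon> as \<in> carrier G"
  by (induction as arbitrary: \<epsilon>) auto

lemma star_hom_alt_prod: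
  assumes "star_algebra A" "star_hom A B h" "\<And>\<epsilon> a. a \<in> set as \<Longrightarrow> \<pi> \<epsilon> a \<in> carrier A"
  shows "h (alt_prod A \<pi> \<epsilon> as) = alt_prod B (\<lambda>\<epsilon> a. h (\<pi> \<epsilon> a)) \<epsilon> as"
proof -
  interpret star_algebra A by fact
  show ?thesis using assms(3)
  proof (induction as arbitrary: \<epsilon>)
    case (Cons a as)
    have "alt_prod A \<pi> (\<not> \<epsilon>) as \<in> carrier A" by (rule alt_prod_closed) (use Cons in auto)
    then show ?case using Cons by (simp add: star_hom_mult[OF assms(2)])
  qed (simp add: star_hom_one[OF assms(2)])
qed

context kernel_space
begin

lemma extend_single: "extend t (Poly_Mapping.single x a) = scale_pm a (t x)"
  by (simp add: extend_def lin_ext_single)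

lemma extend_add: "extend t (u + v) = extend t u + extend t v"
  unfolding extend_def by (rule lin_ext_add) (simp_all add: scale_pm_add_left)

lemma extend_0: "extend t 0 = 0"
  by (simp add: extend_def)

lemma extend_diff: "extend t (u - v) = extend t u - extend t v"
  using extend_add[of t "u - v" v] by simp

end

locale algebra_with_state = star_algebra A for A :: "'a star_algebra" (structure) +
  fixes \<mu> :: "'a \<Rightarrow> complex"
  assumes \<mu>: "state A \<mu>"
begin

text \<open>The inner product of the centred vectors \<open>a - \<mu> a\<close> and
  \<open>b - \<mu> b\<close> in the GNS space of \<open>\<mu>\<close>.\<close>

definition cov :: "'a \<Rightarrow> 'a \<Rightarrow> complex" where
  "cov a b = \<mu> (star A a \<otimes> b) - cnj (\<mu> a) * \<mu> b"

fun list_kernel :: "'a list \<Rightarrow> 'a list \<Rightarrow> complex" where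
  "list_kernel [] [] = 1"
| "list_kernel (a # v) (b # w) = cov a b * list_kernel v w"
| "list_kernel _ _ = 0"

text \<open>The word \<open>(\<delta>, [a\<^sub>1, \<dots>, a\<^sub>n])\<close> stands for the tensor of the centred vectors \<open>a\<^sub>i - \<mu> a\<^sub>i\<close>, taken
  alternately from two copies of \<open>A\<close>, the first one from the copy \<open>\<delta>\<close>. Centring is built into the
  covariance, and all words with \<open>n = 0\<close> represent the vacuum.\<close>

definition word_kernel :: "bool \<times> 'a list \<Rightarrow> bool \<times> 'a list \<Rightarrow> complex" where
  "word_kernel x y = (if snd x = [] \<and> snd y = [] \<or> fst x = fst y then list_kernel (snd x) (snd y) else 0)"

lemma word_kernel_simps [simp]:
  "word_kernel (\<delta>, []) (\<delta>', w) = list_kernel [] w"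
  "word_kernel (\<delta>, v) (\<delta>', []) = list_kernel v []"
  "word_kernel (\<delta>, a # v) (\<delta>', b # w) = (if \<delta> = \<delta>' then cov a b * list_kernel v w else 0)"
  "word_kernel (\<delta>, v) (\<delta>, w) = list_kernel v w"
  "\<delta> \<noteq> \<delta>' \<Longrightarrow> word_kernel (\<delta>, a # v) (\<delta>', w) = 0"
  "\<delta> \<noteq> \<delta>' \<Longrightarrow> word_kernel (\<delta>, v) (\<delta>', b # w) = 0"
  by (cases w; cases v; simp add: word_kernel_def)+

text \<open>It is the Gram kernel of the elements
  \<open>g i \<ominus> \<mu> (g i) \<odot> \<one>\<close>: expanding their products under
  \<open>\<mu>\<close> leaves exactly \<open>cov\<close>.\<close>

lemma psd_on_cov:
  assumes "finite S" "\<And>i. i \<in> S \<Longrightarrow> g i \<in> carrier A"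
  shows "psd_on S (\<lambda>i j. cov (g i) (g j))"
proof (rule psd_on_cong)
  let ?g = "\<lambda>i. g i \<ominus> \<mu> (g i) \<odot> \<one>"
  show "psd_on S (\<lambda>i j. \<mu> (star A (?g i) \<otimes> ?g j))"
    by (rule psd_on_state[OF \<mu> assms(1)]) (use assms(2) smult_closed in auto)
  fix i j assume ij: "i \<in> S" "j \<in> S"
  define a where "a = g i"
  define b where "b = g j"
  have ab: "a \<in> carrier A" "b \<in> carrier A" using ij assms(2) by (auto simp: a_def b_def)
  have "star A (a \<ominus> \<mu> a \<odot> \<one>) = star A a \<ominus> cnj (\<mu> a) \<odot> \<one>"
    using ab by (simp add: star_diff star_smult star_one smult_closed)
  also have "\<dots> \<otimes> (b \<ominus> \<mu> b \<odot> \<one>) = (star A a \<otimes> b \<ominus> cnj (\<mu> a) \<odot> b)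
      \<ominus> (\<mu> b \<odot> star A a \<ominus> (cnj (\<mu> a) * \<mu> b) \<odot> \<one>)"
  proof -
    have d: "(x \<ominus> y) \<otimes> (z \<ominus> w) = (x \<otimes> z \<ominus> y \<otimes> z) \<ominus> (x \<otimes> w \<ominus> y \<otimes> w)"
      if "x \<in> carrier A" "y \<in> carrier A" "z \<in> carrier A" "w \<in> carrier A" for x y z w
      using that by (simp add: a_minus_def l_distr r_distr l_minus r_minus)
    show ?thesis using ab
      by (subst d) (simp_all add: smult_closed star_closed smult_mult_left smult_mult_right smult_smult mult.commute)
  qed
  finally show "cov (g i) (g j) = \<mu> (star A (?g i) \<otimes> ?g j)"
    using ab unfolding a_def[symmetric] b_def[symmetric] cov_def
    by (simp add: state_diff[OF \<mu>] state_smult[OF \<mu>] state_one[OF \<mu>] state_star[OF \<mu>] star_closed smult_closed)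
qed

text \<open>The kernel is a rank one part for the empty word plus, on nonempty words, the product of
  the covariance of the first letters with the kernel of the tails. The induction runs over a bound
  for the lengths.\<close>

lemma psd_on_list_kernel:
  assumes "finite S" "\<And>w. w \<in> S \<Longrightarrow> set w \<subseteq> carrier A" "\<And>w. w \<in> S \<Longrightarrow> length w \<le> n"
  shows "psd_on S list_kernel"
  using assms
proof (induction n arbitrary: S)
  case 0
  show ?case
  proof (rule psd_on_cong[OF psd_on_rank_one[of S "\<lambda>_. 1"]])
    fix v w assume "v \<in> S" "w \<in> S"
    then have "v = []" "w = []" using "0.prems"(3) by auto
    then show "list_kernel v w = cnj 1 * 1" by simp
  qed
next
  case (Suc n)
  \<comment> \<open>The value on the empty word is arbitrary, since the indicator \<open>?f\<close>
    removes it; the zero keeps it in the carrier.\<close>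
  define h where "h w = (case w of [] \<Rightarrow> \<zero> | a # _ \<Rightarrow> a)" for w
  let ?e = "\<lambda>w :: 'a list. if w = [] then 1 else 0 :: complex"
  let ?f = "\<lambda>w :: 'a list. if w = [] then 0 else 1 :: complex"
  have "psd_on (tl ` S) list_kernel"
  proof (rule Suc.IH)
    fix w assume "w \<in> tl ` S"
    then obtain v where "v \<in> S" "w = tl v" by auto
    then show "set w \<subseteq> carrier A" "length w \<le> n" using Suc.prems(2,3)[of v] by (cases v; auto)+
  qed (use Suc.prems in simp)
  then have tl: "psd_on S (\<lambda>v w. list_kernel (tl v) (tl w))"
    by (rule psd_on_vimage) (rule Suc.prems(1))
  have hd: "psd_on S (\<lambda>v w. cov (h v) (h w))"
  proof (rule psd_on_cov[OF Suc.prems(1)])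
    show "h w \<in> carrier A" if "w \<in> S" for w
      using Suc.prems(2)[OF that] by (cases w) (auto simp: h_def)
  qed
  have "psd_on S (\<lambda>v w. cnj (?e v) * ?e w + cnj (?f v) * ?f w * (cov (h v) (h w) * list_kernel (tl v) (tl w)))"
    by (intro psd_on_add psd_on_rank_one psd_on_mult Suc.prems(1) hd tl)
  then show ?case
  proof (rule psd_on_cong)
    fix v w assume "v \<in> S" "w \<in> S"
    show "list_kernel v w = cnj (?e v) * ?e w + cnj (?f v) * ?f w * (cov (h v) (h w) * list_kernel (tl v) (tl w))"
      by (cases v; cases w) (simp_all add: h_def)
  qed
qed

abbreviation "words \<equiv> {x :: bool \<times> 'a list. set (snd x) \<subseteq> carrier A}"

text \<open>The function \<open>?f\<close> marks the nonempty words from the copy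
  \<open>True\<close> and \<open>?g\<close> all other words, and the two rank one kernels compare
  these blocks. That the empty words share a block with the copy \<open>False\<close> is harmless,
  because \<open>list_kernel\<close> separates them from the nonempty ones.\<close>

lemma psd_on_word_kernel:
  assumes "finite S" "S \<subseteq> words"
  shows "psd_on S word_kernel"
proof -
  let ?f = "\<lambda>x :: bool \<times> 'a list. if snd x \<noteq> [] \<and> fst x then 1 else 0 :: complex"
  let ?g = "\<lambda>x :: bool \<times> 'a list. if snd x \<noteq> [] \<and> fst x then 0 else 1 :: complex"
  have "psd_on (snd ` S) list_kernel"
    by (rule psd_on_list_kernel[of _ "Max (length ` snd ` S)"]) (use assms in auto)
  then have l: "psd_on S (\<lambda>x y. list_kernel (snd x) (snd y))"
    by (rule psd_on_vimage) (rule assms(1))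
  have "psd_on S (\<lambda>x y. (cnj (?f x) * ?f y + cnj (?g x) * ?g y) * list_kernel (snd x) (snd y))"
    by (intro psd_on_mult psd_on_add psd_on_rank_one assms(1) l)
  then show ?thesis
  proof (rule psd_on_cong)
    fix x y assume "x \<in> S" "y \<in> S"
    show "word_kernel x y = (cnj (?f x) * ?f y + cnj (?g x) * ?g y) * list_kernel (snd x) (snd y)"
      by (cases "snd x"; cases "snd y") (auto simp: word_kernel_def)
  qed
qed

section \<open>The two copies and the parity projection as operators\<close>

sublocale K: kernel_space words word_kernel
  by unfold_locales (rule psd_on_word_kernel)

text \<open>Left multiplication followed by centring. On the vacuum or on a word from the other
  copy, \<open>a\<close> is its mean plus a new letter. On a first letter \<open>b\<close> of the
  same copy, the product of \<open>a\<close> and \<open>b - \<mu> b\<close> has the mean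
  \<open>\<mu> (a \<otimes> b) - \<mu> a * \<mu> b\<close>, which leaves the tail from the opposite
  copy, and its centred part is represented by the letters \<open>a \<otimes> b\<close> and
  \<open>a\<close>.\<close>

fun act :: "bool \<Rightarrow> 'a \<Rightarrow> bool \<times> 'a list \<Rightarrow> (bool \<times> 'a list) \<Rightarrow>\<^sub>0 complex" where
  "act \<epsilon> a (\<delta>, []) = Poly_Mapping.single (\<delta>, []) (\<mu> a) + Poly_Mapping.single (\<epsilon>, [a]) 1"
| "act \<epsilon> a (\<delta>, b # w) = (if \<delta> = \<epsilon>
    then Poly_Mapping.single (\<not> \<epsilon>, w) (\<mu> (a \<otimes> b) - \<mu> a * \<mu> b)
      + Poly_Mapping.single (\<epsilon>, (a \<otimes> b) # w) 1 - Poly_Mapping.single (\<epsilon>, a # w) (\<mu> b)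
    else Poly_Mapping.single (\<delta>, b # w) (\<mu> a) + Poly_Mapping.single (\<epsilon>, a # b # w) 1)"

lemma keys_diff_subset:
  "Poly_Mapping.keys f \<subseteq> G \<Longrightarrow> Poly_Mapping.keys g \<subseteq> G \<Longrightarrow> Poly_Mapping.keys (f - g) \<subseteq> G"
  for f g :: "'b \<Rightarrow>\<^sub>0 complex"
  using keys_diff[of f g] by blast

lemma act_closed: "a \<in> carrier A \<Longrightarrow> x \<in> words \<Longrightarrow> act \<epsilon> a x \<in> K.V"
  by (cases "(\<epsilon>, a, x)" rule: act.cases) (simp_all add: keys_add_subset keys_diff_subset)

lemmas \<mu>_simps = state_add[OF \<mu>] state_smult[OF \<mu>] state_star[OF \<mu>] state_one[OF \<mu>]

lemma cnj_\<mu>: "a \<in> carrier A \<Longrightarrow> cnj (\<mu> a) = \<mu> (star A a)"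
  by (simp add: state_star[OF \<mu>])

text \<open>The form factors letter by letter and \<open>act\<close> affects only the front of a
  word, so that it suffices to distinguish empty from nonempty words and to compare their
  copies.\<close>

lemma act_adjoint:
  assumes a: "a \<in> carrier A" and x: "x \<in> words" and y: "y \<in> words"
  shows "K.form (act \<epsilon> a x) (K.basis y) = K.form (K.basis x) (act \<epsilon> (star A a) y)"
proof -
  obtain \<delta> v \<delta>' w where xy: "x = (\<delta>, v)" "y = (\<delta>', w)" by (cases x; cases y)
  show ?thesis using assms unfolding xy
    by (cases v; cases w)
      (auto simp: K.form_linear cov_def cnj_\<mu> star_mult star_closed star_star m_assoc algebra_simps)
qed

definition \<pi>_op where
  "\<pi>_op \<epsilon> a = (K.extend (act \<epsilon> a), K.extend (act \<epsilon> (star A a)))"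

lemma \<pi>_op_closed: "a \<in> carrier A \<Longrightarrow> \<pi>_op \<epsilon> a \<in> carrier K.ops"
  unfolding \<pi>_op_def by (intro K.extend_op act_closed act_adjoint star_closed)

definition parity where
  "parity x = (if odd (length (snd x)) then K.basis x else 0)" for x :: "bool \<times> 'a list"

definition P_op where
  "P_op = (K.extend parity, K.extend parity)"

text \<open>This makes the parity projection selfadjoint: words of different parity are
  orthogonal.\<close>

lemma list_kernel_length: "length v \<noteq> length w \<Longrightarrow> list_kernel v w = 0"
  by (induction v w rule: list_kernel.induct) auto

lemma P_op_closed: "P_op \<in> carrier K.ops"
  unfolding P_op_def
proof (rule K.extend_op)
  show "parity x \<in> K.V" if "x \<in> words" for x using that by (simp add: parity_def)
  show "K.form (parity x) (K.basis y) = K.form (K.basis x) (parity y)" for x y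
    by (cases x; cases y; cases "length (snd x) = length (snd y)")
      (auto simp: parity_def K.form_linear word_kernel_def list_kernel_length)
qed (simp add: parity_def)

definition "E = star_quotient K.ops K.null_ops"
definition "\<pi> \<epsilon> a = K.null_ops +>\<^bsub>K.ops\<^esub> \<pi>_op \<epsilon> a"
definition "P = K.null_ops +>\<^bsub>K.ops\<^esub> P_op"

lemmas E_hom = star_hom_quotient[OF K.star_algebra_ops K.star_ideal_null_ops, folded E_def]
lemmas E_carrier = carrier_quotient[OF K.star_algebra_ops K.star_ideal_null_ops, folded E_def]

lemma star_algebra_E: "star_algebra E"
  unfolding E_def by (rule star_algebra_quotient[OF K.star_algebra_ops K.star_ideal_null_ops])

sublocale ops: star_algebra K.ops by (rule K.star_algebra_ops)
sublocale E: star_algebra E by (rule star_algebra_E)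

text \<open>The identity is one of matrix entries. When a letter is absorbed, the empty word comes
  back with the flag \<open>\<not> \<epsilon>\<close>, and empty words with different flags are
  different basis vectors for the same vacuum. The second letter enters the case distinction because
  the outer operator acts on the remaining tail.\<close>

lemma \<pi>_mult_aux:
  assumes "a \<in> carrier A" "b \<in> carrier A" "x \<in> words" "y \<in> words"
  shows "K.form (K.basis y) (K.extend (act \<epsilon> (a \<otimes> b)) (K.basis x)) =
    K.form (K.basis y) (K.extend (act \<epsilon> a) (K.extend (act \<epsilon> b) (K.basis x)))"
proof -
  obtain \<delta> v \<delta>' w where xy: "x = (\<delta>, v)" "y = (\<delta>', w)" by (cases x; cases y)
  show ?thesis using assms unfolding xy
    by (cases v; cases "tl v"; cases w)
      (auto simp: K.form_linear K.extend_add K.extend_diff K.extend_single m_assoc algebra_simps)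
qed

text \<open>Under the kernel the letters become linear and the unit becomes a null letter, although
  formally distinct words are independent basis vectors.\<close>

lemma cov_linear:
  assumes "a \<in> carrier A" "b \<in> carrier A" "d \<in> carrier A"
  shows "cov d (a \<oplus> b) = cov d a + cov d b" "cov d (c \<odot> a) = c * cov d a" "cov d \<one> = 0"
  using assms by (simp_all add: cov_def r_distr star_closed \<mu>_simps smult_mult_right algebra_simps)

text \<open>Adjoints are respected by the operators themselves. The other laws relate formally
  independent words, such as one with the letter \<open>a \<oplus> b\<close> and those with
  \<open>a\<close> and \<open>b\<close>, and hold modulo null operators.\<close>

lemma star_hom_\<pi>: "star_hom A E (\<pi> \<epsilon>)"
proof (rule star_homI)
  fix a b c assume a: "a \<in> carrier A"
  show "\<pi> \<epsilon> a \<in> carrier E" unfolding \<pi>_def by (rule star_hom_closed[OF E_hom \<pi>_op_closed[OF a]])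
  have "star K.ops (\<pi>_op \<epsilon> a) = \<pi>_op \<epsilon> (star A a)" using a by (simp add: \<pi>_op_def star_star)
  then show "\<pi> \<epsilon> (star A a) = star E (\<pi> \<epsilon> a)"
    unfolding \<pi>_def using star_hom_star[OF E_hom \<pi>_op_closed[OF a], of \<epsilon>] by simp
  have "\<pi> \<epsilon> (c \<odot> a) = K.null_ops +>\<^bsub>K.ops\<^esub> (c \<odot>\<^bsub>K.ops\<^esub> \<pi>_op \<epsilon> a)"
    using \<pi>_op_closed[OF smult_closed[OF a]] ops.smult_closed[OF \<pi>_op_closed[OF a]]
    unfolding \<pi>_def \<pi>_op_def K.ops_simps(6)
  proof (rule K.null_opsI)
    fix x y assume xy: "x \<in> words" "y \<in> words"
    obtain \<delta> v \<delta>' w where xy': "x = (\<delta>, v)" "y = (\<delta>', w)" by (cases x; cases y)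
    show "K.form (K.basis y) (K.extend (act \<epsilon> (c \<odot> a)) (K.basis x)) =
        K.form (K.basis y) (scale_pm c (K.extend (act \<epsilon> a) (K.basis x)))"
      using xy a unfolding xy'
      by (cases v; cases w)
        (auto simp: K.form_linear cov_linear smult_mult_left \<mu>_simps algebra_simps)
  qed
  also have "\<dots> = c \<odot>\<^bsub>E\<^esub> \<pi> \<epsilon> a"
    unfolding \<pi>_def by (rule star_hom_smult[OF E_hom \<pi>_op_closed[OF a]])
  finally show "\<pi> \<epsilon> (c \<odot> a) = c \<odot>\<^bsub>E\<^esub> \<pi> \<epsilon> a" .
  assume b: "b \<in> carrier A"
  have "\<pi> \<epsilon> (a \<oplus> b) = K.null_ops +>\<^bsub>K.ops\<^esub> (\<pi>_op \<epsilon> a \<oplus>\<^bsub>K.ops\<^esub> \<pi>_op \<epsilon> b)"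
    using \<pi>_op_closed[OF a_closed[OF a b]] ops.a_closed[OF \<pi>_op_closed[OF a] \<pi>_op_closed[OF b]]
    unfolding \<pi>_def \<pi>_op_def K.ops_simps(5)
  proof (rule K.null_opsI)
    fix x y assume xy: "x \<in> words" "y \<in> words"
    obtain \<delta> v \<delta>' w where xy': "x = (\<delta>, v)" "y = (\<delta>', w)" by (cases x; cases y)
    show "K.form (K.basis y) (K.extend (act \<epsilon> (a \<oplus> b)) (K.basis x)) =
        K.form (K.basis y) (K.extend (act \<epsilon> a) (K.basis x) + K.extend (act \<epsilon> b) (K.basis x))"
      using xy a b unfolding xy'
      by (cases v; cases w) (auto simp: K.form_linear cov_linear l_distr \<mu>_simps algebra_simps)
  qed
  also have "\<dots> = \<pi> \<epsilon> a \<oplus>\<^bsub>E\<^esub> \<pi> \<epsilon> b"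
    unfolding \<pi>_def by (rule star_hom_add[OF E_hom \<pi>_op_closed[OF a] \<pi>_op_closed[OF b]])
  finally show "\<pi> \<epsilon> (a \<oplus> b) = \<pi> \<epsilon> a \<oplus>\<^bsub>E\<^esub> \<pi> \<epsilon> b" .
  have "\<pi> \<epsilon> (a \<otimes> b) = K.null_ops +>\<^bsub>K.ops\<^esub> (\<pi>_op \<epsilon> a \<otimes>\<^bsub>K.ops\<^esub> \<pi>_op \<epsilon> b)"
    using \<pi>_op_closed[OF m_closed[OF a b]] ops.m_closed[OF \<pi>_op_closed[OF a] \<pi>_op_closed[OF b]]
    unfolding \<pi>_def \<pi>_op_def K.ops_simps(2)
    by (rule K.null_opsI) (use \<pi>_mult_aux[OF a b] in simp)
  also have "\<dots> = \<pi> \<epsilon> a \<otimes>\<^bsub>E\<^esub> \<pi> \<epsilon> b"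
    unfolding \<pi>_def by (rule star_hom_mult[OF E_hom \<pi>_op_closed[OF a] \<pi>_op_closed[OF b]])
  finally show "\<pi> \<epsilon> (a \<otimes> b) = \<pi> \<epsilon> a \<otimes>\<^bsub>E\<^esub> \<pi> \<epsilon> b" .
next
  have "\<pi> \<epsilon> \<one> = K.null_ops +>\<^bsub>K.ops\<^esub> \<one>\<^bsub>K.ops\<^esub>"
    using \<pi>_op_closed[OF one_closed] ops.one_closed
    unfolding \<pi>_def \<pi>_op_def K.ops_simps(3)
  proof (rule K.null_opsI)
    fix x y assume xy: "x \<in> words" "y \<in> words"
    obtain \<delta> v \<delta>' w where xy': "x = (\<delta>, v)" "y = (\<delta>', w)" by (cases x; cases y)
    show "K.form (K.basis y) (K.extend (act \<epsilon> \<one>) (K.basis x)) = K.form (K.basis y) (K.basis x)"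
      using xy unfolding xy'
      by (cases v; cases w) (auto simp: K.form_linear cov_linear \<mu>_simps)
  qed
  then show "\<pi> \<epsilon> \<one> = \<one>\<^bsub>E\<^esub>" by (simp only: star_hom_one[OF E_hom])
qed

lemma P_closed: "P \<in> carrier E"
  unfolding P_def by (rule star_hom_closed[OF E_hom P_op_closed])

lemma P_star: "star E P = P"
proof -
  have "star K.ops P_op = P_op" by (simp add: P_op_def)
  then show ?thesis unfolding P_def using star_hom_star[OF E_hom P_op_closed] by simp
qed

lemma P_idem: "P \<otimes>\<^bsub>E\<^esub> P = P"
proof -
  have "P \<otimes>\<^bsub>E\<^esub> P = K.null_ops +>\<^bsub>K.ops\<^esub> (P_op \<otimes>\<^bsub>K.ops\<^esub> P_op)"
    unfolding P_def by (rule star_hom_mult[OF E_hom P_op_closed P_op_closed, symmetric])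
  also have "\<dots> = P"
    using ops.m_closed[OF P_op_closed P_op_closed] P_op_closed
    unfolding P_def P_op_def K.ops_simps(2)
    by (rule K.null_opsI) (auto simp: parity_def K.extend_0)
  finally show ?thesis .
qed

definition "vacuum = K.basis (False, [])"

lemma obtain_vacuum_state:
  obtains \<omega> where "state E \<omega>"
    "\<And>t. t \<in> carrier K.ops \<Longrightarrow> \<omega> (K.null_ops +>\<^bsub>K.ops\<^esub> t) = K.form vacuum (fst t vacuum)"
proof -
  have v: "vacuum \<in> K.V" "K.form vacuum vacuum = 1" by (simp_all add: vacuum_def K.form_single)
  have null: "K.vector_state vacuum t = 0" if "t \<in> K.null_ops" for t
    using that v(1) by (cases t) (simp add: K.vector_state_def K.null_ops_def)
  show thesis
    using state_quotient[OF K.star_algebra_ops K.star_ideal_null_ops K.state_vector_state[OF v] null] that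
    unfolding E_def K.vector_state_def by metis
qed

text \<open>A centred letter from the copy opposite to that of the first letter is simply put in
  front, its mean being zero. Cosets do not act on vectors, hence the representing operator
  \<open>t\<close>.\<close>

lemma alt_prod_vacuum:
  assumes "\<forall>a\<in>set as. a \<in> carrier A \<and> \<mu> a = 0"
  shows "\<exists>t\<in>carrier K.ops. alt_prod E \<pi> \<epsilon> as = K.null_ops +>\<^bsub>K.ops\<^esub> t \<and>
    fst t vacuum = (if as = [] then vacuum else K.basis (\<epsilon>, as))"
  using assms
proof (induction as arbitrary: \<epsilon>)
  case Nil
  show ?case by (rule bexI[OF _ ops.one_closed]) (simp add: star_hom_one[OF E_hom, symmetric])
next
  case (Cons a as)
  then have a: "a \<in> carrier A" "\<mu> a = 0" by auto
  obtain t where t: "t \<in> carrier K.ops" "alt_prod E \<pi> (\<not> \<epsilon>) as = K.null_ops +>\<^bsub>K.ops\<^esub> t"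
    "fst t vacuum = (if as = [] then vacuum else K.basis (\<not> \<epsilon>, as))"
    using Cons.IH[of "\<not> \<epsilon>"] Cons.prems by auto
  let ?s = "\<pi>_op \<epsilon> a \<otimes>\<^bsub>K.ops\<^esub> t"
  have "alt_prod E \<pi> \<epsilon> (a # as) = K.null_ops +>\<^bsub>K.ops\<^esub> ?s"
    using t(2) star_hom_mult[OF E_hom \<pi>_op_closed[OF a(1)] t(1), of \<epsilon>] by (simp add: \<pi>_def)
  moreover have "fst ?s vacuum = K.extend (act \<epsilon> a) (fst t vacuum)"
    by (cases t) (simp add: \<pi>_op_def)
  moreover have "K.extend (act \<epsilon> a) (fst t vacuum) = K.basis (\<epsilon>, a # as)"
    unfolding t(3) using a(2) by (cases as) (simp_all add: vacuum_def)
  ultimately show ?case using ops.m_closed[OF \<pi>_op_closed[OF a(1)] t(1), of \<epsilon>] by auto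
qed

text \<open>In the last property the factor \<open>u\<close> tests against arbitrary vectors. This
  expresses through the state alone that \<open>P\<close> multiplies the vector of a word by the
  parity of its length.\<close>

lemma parity_state:
  obtains \<omega> where "state E \<omega>"
    "\<And>\<epsilon> a. a \<in> carrier A \<Longrightarrow> \<omega> (\<pi> \<epsilon> a) = \<mu> a"
    "\<And>\<epsilon> as. as \<noteq> [] \<Longrightarrow> \<forall>a\<in>set as. a \<in> carrier A \<and> \<mu> a = 0 \<Longrightarrow> \<omega> (alt_prod E \<pi> \<epsilon> as) = 0"
    "\<And>\<epsilon> as u. u \<in> carrier E \<Longrightarrow> \<forall>a\<in>set as. a \<in> carrier A \<and> \<mu> a = 0 \<Longrightarrow>
      \<omega> (u \<otimes>\<^bsub>E\<^esub> (P \<otimes>\<^bsub>E\<^esub> alt_prod E \<pi> \<epsilon> as)) = (if odd (length as) then \<omega> (u \<otimes>\<^bsub>E\<^esub> alt_prod E \<pi> \<epsilon> as) else 0)"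
proof -
  obtain \<omega> where \<omega>: "state E \<omega>"
    "\<And>t. t \<in> carrier K.ops \<Longrightarrow> \<omega> (K.null_ops +>\<^bsub>K.ops\<^esub> t) = K.form vacuum (fst t vacuum)"
    using obtain_vacuum_state by blast
  show thesis
  proof (rule that[OF \<omega>(1)])
    show "\<omega> (\<pi> \<epsilon> a) = \<mu> a" if "a \<in> carrier A" for \<epsilon> a
      unfolding \<pi>_def \<omega>(2)[OF \<pi>_op_closed[OF that]]
      by (simp add: \<pi>_op_def vacuum_def K.form_linear)
    fix as :: "'a list" and \<epsilon> assume as: "\<forall>a\<in>set as. a \<in> carrier A \<and> \<mu> a = 0"
    obtain t where t: "t \<in> carrier K.ops" "alt_prod E \<pi> \<epsilon> as = K.null_ops +>\<^bsub>K.ops\<^esub> t"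
      "fst t vacuum = (if as = [] then vacuum else K.basis (\<epsilon>, as))"
      using alt_prod_vacuum[OF as, of \<epsilon>] by (elim bexE conjE)
    show "\<omega> (alt_prod E \<pi> \<epsilon> as) = 0" if "as \<noteq> []"
      unfolding t(2) \<omega>(2)[OF t(1)] t(3) using that by (cases as) (simp_all add: vacuum_def K.form_single)
    fix u assume "u \<in> carrier E"
    then obtain s where s: "s \<in> carrier K.ops" "u = K.null_ops +>\<^bsub>K.ops\<^esub> s" by (auto simp: E_carrier)
    obtain S S' T T' where ST: "s = (S, S')" "t = (T, T')" by (cases s; cases t)
    have S0: "S 0 = 0" using s(1) K.linear_on_V_zero by (simp add: ST)
    have "u \<otimes>\<^bsub>E\<^esub> (P \<otimes>\<^bsub>E\<^esub> alt_prod E \<pi> \<epsilon> as) = K.null_ops +>\<^bsub>K.ops\<^esub> (s \<otimes>\<^bsub>K.ops\<^esub> (P_op \<otimes>\<^bsub>K.ops\<^esub> t))"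
      unfolding t(2) s(2) P_def
      by (simp only: star_hom_mult[OF E_hom] s(1) t(1) P_op_closed ops.m_closed)
    then have "\<omega> (u \<otimes>\<^bsub>E\<^esub> (P \<otimes>\<^bsub>E\<^esub> alt_prod E \<pi> \<epsilon> as)) = K.form vacuum (S (K.extend parity (T vacuum)))"
      by (simp only: \<omega>(2) ops.m_closed s(1) t(1) P_op_closed) (simp add: ST P_op_def)
    moreover have "u \<otimes>\<^bsub>E\<^esub> alt_prod E \<pi> \<epsilon> as = K.null_ops +>\<^bsub>K.ops\<^esub> (s \<otimes>\<^bsub>K.ops\<^esub> t)"
      unfolding t(2) s(2) by (simp only: star_hom_mult[OF E_hom] s(1) t(1))
    then have "\<omega> (u \<otimes>\<^bsub>E\<^esub> alt_prod E \<pi> \<epsilon> as) = K.form vacuum (S (T vacuum))"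
      by (simp only: \<omega>(2) ops.m_closed s(1) t(1)) (simp add: ST)
    moreover have "K.extend parity (T vacuum) = (if odd (length as) then T vacuum else 0)"
      using t(3) by (auto simp: ST vacuum_def parity_def)
    ultimately show "\<omega> (u \<otimes>\<^bsub>E\<^esub> (P \<otimes>\<^bsub>E\<^esub> alt_prod E \<pi> \<epsilon> as)) =
        (if odd (length as) then \<omega> (u \<otimes>\<^bsub>E\<^esub> alt_prod E \<pi> \<epsilon> as) else 0)"
      by (simp add: S0 K.form_0)
  qed
qed

end

section \<open>The algebra \<open>H0 A\<close>\<close>

definition "projs_free = free_star_algebra {1 :: nat..} id"

definition "projs_relations = {Poly_Mapping.single [k, l] (1 :: complex)
  - (if k = l then Poly_Mapping.single [k] 1 else 0) | k l :: nat. k \<ge> 1 \<and> l \<ge> 1}"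

lemma projs_adj: "\<forall>g\<in>{1 :: nat..}. id g \<in> {1..} \<and> id (id g) = g"
  by simp

lemmas projs_free_star_algebra = star_algebra_free_star_algebra[OF projs_adj, folded projs_free_def]
lemmas projs_free_carrier = carrier_free_star_algebra[OF projs_adj, folded projs_free_def]
lemmas projs_free_zero = free_star_algebra_zero[OF projs_adj, folded projs_free_def]
lemmas projs_free_mult_single = free_star_algebra_mult_single[OF projs_adj, folded projs_free_def]
lemmas projs_free_star_single = free_star_algebra_star_single[OF projs_adj, folded projs_free_def]
lemmas projs_free_minus = free_star_algebra_minus[OF projs_adj, folded projs_free_def]
lemmas projs_free_generated = free_star_algebra_generated[OF projs_adj, folded projs_free_def]
lemmas projs_gen_eq = projs_gen_def[folded projs_free_def]
lemmas projs_algebra_eq = projs_algebra_def[folded projs_free_def]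

lemma projs_relations_closed: "projs_relations \<subseteq> carrier projs_free"
proof -
  interpret star_algebra projs_free by (rule projs_free_star_algebra)
  have d: "f - g \<in> carrier projs_free" if "f \<in> carrier projs_free" "g \<in> carrier projs_free" for f g
    using minus_closed[OF that] by (simp only: projs_free_minus[OF that])
  show ?thesis
    unfolding projs_relations_def by (auto intro!: d simp: projs_free_carrier)
qed

lemma projs_ideal_eq: "projs_ideal = star_ideal_generated projs_free projs_relations"
  unfolding projs_ideal_def projs_relations_def projs_free_def ..

lemma star_ideal_projs: "star_ideal projs_free projs_ideal"
  unfolding projs_ideal_eq by (rule star_ideal_star_ideal_generated[OF projs_free_star_algebra projs_relations_closed])

lemma star_algebra_projs: "star_algebra projs_algebra"
  unfolding projs_algebra_eq by (rule star_algebra_quotient[OF projs_free_star_algebra star_ideal_projs])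

lemmas projs_hom = star_hom_quotient[OF projs_free_star_algebra star_ideal_projs, folded projs_algebra_eq]

lemma single_proj: "1 \<le> k \<Longrightarrow> Poly_Mapping.single [k] c \<in> carrier projs_free"
  by (simp add: projs_free_carrier)

lemma projs_gen_closed: "1 \<le> k \<Longrightarrow> projs_gen k \<in> carrier projs_algebra"
  unfolding projs_gen_eq by (intro star_hom_closed[OF projs_hom] single_proj)

lemma projs_gen_star: "1 \<le> k \<Longrightarrow> star projs_algebra (projs_gen k) = projs_gen k"
  unfolding projs_gen_eq by (subst star_hom_star[OF projs_hom, symmetric]) (simp_all add: single_proj projs_free_star_single)

lemma projs_gen_idem:
  assumes "1 \<le> k"
  shows "projs_gen k \<otimes>\<^bsub>projs_algebra\<^esub> projs_gen k = projs_gen k"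
proof -
  have kk: "Poly_Mapping.single [k, k] 1 \<in> carrier projs_free" using assms by (simp add: projs_free_carrier)
  have "projs_gen k \<otimes>\<^bsub>projs_algebra\<^esub> projs_gen k = projs_ideal +>\<^bsub>projs_free\<^esub> Poly_Mapping.single [k, k] 1"
    unfolding projs_gen_eq
    by (subst star_hom_mult[OF projs_hom, symmetric]) (use assms in \<open>simp_all add: single_proj projs_free_mult_single\<close>)
  also have "\<dots> = projs_gen k"
    unfolding projs_gen_eq
  proof (subst coset_eq_iff[OF projs_free_star_algebra star_ideal_projs kk single_proj[OF assms]])
    have "Poly_Mapping.single [k, k] 1 - Poly_Mapping.single [k] 1 \<in> projs_relations"
      unfolding projs_relations_def using assms by force
    then show "Poly_Mapping.single [k, k] 1 \<ominus>\<^bsub>projs_free\<^esub> Poly_Mapping.single [k] 1 \<in> projs_ideal"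
      unfolding projs_free_minus[OF kk single_proj[OF assms]] projs_ideal_eq
      using star_ideal_generated_incl[OF projs_free_star_algebra projs_relations_closed] by blast
  qed
  finally show ?thesis .
qed

lemma projs_universal:
  assumes B: "star_algebra B" and g: "\<And>k. 1 \<le> k \<Longrightarrow> g k \<in> carrier B" "\<And>k. 1 \<le> k \<Longrightarrow> star B (g k) = g k"
    "\<And>k l. 1 \<le> k \<Longrightarrow> 1 \<le> l \<Longrightarrow> g k \<otimes>\<^bsub>B\<^esub> g l = (if k = l then g k else \<zero>\<^bsub>B\<^esub>)"
  shows "\<exists>h. star_hom projs_algebra B h \<and> (\<forall>k\<ge>1. h (projs_gen k) = g k)"
proof -
  interpret B: star_algebra B by fact
  obtain f where f: "star_hom projs_free B f"
    "\<And>w c. w \<in> lists {1..} \<Longrightarrow> f (Poly_Mapping.single w c) = c \<odot>\<^bsub>B\<^esub> list_prod B (map g w)"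
  proof (rule free_star_algebra_universal[OF projs_adj B, of g])
    fix f assume "star_hom (free_star_algebra {1..} id) B f"
      "\<And>w c. w \<in> lists {1..} \<Longrightarrow> f (Poly_Mapping.single w c) = c \<odot>\<^bsub>B\<^esub> list_prod B (map g w)"
    then show thesis unfolding projs_free_def[symmetric] by (rule that)
  qed (use g in auto)
  have "f r = \<zero>\<^bsub>B\<^esub>" if r: "r \<in> projs_relations" for r
  proof -
    obtain k l where kl: "1 \<le> k" "1 \<le> l"
      "r = Poly_Mapping.single [k, l] 1 - (if k = l then Poly_Mapping.single [k] 1 else 0)"
      using r by (auto simp: projs_relations_def)
    let ?x = "Poly_Mapping.single [k, l] (1::complex)"
    let ?y = "if k = l then Poly_Mapping.single [k] (1::complex) else 0"
    have c: "?x \<in> carrier projs_free" "?y \<in> carrier projs_free" using kl by (auto simp: projs_free_carrier)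
    have "f r = f ?x \<ominus>\<^bsub>B\<^esub> f ?y"
      unfolding kl(3) using star_hom_diff[OF projs_free_star_algebra B f(1) c] by (simp only: projs_free_minus[OF c])
    also have "f ?x = (if k = l then g k else \<zero>\<^bsub>B\<^esub>)" using kl g by (simp add: f(2) B.smult_1)
    also have "f ?y = (if k = l then g k else \<zero>\<^bsub>B\<^esub>)"
      using kl g star_hom_zero[OF projs_free_star_algebra B f(1)] by (simp add: f(2) B.smult_1 projs_free_zero)
    finally show ?thesis using g(1)[OF kl(1)] g(1)[OF kl(2)] by (auto simp: a_minus_def B.r_neg)
  qed
  from quotient_universal[OF projs_free_star_algebra B f(1) projs_relations_closed this]
  obtain h where h: "star_hom projs_algebra B h"
    "\<And>x. x \<in> carrier projs_free \<Longrightarrow> h (projs_ideal +>\<^bsub>projs_free\<^esub> x) = f x"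
    unfolding projs_algebra_eq projs_ideal_eq by blast
  have "h (projs_gen k) = g k" if "1 \<le> k" for k
    unfolding projs_gen_eq using that g(1) by (simp add: h(2) single_proj f(2) B.smult_1)
  with h(1) show ?thesis by blast
qed

lemma projs_generated:
  assumes "star_subalgebra projs_algebra S" "\<And>k. 1 \<le> k \<Longrightarrow> projs_gen k \<in> S"
  shows "S = carrier projs_algebra"
proof -
  let ?k = "\<lambda>f. projs_ideal +>\<^bsub>projs_free\<^esub> f"
  have "{f \<in> carrier projs_free. ?k f \<in> S} = carrier projs_free"
    by (rule projs_free_generated[OF star_subalgebra_vimage[OF projs_free_star_algebra projs_hom assms(1)]])
      (use assms(2) in \<open>auto simp: single_proj projs_gen_eq\<close>)
  moreover have "carrier projs_algebra = ?k ` carrier projs_free"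
    unfolding projs_algebra_eq by (rule carrier_quotient[OF projs_free_star_algebra star_ideal_projs])
  ultimately have "carrier projs_algebra \<subseteq> S" by auto
  then show ?thesis using assms(1) by (auto simp: star_subalgebra_def)
qed

section \<open>Universal property, generators and chain of \<open>H0 A\<close>\<close>

locale plain_star_algebra = star_algebra A for A :: "'a star_algebra"
begin

lemma H0_family_alg: "star_algebra (H0_family A k)"
  by (simp add: H0_family_def star_algebra_transported star_algebra_axioms star_algebra_projs)

sublocale HF: algebra_family "H0_family A"
  by (rule algebra_family.intro) (rule H0_family_alg)

lemma star_algebra_H0_free: "star_algebra (H0_free A)"
  unfolding H0_free_def by (rule HF.star_algebra_free_product)

sublocale HF: star_algebra "H0_free A" by (rule star_algebra_H0_free)

lemma star_hom_H0_free_copy: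
  assumes "1 \<le> k"
  shows "star_hom A (H0_free A) (H0_free_copy A k)"
proof -
  have "star_hom A (H0_family A k) Inl"
    using assms by (simp add: H0_family_def star_hom_transported star_algebra_axioms)
  from star_hom_comp[OF this HF.star_hom_free_product_in]
  show ?thesis unfolding H0_free_def H0_free_copy_def .
qed

lemma star_hom_H0_free_projs:
  "star_hom projs_algebra (H0_free A) (\<lambda>x. free_product_in (H0_family A) 0 (Inr x))"
proof -
  have "star_hom projs_algebra (H0_family A 0) Inr"
    by (simp add: H0_family_def star_hom_transported star_algebra_projs)
  from star_hom_comp[OF this HF.star_hom_free_product_in]
  show ?thesis unfolding H0_free_def .
qed

lemma H0_free_p_closed: "1 \<le> k \<Longrightarrow> H0_free_p A k \<in> carrier (H0_free A)"
  unfolding H0_free_p_def by (intro star_hom_closed[OF star_hom_H0_free_projs] projs_gen_closed)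

lemma H0_free_p_star: "1 \<le> k \<Longrightarrow> star (H0_free A) (H0_free_p A k) = H0_free_p A k"
  unfolding H0_free_p_def
  by (subst star_hom_star[OF star_hom_H0_free_projs, symmetric]) (simp_all add: projs_gen_closed projs_gen_star)

lemma H0_free_p_idem: "1 \<le> k \<Longrightarrow> H0_free_p A k \<otimes>\<^bsub>H0_free A\<^esub> H0_free_p A k = H0_free_p A k"
  unfolding H0_free_p_def
  by (subst star_hom_mult[OF star_hom_H0_free_projs, symmetric]) (simp_all add: projs_gen_closed projs_gen_idem)

lemma H0_free_q_0: "H0_free_q A 0 = \<zero>\<^bsub>H0_free A\<^esub>"
  by (simp add: H0_free_q_def)

lemma H0_free_q_Suc: "H0_free_q A (Suc m) = H0_free_p A (Suc m) \<oplus>\<^bsub>H0_free A\<^esub> H0_free_q A m"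
proof -
  have "{1..Suc m} = insert (Suc m) {1..m}" by auto
  then show ?thesis
    unfolding H0_free_q_def by (simp only:) (subst HF.finsum_insert, auto simp: H0_free_p_closed)
qed

lemma H0_free_q_closed: "H0_free_q A m \<in> carrier (H0_free A)"
  by (induction m) (simp_all add: H0_free_q_0 H0_free_q_Suc H0_free_p_closed)

definition "H0_relations = {(\<one>\<^bsub>H0_free A\<^esub> \<ominus>\<^bsub>H0_free A\<^esub> H0_free_q A m) \<otimes>\<^bsub>H0_free A\<^esub> H0_free_copy A k X
  | k m X. 1 \<le> k \<and> k < m \<and> X \<in> carrier A}"

lemma H0_ideal_eq: "H0_ideal A = star_ideal_generated (H0_free A) H0_relations"
  unfolding H0_ideal_def H0_relations_def ..

lemma H0_relations_closed: "H0_relations \<subseteq> carrier (H0_free A)"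
  unfolding H0_relations_def by (auto simp: H0_free_q_closed star_hom_closed[OF star_hom_H0_free_copy])

lemma star_ideal_H0: "star_ideal (H0_free A) (H0_ideal A)"
  unfolding H0_ideal_eq
  by (rule star_ideal_star_ideal_generated[OF star_algebra_H0_free H0_relations_closed])

lemma star_algebra_H0: "star_algebra (H0 A)"
  unfolding H0_def by (rule star_algebra_quotient[OF star_algebra_H0_free star_ideal_H0])

sublocale H0: star_algebra "H0 A" by (rule star_algebra_H0)

lemmas H0_hom = star_hom_quotient[OF star_algebra_H0_free star_ideal_H0, folded H0_def]
lemmas H0_carrier = carrier_quotient[OF star_algebra_H0_free star_ideal_H0, folded H0_def]

lemma star_hom_H0_copy: "1 \<le> k \<Longrightarrow> star_hom A (H0 A) (H0_copy A k)"
  using star_hom_comp[OF star_hom_H0_free_copy H0_hom] unfolding H0_copy_def .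

lemma H0_p_closed: "1 \<le> k \<Longrightarrow> H0_p A k \<in> carrier (H0 A)"
  unfolding H0_p_def by (intro star_hom_closed[OF H0_hom] H0_free_p_closed)

lemma H0_p_star: "1 \<le> k \<Longrightarrow> star (H0 A) (H0_p A k) = H0_p A k"
  unfolding H0_p_def by (subst star_hom_star[OF H0_hom, symmetric]) (simp_all add: H0_free_p_closed H0_free_p_star)

lemma H0_p_idem: "1 \<le> k \<Longrightarrow> H0_p A k \<otimes>\<^bsub>H0 A\<^esub> H0_p A k = H0_p A k"
  unfolding H0_p_def by (subst star_hom_mult[OF H0_hom, symmetric]) (simp_all add: H0_free_p_closed H0_free_p_idem)

lemma H0_q_0: "H0_q A 0 = \<zero>\<^bsub>H0 A\<^esub>"
  unfolding H0_q_def H0_free_q_0 by (rule star_hom_zero[OF star_algebra_H0_free star_algebra_H0 H0_hom])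

lemma H0_q_1: "H0_q A (Suc 0) = H0_p A (Suc 0)"
  unfolding H0_q_def H0_p_def H0_free_q_Suc H0_free_q_0 by (simp add: H0_free_p_closed)

text \<open>The relation \<open>(1 - q\<^sub>m) X(k) = 0\<close> for the unit \<open>X = 1\<close>, whose copies are all identified with
  the unit of \<open>H0 A\<close>, reads \<open>q\<^sub>m = 1\<close>.\<close>

lemma H0_q_ge_2:
  assumes "2 \<le> m"
  shows "H0_q A m = \<one>\<^bsub>H0 A\<^esub>"
proof -
  have "(\<one>\<^bsub>H0_free A\<^esub> \<ominus>\<^bsub>H0_free A\<^esub> H0_free_q A m) \<otimes>\<^bsub>H0_free A\<^esub> H0_free_copy A 1 \<one>\<^bsub>A\<^esub> \<in> H0_relations"
    unfolding H0_relations_def by (intro CollectI exI conjI, rule refl) (use assms in simp_all)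
  then have "\<one>\<^bsub>H0_free A\<^esub> \<ominus>\<^bsub>H0_free A\<^esub> H0_free_q A m \<in> H0_ideal A"
    unfolding H0_ideal_eq
    using star_ideal_generated_incl[OF star_algebra_H0_free H0_relations_closed]
      star_hom_one[OF star_hom_H0_free_copy, of 1] H0_free_q_closed by auto
  then have "H0_ideal A +>\<^bsub>H0_free A\<^esub> \<one>\<^bsub>H0_free A\<^esub> = H0_q A m"
    unfolding H0_q_def
    using coset_eq_iff[OF star_algebra_H0_free star_ideal_H0 HF.one_closed H0_free_q_closed] by blast
  then show ?thesis using star_hom_one[OF H0_hom] by simp
qed

text \<open>The copies may be represented arbitrarily, together with one projection: as
  \<open>q\<^sub>m\<close> has to become 1 for \<open>m \<ge> 2\<close>, the second projection goes
  to the complement of \<open>P\<close> and the later ones go to 0. All defining relations then hold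
  because their first factor is mapped to 0.\<close>

lemma H0_universal:
  assumes B: "star_algebra B" and \<pi>: "\<And>k. 1 \<le> k \<Longrightarrow> star_hom A B (\<pi> k)"
    and P: "P \<in> carrier B" "star B P = P" "P \<otimes>\<^bsub>B\<^esub> P = P"
  obtains h where "star_hom (H0 A) B h" "\<And>k a. 1 \<le> k \<Longrightarrow> a \<in> carrier A \<Longrightarrow> h (H0_copy A k a) = \<pi> k a"
    "h (H0_p A 1) = P"
proof -
  interpret B: star_algebra B by fact
  define g where "g k = (if k = 1 then P else if k = 2 then \<one>\<^bsub>B\<^esub> \<ominus>\<^bsub>B\<^esub> P else \<zero>\<^bsub>B\<^esub>)" for k :: nat
  have Q: "P \<otimes>\<^bsub>B\<^esub> (\<one>\<^bsub>B\<^esub> \<ominus>\<^bsub>B\<^esub> P) = \<zero>\<^bsub>B\<^esub>" "(\<one>\<^bsub>B\<^esub> \<ominus>\<^bsub>B\<^esub> P) \<otimes>\<^bsub>B\<^esub> P = \<zero>\<^bsub>B\<^esub>"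
    "(\<one>\<^bsub>B\<^esub> \<ominus>\<^bsub>B\<^esub> P) \<otimes>\<^bsub>B\<^esub> (\<one>\<^bsub>B\<^esub> \<ominus>\<^bsub>B\<^esub> P) = \<one>\<^bsub>B\<^esub> \<ominus>\<^bsub>B\<^esub> P" "star B (\<one>\<^bsub>B\<^esub> \<ominus>\<^bsub>B\<^esub> P) = \<one>\<^bsub>B\<^esub> \<ominus>\<^bsub>B\<^esub> P"
    using P by (simp_all add: a_minus_def B.r_distr B.l_distr B.r_minus B.l_minus B.r_neg B.l_neg
      B.star_add B.star_minus B.star_one)
  have g: "g k \<in> carrier B" "star B (g k) = g k" "g k \<otimes>\<^bsub>B\<^esub> g l = (if k = l then g k else \<zero>\<^bsub>B\<^esub>)" for k l
    using P Q by (auto simp: g_def B.star_zero)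
  obtain h0 where h0: "star_hom projs_algebra B h0" "\<And>k. 1 \<le> k \<Longrightarrow> h0 (projs_gen k) = g k"
    using projs_universal[OF B, of g, OF g] by blast
  \<comment> \<open>The factors of the free product are tagged copies in a sum type, hence the
    inverses of the injections.\<close>
  define H where "H k = (if k = 0 then (\<lambda>x. h0 (inv_into (carrier projs_algebra) Inr x))
    else (\<lambda>x. \<pi> k (inv_into (carrier A) Inl x)))" for k
  have H: "star_hom (H0_family A k) B (H k)" for k
    using \<pi>[of k] star_hom_comp[OF star_hom_inv_transported[OF star_algebra_projs] h0(1), of Inr]
      star_hom_comp[OF star_hom_inv_transported[OF star_algebra_axioms], of Inl B "\<pi> k"]
    by (auto simp: H_def H0_family_def)
  obtain f where f: "star_hom (H0_free A) B f"
    "\<And>k x. x \<in> carrier (H0_family A k) \<Longrightarrow> f (free_product_in (H0_family A) k x) = H k x"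
    using HF.free_product_universal[OF B H] unfolding H0_free_def by metis
  have fc: "f (H0_free_copy A k a) = \<pi> k a" if "1 \<le> k" "a \<in> carrier A" for k a
    using that unfolding H0_free_copy_def by (subst f(2)) (simp_all add: H0_family_def carrier_transported H_def)
  have fp: "f (H0_free_p A k) = g k" if "1 \<le> k" for k
    using that projs_gen_closed[OF that] unfolding H0_free_p_def
    by (subst f(2)) (simp_all add: H0_family_def carrier_transported H_def h0(2))
  have f0: "f \<zero>\<^bsub>H0_free A\<^esub> = \<zero>\<^bsub>B\<^esub>" by (rule star_hom_zero[OF star_algebra_H0_free B f(1)])
  have fq: "f (H0_free_q A m) = \<one>\<^bsub>B\<^esub>" if "2 \<le> m" for m
    using that
  proof (induction m rule: dec_induct)
    case base
    have "f (H0_free_q A (Suc (Suc 0))) = (\<one>\<^bsub>B\<^esub> \<ominus>\<^bsub>B\<^esub> P) \<oplus>\<^bsub>B\<^esub> P"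
      using P by (simp add: H0_free_q_Suc H0_free_q_0 star_hom_add[OF f(1)] H0_free_p_closed fp f0 g_def)
    also have "\<dots> = \<one>\<^bsub>B\<^esub>" using P by (simp add: a_minus_def B.a_assoc B.l_neg)
    finally show ?case by (simp add: numeral_2_eq_2)
  next
    case (step m)
    then show ?case
      by (simp add: H0_free_q_Suc star_hom_add[OF f(1)] H0_free_p_closed H0_free_q_closed fp g_def)
  qed
  have "f r = \<zero>\<^bsub>B\<^esub>" if r: "r \<in> H0_relations" for r
  proof -
    obtain k m X where "1 \<le> k" "k < m" "X \<in> carrier A"
      "r = (\<one>\<^bsub>H0_free A\<^esub> \<ominus>\<^bsub>H0_free A\<^esub> H0_free_q A m) \<otimes>\<^bsub>H0_free A\<^esub> H0_free_copy A k X"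
      using r by (auto simp: H0_relations_def)
    moreover from this have "f (\<one>\<^bsub>H0_free A\<^esub> \<ominus>\<^bsub>H0_free A\<^esub> H0_free_q A m) = \<zero>\<^bsub>B\<^esub>"
      using fq[of m] star_hom_diff[OF star_algebra_H0_free B f(1) HF.one_closed H0_free_q_closed[of m]]
        B.r_neg[OF B.one_closed] by (simp add: star_hom_one[OF f(1)] a_minus_def[of B])
    ultimately show ?thesis
      by (simp add: star_hom_mult[OF f(1)] H0_free_q_closed star_hom_closed[OF star_hom_H0_free_copy]
        fc star_hom_closed[OF \<pi>])
  qed
  from quotient_universal[OF star_algebra_H0_free B f(1) H0_relations_closed this]
  obtain h where h: "star_hom (H0 A) B h"
    "\<And>x. x \<in> carrier (H0_free A) \<Longrightarrow> h (H0_ideal A +>\<^bsub>H0_free A\<^esub> x) = f x"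
    unfolding H0_def H0_ideal_eq by blast
  show thesis
  proof (rule that[OF h(1)])
    show "h (H0_copy A k a) = \<pi> k a" if "1 \<le> k" "a \<in> carrier A" for k a
      using that unfolding H0_copy_def by (simp add: h(2) star_hom_closed[OF star_hom_H0_free_copy] fc)
    show "h (H0_p A 1) = P"
      unfolding H0_p_def using fp[of 1] by (simp add: h(2) H0_free_p_closed g_def)
  qed
qed

lemma H0_generated:
  assumes S: "star_subalgebra (H0 A) S" and p: "\<And>k. 1 \<le> k \<Longrightarrow> H0_p A k \<in> S"
    and copy: "\<And>k a. 1 \<le> k \<Longrightarrow> a \<in> carrier A \<Longrightarrow> H0_copy A k a \<in> S"
  shows "S = carrier (H0 A)"
proof -
  let ?k = "\<lambda>f. H0_ideal A +>\<^bsub>H0_free A\<^esub> f"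
  let ?S = "{f \<in> carrier (H0_free A). ?k f \<in> S}"
  have S': "star_subalgebra (H0_free A) ?S"
    by (rule star_subalgebra_vimage[OF star_algebra_H0_free H0_hom S])
  \<comment> \<open>The factor with index 0 is generated by its projections, so that it lies in the
    preimage of \<open>S\<close> as soon as these do.\<close>
  have proj: "x \<in> {x \<in> carrier projs_algebra. free_product_in (H0_family A) 0 (Inr x) \<in> ?S}"
    if "x \<in> carrier projs_algebra" for x
  proof -
    have "{x \<in> carrier projs_algebra. free_product_in (H0_family A) 0 (Inr x) \<in> ?S} = carrier projs_algebra"
      using p H0_free_p_closed
      by (intro projs_generated[OF star_subalgebra_vimage[OF star_algebra_projs star_hom_H0_free_projs S']])
        (auto simp: projs_gen_closed H0_p_def H0_free_p_def)
    then show ?thesis using that by blast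
  qed
  have "?S = carrier (H0_free A)"
    unfolding H0_free_def
  proof (rule HF.free_product_generated[OF S'[unfolded H0_free_def]])
    fix k x assume x: "x \<in> carrier (H0_family A k)"
    show "free_product_in (H0_family A) k x \<in> {f \<in> carrier (free_product (H0_family A)).
      H0_ideal A +>\<^bsub>free_product (H0_family A)\<^esub> f \<in> S}"
    proof (cases "k = 0")
      case True
      then obtain y where "y \<in> carrier projs_algebra" "x = Inr y"
        using x by (auto simp: H0_family_def carrier_transported)
      then show ?thesis using proj[of y] True by (simp add: H0_free_def)
    next
      case False
      then obtain a where a: "a \<in> carrier A" "x = Inl a"
        using x by (auto simp: H0_family_def carrier_transported)
      then have "H0_free_copy A k a \<in> ?S"
        using copy[of k a] False star_hom_closed[OF star_hom_H0_free_copy, of k a] by (simp add: H0_copy_def)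
      then show ?thesis using a by (simp add: H0_free_def H0_free_copy_def)
    qed
  qed
  then have "carrier (H0 A) \<subseteq> S" by (auto simp: H0_carrier)
  then show ?thesis using S by (auto simp: star_subalgebra_def)
qed

text \<open>Every generator lies in some stage, so that the union of the increasing stages is the
  whole algebra. The chain collapses from index 2 on because \<open>q\<^sub>m\<close> is the unit
  there.\<close>

lemma short_chain_H0: "short_chain (H0 A) (H0_filt A) (H0_q A)"
proof -
  let ?G = "\<lambda>m. {H0_p A j | j. j \<ge> 1} \<union> {H0_copy A k X | k X. 1 \<le> k \<and> k \<le> m \<and> X \<in> carrier A}"
  have G: "?G m \<subseteq> carrier (H0 A)" for m
    using H0_p_closed star_hom_closed[OF star_hom_H0_copy] by auto
  have sub: "star_subalgebra (H0 A) (H0_filt A m)" for m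
    unfolding H0_filt_def by (rule star_subalgebra_star_subalgebra_generated[OF star_algebra_H0 G])
  have mono: "H0_filt A m \<subseteq> H0_filt A n" if "m \<le> n" for m n
    unfolding H0_filt_def by (rule star_subalgebra_generated_mono) (use that le_trans in blast)
  have incl: "?G m \<subseteq> H0_filt A m" for m
    unfolding H0_filt_def by (rule star_subalgebra_generated_incl)
  have "(\<Union>m. H0_filt A m) = carrier (H0 A)"
  proof (rule H0_generated[OF star_subalgebra_directed_Union[OF sub mono]])
    show "H0_p A k \<in> (\<Union>m. H0_filt A m)" if "1 \<le> k" for k using incl[of 0] that by blast
    show "H0_copy A k a \<in> (\<Union>m. H0_filt A m)" if "1 \<le> k" "a \<in> carrier A" for k a
      using incl[of k] that by blast
  qed
  with sub mono show ?thesis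
    by unfold_locales (simp_all add: H0_q_0 H0_q_1 H0_p_closed H0_p_idem H0_q_ge_2)
qed

text \<open>Truth values as indices let negation switch the copy and let a parity test select it,
  odd parity standing for the first copy.\<close>

definition "copy2 \<epsilon> a = H0_copy A (if \<epsilon> then 1 else 2) a"

lemma star_hom_copy2: "star_hom A (H0 A) (copy2 \<epsilon>)"
  unfolding copy2_def using star_hom_H0_copy[of 1] star_hom_H0_copy[of 2] by (cases \<epsilon>) simp_all

lemma H0_state:
  assumes \<mu>: "state A \<mu>"
  obtains \<phi> where "state (H0 A) \<phi>"
    "\<And>\<epsilon> a. a \<in> carrier A \<Longrightarrow> \<phi> (copy2 \<epsilon> a) = \<mu> a"
    "\<And>\<epsilon> as. as \<noteq> [] \<Longrightarrow> \<forall>a\<in>set as. a \<in> carrier A \<and> \<mu> a = 0 \<Longrightarrow> \<phi> (alt_prod (H0 A) copy2 \<epsilon> as) = 0"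
    "\<And>\<epsilon> as u. u \<in> carrier (H0 A) \<Longrightarrow> \<forall>a\<in>set as. a \<in> carrier A \<and> \<mu> a = 0 \<Longrightarrow>
      \<phi> (u \<otimes>\<^bsub>H0 A\<^esub> (H0_p A 1 \<otimes>\<^bsub>H0 A\<^esub> alt_prod (H0 A) copy2 \<epsilon> as)) =
        (if odd (length as) then \<phi> (u \<otimes>\<^bsub>H0 A\<^esub> alt_prod (H0 A) copy2 \<epsilon> as) else 0)"
proof -
  interpret S: algebra_with_state A \<mu> by unfold_locales (rule \<mu>)
  obtain \<omega> where \<omega>: "state S.E \<omega>"
    "\<And>\<epsilon> a. a \<in> carrier A \<Longrightarrow> \<omega> (S.\<pi> \<epsilon> a) = \<mu> a"
    "\<And>\<epsilon> as. as \<noteq> [] \<Longrightarrow> \<forall>a\<in>set as. a \<in> carrier A \<and> \<mu> a = 0 \<Longrightarrow> \<omega> (alt_prod S.E S.\<pi> \<epsilon> as) = 0"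
    "\<And>\<epsilon> as u. u \<in> carrier S.E \<Longrightarrow> \<forall>a\<in>set as. a \<in> carrier A \<and> \<mu> a = 0 \<Longrightarrow>
      \<omega> (u \<otimes>\<^bsub>S.E\<^esub> (S.P \<otimes>\<^bsub>S.E\<^esub> alt_prod S.E S.\<pi> \<epsilon> as)) =
        (if odd (length as) then \<omega> (u \<otimes>\<^bsub>S.E\<^esub> alt_prod S.E S.\<pi> \<epsilon> as) else 0)"
  proof (rule S.parity_state)
    fix \<omega> assume "state S.E \<omega>"
      "\<And>\<epsilon> a. a \<in> carrier A \<Longrightarrow> \<omega> (S.\<pi> \<epsilon> a) = \<mu> a"
      "\<And>\<epsilon> as. as \<noteq> [] \<Longrightarrow> \<forall>a\<in>set as. a \<in> carrier A \<and> \<mu> a = 0 \<Longrightarrow> \<omega> (alt_prod S.E S.\<pi> \<epsilon> as) = 0"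
      "\<And>\<epsilon> as u. u \<in> carrier S.E \<Longrightarrow> \<forall>a\<in>set as. a \<in> carrier A \<and> \<mu> a = 0 \<Longrightarrow>
        \<omega> (u \<otimes>\<^bsub>S.E\<^esub> (S.P \<otimes>\<^bsub>S.E\<^esub> alt_prod S.E S.\<pi> \<epsilon> as)) =
          (if odd (length as) then \<omega> (u \<otimes>\<^bsub>S.E\<^esub> alt_prod S.E S.\<pi> \<epsilon> as) else 0)"
    then show thesis by (rule that)
  qed
  \<comment> \<open>All copies have to be represented; those after the first one are all sent to the
    second copy of the word model.\<close>
  obtain h where h: "star_hom (H0 A) S.E h"
    "\<And>k a. 1 \<le> k \<Longrightarrow> a \<in> carrier A \<Longrightarrow> h (H0_copy A k a) = S.\<pi> (k = 1) a" "h (H0_p A 1) = S.P"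
  proof (rule H0_universal[OF S.star_algebra_E S.star_hom_\<pi> S.P_closed S.P_star S.P_idem])
    fix h assume "star_hom (H0 A) S.E h"
      "\<And>k a. 1 \<le> k \<Longrightarrow> a \<in> carrier A \<Longrightarrow> h (H0_copy A k a) = S.\<pi> (k = 1) a" "h (H0_p A 1) = S.P"
    then show thesis by (rule that)
  qed
  have hc: "h (copy2 \<epsilon> a) = S.\<pi> \<epsilon> a" if "a \<in> carrier A" for \<epsilon> a
    using h(2)[of 1 a] h(2)[of 2 a] that by (cases \<epsilon>) (simp_all add: copy2_def)
  have ap: "alt_prod (H0 A) copy2 \<epsilon> as \<in> carrier (H0 A)" "h (alt_prod (H0 A) copy2 \<epsilon> as) = alt_prod S.E S.\<pi> \<epsilon> as"
    if as: "\<forall>a\<in>set as. a \<in> carrier A \<and> \<mu> a = 0" for \<epsilon> as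
  proof -
    have c: "copy2 \<epsilon> a \<in> carrier (H0 A)" if "a \<in> set as" for \<epsilon> a
      using as that star_hom_closed[OF star_hom_copy2] by blast
    show "alt_prod (H0 A) copy2 \<epsilon> as \<in> carrier (H0 A)" by (rule H0.alt_prod_closed[OF c])
    have "alt_prod S.E (\<lambda>\<epsilon> a. h (copy2 \<epsilon> a)) \<epsilon> as = alt_prod S.E S.\<pi> \<epsilon> as"
      using as by (induction as arbitrary: \<epsilon>) (simp_all add: hc)
    then show "h (alt_prod (H0 A) copy2 \<epsilon> as) = alt_prod S.E S.\<pi> \<epsilon> as"
      using star_hom_alt_prod[OF star_algebra_H0 h(1), of as copy2 \<epsilon>] c by simp
  qed
  show thesis
  proof (rule that[OF state_star_hom[OF star_algebra_H0 h(1) \<omega>(1)]])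
    show "\<omega> (h (copy2 \<epsilon> a)) = \<mu> a" if "a \<in> carrier A" for \<epsilon> a using that by (simp add: hc \<omega>(2))
    show "\<omega> (h (alt_prod (H0 A) copy2 \<epsilon> as)) = 0"
      if "as \<noteq> []" "\<forall>a\<in>set as. a \<in> carrier A \<and> \<mu> a = 0" for \<epsilon> as
      unfolding ap(2)[OF that(2)] by (rule \<omega>(3)[OF that])
    show "\<omega> (h (u \<otimes>\<^bsub>H0 A\<^esub> (H0_p A 1 \<otimes>\<^bsub>H0 A\<^esub> alt_prod (H0 A) copy2 \<epsilon> as))) =
        (if odd (length as) then \<omega> (h (u \<otimes>\<^bsub>H0 A\<^esub> alt_prod (H0 A) copy2 \<epsilon> as)) else 0)"
      if u: "u \<in> carrier (H0 A)" and as: "\<forall>a\<in>set as. a \<in> carrier A \<and> \<mu> a = 0" for u \<epsilon> as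
    proof -
      have "h (u \<otimes>\<^bsub>H0 A\<^esub> (H0_p A 1 \<otimes>\<^bsub>H0 A\<^esub> alt_prod (H0 A) copy2 \<epsilon> as)) =
        h u \<otimes>\<^bsub>S.E\<^esub> (S.P \<otimes>\<^bsub>S.E\<^esub> alt_prod S.E S.\<pi> \<epsilon> as)"
        by (simp only: star_hom_mult[OF h(1)] u ap[OF as] h(3) H0.m_closed H0_p_closed order_refl)
      moreover have "h (u \<otimes>\<^bsub>H0 A\<^esub> alt_prod (H0 A) copy2 \<epsilon> as) = h u \<otimes>\<^bsub>S.E\<^esub> alt_prod S.E S.\<pi> \<epsilon> as"
        by (simp only: star_hom_mult[OF h(1)] u ap[OF as])
      ultimately show ?thesis using \<omega>(4)[OF star_hom_closed[OF h(1) u] as] by simp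
    qed
  qed
qed

end

section \<open>Functionals on free products\<close>

lemma vanishes_on_alternatingI:
  assumes "\<And>xs. xs \<noteq> [] \<Longrightarrow> alternating S T xs \<or> alternating T S xs \<Longrightarrow> \<phi> (list_prod A xs) = 0"
  shows "vanishes_on_alternating A \<phi> S T"
  using assms by (simp add: vanishes_on_alternating_def)

text \<open>It lifts alternating lists from the image of a homomorphism to its domain, where the
  vanishing of the state is known.\<close>

lemma alternating_image:
  "alternating (f ` S) (f ` T) xs \<Longrightarrow> \<exists>ys. alternating S T ys \<and> xs = map f ys"
proof (induction xs arbitrary: S T)
  case (Cons x xs)
  then obtain y where "y \<in> S" "x = f y" by auto
  moreover obtain ys where "alternating T S ys" "xs = map f ys" using Cons.IH[of T S] Cons.prems by auto
  ultimately show ?case by (intro exI[of _ "y # ys"]) simp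
qed simp

lemma alternating_set: "alternating S T xs \<Longrightarrow> set xs \<subseteq> S \<union> T"
  by (induction xs arbitrary: S T) auto

text \<open>With only two indices, different neighbours means alternation.\<close>

lemma alternating_map_distinct_adj:
  assumes "distinct_adj (map fst w)" "w = [] \<or> fst (hd w) = b" "\<And>i x. (i, x) \<in> set w \<Longrightarrow> g (i, x) \<in> S i"
  shows "alternating (S b) (S (\<not> b)) (map g w)"
  using assms
proof (induction w arbitrary: b)
  case (Cons l w)
  obtain i x where l: "l = (i, x)" by (cases l)
  have "alternating (S (\<not> b)) (S (\<not> \<not> b)) (map g w)"
    by (rule Cons.IH) (use Cons.prems l in \<open>cases w; auto\<close>)+
  then show ?case using Cons.prems l by simp
qed simp

lemma distinct_adj_split:
  "\<not> distinct_adj xs \<Longrightarrow> \<exists>us x vs. xs = us @ [x, x] @ vs"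
proof (induction xs)
  case (Cons x xs)
  show ?case
  proof (cases "distinct_adj xs")
    case True
    then obtain vs where "xs = x # vs" using Cons.prems by (cases xs) auto
    then have "x # xs = [] @ [x, x] @ vs" by simp
    then show ?thesis by blast
  next
    case False
    then obtain us y vs where "xs = us @ [y, y] @ vs" using Cons.IH by blast
    then have "x # xs = (x # us) @ [y, y] @ vs" by simp
    then show ?thesis by blast
  qed
qed simp

context algebra_family
begin

abbreviation "FP \<equiv> free_product F"

definition word_val :: "('i \<times> 'c) list \<Rightarrow> (('i \<times> 'c) list \<Rightarrow>\<^sub>0 complex) set" where
  "word_val w = list_prod FP (map (\<lambda>(i, x). free_product_in F i x) w)"

sublocale FP: star_algebra FP by (rule star_algebra_free_product)

lemma letters_closed: "w \<in> lists letters \<Longrightarrow> set (map (\<lambda>(i, x). free_product_in F i x) w) \<subseteq> carrier FP"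
  using star_hom_closed[OF star_hom_free_product_in] by auto

lemma word_val_closed: "w \<in> lists letters \<Longrightarrow> word_val w \<in> carrier FP"
  unfolding word_val_def by (intro FP.list_prod_closed letters_closed)

lemma word_val_append:
  "v \<in> lists letters \<Longrightarrow> w \<in> lists letters \<Longrightarrow> word_val (v @ w) = word_val v \<otimes>\<^bsub>FP\<^esub> word_val w"
  unfolding word_val_def map_append by (intro FP.list_prod_append letters_closed)

lemma word_val_Cons: "word_val ((i, x) # w) = free_product_in F i x \<otimes>\<^bsub>FP\<^esub> word_val w"
  by (simp add: word_val_def)

text \<open>A word with a letter that is not centred splits into one with fewer such letters and a shorter
  one; two neighbouring letters from the same factor merge.\<close>

lemma linear_functional_eq_zero:
  fixes D :: "_ \<Rightarrow> complex"
  assumes add: "\<And>x y. x \<in> carrier FP \<Longrightarrow> y \<in> carrier FP \<Longrightarrow> D (x \<oplus>\<^bsub>FP\<^esub> y) = D x + D y"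
    and smult: "\<And>c x. x \<in> carrier FP \<Longrightarrow> D (c \<odot>\<^bsub>FP\<^esub> x) = c * D x"
    and one: "D \<one>\<^bsub>FP\<^esub> = 0"
    and \<tau>: "\<And>i. state (F i) (\<tau> i)"
    and alt: "\<And>w. w \<noteq> [] \<Longrightarrow> w \<in> lists letters \<Longrightarrow> distinct_adj (map fst w) \<Longrightarrow>
      (\<And>i x. (i, x) \<in> set w \<Longrightarrow> \<tau> i x = 0) \<Longrightarrow> D (word_val w) = 0"
    and z: "z \<in> carrier FP"
  shows "D z = 0"
proof -
  have words: "D (word_val w) = 0" if "w \<in> lists letters" for w
    using that
  \<comment> \<open>Centring a letter keeps the length in one summand and shortens the other. The
    induction on the length therefore contains a second one, at fixed length, on the number
    \<open>N\<close> of letters that are not centred.\<close>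
  proof (induction "length w" arbitrary: w rule: less_induct)
    case outer: less
    define N where "N w = length (filter (\<lambda>(i, x). \<tau> i x \<noteq> 0) w)" for w
    have "D (word_val v) = 0" if "length v = length w" "v \<in> lists letters" for v
      using that
    proof (induction "N v" arbitrary: v rule: less_induct)
      case inner: less
      show ?case
      proof (cases "\<exists>(i, x) \<in> set v. \<tau> i x \<noteq> 0")
        case True
        then obtain i x where ix: "(i, x) \<in> set v" "\<tau> i x \<noteq> 0" by blast
        then obtain us vs where v: "v = us @ (i, x) # vs" by (meson split_list)
        have l: "us \<in> lists letters" "vs \<in> lists letters" "x \<in> carrier (F i)" using inner.prems(2) v by auto
        interpret Fi: star_algebra "F i" by (rule alg)
        define y where "y = x \<ominus>\<^bsub>F i\<^esub> \<tau> i x \<odot>\<^bsub>F i\<^esub> \<one>\<^bsub>F i\<^esub>"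
        have y: "y \<in> carrier (F i)" using l by (simp add: y_def Fi.smult_closed)
        have \<tau>y: "\<tau> i y = 0"
          using l by (simp add: y_def Fi.state_diff[OF \<tau>] Fi.smult_closed state_smult[OF \<tau>] state_one[OF \<tau>])
        have x: "x = y \<oplus>\<^bsub>F i\<^esub> \<tau> i x \<odot>\<^bsub>F i\<^esub> \<one>\<^bsub>F i\<^esub>"
          using l by (simp add: y_def a_minus_def Fi.a_assoc Fi.l_neg Fi.smult_closed)
        note h = star_homD[OF star_hom_free_product_in]
        have "free_product_in F i x = free_product_in F i y \<oplus>\<^bsub>FP\<^esub> \<tau> i x \<odot>\<^bsub>FP\<^esub> \<one>\<^bsub>FP\<^esub>"
          using y Fi.one_closed Fi.smult_closed by (subst x) (simp only: h)
        moreover have c: "word_val us \<in> carrier FP" "word_val vs \<in> carrier FP" "free_product_in F i y \<in> carrier FP"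
          using l y by (simp_all add: word_val_closed h)
        ultimately have "word_val v = word_val us \<otimes>\<^bsub>FP\<^esub> (free_product_in F i y \<otimes>\<^bsub>FP\<^esub> word_val vs)
            \<oplus>\<^bsub>FP\<^esub> \<tau> i x \<odot>\<^bsub>FP\<^esub> (word_val us \<otimes>\<^bsub>FP\<^esub> word_val vs)"
          using l unfolding v
          by (simp add: word_val_append word_val_Cons FP.l_distr FP.r_distr FP.smult_closed
            FP.smult_mult_left FP.smult_mult_right)
        also have "\<dots> = word_val (us @ (i, y) # vs) \<oplus>\<^bsub>FP\<^esub> \<tau> i x \<odot>\<^bsub>FP\<^esub> word_val (us @ vs)"
          using l y by (simp add: word_val_append word_val_Cons)
        finally have "D (word_val v) = D (word_val (us @ (i, y) # vs)) + \<tau> i x * D (word_val (us @ vs))"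
          using l y by (simp add: add smult word_val_closed FP.smult_closed)
        moreover have "D (word_val (us @ (i, y) # vs)) = 0"
          by (rule inner.hyps) (use ix \<tau>y inner.prems l y in \<open>auto simp: N_def v\<close>)
        moreover have "D (word_val (us @ vs)) = 0"
          by (rule outer.hyps) (use inner.prems l in \<open>auto simp: v\<close>)
        ultimately show ?thesis by simp
      next
        case False
        then have cen: "\<tau> i x = 0" if "(i, x) \<in> set v" for i x using that by blast
        show ?thesis
        proof (cases "v = []")
          case True
          then show ?thesis using one by (simp add: word_val_def)
        next
          case ne: False
          show ?thesis
          proof (cases "distinct_adj (map fst v)")
            case True
            then show ?thesis using alt[OF ne inner.prems(2)] cen by blast
          next
            case False
            then obtain ks i js where "map fst v = ks @ [i, i] @ js" using distinct_adj_split by blast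
            then obtain us x y vs where v: "v = us @ (i, x) # (i, y) # vs"
              by (auto simp: map_eq_append_conv)
            have l: "us \<in> lists letters" "vs \<in> lists letters" "x \<in> carrier (F i)" "y \<in> carrier (F i)"
              using inner.prems(2) v by auto
            interpret Fi: star_algebra "F i" by (rule alg)
            have "word_val v = word_val (us @ (i, x \<otimes>\<^bsub>F i\<^esub> y) # vs)"
              using l unfolding v
              by (simp add: word_val_append word_val_Cons star_hom_mult[OF star_hom_free_product_in] FP.m_assoc
                word_val_closed star_hom_closed[OF star_hom_free_product_in])
            also have "D \<dots> = 0"
              by (rule outer.hyps) (use inner.prems l in \<open>auto simp: v\<close>)
            finally show ?thesis .
          qed
        qed
      qed
    qed
    then show ?case using outer.prems by blast
  qed
  obtain f where f: "f \<in> carrier (free_product_letters F)"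
    "z = free_product_ideal F +>\<^bsub>free_product_letters F\<^esub> f"
    using z by (auto simp: quot_carrier)
  have "Poly_Mapping.keys f \<subseteq> lists letters" using f(1) by (simp add: letters_carrier)
  then have "D (free_product_ideal F +>\<^bsub>free_product_letters F\<^esub> f) = 0"
  proof (induction rule: poly_mapping_span_induct)
    case zero
    have "free_product_ideal F +>\<^bsub>free_product_letters F\<^esub> 0 = \<zero>\<^bsub>FP\<^esub>"
      using star_hom_zero[OF letters_star_algebra star_algebra_free_product quot_hom] by (simp add: letters_zero)
    moreover have "D \<zero>\<^bsub>FP\<^esub> = 0" using add[of "\<zero>\<^bsub>FP\<^esub>" "\<zero>\<^bsub>FP\<^esub>"] by simp
    ultimately show ?case by simp
  next
    case (single w c)
    have sw: "Poly_Mapping.single w 1 \<in> carrier (free_product_letters F)" using single by (simp add: letters_carrier)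
    have "Poly_Mapping.single w c = c \<odot>\<^bsub>free_product_letters F\<^esub> Poly_Mapping.single w 1" by (simp add: letters_smult)
    then have "free_product_ideal F +>\<^bsub>free_product_letters F\<^esub> Poly_Mapping.single w c = c \<odot>\<^bsub>FP\<^esub> word_val w"
      using star_hom_smult[OF quot_hom sw] free_product_word[OF single] by (simp add: word_val_def)
    then show ?case using single words by (simp add: smult word_val_closed)
  next
    case (add f g)
    then have "f \<in> carrier (free_product_letters F)" "g \<in> carrier (free_product_letters F)" by (simp_all add: letters_carrier)
    then have "D (free_product_ideal F +>\<^bsub>free_product_letters F\<^esub> (f \<oplus>\<^bsub>free_product_letters F\<^esub> g)) =
      D (free_product_ideal F +>\<^bsub>free_product_letters F\<^esub> f) + D (free_product_ideal F +>\<^bsub>free_product_letters F\<^esub> g)"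
      by (simp add: star_hom_add[OF quot_hom] assms(1) star_hom_closed[OF quot_hom])
    then show ?case using add by (simp add: letters_add)
  qed
  then show ?thesis using f by simp
qed

end

section \<open>The free product of two algebras and its state\<close>

context algebra_pair
begin

lemma pair_family_alg: "star_algebra (pair_family A B i)"
  by (simp add: pair_family_def star_algebra_transported A.star_algebra_axioms B.star_algebra_axioms)

sublocale PF: algebra_family "pair_family A B"
  by (rule algebra_family.intro) (rule pair_family_alg)

lemma star_algebra_free_product2: "star_algebra (free_product2 A B)"
  unfolding free_product2_def by (rule PF.star_algebra_free_product)

sublocale FP2: star_algebra "free_product2 A B" by (rule star_algebra_free_product2)

lemma star_hom_free_inl: "star_hom A (free_product2 A B) (free_inl A B)"
proof -
  have "star_hom A (pair_family A B True) Inl"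
    by (simp add: pair_family_def star_hom_transported A.star_algebra_axioms)
  from star_hom_comp[OF this PF.star_hom_free_product_in]
  show ?thesis unfolding free_product2_def free_inl_def .
qed

lemma star_hom_free_inr: "star_hom B (free_product2 A B) (free_inr A B)"
proof -
  have "star_hom B (pair_family A B False) Inr"
    by (simp add: pair_family_def star_hom_transported B.star_algebra_axioms)
  from star_hom_comp[OF this PF.star_hom_free_product_in]
  show ?thesis unfolding free_product2_def free_inr_def .
qed

lemma free_product2_universal:
  assumes C: "star_algebra C" and f: "star_hom A C f" and g: "star_hom B C g"
  obtains h where "star_hom (free_product2 A B) C h"
    "\<And>a. a \<in> carrier A \<Longrightarrow> h (free_inl A B a) = f a" "\<And>b. b \<in> carrier B \<Longrightarrow> h (free_inr A B b) = g b"
proof -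
  define H where "H i = (if i then (\<lambda>x. f (inv_into (carrier A) Inl x)) else (\<lambda>x. g (inv_into (carrier B) Inr x)))" for i
  have H: "star_hom (pair_family A B i) C (H i)" for i
    using star_hom_comp[OF star_hom_inv_transported[OF A.star_algebra_axioms] f, of Inl]
      star_hom_comp[OF star_hom_inv_transported[OF B.star_algebra_axioms] g, of Inr]
    by (auto simp: H_def pair_family_def)
  show thesis
  proof (rule PF.free_product_universal[OF C H])
    fix h assume h: "star_hom (free_product (pair_family A B)) C h"
      "\<And>i x. x \<in> carrier (pair_family A B i) \<Longrightarrow> h (free_product_in (pair_family A B) i x) = H i x"
    show thesis
    proof (rule that)
      show "star_hom (free_product2 A B) C h" using h(1) by (simp add: free_product2_def)
      show "h (free_inl A B a) = f a" if "a \<in> carrier A" for a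
        using that unfolding free_inl_def by (subst h(2)) (simp_all add: pair_family_def carrier_transported H_def)
      show "h (free_inr A B b) = g b" if "b \<in> carrier B" for b
        using that unfolding free_inr_def by (subst h(2)) (simp_all add: pair_family_def carrier_transported H_def)
    qed
  qed
qed

text \<open>The condition in the definite description of \<open>free_product_state\<close> apart
  from extensionality, so that it can be verified for a functional given by a formula.\<close>

definition "free_state \<mu> \<nu> \<theta> \<longleftrightarrow> state (free_product2 A B) \<theta> \<and>
  (\<forall>a\<in>carrier A. \<theta> (free_inl A B a) = \<mu> a) \<and> (\<forall>b\<in>carrier B. \<theta> (free_inr A B b) = \<nu> b) \<and>
  vanishes_on_alternating (free_product2 A B) \<theta>
    (free_inl A B ` {a \<in> carrier A. \<mu> a = 0}) (free_inr A B ` {b \<in> carrier B. \<nu> b = 0})"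

text \<open>The difference of two such functionals is linear and vanishes at the unit and on
  alternating words of centred letters; every element is reduced to these.\<close>

lemma free_state_unique:
  assumes \<mu>: "state A \<mu>" and \<nu>: "state B \<nu>" and \<theta>: "free_state \<mu> \<nu> \<theta>" and \<theta>': "free_state \<mu> \<nu> \<theta>'"
    and z: "z \<in> carrier (free_product2 A B)"
  shows "\<theta> z = \<theta>' z"
proof -
  \<comment> \<open>The given states, read on the tagged copies of the two algebras in the sum
    type.\<close>
  define \<tau> where "\<tau> i = (if i then (\<lambda>x. \<mu> (inv_into (carrier A) Inl x)) else (\<lambda>x. \<nu> (inv_into (carrier B) Inr x)))" for i
  have \<tau>: "state (pair_family A B i) (\<tau> i)" for i
    using state_star_hom[OF star_algebra_transported star_hom_inv_transported \<mu>, of Inl]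
      state_star_hom[OF star_algebra_transported star_hom_inv_transported \<nu>, of Inr]
    by (auto simp: \<tau>_def pair_family_def A.star_algebra_axioms B.star_algebra_axioms)
  let ?S = "\<lambda>i. if i then free_inl A B ` {a \<in> carrier A. \<mu> a = 0} else free_inr A B ` {b \<in> carrier B. \<nu> b = 0}"
  have st: "state (free_product2 A B) \<theta>" "state (free_product2 A B) \<theta>'" using \<theta> \<theta>' by (simp_all add: free_state_def)
  have van: "\<theta>'' (PF.word_val w) = 0"
    if "free_state \<mu> \<nu> \<theta>''" and w: "w \<noteq> []" "w \<in> lists PF.letters" "distinct_adj (map fst w)"
      "\<And>i x. (i, x) \<in> set w \<Longrightarrow> \<tau> i x = 0" for \<theta>'' w
  proof -
    define b where "b = fst (hd w)"
    have "alternating (?S b) (?S (\<not> b)) (map (\<lambda>(i, x). free_product_in (pair_family A B) i x) w)"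
    proof (rule alternating_map_distinct_adj[OF w(3)])
      fix i x assume ix: "(i, x) \<in> set w"
      then have x: "x \<in> carrier (pair_family A B i)" "\<tau> i x = 0" using w(2,4) by auto
      show "(case (i, x) of (i, x) \<Rightarrow> free_product_in (pair_family A B) i x) \<in> ?S i"
      proof (cases i)
        case True
        then obtain a where "a \<in> carrier A" "x = Inl a" using x by (auto simp: pair_family_def carrier_transported)
        then show ?thesis using x True by (auto simp: \<tau>_def free_inl_def)
      next
        case False
        then obtain a where "a \<in> carrier B" "x = Inr a" using x by (auto simp: pair_family_def carrier_transported)
        then show ?thesis using x False by (auto simp: \<tau>_def free_inr_def)
      qed
    qed (simp add: b_def)
    then have "alternating (?S True) (?S False) (map (\<lambda>(i, x). free_product_in (pair_family A B) i x) w) \<or>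
      alternating (?S False) (?S True) (map (\<lambda>(i, x). free_product_in (pair_family A B) i x) w)"
      by (cases b) simp_all
    then show ?thesis
      using that(1) w(1) unfolding free_state_def vanishes_on_alternating_def PF.word_val_def free_product2_def
      by simp
  qed
  have "\<theta> z - \<theta>' z = 0"
  proof (rule PF.linear_functional_eq_zero[where \<tau> = \<tau>])
    show "\<theta> (PF.word_val w) - \<theta>' (PF.word_val w) = 0"
      if "w \<noteq> []" "w \<in> lists PF.letters" "distinct_adj (map fst w)"
        "\<And>i x. (i, x) \<in> set w \<Longrightarrow> \<tau> i x = 0" for w
      using van[OF \<theta> that] van[OF \<theta>' that] by simp
  qed (use z st \<tau> in \<open>simp_all add: state_def free_product2_def algebra_simps\<close>)
  then show ?thesis by simp
qed

text \<open>Restriction to the carrier makes the functional extensional without affecting its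
  properties; by uniqueness it is then the one described.\<close>

lemma free_product_state_eq:
  assumes \<mu>: "state A \<mu>" and \<nu>: "state B \<nu>" and \<theta>: "free_state \<mu> \<nu> \<theta>" and z: "z \<in> carrier (free_product2 A B)"
  shows "free_product_state A B \<mu> \<nu> z = \<theta> z"
proof -
  let ?C = "carrier (free_product2 A B)"
  let ?S = "free_inl A B ` {a \<in> carrier A. \<mu> a = 0}" and ?T = "free_inr A B ` {b \<in> carrier B. \<nu> b = 0}"
  have sub: "?S \<subseteq> ?C" "?T \<subseteq> ?C"
    using star_hom_closed[OF star_hom_free_inl] star_hom_closed[OF star_hom_free_inr] by auto
  have ext: "free_state \<mu> \<nu> (restrict \<theta> ?C)"
    unfolding free_state_def
  proof (intro conjI ballI vanishes_on_alternatingI)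
    show "state (free_product2 A B) (restrict \<theta> ?C)"
      using \<theta> by (simp add: free_state_def state_def FP2.smult_closed FP2.star_closed)
    fix xs assume xs: "xs \<noteq> []" "alternating ?S ?T xs \<or> alternating ?T ?S xs"
    then have "set xs \<subseteq> ?C" using alternating_set sub by blast
    then have "list_prod (free_product2 A B) xs \<in> ?C" by (rule FP2.list_prod_closed)
    then show "restrict \<theta> ?C (list_prod (free_product2 A B) xs) = 0"
      using \<theta> xs by (simp add: free_state_def vanishes_on_alternating_def)
  qed (use \<theta> star_hom_closed[OF star_hom_free_inl] star_hom_closed[OF star_hom_free_inr] in \<open>auto simp: free_state_def\<close>)
  have "free_product_state A B \<mu> \<nu> = (THE \<phi>. \<phi> \<in> extensional ?C \<and> free_state \<mu> \<nu> \<phi>)"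
    unfolding free_product_state_def free_state_def by simp
  also have "\<dots> = restrict \<theta> ?C"
  proof (rule the_equality)
    fix \<phi> assume \<phi>: "\<phi> \<in> extensional ?C \<and> free_state \<mu> \<nu> \<phi>"
    show "\<phi> = restrict \<theta> ?C"
      by (rule extensionalityI[of _ ?C]) (use \<phi> free_state_unique[OF \<mu> \<nu> _ \<theta>] in auto)
  qed (use ext in simp)
  finally show ?thesis using z by simp
qed

end

section \<open>Freeness in the tensor product\<close>

lemma alternating_subset:
  assumes "alternating S R xs \<or> alternating R S xs" "S \<subseteq> C" "R \<subseteq> C"
  shows "set xs \<subseteq> C"
  using assms alternating_set[of S R xs] alternating_set[of R S xs] by fastforce

text \<open>The projection \<open>Q\<close> commutes with both ranges, so that the map is
  \<open>h\<close> on the corner of \<open>Q\<close> and \<open>h'\<close> on the complementary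
  corner. Cross terms contain the product of \<open>Q\<close> with its complement and
  vanish.\<close>

lemma star_hom_combine:
  assumes A: "star_algebra A" and T: "star_algebra T" and h: "star_hom A T h" "star_hom A T h'"
    and Q: "Q \<in> carrier T" "star T Q = Q" "Q \<otimes>\<^bsub>T\<^esub> Q = Q"
    and comm: "\<And>a. a \<in> carrier A \<Longrightarrow> h a \<otimes>\<^bsub>T\<^esub> Q = Q \<otimes>\<^bsub>T\<^esub> h a"
      "\<And>a. a \<in> carrier A \<Longrightarrow> h' a \<otimes>\<^bsub>T\<^esub> Q = Q \<otimes>\<^bsub>T\<^esub> h' a"
  shows "star_hom A T (\<lambda>a. h a \<otimes>\<^bsub>T\<^esub> Q \<oplus>\<^bsub>T\<^esub> h' a \<otimes>\<^bsub>T\<^esub> (\<one>\<^bsub>T\<^esub> \<ominus>\<^bsub>T\<^esub> Q))"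
proof -
  interpret A: star_algebra A by fact
  interpret T: star_algebra T by fact
  define R where "R = \<one>\<^bsub>T\<^esub> \<ominus>\<^bsub>T\<^esub> Q"
  have R: "R \<in> carrier T" "star T R = R" "R \<otimes>\<^bsub>T\<^esub> R = R" "Q \<otimes>\<^bsub>T\<^esub> R = \<zero>\<^bsub>T\<^esub>" "R \<otimes>\<^bsub>T\<^esub> Q = \<zero>\<^bsub>T\<^esub>"
    "R \<oplus>\<^bsub>T\<^esub> Q = \<one>\<^bsub>T\<^esub>"
    using Q by (simp_all add: R_def a_minus_def T.r_distr T.l_distr T.r_minus T.l_minus T.r_neg T.l_neg
      T.star_add T.star_minus T.star_one T.a_assoc)
  have commR: "h' a \<otimes>\<^bsub>T\<^esub> R = R \<otimes>\<^bsub>T\<^esub> h' a" if "a \<in> carrier A" for a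
    using comm(2)[OF that] that star_hom_closed[OF h(2)] Q(1)
    by (simp add: R_def a_minus_def T.r_distr T.l_distr T.r_minus T.l_minus)
  note hs = star_homD[OF h(1)] star_homD[OF h(2)]
  show ?thesis
    unfolding R_def[symmetric]
  proof (rule star_homI)
    fix a b c assume a: "a \<in> carrier A"
    show "h a \<otimes>\<^bsub>T\<^esub> Q \<oplus>\<^bsub>T\<^esub> h' a \<otimes>\<^bsub>T\<^esub> R \<in> carrier T" using a Q R by (simp add: hs)
    show "h (c \<odot>\<^bsub>A\<^esub> a) \<otimes>\<^bsub>T\<^esub> Q \<oplus>\<^bsub>T\<^esub> h' (c \<odot>\<^bsub>A\<^esub> a) \<otimes>\<^bsub>T\<^esub> R =
        c \<odot>\<^bsub>T\<^esub> (h a \<otimes>\<^bsub>T\<^esub> Q \<oplus>\<^bsub>T\<^esub> h' a \<otimes>\<^bsub>T\<^esub> R)"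
      using a Q R by (simp add: hs T.smult_mult_left T.smult_add_right)
    show "h (star A a) \<otimes>\<^bsub>T\<^esub> Q \<oplus>\<^bsub>T\<^esub> h' (star A a) \<otimes>\<^bsub>T\<^esub> R =
        star T (h a \<otimes>\<^bsub>T\<^esub> Q \<oplus>\<^bsub>T\<^esub> h' a \<otimes>\<^bsub>T\<^esub> R)"
      using a Q R comm[OF A.star_closed[OF a]] commR[OF A.star_closed[OF a]]
      by (simp add: hs T.star_add T.star_mult)
    assume b: "b \<in> carrier A"
    have c: "h a \<in> carrier T" "h b \<in> carrier T" "h' a \<in> carrier T" "h' b \<in> carrier T"
      using a b by (simp_all add: hs)
    show "h (a \<oplus>\<^bsub>A\<^esub> b) \<otimes>\<^bsub>T\<^esub> Q \<oplus>\<^bsub>T\<^esub> h' (a \<oplus>\<^bsub>A\<^esub> b) \<otimes>\<^bsub>T\<^esub> R =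
        h a \<otimes>\<^bsub>T\<^esub> Q \<oplus>\<^bsub>T\<^esub> h' a \<otimes>\<^bsub>T\<^esub> R \<oplus>\<^bsub>T\<^esub> (h b \<otimes>\<^bsub>T\<^esub> Q \<oplus>\<^bsub>T\<^esub> h' b \<otimes>\<^bsub>T\<^esub> R)"
      using a b c Q R by (simp add: hs T.l_distr T.a_ac)
    have x: "(x \<otimes>\<^bsub>T\<^esub> U) \<otimes>\<^bsub>T\<^esub> (y \<otimes>\<^bsub>T\<^esub> V) = (x \<otimes>\<^bsub>T\<^esub> y) \<otimes>\<^bsub>T\<^esub> (U \<otimes>\<^bsub>T\<^esub> V)"
      if "y \<otimes>\<^bsub>T\<^esub> U = U \<otimes>\<^bsub>T\<^esub> y" "x \<in> carrier T" "y \<in> carrier T" "U \<in> carrier T" "V \<in> carrier T" for x y U V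
    proof -
      have "(x \<otimes>\<^bsub>T\<^esub> U) \<otimes>\<^bsub>T\<^esub> (y \<otimes>\<^bsub>T\<^esub> V) = x \<otimes>\<^bsub>T\<^esub> ((U \<otimes>\<^bsub>T\<^esub> y) \<otimes>\<^bsub>T\<^esub> V)"
        using that(2-) by (simp add: T.m_assoc)
      also have "\<dots> = x \<otimes>\<^bsub>T\<^esub> ((y \<otimes>\<^bsub>T\<^esub> U) \<otimes>\<^bsub>T\<^esub> V)" by (simp only: that(1))
      finally show ?thesis using that(2-) by (simp add: T.m_assoc)
    qed
    have hR: "h b \<otimes>\<^bsub>T\<^esub> R = R \<otimes>\<^bsub>T\<^esub> h b" using comm(1)[OF b] c Q(1)
      by (simp add: R_def a_minus_def T.r_distr T.l_distr T.r_minus T.l_minus)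
    have "(h a \<otimes>\<^bsub>T\<^esub> Q \<oplus>\<^bsub>T\<^esub> h' a \<otimes>\<^bsub>T\<^esub> R) \<otimes>\<^bsub>T\<^esub> (h b \<otimes>\<^bsub>T\<^esub> Q \<oplus>\<^bsub>T\<^esub> h' b \<otimes>\<^bsub>T\<^esub> R) =
        ((h a \<otimes>\<^bsub>T\<^esub> Q) \<otimes>\<^bsub>T\<^esub> (h b \<otimes>\<^bsub>T\<^esub> Q) \<oplus>\<^bsub>T\<^esub> (h a \<otimes>\<^bsub>T\<^esub> Q) \<otimes>\<^bsub>T\<^esub> (h' b \<otimes>\<^bsub>T\<^esub> R)) \<oplus>\<^bsub>T\<^esub>
        ((h' a \<otimes>\<^bsub>T\<^esub> R) \<otimes>\<^bsub>T\<^esub> (h b \<otimes>\<^bsub>T\<^esub> Q) \<oplus>\<^bsub>T\<^esub> (h' a \<otimes>\<^bsub>T\<^esub> R) \<otimes>\<^bsub>T\<^esub> (h' b \<otimes>\<^bsub>T\<^esub> R))"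
      using c Q(1) R(1) by (simp add: T.l_distr T.r_distr T.a_ac)
    also have "\<dots> = h a \<otimes>\<^bsub>T\<^esub> h b \<otimes>\<^bsub>T\<^esub> Q \<oplus>\<^bsub>T\<^esub> h' a \<otimes>\<^bsub>T\<^esub> h' b \<otimes>\<^bsub>T\<^esub> R"
      unfolding x[OF comm(1)[OF b] c(1,2) Q(1) Q(1)] x[OF comm(2)[OF b] c(1,4) Q(1) R(1)]
        x[OF hR c(3,2) R(1) Q(1)] x[OF commR[OF b] c(3,4) R(1) R(1)] Q(3) R(3,4,5)
      using c Q(1) R(1) by simp
    finally show "h (a \<otimes>\<^bsub>A\<^esub> b) \<otimes>\<^bsub>T\<^esub> Q \<oplus>\<^bsub>T\<^esub> h' (a \<otimes>\<^bsub>A\<^esub> b) \<otimes>\<^bsub>T\<^esub> R =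
        (h a \<otimes>\<^bsub>T\<^esub> Q \<oplus>\<^bsub>T\<^esub> h' a \<otimes>\<^bsub>T\<^esub> R) \<otimes>\<^bsub>T\<^esub> (h b \<otimes>\<^bsub>T\<^esub> Q \<oplus>\<^bsub>T\<^esub> h' b \<otimes>\<^bsub>T\<^esub> R)"
      using a b by (simp add: hs)
  next
    show "h \<one>\<^bsub>A\<^esub> \<otimes>\<^bsub>T\<^esub> Q \<oplus>\<^bsub>T\<^esub> h' \<one>\<^bsub>A\<^esub> \<otimes>\<^bsub>T\<^esub> R = \<one>\<^bsub>T\<^esub>"
      using Q R T.a_comm[OF Q(1) R(1)] by (simp add: hs)
  qed
qed

context star_algebra
begin

text \<open>Equality modulo the left kernel of \<open>\<theta>\<close>, that is, equality of the vectors in the GNS space.\<close>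

definition vec_eq :: "('a \<Rightarrow> complex) \<Rightarrow> 'a \<Rightarrow> 'a \<Rightarrow> bool" where
  "vec_eq \<theta> z w \<longleftrightarrow> (\<forall>y\<in>carrier A. \<theta> (y \<otimes> z) = \<theta> (y \<otimes> w))"

lemma vec_eq_refl: "vec_eq \<theta> z z"
  by (simp add: vec_eq_def)

lemma vec_eq_trans: "vec_eq \<theta> x y \<Longrightarrow> vec_eq \<theta> y z \<Longrightarrow> vec_eq \<theta> x z"
  by (simp add: vec_eq_def)

text \<open>The left kernel is a left ideal, so that congruences are multiplied from the left, and
  products are evaluated starting from their right end.\<close>

lemma vec_eq_mult:
  "vec_eq \<theta> z w \<Longrightarrow> x \<in> carrier A \<Longrightarrow> z \<in> carrier A \<Longrightarrow> w \<in> carrier A \<Longrightarrow> vec_eq \<theta> (x \<otimes> z) (x \<otimes> w)"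
  by (simp add: vec_eq_def flip: m_assoc)

lemma vec_eq_value:
  assumes "vec_eq \<theta> z w" "z \<in> carrier A" "w \<in> carrier A"
  shows "\<theta> z = \<theta> w"
  using assms(1)[unfolded vec_eq_def, rule_format, OF one_closed] assms(2,3) by simp

text \<open>On a vector where \<open>Q\<close> acts as 1 or as 0, the element controlled by
  \<open>Q\<close> reduces to the branch that is selected.\<close>

lemma vec_eq_combine:
  assumes \<theta>: "state A \<theta>" and c: "x \<in> carrier A" "x' \<in> carrier A" "Q \<in> carrier A" "w \<in> carrier A"
    and Q: "vec_eq \<theta> (Q \<otimes> w) (if b then w else \<zero>)"
  shows "vec_eq \<theta> ((x \<otimes> Q \<oplus> x' \<otimes> (\<one> \<ominus> Q)) \<otimes> w) ((if b then x else x') \<otimes> w)"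
  unfolding vec_eq_def
proof
  fix y assume y: "y \<in> carrier A"
  have q: "\<theta> (v \<otimes> (Q \<otimes> w)) = (if b then \<theta> (v \<otimes> w) else 0)" if "v \<in> carrier A" for v
    using Q that by (simp add: vec_eq_def state_zero[OF \<theta>] split: if_splits)
  have "y \<otimes> ((x \<otimes> Q \<oplus> x' \<otimes> (\<one> \<ominus> Q)) \<otimes> w) =
      (y \<otimes> x) \<otimes> (Q \<otimes> w) \<oplus> ((y \<otimes> x') \<otimes> w \<ominus> (y \<otimes> x') \<otimes> (Q \<otimes> w))"
    using c y by (simp add: a_minus_def l_distr r_distr l_minus r_minus m_assoc)
  then have "\<theta> (y \<otimes> ((x \<otimes> Q \<oplus> x' \<otimes> (\<one> \<ominus> Q)) \<otimes> w)) =
      \<theta> ((y \<otimes> x) \<otimes> (Q \<otimes> w)) + (\<theta> ((y \<otimes> x') \<otimes> w) - \<theta> ((y \<otimes> x') \<otimes> (Q \<otimes> w)))"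
    using c y by (simp add: state_add[OF \<theta>] state_diff[OF \<theta>])
  also have "\<dots> = \<theta> ((y \<otimes> (if b then x else x')) \<otimes> w)"
    using c y by (simp add: q)
  finally show "\<theta> (y \<otimes> ((x \<otimes> Q \<oplus> x' \<otimes> (\<one> \<ominus> Q)) \<otimes> w)) = \<theta> (y \<otimes> ((if b then x else x') \<otimes> w))"
    using c y by (simp add: m_assoc)
qed

end

locale plain_pair = A: plain_star_algebra A + B: plain_star_algebra B
  for A :: "'a star_algebra" and B :: "'b star_algebra"
begin

sublocale AB: algebra_pair A B ..
sublocale XY: algebra_pair "H0 A" "H0 B" ..

abbreviation "X \<equiv> H0 A"
abbreviation "Y \<equiv> H0 B"
abbreviation "T \<equiv> tensor_product (H0 A) (H0 B)"
abbreviation "tens \<equiv> tensor_elem (H0 A) (H0 B)"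

definition "PA = tens (H0_p A 1) \<one>\<^bsub>Y\<^esub>"
definition "PB = tens \<one>\<^bsub>X\<^esub> (H0_p B 1)"
definition "jA a = tens (A.copy2 True a) \<one>\<^bsub>Y\<^esub> \<otimes>\<^bsub>T\<^esub> PB \<oplus>\<^bsub>T\<^esub> tens (A.copy2 False a) \<one>\<^bsub>Y\<^esub> \<otimes>\<^bsub>T\<^esub> (\<one>\<^bsub>T\<^esub> \<ominus>\<^bsub>T\<^esub> PB)"
definition "jB b = tens \<one>\<^bsub>X\<^esub> (B.copy2 True b) \<otimes>\<^bsub>T\<^esub> PA \<oplus>\<^bsub>T\<^esub> tens \<one>\<^bsub>X\<^esub> (B.copy2 False b) \<otimes>\<^bsub>T\<^esub> (\<one>\<^bsub>T\<^esub> \<ominus>\<^bsub>T\<^esub> PA)"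

lemma pA: "H0_p A 1 \<in> carrier X" "star X (H0_p A 1) = H0_p A 1" "H0_p A 1 \<otimes>\<^bsub>X\<^esub> H0_p A 1 = H0_p A 1"
  using A.H0_p_closed A.H0_p_star A.H0_p_idem by simp_all

lemma pB: "H0_p B 1 \<in> carrier Y" "star Y (H0_p B 1) = H0_p B 1" "H0_p B 1 \<otimes>\<^bsub>Y\<^esub> H0_p B 1 = H0_p B 1"
  using B.H0_p_closed B.H0_p_star B.H0_p_idem by simp_all

lemma copyA_closed: "a \<in> carrier A \<Longrightarrow> A.copy2 \<epsilon> a \<in> carrier X"
  by (rule star_hom_closed[OF A.star_hom_copy2])

lemma copyB_closed: "b \<in> carrier B \<Longrightarrow> B.copy2 \<epsilon> b \<in> carrier Y"
  by (rule star_hom_closed[OF B.star_hom_copy2])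

lemma PA_PB_closed: "PA \<in> carrier T" "PB \<in> carrier T"
  unfolding PA_def PB_def by (rule XY.elem_closed[OF pA(1) B.H0.one_closed], rule XY.elem_closed[OF A.H0.one_closed pB(1)])

lemma star_hom_jA: "star_hom A T jA"
proof -
  have hom: "star_hom A T (\<lambda>a. tens (A.copy2 \<epsilon> a) \<one>\<^bsub>Y\<^esub>)" for \<epsilon>
    by (rule star_hom_comp[OF A.star_hom_copy2 XY.star_hom_elem_left])
  have Q: "star T PB = PB" "PB \<otimes>\<^bsub>T\<^esub> PB = PB"
    unfolding PB_def using XY.elem_star[OF A.H0.one_closed pB(1)] XY.elem_mult[OF A.H0.one_closed A.H0.one_closed pB(1) pB(1)]
    by (simp_all only: pB A.H0.star_one A.H0.l_one A.H0.one_closed)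
  have "tens (A.copy2 \<epsilon> a) \<one>\<^bsub>Y\<^esub> \<otimes>\<^bsub>T\<^esub> PB = PB \<otimes>\<^bsub>T\<^esub> tens (A.copy2 \<epsilon> a) \<one>\<^bsub>Y\<^esub>" if "a \<in> carrier A" for a \<epsilon>
    unfolding PB_def using copyA_closed[OF that, of \<epsilon>] pB(1)
    by (simp only: XY.elem_mult A.H0.one_closed B.H0.one_closed A.H0.l_one A.H0.r_one B.H0.l_one B.H0.r_one)
  then show ?thesis
    unfolding jA_def
    by (intro star_hom_combine[OF A.star_algebra_axioms XY.star_algebra_tensor_product hom hom PA_PB_closed(2) Q])
qed

lemma star_hom_jB: "star_hom B T jB"
proof -
  have hom: "star_hom B T (\<lambda>b. tens \<one>\<^bsub>X\<^esub> (B.copy2 \<epsilon> b))" for \<epsilon>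
    by (rule star_hom_comp[OF B.star_hom_copy2 XY.star_hom_elem_right])
  have Q: "star T PA = PA" "PA \<otimes>\<^bsub>T\<^esub> PA = PA"
    unfolding PA_def using XY.elem_star[OF pA(1) B.H0.one_closed] XY.elem_mult[OF pA(1) pA(1) B.H0.one_closed B.H0.one_closed]
    by (simp_all only: pA B.H0.star_one B.H0.l_one B.H0.one_closed)
  have "tens \<one>\<^bsub>X\<^esub> (B.copy2 \<epsilon> b) \<otimes>\<^bsub>T\<^esub> PA = PA \<otimes>\<^bsub>T\<^esub> tens \<one>\<^bsub>X\<^esub> (B.copy2 \<epsilon> b)" if "b \<in> carrier B" for b \<epsilon>
    unfolding PA_def using copyB_closed[OF that, of \<epsilon>] pA(1)
    by (simp only: XY.elem_mult A.H0.one_closed B.H0.one_closed A.H0.l_one A.H0.r_one B.H0.l_one B.H0.r_one)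
  then show ?thesis
    unfolding jB_def
    by (intro star_hom_combine[OF B.star_algebra_axioms XY.star_algebra_tensor_product hom hom PA_PB_closed(1) Q])
qed

text \<open>The only intermediate projection is the tensor of the two first projections, and from
  index 2 on both factors are 1. An elementary tensor lies in the stage with the larger of the
  indices of its factors.\<close>

lemma short_chain_tensor:
  "short_chain T (\<lambda>m. tensor_subalgebra X Y (H0_filt A m) (H0_filt B m)) (\<lambda>m. tens (H0_q A m) (H0_q B m))"
proof -
  interpret SA: short_chain X "H0_filt A" "H0_q A" by (rule A.short_chain_H0)
  interpret SB: short_chain Y "H0_filt B" "H0_q B" by (rule B.short_chain_H0)
  let ?G = "\<lambda>m. {tens a b | a b. a \<in> H0_filt A m \<and> b \<in> H0_filt B m}"
  let ?F = "\<lambda>m. tensor_subalgebra X Y (H0_filt A m) (H0_filt B m)"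
  have G: "?G m \<subseteq> carrier T" for m
    using SA.F_simps(1) SB.F_simps(1) XY.elem_closed by blast
  have sub: "star_subalgebra T (?F m)" for m
    unfolding tensor_subalgebra_def
    by (rule star_subalgebra_star_subalgebra_generated[OF XY.star_algebra_tensor_product G])
  have mono: "?F m \<subseteq> ?F n" if "m \<le> n" for m n
    unfolding tensor_subalgebra_def
    by (rule star_subalgebra_generated_mono) (use SA.F_mono[OF that] SB.F_mono[OF that] in blast)
  have incl: "?G m \<subseteq> ?F m" for m
    unfolding tensor_subalgebra_def by (rule star_subalgebra_generated_incl)
  have U: "star_subalgebra T (\<Union>m. ?F m)" by (rule star_subalgebra_directed_Union[OF sub mono])
  have "w \<in> (\<Union>m. ?F m)" if "w \<in> carrier T" for w
    using that
  proof (induction rule: XY.T_induct)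
    case (elem a b)
    obtain k l where "a \<in> H0_filt A k" "b \<in> H0_filt B l"
      using elem SA.F_Union SB.F_Union by blast
    then have "a \<in> H0_filt A (max k l)" "b \<in> H0_filt B (max k l)"
      using SA.F_mono[of k "max k l"] SB.F_mono[of l "max k l"] by auto
    then have "tens a b \<in> ?F (max k l)" using incl[of "max k l"] by blast
    then show ?case by blast
  next
    case (add v w)
    then show ?case using U unfolding star_subalgebra_def by blast
  qed
  moreover have "(\<Union>m. ?F m) \<subseteq> carrier T" using U by (simp add: star_subalgebra_def)
  ultimately have "(\<Union>m. ?F m) = carrier T" by blast
  with sub mono show ?thesis
    by unfold_locales
      (simp_all add: SA.c_0 SB.c_0 SA.c_1 SB.c_1 SA.c_ge_2 SB.c_ge_2 XY.elem_closed XY.elem_mult XY.elem_zero XY.elem_one)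
qed

end

text \<open>On the vector given by alternating words of lengths \<open>m\<close> in the first and \<open>n\<close> in the second
  tensor factor, the projections \<open>PA\<close> and \<open>PB\<close> are the parities of \<open>m\<close> and \<open>n\<close>. Hence \<open>jA a\<close> acts as the
  copy of \<open>a\<close> selected by the parity of \<open>n\<close>, and \<open>jB b\<close> as the copy of \<open>b\<close> selected by the parity of \<open>m\<close>;
  in an alternating product of centred factors the selected copy is always the one that prolongs the word.\<close>

locale coupling = plain_pair A B
  for A :: "'a star_algebra" and B :: "'b star_algebra" +
  fixes \<mu> :: "'a \<Rightarrow> complex" and \<nu> :: "'b \<Rightarrow> complex"
    and \<phi> :: "'a H0 \<Rightarrow> complex" and \<psi> :: "'b H0 \<Rightarrow> complex"
    and \<Theta> :: "('a, 'b) H0_tensor \<Rightarrow> complex"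
  assumes \<phi>: "state (H0 A) \<phi>"
    and \<phi>_copy: "a \<in> carrier A \<Longrightarrow> \<phi> (A.copy2 \<epsilon> a) = \<mu> a"
    and \<phi>_alt: "as \<noteq> [] \<Longrightarrow> \<forall>a\<in>set as. a \<in> carrier A \<and> \<mu> a = 0 \<Longrightarrow> \<phi> (alt_prod (H0 A) A.copy2 \<epsilon> as) = 0"
    and \<phi>_parity: "u \<in> carrier (H0 A) \<Longrightarrow> \<forall>a\<in>set as. a \<in> carrier A \<and> \<mu> a = 0 \<Longrightarrow>
      \<phi> (u \<otimes>\<^bsub>H0 A\<^esub> (H0_p A 1 \<otimes>\<^bsub>H0 A\<^esub> alt_prod (H0 A) A.copy2 \<epsilon> as)) =
        (if odd (length as) then \<phi> (u \<otimes>\<^bsub>H0 A\<^esub> alt_prod (H0 A) A.copy2 \<epsilon> as) else 0)"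
    and \<psi>: "state (H0 B) \<psi>"
    and \<psi>_copy: "b \<in> carrier B \<Longrightarrow> \<psi> (B.copy2 \<epsilon> b) = \<nu> b"
    and \<psi>_alt: "bs \<noteq> [] \<Longrightarrow> \<forall>b\<in>set bs. b \<in> carrier B \<and> \<nu> b = 0 \<Longrightarrow> \<psi> (alt_prod (H0 B) B.copy2 \<epsilon> bs) = 0"
    and \<psi>_parity: "v \<in> carrier (H0 B) \<Longrightarrow> \<forall>b\<in>set bs. b \<in> carrier B \<and> \<nu> b = 0 \<Longrightarrow>
      \<psi> (v \<otimes>\<^bsub>H0 B\<^esub> (H0_p B 1 \<otimes>\<^bsub>H0 B\<^esub> alt_prod (H0 B) B.copy2 \<epsilon> bs)) =
        (if odd (length bs) then \<psi> (v \<otimes>\<^bsub>H0 B\<^esub> alt_prod (H0 B) B.copy2 \<epsilon> bs) else 0)"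
    and \<Theta>: "state (tensor_product (H0 A) (H0 B)) \<Theta>"
    and \<Theta>_elem: "u \<in> carrier (H0 A) \<Longrightarrow> v \<in> carrier (H0 B) \<Longrightarrow> \<Theta> (tensor_elem (H0 A) (H0 B) u v) = \<phi> u * \<psi> v"
begin

abbreviation "cenA as \<equiv> \<forall>a\<in>set as. a \<in> carrier A \<and> \<mu> a = 0"
abbreviation "cenB bs \<equiv> \<forall>b\<in>set bs. b \<in> carrier B \<and> \<nu> b = 0"
abbreviation "wA \<equiv> alt_prod X A.copy2"
abbreviation "wB \<equiv> alt_prod Y B.copy2"

lemma wA_closed: "cenA as \<Longrightarrow> wA \<epsilon> as \<in> carrier X"
  by (rule A.H0.alt_prod_closed) (simp add: copyA_closed)

lemma wB_closed: "cenB bs \<Longrightarrow> wB \<delta> bs \<in> carrier Y"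
  by (rule B.H0.alt_prod_closed) (simp add: copyB_closed)

text \<open>Both sides are additive in the test element, and elementary tensors span.\<close>

lemma vec_eqI:
  assumes z: "z \<in> carrier T" "w \<in> carrier T"
    and "\<And>u v. u \<in> carrier X \<Longrightarrow> v \<in> carrier Y \<Longrightarrow> \<Theta> (tens u v \<otimes>\<^bsub>T\<^esub> z) = \<Theta> (tens u v \<otimes>\<^bsub>T\<^esub> w)"
  shows "XY.T.vec_eq \<Theta> z w"
  unfolding XY.T.vec_eq_def
proof
  fix y assume "y \<in> carrier T"
  then show "\<Theta> (y \<otimes>\<^bsub>T\<^esub> z) = \<Theta> (y \<otimes>\<^bsub>T\<^esub> w)"
    by (induction rule: XY.T_induct) (simp_all add: assms XY.T.l_distr state_add[OF \<Theta>])
qed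

text \<open>On elementary tensors \<open>\<Theta>\<close> factors, which leaves the parity property
  of \<open>\<phi>\<close> with an arbitrary test element \<open>u\<close> and does not touch the
  second factor.\<close>

lemma PA_word:
  assumes "cenA as" "cenB bs"
  shows "XY.T.vec_eq \<Theta> (PA \<otimes>\<^bsub>T\<^esub> tens (wA \<epsilon> as) (wB \<delta> bs)) (if odd (length as) then tens (wA \<epsilon> as) (wB \<delta> bs) else \<zero>\<^bsub>T\<^esub>)"
proof (rule vec_eqI)
  note c = wA_closed[OF assms(1), of \<epsilon>] wB_closed[OF assms(2), of \<delta>]
  show "PA \<otimes>\<^bsub>T\<^esub> tens (wA \<epsilon> as) (wB \<delta> bs) \<in> carrier T"
    "(if odd (length as) then tens (wA \<epsilon> as) (wB \<delta> bs) else \<zero>\<^bsub>T\<^esub>) \<in> carrier T"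
    using c by (simp_all add: PA_PB_closed XY.elem_closed)
  fix u v assume uv: "u \<in> carrier X" "v \<in> carrier Y"
  show "\<Theta> (tens u v \<otimes>\<^bsub>T\<^esub> (PA \<otimes>\<^bsub>T\<^esub> tens (wA \<epsilon> as) (wB \<delta> bs))) =
      \<Theta> (tens u v \<otimes>\<^bsub>T\<^esub> (if odd (length as) then tens (wA \<epsilon> as) (wB \<delta> bs) else \<zero>\<^bsub>T\<^esub>))"
    unfolding PA_def using uv c pA(1) \<phi>_parity[OF uv(1) assms(1), of \<epsilon>]
    by (simp add: XY.elem_mult XY.elem_closed \<Theta>_elem XY.T.state_zero[OF \<Theta>])
qed

lemma PB_word:
  assumes "cenA as" "cenB bs"
  shows "XY.T.vec_eq \<Theta> (PB \<otimes>\<^bsub>T\<^esub> tens (wA \<epsilon> as) (wB \<delta> bs)) (if odd (length bs) then tens (wA \<epsilon> as) (wB \<delta> bs) else \<zero>\<^bsub>T\<^esub>)"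
proof (rule vec_eqI)
  note c = wA_closed[OF assms(1), of \<epsilon>] wB_closed[OF assms(2), of \<delta>]
  show "PB \<otimes>\<^bsub>T\<^esub> tens (wA \<epsilon> as) (wB \<delta> bs) \<in> carrier T"
    "(if odd (length bs) then tens (wA \<epsilon> as) (wB \<delta> bs) else \<zero>\<^bsub>T\<^esub>) \<in> carrier T"
    using c by (simp_all add: PA_PB_closed XY.elem_closed)
  fix u v assume uv: "u \<in> carrier X" "v \<in> carrier Y"
  show "\<Theta> (tens u v \<otimes>\<^bsub>T\<^esub> (PB \<otimes>\<^bsub>T\<^esub> tens (wA \<epsilon> as) (wB \<delta> bs))) =
      \<Theta> (tens u v \<otimes>\<^bsub>T\<^esub> (if odd (length bs) then tens (wA \<epsilon> as) (wB \<delta> bs) else \<zero>\<^bsub>T\<^esub>))"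
    unfolding PB_def using uv c pB(1) \<psi>_parity[OF uv(2) assms(2), of \<delta>]
    by (simp add: XY.elem_mult XY.elem_closed \<Theta>_elem XY.T.state_zero[OF \<Theta>])
qed

text \<open>The parity of \<open>bs\<close> selects the copy \<open>odd (length bs)\<close> for the
  new letter. It prolongs the word because the old word starts with the opposite copy, the flag
  \<open>even (length bs)\<close>.\<close>

lemma jA_word:
  assumes "cenA (a # as)" "cenB bs"
  shows "XY.T.vec_eq \<Theta> (jA a \<otimes>\<^bsub>T\<^esub> tens (wA (even (length bs)) as) (wB \<delta> bs))
    (tens (wA (odd (length bs)) (a # as)) (wB \<delta> bs))"
proof -
  have as: "cenA as" and a: "a \<in> carrier A" using assms(1) by auto
  note c = wA_closed[OF as, of "even (length bs)"] wB_closed[OF assms(2), of \<delta>] copyA_closed[OF a]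
  have "tens (wA (odd (length bs)) (a # as)) (wB \<delta> bs) =
      (if odd (length bs) then tens (A.copy2 True a) \<one>\<^bsub>Y\<^esub> else tens (A.copy2 False a) \<one>\<^bsub>Y\<^esub>)
        \<otimes>\<^bsub>T\<^esub> tens (wA (even (length bs)) as) (wB \<delta> bs)"
    using c by (cases "odd (length bs)") (simp_all add: XY.elem_mult)
  then show ?thesis
    unfolding jA_def
    using XY.T.vec_eq_combine[OF \<Theta> _ _ _ _ PB_word[OF as assms(2)]] c
    by (simp only: XY.elem_closed PA_PB_closed B.H0.one_closed)
qed

lemma jB_word:
  assumes "cenA as" "cenB (b # bs)"
  shows "XY.T.vec_eq \<Theta> (jB b \<otimes>\<^bsub>T\<^esub> tens (wA \<epsilon> as) (wB (even (length as)) bs))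
    (tens (wA \<epsilon> as) (wB (odd (length as)) (b # bs)))"
proof -
  have bs: "cenB bs" and b: "b \<in> carrier B" using assms(2) by auto
  note c = wA_closed[OF assms(1), of \<epsilon>] wB_closed[OF bs, of "even (length as)"] copyB_closed[OF b]
  have "tens (wA \<epsilon> as) (wB (odd (length as)) (b # bs)) =
      (if odd (length as) then tens \<one>\<^bsub>X\<^esub> (B.copy2 True b) else tens \<one>\<^bsub>X\<^esub> (B.copy2 False b))
        \<otimes>\<^bsub>T\<^esub> tens (wA \<epsilon> as) (wB (even (length as)) bs)"
    using c by (cases "odd (length as)") (simp_all add: XY.elem_mult)
  then show ?thesis
    unfolding jB_def
    using XY.T.vec_eq_combine[OF \<Theta> _ _ _ _ PA_word[OF assms(1) bs]] c
    by (simp only: XY.elem_closed PA_PB_closed A.H0.one_closed)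
qed

text \<open>The unit is the pair of empty words. Both parities are even there, so that the copies
  with the flag \<open>False\<close> are selected.\<close>

lemma j_value:
  shows "a \<in> carrier A \<Longrightarrow> \<Theta> (jA a) = \<mu> a" "b \<in> carrier B \<Longrightarrow> \<Theta> (jB b) = \<nu> b"
proof -
  have P: "XY.T.vec_eq \<Theta> (PA \<otimes>\<^bsub>T\<^esub> \<one>\<^bsub>T\<^esub>) (if False then \<one>\<^bsub>T\<^esub> else \<zero>\<^bsub>T\<^esub>)"
    "XY.T.vec_eq \<Theta> (PB \<otimes>\<^bsub>T\<^esub> \<one>\<^bsub>T\<^esub>) (if False then \<one>\<^bsub>T\<^esub> else \<zero>\<^bsub>T\<^esub>)"
    using PA_word[of "[]" "[]" True True] PB_word[of "[]" "[]" True True] by (simp_all add: XY.elem_one)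
  show "\<Theta> (jA a) = \<mu> a" if a: "a \<in> carrier A"
  proof -
    have t: "tens (A.copy2 \<epsilon> a) \<one>\<^bsub>Y\<^esub> \<in> carrier T" for \<epsilon>
      by (rule XY.elem_closed[OF copyA_closed[OF a] B.H0.one_closed])
    have "\<Theta> (jA a \<otimes>\<^bsub>T\<^esub> \<one>\<^bsub>T\<^esub>) = \<Theta> ((if False then tens (A.copy2 True a) \<one>\<^bsub>Y\<^esub> else tens (A.copy2 False a) \<one>\<^bsub>Y\<^esub>) \<otimes>\<^bsub>T\<^esub> \<one>\<^bsub>T\<^esub>)"
      unfolding jA_def
      by (rule XY.T.vec_eq_value[OF XY.T.vec_eq_combine[OF \<Theta> t t PA_PB_closed(2) XY.T.one_closed P(2)]])
        (use t PA_PB_closed in simp_all)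
    then show ?thesis
      using t star_hom_closed[OF star_hom_jA a] copyA_closed[OF a]
      by (simp add: \<Theta>_elem \<phi>_copy a state_one[OF \<psi>])
  qed
  show "\<Theta> (jB b) = \<nu> b" if b: "b \<in> carrier B"
  proof -
    have t: "tens \<one>\<^bsub>X\<^esub> (B.copy2 \<epsilon> b) \<in> carrier T" for \<epsilon>
      by (rule XY.elem_closed[OF A.H0.one_closed copyB_closed[OF b]])
    have "\<Theta> (jB b \<otimes>\<^bsub>T\<^esub> \<one>\<^bsub>T\<^esub>) = \<Theta> ((if False then tens \<one>\<^bsub>X\<^esub> (B.copy2 True b) else tens \<one>\<^bsub>X\<^esub> (B.copy2 False b)) \<otimes>\<^bsub>T\<^esub> \<one>\<^bsub>T\<^esub>)"
      unfolding jB_def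
      by (rule XY.T.vec_eq_value[OF XY.T.vec_eq_combine[OF \<Theta> t t PA_PB_closed(1) XY.T.one_closed P(1)]])
        (use t PA_PB_closed in simp_all)
    then show ?thesis
      using t star_hom_closed[OF star_hom_jB b] copyB_closed[OF b]
      by (simp add: \<Theta>_elem \<psi>_copy b state_one[OF \<phi>])
  qed
qed

text \<open>The flags record the copies of the current first letters. If \<open>jA\<close> acted
  last, its letter was chosen by the present parity of \<open>bs\<close>, while the first letter of
  \<open>bs\<close> was chosen when \<open>as\<close> had one letter less, hence the flag
  \<open>even (length as)\<close>. The other case is symmetric, and the next factor, coming from the
  other side, finds exactly the flags that prolong its word.\<close>

lemma alternating_word:
  assumes "S = jA ` {a \<in> carrier A. \<mu> a = 0}" "R = jB ` {b \<in> carrier B. \<nu> b = 0}"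
  shows "(alternating S R xs \<longrightarrow> (\<exists>as bs. cenA as \<and> cenB bs \<and> length as + length bs = length xs \<and>
      XY.T.vec_eq \<Theta> (list_prod T xs) (tens (wA (odd (length bs)) as) (wB (even (length as)) bs)))) \<and>
    (alternating R S xs \<longrightarrow> (\<exists>as bs. cenA as \<and> cenB bs \<and> length as + length bs = length xs \<and>
      XY.T.vec_eq \<Theta> (list_prod T xs) (tens (wA (even (length bs)) as) (wB (odd (length as)) bs))))"
proof (induction xs)
  case Nil
  \<comment> \<open>For empty words every flag gives the unit, so that both claims hold at the
    start.\<close>
  have "XY.T.vec_eq \<Theta> \<one>\<^bsub>T\<^esub> (tens (wA \<epsilon> []) (wB \<delta> []))" for \<epsilon> \<delta>
    by (simp add: XY.elem_one XY.T.vec_eq_refl)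
  then show ?case by (metis alternating.simps(1) empty_iff list.set(1) list.size(3) list_prod_Nil add_0)
next
  case (Cons x xs)
  have SR: "S \<subseteq> carrier T" "R \<subseteq> carrier T"
    unfolding assms using star_hom_closed[OF star_hom_jA] star_hom_closed[OF star_hom_jB] by auto
  have cl: "list_prod T xs \<in> carrier T" if "alternating S R xs \<or> alternating R S xs"
    by (rule XY.T.list_prod_closed[OF alternating_subset[OF that SR]])
  show ?case
  proof (intro conjI impI)
    assume "alternating S R (x # xs)"
    then have x: "x \<in> S" and alt: "alternating R S xs" by auto
    then obtain a where a: "a \<in> carrier A" "\<mu> a = 0" "x = jA a" by (auto simp: assms)
    obtain as bs where w: "cenA as" "cenB bs" "length as + length bs = length xs"
      "XY.T.vec_eq \<Theta> (list_prod T xs) (tens (wA (even (length bs)) as) (wB (odd (length as)) bs))"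
      using Cons.IH alt by blast
    have "XY.T.vec_eq \<Theta> (list_prod T (x # xs)) (jA a \<otimes>\<^bsub>T\<^esub> tens (wA (even (length bs)) as) (wB (odd (length as)) bs))"
      unfolding list_prod_Cons a(3)
      by (rule XY.T.vec_eq_mult[OF w(4) star_hom_closed[OF star_hom_jA a(1)]])
        (use cl alt w wA_closed wB_closed XY.elem_closed in auto)
    from XY.T.vec_eq_trans[OF this jA_word] a w
    have "XY.T.vec_eq \<Theta> (list_prod T (x # xs)) (tens (wA (odd (length bs)) (a # as)) (wB (even (length (a # as))) bs))"
      by simp
    then show "\<exists>as bs. cenA as \<and> cenB bs \<and> length as + length bs = length (x # xs) \<and>
      XY.T.vec_eq \<Theta> (list_prod T (x # xs)) (tens (wA (odd (length bs)) as) (wB (even (length as)) bs))"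
      using a w by (intro exI[of _ "a # as"] exI[of _ bs]) simp
  next
    assume "alternating R S (x # xs)"
    then have x: "x \<in> R" and alt: "alternating S R xs" by auto
    then obtain b where b: "b \<in> carrier B" "\<nu> b = 0" "x = jB b" by (auto simp: assms)
    obtain as bs where w: "cenA as" "cenB bs" "length as + length bs = length xs"
      "XY.T.vec_eq \<Theta> (list_prod T xs) (tens (wA (odd (length bs)) as) (wB (even (length as)) bs))"
      using Cons.IH alt by blast
    have "XY.T.vec_eq \<Theta> (list_prod T (x # xs)) (jB b \<otimes>\<^bsub>T\<^esub> tens (wA (odd (length bs)) as) (wB (even (length as)) bs))"
      unfolding list_prod_Cons b(3)
      by (rule XY.T.vec_eq_mult[OF w(4) star_hom_closed[OF star_hom_jB b(1)]])
        (use cl alt w wA_closed wB_closed XY.elem_closed in auto)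
    from XY.T.vec_eq_trans[OF this jB_word] b w
    have "XY.T.vec_eq \<Theta> (list_prod T (x # xs)) (tens (wA (even (length (b # bs))) as) (wB (odd (length as)) (b # bs)))"
      by simp
    then show "\<exists>as bs. cenA as \<and> cenB bs \<and> length as + length bs = length (x # xs) \<and>
      XY.T.vec_eq \<Theta> (list_prod T (x # xs)) (tens (wA (even (length bs)) as) (wB (odd (length as)) bs))"
      using b w by (intro exI[of _ as] exI[of _ "b # bs"]) simp
  qed
qed

text \<open>The lengths of the two words add up to the positive number of factors. Hence one of the
  words is nonempty, and the state of its tensor factor vanishes on it.\<close>

lemma vanishes_jA_jB:
  "vanishes_on_alternating T \<Theta> (jA ` {a \<in> carrier A. \<mu> a = 0}) (jB ` {b \<in> carrier B. \<nu> b = 0})"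
    (is "vanishes_on_alternating T \<Theta> ?S ?R")
proof (rule vanishes_on_alternatingI)
  fix xs assume xs: "xs \<noteq> []" "alternating ?S ?R xs \<or> alternating ?R ?S xs"
  obtain as bs \<epsilon> \<delta> where w: "cenA as" "cenB bs" "length as + length bs = length xs"
    "XY.T.vec_eq \<Theta> (list_prod T xs) (tens (wA \<epsilon> as) (wB \<delta> bs))"
    using alternating_word[OF refl refl, of xs] xs(2) by blast
  have "?S \<subseteq> carrier T" "?R \<subseteq> carrier T"
    using star_hom_closed[OF star_hom_jA] star_hom_closed[OF star_hom_jB] by auto
  then have "set xs \<subseteq> carrier T" by (rule alternating_subset[OF xs(2)])
  then have "\<Theta> (list_prod T xs) = \<Theta> (tens (wA \<epsilon> as) (wB \<delta> bs))"
    using w wA_closed wB_closed by (intro XY.T.vec_eq_value XY.T.list_prod_closed XY.elem_closed)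
  also have "\<dots> = \<phi> (wA \<epsilon> as) * \<psi> (wB \<delta> bs)"
    using w wA_closed wB_closed by (intro \<Theta>_elem)
  also have "\<dots> = 0"
  proof (cases "as = []")
    case True
    then have "bs \<noteq> []" using w(3) xs(1) by auto
    then show ?thesis using \<psi>_alt w(2) by simp
  next
    case False
    then show ?thesis using \<phi>_alt w(1) by simp
  qed
  finally show "\<Theta> (list_prod T xs) = 0" .
qed

lemma free_state_pullback:
  assumes j: "star_hom (free_product2 A B) T j" "\<And>a. a \<in> carrier A \<Longrightarrow> j (free_inl A B a) = jA a"
    "\<And>b. b \<in> carrier B \<Longrightarrow> j (free_inr A B b) = jB b"
  shows "AB.free_state \<mu> \<nu> (\<lambda>z. \<Theta> (j z))"
  unfolding AB.free_state_def
proof (intro conjI ballI vanishes_on_alternatingI)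
  show "state (free_product2 A B) (\<lambda>z. \<Theta> (j z))"
    by (rule state_star_hom[OF AB.star_algebra_free_product2 j(1) \<Theta>])
  show "\<Theta> (j (free_inl A B a)) = \<mu> a" if "a \<in> carrier A" for a using that by (simp add: j(2) j_value)
  show "\<Theta> (j (free_inr A B b)) = \<nu> b" if "b \<in> carrier B" for b using that by (simp add: j(3) j_value)
  let ?S = "free_inl A B ` {a \<in> carrier A. \<mu> a = 0}" and ?R = "free_inr A B ` {b \<in> carrier B. \<nu> b = 0}"
  fix xs assume xs: "xs \<noteq> []" "alternating ?S ?R xs \<or> alternating ?R ?S xs"
  have img: "j ` ?S = jA ` {a \<in> carrier A. \<mu> a = 0}" "j ` ?R = jB ` {b \<in> carrier B. \<nu> b = 0}"
    using j(2,3) by (auto simp: image_image)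
  have map: "alternating (j ` S) (j ` R) (map j xs)" if "alternating S R xs" for S R
    using that by (induction xs arbitrary: S R) auto
  have "?S \<subseteq> carrier (free_product2 A B)" "?R \<subseteq> carrier (free_product2 A B)"
    using star_hom_closed[OF AB.star_hom_free_inl] star_hom_closed[OF AB.star_hom_free_inr] by auto
  then have "set xs \<subseteq> carrier (free_product2 A B)" by (rule alternating_subset[OF xs(2)])
  then have "j (list_prod (free_product2 A B) xs) = list_prod T (map j xs)"
    by (rule star_hom_list_prod[OF AB.star_algebra_free_product2 j(1)])
  moreover have "\<Theta> (list_prod T (map j xs)) = 0"
    using vanishes_jA_jB xs map[of ?S ?R] map[of ?R ?S]
    unfolding vanishes_on_alternating_def img by blast
  ultimately show "\<Theta> (j (list_prod (free_product2 A B) xs)) = 0" by simp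
qed

end


theorem theorem5p3:
  fixes A :: "'a star_algebra" and B :: "'b star_algebra"
    and \<mu> :: "'a \<Rightarrow> complex" and \<nu> :: "'b \<Rightarrow> complex"
  assumes "star_algebra A" and "star_algebra B"
    and "state A \<mu>" and "state B \<nu>"
  shows "\<exists>\<mu>' \<nu>' j.
    state (H A) \<mu>' \<and> state (H B) \<nu>' \<and>
    star_hom (free_product2 A B) (H_tensor A B) j \<and>
    (\<forall>W\<in>carrier (H_tensor A B). \<exists>z. has_limit_functional (H0_tensor_functional A B \<mu>' \<nu>') W z) \<and>
    state (H_tensor A B) (H_tensor_functional A B \<mu>' \<nu>') \<and>
    (\<forall>z\<in>carrier (free_product2 A B).
       free_product_state A B \<mu> \<nu> z = H_tensor_functional A B \<mu>' \<nu>' (j z)) \<and>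
    free_wrt (H_tensor A B) (H_tensor_functional A B \<mu>' \<nu>')
      (j ` free_inl A B ` carrier A) (j ` free_inr A B ` carrier B)"
proof -
  interpret A: star_algebra A by fact
  interpret B: star_algebra B by fact
  interpret plain_pair A B ..
  interpret SA: short_chain "H0 A" "H0_filt A" "H0_q A" by (rule A.short_chain_H0)
  interpret SB: short_chain "H0 B" "H0_filt B" "H0_q B" by (rule B.short_chain_H0)
  interpret ST: short_chain T "\<lambda>m. tensor_subalgebra (H0 A) (H0 B) (H0_filt A m) (H0_filt B m)"
    "\<lambda>m. tens (H0_q A m) (H0_q B m)" by (rule short_chain_tensor)
  have H: "H A = SA.MC" "H B = SB.MC" "H_tensor A B = ST.MC"
    by (simp_all add: H_def H_tensor_def)
  show ?thesis
  proof (rule A.H0_state[OF assms(3)], rule B.H0_state[OF assms(4)])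
    fix \<phi> \<psi>
    assume \<phi>: "state (H0 A) \<phi>" "\<And>\<epsilon> a. a \<in> carrier A \<Longrightarrow> \<phi> (A.copy2 \<epsilon> a) = \<mu> a"
      "\<And>\<epsilon> as. as \<noteq> [] \<Longrightarrow> \<forall>a\<in>set as. a \<in> carrier A \<and> \<mu> a = 0 \<Longrightarrow> \<phi> (alt_prod (H0 A) A.copy2 \<epsilon> as) = 0"
      "\<And>\<epsilon> as u. u \<in> carrier (H0 A) \<Longrightarrow> \<forall>a\<in>set as. a \<in> carrier A \<and> \<mu> a = 0 \<Longrightarrow>
        \<phi> (u \<otimes>\<^bsub>H0 A\<^esub> (H0_p A 1 \<otimes>\<^bsub>H0 A\<^esub> alt_prod (H0 A) A.copy2 \<epsilon> as)) =
          (if odd (length as) then \<phi> (u \<otimes>\<^bsub>H0 A\<^esub> alt_prod (H0 A) A.copy2 \<epsilon> as) else 0)"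
    assume \<psi>: "state (H0 B) \<psi>" "\<And>\<epsilon> b. b \<in> carrier B \<Longrightarrow> \<psi> (B.copy2 \<epsilon> b) = \<nu> b"
      "\<And>\<epsilon> bs. bs \<noteq> [] \<Longrightarrow> \<forall>b\<in>set bs. b \<in> carrier B \<and> \<nu> b = 0 \<Longrightarrow> \<psi> (alt_prod (H0 B) B.copy2 \<epsilon> bs) = 0"
      "\<And>\<epsilon> bs u. u \<in> carrier (H0 B) \<Longrightarrow> \<forall>b\<in>set bs. b \<in> carrier B \<and> \<nu> b = 0 \<Longrightarrow>
        \<psi> (u \<otimes>\<^bsub>H0 B\<^esub> (H0_p B 1 \<otimes>\<^bsub>H0 B\<^esub> alt_prod (H0 B) B.copy2 \<epsilon> bs)) =
          (if odd (length bs) then \<psi> (u \<otimes>\<^bsub>H0 B\<^esub> alt_prod (H0 B) B.copy2 \<epsilon> bs) else 0)"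
    define \<mu>' where "\<mu>' = limit_functional \<phi>"
    define \<nu>' where "\<nu>' = limit_functional \<psi>"
    define \<Theta> where "\<Theta> = H0_tensor_functional A B \<mu>' \<nu>'"
    \<comment> \<open>Restricted along the embedding, the state on the closure returns
      \<open>\<phi>\<close>. The equality is claimed on the carrier only, so that the state property
      of the composite is derived separately.\<close>
    have \<mu>': "(\<mu>' \<circ> H_embed A) u = \<phi> u" if "u \<in> carrier (H0 A)" for u
      using that by (simp add: \<mu>'_def H_embed_def SA.mco_embed_eq SA.limit_functional_cls)
    have \<nu>': "(\<nu>' \<circ> H_embed B) u = \<psi> u" if "u \<in> carrier (H0 B)" for u
      using that by (simp add: \<nu>'_def H_embed_def SB.mco_embed_eq SB.limit_functional_cls)
    have st: "state (H0 A) (\<mu>' \<circ> H_embed A)" "state (H0 B) (\<nu>' \<circ> H_embed B)"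
      using \<phi>(1) \<psi>(1) \<mu>' \<nu>' A.H0.smult_closed A.H0.star_closed B.H0.smult_closed B.H0.star_closed
      by (simp_all add: state_def del: comp_apply)
    \<comment> \<open>The functional \<open>\<Theta>\<close> is built from the composites with the
      embeddings; the coupling argument sees only that it is a state and that it factors through
      \<open>\<phi>\<close> and \<open>\<psi>\<close> on elementary tensors.\<close>
    interpret coupling A B \<mu> \<nu> \<phi> \<psi> \<Theta>
    proof
      show "state T \<Theta>" unfolding \<Theta>_def H0_tensor_functional_def by (rule XY.state_tensor_functional[OF st])
      show "\<Theta> (tens u v) = \<phi> u * \<psi> v" if "u \<in> carrier (H0 A)" "v \<in> carrier (H0 B)" for u v
        unfolding \<Theta>_def H0_tensor_functional_def XY.tensor_functional_elem[OF st that]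
        using \<mu>' \<nu>' that by simp
    qed (fact \<phi> \<psi>)+
    obtain i where i: "star_hom (free_product2 A B) T i" "\<And>a. a \<in> carrier A \<Longrightarrow> i (free_inl A B a) = jA a"
      "\<And>b. b \<in> carrier B \<Longrightarrow> i (free_inr A B b) = jB b"
      using AB.free_product2_universal[OF XY.star_algebra_tensor_product star_hom_jA star_hom_jB] by metis
    \<comment> \<open>The map into the algebraic tensor product, followed by the passage to classes
      of eventually constant sequences.\<close>
    define j where "j z = ST.cls (i z)" for z
    have j: "star_hom (free_product2 A B) (H_tensor A B) j"
      unfolding j_def H by (rule star_hom_comp[OF i(1) ST.star_hom_cls])
    have \<Theta>j: "H_tensor_functional A B \<mu>' \<nu>' (j z) = \<Theta> (i z)" if "z \<in> carrier (free_product2 A B)" for z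
      using star_hom_closed[OF i(1) that]
      by (simp add: j_def H_tensor_functional_def \<Theta>_def ST.limit_functional_cls)
    have fs: "AB.free_state \<mu> \<nu> (\<lambda>z. \<Theta> (i z))" by (rule free_state_pullback[OF i])
    let ?\<Phi> = "H_tensor_functional A B \<mu>' \<nu>'"
    have inl: "free_inl A B a \<in> carrier (free_product2 A B)" "?\<Phi> (j (free_inl A B a)) = \<mu> a" if "a \<in> carrier A" for a
      using that fs star_hom_closed[OF AB.star_hom_free_inl] by (simp_all add: \<Theta>j AB.free_state_def)
    have inr: "free_inr A B b \<in> carrier (free_product2 A B)" "?\<Phi> (j (free_inr A B b)) = \<nu> b" if "b \<in> carrier B" for b
      using that fs star_hom_closed[OF AB.star_hom_free_inr] by (simp_all add: \<Theta>j AB.free_state_def)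
    have "free_wrt (H_tensor A B) ?\<Phi> (j ` free_inl A B ` carrier A) (j ` free_inr A B ` carrier B)"
      unfolding free_wrt_def
    proof (intro conjI vanishes_on_alternatingI)
      show "star_subalgebra (H_tensor A B) (j ` free_inl A B ` carrier A)"
        by (rule star_subalgebra_image[OF j star_subalgebra_image[OF AB.star_hom_free_inl star_subalgebra_carrier[OF assms(1)]]])
      show "star_subalgebra (H_tensor A B) (j ` free_inr A B ` carrier B)"
        by (rule star_subalgebra_image[OF j star_subalgebra_image[OF AB.star_hom_free_inr star_subalgebra_carrier[OF assms(2)]]])
      let ?S = "free_inl A B ` {a \<in> carrier A. \<mu> a = 0}" and ?R = "free_inr A B ` {b \<in> carrier B. \<nu> b = 0}"
      \<comment> \<open>On the images of \<open>A\<close> and \<open>B\<close> the functional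
        \<open>?\<Phi>\<close> takes the values of \<open>\<mu>\<close> and \<open>\<nu>\<close>, so
        that its centred elements are images of centred ones, and alternating lists lift to the free
        product.\<close>
      have img: "{x \<in> j ` free_inl A B ` carrier A. ?\<Phi> x = 0} = j ` ?S"
        "{x \<in> j ` free_inr A B ` carrier B. ?\<Phi> x = 0} = j ` ?R"
        using inl(2) inr(2) by auto
      fix xs assume xs: "xs \<noteq> []"
        "alternating {x \<in> j ` free_inl A B ` carrier A. ?\<Phi> x = 0} {x \<in> j ` free_inr A B ` carrier B. ?\<Phi> x = 0} xs \<or>
         alternating {x \<in> j ` free_inr A B ` carrier B. ?\<Phi> x = 0} {x \<in> j ` free_inl A B ` carrier A. ?\<Phi> x = 0} xs"
      obtain ys where ys: "xs = map j ys" "alternating ?S ?R ys \<or> alternating ?R ?S ys"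
        using xs(2) alternating_image[of j ?S ?R xs] alternating_image[of j ?R ?S xs] unfolding img by blast
      have "?S \<subseteq> carrier (free_product2 A B)" "?R \<subseteq> carrier (free_product2 A B)"
        using inl(1) inr(1) by auto
      then have set: "set ys \<subseteq> carrier (free_product2 A B)" by (rule alternating_subset[OF ys(2)])
      have "?\<Phi> (list_prod (H_tensor A B) xs) = ?\<Phi> (j (list_prod (free_product2 A B) ys))"
        unfolding ys(1) by (simp only: star_hom_list_prod[OF AB.star_algebra_free_product2 j set])
      also have "\<dots> = \<Theta> (i (list_prod (free_product2 A B) ys))"
        by (rule \<Theta>j[OF AB.FP2.list_prod_closed[OF set]])
      also have "\<dots> = 0"
        using fs ys xs(1) by (auto simp: AB.free_state_def vanishes_on_alternating_def)
      finally show "?\<Phi> (list_prod (H_tensor A B) xs) = 0" .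
    qed
    moreover have "state (H A) \<mu>'" "state (H B) \<nu>'"
      unfolding \<mu>'_def \<nu>'_def H by (rule SA.state_limit_functional[OF \<phi>(1)], rule SB.state_limit_functional[OF \<psi>(1)])
    moreover have "\<exists>z. has_limit_functional (H0_tensor_functional A B \<mu>' \<nu>') W z" if "W \<in> carrier (H_tensor A B)" for W
      using ST.has_limit_functional_ex that unfolding H .
    moreover have "state (H_tensor A B) ?\<Phi>"
      unfolding H_tensor_functional_def \<Theta>_def[symmetric] H by (rule ST.state_limit_functional[OF \<Theta>])
    moreover have "free_product_state A B \<mu> \<nu> z = ?\<Phi> (j z)" if "z \<in> carrier (free_product2 A B)" for z
      using AB.free_product_state_eq[OF assms(3,4) fs that] \<Theta>j[OF that] by simp
    ultimately show ?thesis using j by blast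
  qed
qed

end
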